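(* Let $d,n\ge 1$ be integers and, for $j\in\{1,\dots,d\}$ and $U\in\mathbb{R}^n$, let $A_j(U)$ be a real symmetric $n\times n$ matrix whose entries are polynomial functions of $U$. Write $A_j^0:=A_j(0)$ and $A_j^1(U):=A_j(U)-A_j^0$. Let $s>d/2+1$, $M>0$, and $U^0\in H^s((2\pi\mathbb{T})^d)^n$ with $|U^0|_{H^s}\le M$. Let $U\in\mathcal{C}(I;H^s((2\pi\mathbb{T})^d)^n)$ be the maximal-in-time classical solution to $$\partial_t U+\sum_{j=1}^d A_j(U)\partial_{x_j}U=0,\qquad U|_{t=0}=U^0, \qquad (\mathrm{H})$$ and, for $N\in\mathbb{N}$, let $U_N\in\mathcal{C}(I_N;H^s((2\pi\mathbb{T})^d)^n)$ be the maximal-in-time classical solution to $(\mathrm{H}_N)$, where $(\mathrm{H}_N)$ is either one of the two problems (the same one throughout) $$\partial_t U_N+\mathsf{S}_N\Big(\sum_{j=1}^d A_j(U_N)\partial_{x_j}U_N\Big)=0,\qquad U_N|_{t=0}=\mathsf{P}_N U^0,$$ or $$\partial_t U_N+\sum_{j=1}^d \Big(A_j^0\partial_{x_j}U_N+\mathsf{S}_N\big(A_j^1(U_N)\partial_{x_j}U_N\big)\Big)=0,\qquad U_N|_{t=0}=\mathsf{P}_N U^0.$$ (1) Let $T>0$, depending only on $s$ and $M$, be a uniform existence time for both (H) and $(\mathrm{H}_N)$, in the sense that for some $C_1>0$ depending only on $s$ and $M$, for every $V^0\in H^s((2\pi\mathbb{T})^d)^n$ with $|V^0|_{H^s}\le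 M$ and every $N\in\mathbb{N}$, the maximal-in-time classical solutions $V$ of (H) with initial data $V^0$ and $V_N$ of $(\mathrm{H}_N)$ with initial data $\mathsf{P}_N V^0$ are defined on $[0,T/|V^0|_{H^s}]$ and satisfy there $|V(t,\cdot)|_{H^s}\le |V^0|_{H^s}\exp(C_1|V^0|_{H^s}t)\le 2|V^0|_{H^s}$ and $|V_N(t,\cdot)|_{H^s}\le |V^0|_{H^s}\exp(C_1|V^0|_{H^s}t)\le 2|V^0|_{H^s}$. Then there is $C>0$, depending only on $s$ and $M$, such that for all $N\in\mathbb{N}$, all $0\le t\le T/|U^0|_{H^s}$ and all $0\le r\le s$, $$|(U-U_N)(t,\cdot)|_{H^r}\le C\,|U^0|_{H^s}\,N^{r-s}.$$ (2) Moreover, for every compact subset $I^*\subset I$, there are $N_0\in\mathbb{N}$ and $C^*>0$, depending only on $s$, $|I^*|$ and $M^*:=\sup_{t\in I^*}|U(t,\cdot)|_{H^s}$, such that for all $N\ge N_0$ one has $I_N\supset I^*$ and, for any $0\le r\le s$, $$\sup_{t\in I^*}|(U-U_N)(t,\cdot)|_{H^r}\le C^*\,M^*\,N^{r-s}.$$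
   Context: $(2\pi\mathbb{T})^d$ is the torus of period $2\pi$ in each of the $d$ variables; functions on it are real-valued. For real $s\ge0$, $H^s((2\pi\mathbb{T})^d)^n$ is the space of $U\in L^2((2\pi\mathbb{T})^d)^n$ with $|U|_{H^s}^2=\sum_{k\in\mathbb{Z}^d}\langle k\rangle^{2s}|\widehat U_k|^2<\infty$, where $\widehat U_k$ is the $k$-th Fourier coefficient and $\langle k\rangle=(1+|k|^2)^{1/2}$. $\mathcal{C}(I;X)$ denotes continuous functions on the interval $I$ with values in the Banach space $X$. $\mathbb{N}$ denotes the positive integers. $|I^*|$ denotes the length (Lebesgue measure) of $I^*\subset\mathbb{R}$. $\mathsf{P}_N$ (sharp low-pass filter) acts componentwise as the Fourier multiplier with symbol $\mathbf{1}_{\{-N,\dots,N\}^d}$. $\mathsf{S}_N$ (smooth low-pass filter) acts componentwise as the Fourier multiplier with symbol $k\mapsto\chi(k/N)$, where $\chi:\mathbb{R}^d\to[0,1]$ is a fixed even function with $\chi(k)=1$ if $\max_j|k_j|\le1/2$, $\chi(k)=0$ if $\max_j|k_j|\ge1$, and $\chi^{1/2}$ Lipschitz continuous. A maximal-in-time classical solution in $\mathcal{C}(I;H^s)$ is a solution on an open interval $I\ni0$ which cannot be extended to a solution in the same class on a strictly larger interval; for the problems considered with $s>d/2+1$ it exists and is unique, and a time $T$ as in (1) exists. If the initial datum is $0$, the interval $[0,T/|U^0|_{H^s}]$ is read as $[0,\infty)$. Constants said to depend "only" on certain quantities may also depend on the fixed data $d,n,\chi,A_1,\dots,A_d$, but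 never on $N$.
   Formalization: In (2), N_0 and C* depend on s and on the length of, and the sup of |U|_{H^s} over, the smallest interval containing I* and 0, instead of |I*| and M*; these agree when I* is an interval containing 0, and the literal dependence fails in general, e.g. for I* = {t_1}. *)

theory Defs
  imports "HOL-Analysis.Analysis"
begin

section \<open>Sobolev spaces on the torus\<close>

text \<open>
  A function on the torus of period \<open>2\<pi>\<close> in each variable is a function on \<open>\<real>\<^sup>d\<close>
  (\<open>d = CARD('d)\<close>) that is \<open>2\<pi>\<close>-periodic in each variable. Elements of \<open>L\<^sup>2\<close> and of \<open>H\<^sup>s\<close>
  are represented by functions, not by classes modulo almost everywhere equality;
  the norms and the Fourier coefficients below do not depend on the representative.
\<close>

definition torus_periodic :: "(real^'d \<Rightarrow> 'a) \<Rightarrow> bool" where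
  "torus_periodic f \<longleftrightarrow> (\<forall>x j. f (x + axis j (2 * pi)) = f x)"

definition torus_cell :: "(real^'d) set" where
  "torus_cell = cbox 0 (\<chi> j. 2 * pi)"

definition torus_L2 :: "(real^'d \<Rightarrow> real^'n) \<Rightarrow> bool" where
  "torus_L2 f \<longleftrightarrow> torus_periodic f \<and> f \<in> borel_measurable lebesgue \<and>
     set_integrable lebesgue torus_cell (\<lambda>x. (norm (f x))\<^sup>2)"

definition phase :: "int^'d \<Rightarrow> real^'d \<Rightarrow> real" where
  "phase k x = (\<Sum>j\<in>UNIV. of_int (k $ j) * x $ j)"

text \<open>The normalisation is the one for which \<open>f\<close> is the sum of its Fourier series.\<close>

definition fourier_coeff :: "(real^'d \<Rightarrow> real^'n) \<Rightarrow> int^'d \<Rightarrow> complex^'n" where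
  "fourier_coeff f k =
     (\<chi> i. (LINT x:torus_cell|lebesgue. of_real (f x $ i) * cis (- phase k x))
           / of_real ((2 * pi) ^ CARD('d)))"

definition japanese_bracket :: "int^'d \<Rightarrow> real" where
  "japanese_bracket k = sqrt (1 + (\<Sum>j\<in>UNIV. (of_int (k $ j))\<^sup>2))"

definition in_sobolev :: "real \<Rightarrow> (real^'d \<Rightarrow> real^'n) \<Rightarrow> bool" where
  "in_sobolev s f \<longleftrightarrow> torus_L2 f \<and>
     (\<lambda>k. japanese_bracket k powr (2 * s) * (norm (fourier_coeff f k))\<^sup>2) summable_on UNIV"

text \<open>Meaningful only under \<^const>\<open>in_sobolev\<close>: a divergent sum has the value \<open>0\<close>.\<close>

definition sobolev_norm :: "real \<Rightarrow> (real^'d \<Rightarrow> real^'n) \<Rightarrow> real" where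
  "sobolev_norm s f =
     sqrt (\<Sum>\<^sub>\<infinity>k. japanese_bracket k powr (2 * s) * (norm (fourier_coeff f k))\<^sup>2)"

definition sobolev_continuous_on ::
    "real \<Rightarrow> real set \<Rightarrow> (real \<Rightarrow> real^'d \<Rightarrow> real^'n) \<Rightarrow> bool" where
  "sobolev_continuous_on s I U \<longleftrightarrow> (\<forall>t\<in>I. in_sobolev s (U t)) \<and>
     (\<forall>t\<in>I. ((\<lambda>\<tau>. sobolev_norm s (\<lambda>x. U \<tau> x - U t x)) \<longlongrightarrow> 0) (at t within I))"


section \<open>Low-pass filters\<close>

text \<open>
  Only used for even symbols of finite support: the sum is then finite and, \<open>f\<close> being
  real-valued, its imaginary part vanishes.
\<close>

definition fourier_multiplier ::
    "(int^'d \<Rightarrow> real) \<Rightarrow> (real^'d \<Rightarrow> real^'n) \<Rightarrow> real^'d \<Rightarrow> real^'n" where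
  "fourier_multiplier m f x =
     (\<chi> i. Re (\<Sum>\<^sub>\<infinity>k. of_real (m k) * (fourier_coeff f k $ i) * cis (phase k x)))"

definition sharp_filter :: "nat \<Rightarrow> (real^'d \<Rightarrow> real^'n) \<Rightarrow> real^'d \<Rightarrow> real^'n" where
  "sharp_filter N = fourier_multiplier (indicator {k. \<forall>j. \<bar>k $ j\<bar> \<le> int N})"

definition cutoff_profile :: "(real^'d \<Rightarrow> real) \<Rightarrow> bool" where
  "cutoff_profile chi \<longleftrightarrow>
     (\<forall>k. 0 \<le> chi k \<and> chi k \<le> 1) \<and>
     (\<forall>k. chi (- k) = chi k) \<and>
     (\<forall>k. (\<forall>j. \<bar>k $ j\<bar> \<le> 1 / 2) \<longrightarrow> chi k = 1) \<and>
     (\<forall>k. (\<exists>j. \<bar>k $ j\<bar> \<ge> 1) \<longrightarrow> chi k = 0) \<and>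
     (\<exists>L. L-lipschitz_on UNIV (\<lambda>k. sqrt (chi k)))"

definition smooth_filter ::
    "(real^'d \<Rightarrow> real) \<Rightarrow> nat \<Rightarrow> (real^'d \<Rightarrow> real^'n) \<Rightarrow> real^'d \<Rightarrow> real^'n" where
  "smooth_filter chi N = fourier_multiplier (\<lambda>k. chi (\<chi> j. of_int (k $ j) / real N))"


section \<open>The system and its filtered versions\<close>

definition symmetric_polynomial_matrices :: "('d \<Rightarrow> real^'n \<Rightarrow> real^'n^'n) \<Rightarrow> bool" where
  "symmetric_polynomial_matrices A \<longleftrightarrow>
     (\<forall>j u. transpose (A j u) = A j u) \<and>
     (\<forall>j a b. real_polynomial_function (\<lambda>u. A j u $ a $ b))"

definition partial_deriv :: "'d \<Rightarrow> (real^'d \<Rightarrow> real^'n) \<Rightarrow> real^'d \<Rightarrow> real^'n" where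
  "partial_deriv j V x = frechet_derivative V (at x) (axis j 1)"

definition quasilinear ::
    "('d \<Rightarrow> real^'n \<Rightarrow> real^'n^'n) \<Rightarrow> (real^'d \<Rightarrow> real^'n) \<Rightarrow> real^'d \<Rightarrow> real^'n" where
  "quasilinear B V x = (\<Sum>j\<in>UNIV. B j (V x) *v partial_deriv j V x)"

text \<open>The two filtered problems: filter everything, or only the part in \<open>A\<^sub>j(U) - A\<^sub>j(0)\<close>.\<close>

datatype filtering = Filter_All | Filter_Nonlinear

fun filtered_quasilinear ::
    "filtering \<Rightarrow> (real^'d \<Rightarrow> real) \<Rightarrow> ('d \<Rightarrow> real^'n \<Rightarrow> real^'n^'n) \<Rightarrow> nat \<Rightarrow>
     (real^'d \<Rightarrow> real^'n) \<Rightarrow> real^'d \<Rightarrow> real^'n" where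
  "filtered_quasilinear Filter_All chi A N V x = smooth_filter chi N (quasilinear A V) x"
| "filtered_quasilinear Filter_Nonlinear chi A N V x =
     quasilinear (\<lambda>j u. A j 0) V x +
     smooth_filter chi N (quasilinear (\<lambda>j u. A j u - A j 0) V) x"

text \<open>
  Classical solution in \<open>C(I; H\<^sup>s)\<close> of \<open>\<partial>\<^sub>tU + F(U) = 0\<close>, \<open>U = U0\<close> at \<open>t = 0\<close>, on an open
  interval \<open>I\<close> containing \<open>0\<close>: the equation holds pointwise.
  Differentiability in space makes
  \<open>U t\<close> the continuous representative of its class, whereas \<open>U0\<close> may be any
  representative; hence the initial condition almost everywhere.
\<close>

definition classical_solution ::
    "real \<Rightarrow> ((real^'d \<Rightarrow> real^'n) \<Rightarrow> real^'d \<Rightarrow> real^'n) \<Rightarrow> (real^'d \<Rightarrow> real^'n) \<Rightarrow>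
     real set \<Rightarrow> (real \<Rightarrow> real^'d \<Rightarrow> real^'n) \<Rightarrow> bool" where
  "classical_solution s F U0 I U \<longleftrightarrow>
     open I \<and> is_interval I \<and> 0 \<in> I \<and>
     sobolev_continuous_on s I U \<and>
     (\<forall>t\<in>I. \<forall>x. U t differentiable (at x)) \<and>
     (\<forall>t\<in>I. \<forall>x. ((\<lambda>\<tau>. U \<tau> x) has_vector_derivative - F (U t) x) (at t)) \<and>
     (AE x in lebesgue. U 0 x = U0 x)"

definition maximal_solution ::
    "real \<Rightarrow> ((real^'d \<Rightarrow> real^'n) \<Rightarrow> real^'d \<Rightarrow> real^'n) \<Rightarrow> (real^'d \<Rightarrow> real^'n) \<Rightarrow>
     real set \<Rightarrow> (real \<Rightarrow> real^'d \<Rightarrow> real^'n) \<Rightarrow> bool" where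
  "maximal_solution s F U0 I U \<longleftrightarrow>
     classical_solution s F U0 I U \<and>
     \<not> (\<exists>J V. I \<subset> J \<and> classical_solution s F U0 J V \<and> (\<forall>t\<in>I. V t = U t))"


section \<open>Uniform existence time\<close>

text \<open>The interval \<open>[0, T / a]\<close>, read as \<open>[0, \<infinity>)\<close> for \<open>a = 0\<close>.\<close>

definition time_span :: "real \<Rightarrow> real \<Rightarrow> real set" where
  "time_span T a = (if a = 0 then {0..} else {0..T / a})"

definition controlled_growth ::
    "real \<Rightarrow> real \<Rightarrow> real \<Rightarrow> real \<Rightarrow> real set \<Rightarrow> (real \<Rightarrow> real^'d \<Rightarrow> real^'n) \<Rightarrow> bool" where
  "controlled_growth s T C1 a J V \<longleftrightarrow>
     time_span T a \<subseteq> J \<and>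
     (\<forall>t\<in>time_span T a. sobolev_norm s (V t) \<le> a * exp (C1 * a * t) \<and>
        a * exp (C1 * a * t) \<le> 2 * a)"

definition uniform_existence_time ::
    "filtering \<Rightarrow> (real^'d \<Rightarrow> real) \<Rightarrow> ('d \<Rightarrow> real^'n \<Rightarrow> real^'n^'n) \<Rightarrow>
     real \<Rightarrow> real \<Rightarrow> real \<Rightarrow> real \<Rightarrow> bool" where
  "uniform_existence_time \<phi> chi A s M T C1 \<longleftrightarrow>
     (\<forall>V0. in_sobolev s V0 \<and> sobolev_norm s V0 \<le> M \<longrightarrow>
        (\<forall>J V. maximal_solution s (quasilinear A) V0 J V \<longrightarrow>
           controlled_growth s T C1 (sobolev_norm s V0) J V) \<and>
        (\<forall>N\<ge>1. \<forall>J V.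
           maximal_solution s (filtered_quasilinear \<phi> chi A N) (sharp_filter N V0) J V \<longrightarrow>
           controlled_growth s T C1 (sobolev_norm s V0) J V))"

end

theory Submission
  imports Defs
begin

text \<open>
  Two facts carry the proof. At low frequency the filtered and the unfiltered problems have the same
  Fourier multipliers, so the difference \<open>W = U - U\<^sub>N\<close>, truncated to frequencies well below \<open>N\<close>, solves a
  linear symmetric system whose source is controlled by \<open>W\<close> itself, up to commutators of the truncation.
  At high frequency a bound in \<open>H\<^sup>s\<close> alone gives \<open>O(N\<^sup>-\<^sup>s)\<close> in \<open>L\<^sup>2\<close>. Combining the two in a
  Gronwall argument bounds the \<open>L\<^sup>2\<close> norm of \<open>W\<close> by \<open>O(N\<^sup>-\<^sup>s)\<close>, and interpolation with the \<open>H\<^sup>s\<close> bound yields the rate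
  \<open>N\<^sup>r\<^sup>-\<^sup>s\<close> (\<open>error_estimate\<close>).

  Everything is done on Fourier coefficients. For \<open>s > d/2 + 1\<close> the coefficients of an \<open>H\<^sup>s\<close> function
  are summable with weight \<open>\<langle>k\<rangle>\<close> (\<open>sobolev_embedding\<close>); such a function is the sum of its
  Fourier series, differentiation acts termwise, products become convolutions, and polynomials satisfy
  tame estimates (\<open>polynomial_tame\<close>), because Young's inequality bounds all convolutions. The energy
  estimates rest on one identity (\<open>symmetric_energy\<close>): for symmetric matrices, exchanging the two
  frequencies of a trilinear sum replaces the derivative by a commutator of order zero. The same
  estimate controls the \<open>H\<^sup>s\<close> norm of both solutions, uniformly in \<open>N\<close>, because the symbol of the smooth
  filter is the square of a Lipschitz function at scale \<open>N\<close>, hence itself Lipschitz at scale \<open>N\<close> (\<open>Hs_growth\<close>).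

  In the first part of the theorem the \<open>H\<^sup>s\<close> bounds are hypotheses and the error estimate applies
  directly. In the second only \<open>U\<close> is controlled. As long as \<open>U\<^sub>N\<close> stays in a fixed ball of the weighted
  Wiener algebra, the growth and error estimates hold; choosing \<open>r\<close> strictly between \<open>d/2 + 1\<close> and \<open>s\<close>, the error tends to zero in
  that algebra, so for large \<open>N\<close> the ball is never left (\<open>bootstrap\<close>). Finally \<open>U\<^sub>N\<close> is a trigonometric
  polynomial, solving an ordinary differential equation, so a bounded \<open>U\<^sub>N\<close> can be continued and its interval
  of existence contains the given compact set (\<open>band_limited_continuation\<close>).
\<close>

section \<open>Characters and mean values on the torus\<close>

lemma phase_add: "phase (k + l) x = phase k x + phase l x"
  by (simp add: phase_def algebra_simps sum.distrib)

lemma phase_minus: "phase (- k) x = - phase k x"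
  by (simp add: phase_def sum_negf)

lemma phase_diff: "phase (k - l) x = phase k x - phase l x"
  by (simp add: phase_def algebra_simps sum_subtractf)

lemma phase_zero [simp]: "phase 0 x = 0"
  by (simp add: phase_def)

lemma phase_add_axis: "phase k (x + axis j h) = phase k x + of_int (k $ j) * h"
proof -
  have "phase k (x + axis j h) = phase k x + (\<Sum>i\<in>UNIV. of_int (k $ i) * axis j h $ i)"
    by (simp add: phase_def algebra_simps sum.distrib)
  also have "(\<Sum>i\<in>UNIV. of_int (k $ i) * axis j h $ i) = (\<Sum>i\<in>UNIV. if i = j then of_int (k $ j) * h else 0)"
    by (rule sum.cong) (auto simp: axis_def)
  finally show ?thesis by simp
qed

lemma continuous_on_phase [continuous_intros]:
  "continuous_on A f \<Longrightarrow> continuous_on A (\<lambda>x. phase k (f x))"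
  unfolding phase_def by (intro continuous_intros)

lemma continuous_on_character [continuous_intros]: "continuous_on A (\<lambda>x. cis (phase k x))"
  by (intro continuous_intros)

lemma cis_phase_periodic: "cis (phase k (x + axis j (2 * pi))) = cis (phase k x)"
proof -
  have "cis (of_int (k $ j) * (2 * pi)) = 1"
    using cos_int_2pin[of "k $ j"] sin_int_2pin[of "k $ j"]
    by (intro complex_eqI) (simp_all add: ac_simps)
  then show ?thesis by (simp add: phase_add_axis flip: cis_mult)
qed

definition mean :: "(real^'d \<Rightarrow> complex) \<Rightarrow> complex" where
  "mean h = (LINT x:torus_cell|lebesgue. h x) / of_real ((2 * pi) ^ CARD('d))"

lemma torus_cell_measure:
  "emeasure lebesgue (torus_cell :: (real^'d) set) = ennreal ((2 * pi) ^ CARD('d))"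
  "torus_cell \<in> sets lebesgue"
proof -
  let ?u = "(\<chi> j. 2 * pi) :: real^'d"
  have "emeasure lborel (cbox 0 ?u) = ennreal (\<Prod>b\<in>Basis. (?u - 0) \<bullet> b)"
    by (rule emeasure_lborel_cbox) (auto simp: Basis_vec_def inner_axis)
  also have "(\<Prod>b\<in>(Basis::(real^'d) set). (?u - 0) \<bullet> b) = (\<Prod>b\<in>(Basis::(real^'d) set). 2 * pi)"
    by (rule prod.cong) (auto simp: Basis_vec_def inner_axis)
  also have "\<dots> = (2 * pi) ^ CARD('d)" by simp
  finally show "emeasure lebesgue (torus_cell :: (real^'d) set) = ennreal ((2 * pi) ^ CARD('d))"
    by (simp add: torus_cell_def)
qed (simp add: torus_cell_def)

lemma cell_integrable:
  fixes h :: "real^'d \<Rightarrow> complex"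
  assumes "h \<in> borel_measurable lebesgue" and "\<And>x. norm (h x) \<le> B"
  shows "set_integrable lebesgue torus_cell h"
  unfolding set_integrable_def
proof (rule integrableI_bounded_set_indicator[where B = B])
  show "emeasure lebesgue (torus_cell :: (real^'d) set) < \<infinity>"
    by (simp add: torus_cell_measure)
qed (use assms torus_cell_measure in auto)

lemma cell_integrable_continuous:
  fixes h :: "real^'d \<Rightarrow> 'b::{banach, second_countable_topology}"
  assumes "continuous_on UNIV h"
  shows "set_integrable lebesgue torus_cell h"
proof -
  have "compact (torus_cell :: (real^'d) set)" by (simp add: torus_cell_def)
  moreover have "set_integrable lborel torus_cell h"
    unfolding set_integrable_def using assms \<open>compact torus_cell\<close>
    by (intro borel_integrable_compact) (auto intro: continuous_on_subset)
  moreover have "(\<lambda>x. indicator torus_cell x *\<^sub>R h x) \<in> borel_measurable lborel"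
    using \<open>set_integrable lborel torus_cell h\<close> unfolding set_integrable_def by auto
  ultimately show ?thesis
    unfolding set_integrable_def by (simp add: integrable_completion)
qed

lemma mean_add:
  "set_integrable lebesgue torus_cell f \<Longrightarrow> set_integrable lebesgue torus_cell g \<Longrightarrow>
    mean (\<lambda>x. f x + g x) = mean f + mean g"
  by (simp add: mean_def set_integral_add add_divide_distrib)

lemma mean_diff:
  "set_integrable lebesgue torus_cell f \<Longrightarrow> set_integrable lebesgue torus_cell g \<Longrightarrow>
    mean (\<lambda>x. f x - g x) = mean f - mean g"
  by (simp add: mean_def set_integral_diff diff_divide_distrib)

lemma mean_cmult: "mean (\<lambda>x. c * f x) = c * mean f"
  by (simp add: mean_def)

lemma mean_cnj: "mean (\<lambda>x. cnj (f x)) = cnj (mean f)"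
proof -
  have "(LINT x:torus_cell|lebesgue. cnj (f x)) = cnj (LINT x:torus_cell|lebesgue. f x)"
  proof -
    have "(\<lambda>x. indicator torus_cell x *\<^sub>R cnj (f x)) = (\<lambda>x. cnj (indicator torus_cell x *\<^sub>R f x))"
      by (auto simp: scaleR_conv_of_real)
    then show ?thesis
      unfolding set_lebesgue_integral_def by (simp only: Bochner_Integration.integral_cnj)
  qed
  then show ?thesis by (simp add: mean_def)
qed

lemma mean_const [simp]: "mean (\<lambda>x::real^'d. c) = c"
proof -
  have "(LINT x:(torus_cell::(real^'d) set)|lebesgue. c) = measure lebesgue (torus_cell::(real^'d) set) *\<^sub>R c"
    unfolding set_lebesgue_integral_def by (simp add: torus_cell_measure)
  also have "measure lebesgue (torus_cell::(real^'d) set) = (2 * pi) ^ CARD('d)"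
    by (simp add: measure_def torus_cell_measure)
  finally show ?thesis by (simp add: mean_def scaleR_conv_of_real)
qed

lemma norm_mean_le:
  fixes h :: "real^'d \<Rightarrow> complex"
  assumes "\<And>x. x \<in> torus_cell \<Longrightarrow> norm (h x) \<le> B"
  shows "norm (mean h) \<le> B"
proof -
  let ?v = "(2 * pi) ^ CARD('d)"
  have m: "measure lebesgue (torus_cell::(real^'d) set) = ?v"
    by (simp add: measure_def torus_cell_measure)
  have "norm (LINT x:torus_cell|lebesgue. h x) \<le> ?v * B"
  proof (cases "set_integrable lebesgue torus_cell h")
    case True
    have "norm (LINT x:torus_cell|lebesgue. h x)
        \<le> (LINT x|lebesgue. indicator (torus_cell::(real^'d) set) x *\<^sub>R B)"
      unfolding set_lebesgue_integral_def
    proof (rule Bochner_Integration.integral_norm_bound_integral)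
      show "integrable lebesgue (\<lambda>x. indicator (torus_cell::(real^'d) set) x *\<^sub>R B)"
        by (simp add: torus_cell_measure)
    qed (use True assms in \<open>auto simp: set_integrable_def indicator_def\<close>)
    then show ?thesis by (simp add: torus_cell_measure m)
  next
    case False
    have "(0::real^'d) \<in> torus_cell" by (simp add: torus_cell_def mem_box_cart)
    then have "B \<ge> 0" using assms[of 0] norm_ge_zero order_trans by blast
    then show ?thesis using False
      by (simp add: set_lebesgue_integral_def set_integrable_def not_integrable_integral_eq)
  qed
  then show ?thesis
    by (simp add: mean_def norm_divide norm_power norm_mult divide_le_eq mult.commute)
qed

lemma mean_character:
  fixes k :: "int^'d"
  shows "mean (\<lambda>x. cis (phase k x)) = (if k = 0 then 1 else 0)"
proof (cases "k = 0")
  case False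
  then obtain j where j: "k $ j \<noteq> 0" by (auto simp: vec_eq_iff)
  interpret product_sigma_finite "\<lambda>_::real^'d. lborel :: real measure"
    by unfold_locales
  define f where "f b t = (of_real (indicator {0..2*pi} t) * cis (phase k (t *\<^sub>R b)) :: complex)" for b :: "real^'d" and t
  have ph: "phase k (t *\<^sub>R axis i 1) = of_int (k $ i) * t" for i t
    using phase_add_axis[of k 0 i t] by (simp add: phase_def axis_def if_distrib cong: if_cong)
  have int: "integrable lborel (f b)" for b
    unfolding f_def phase_def scaleR_conv_of_real[symmetric]
    by (rule borel_integrable_compact) (auto intro!: continuous_intros)
  have sumph: "phase k (\<Sum>b\<in>Basis. (x \<bullet> b) *\<^sub>R b) = (\<Sum>b\<in>Basis. phase k ((x \<bullet> b) *\<^sub>R b))" for x :: "real^'d"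
    unfolding phase_def by (subst sum.swap) (simp add: sum_distrib_left)
  have cis_sum: "cis (\<Sum>b\<in>B. g b) = (\<Prod>b\<in>B. cis (g b))" if "finite B" for g and B :: "(real^'d) set"
    using that by induction (auto simp: cis_mult[symmetric])
  have ind: "(indicator torus_cell x :: real) = (\<Prod>b\<in>Basis. indicator {0..2*pi} (x \<bullet> b))" for x :: "real^'d"
  proof (cases "x \<in> torus_cell")
    case True
    then have "(\<Prod>b\<in>Basis. indicator {0..2*pi} (x \<bullet> b)) = (\<Prod>b\<in>(Basis::(real^'d) set). 1::real)"
      by (intro prod.cong) (auto simp: torus_cell_def mem_box_cart Basis_vec_def inner_axis)
    then show ?thesis using True by simp
  next
    case False
    then obtain i where "x \<bullet> axis i 1 \<notin> {0..2*pi}"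
      by (auto simp: torus_cell_def mem_box_cart inner_axis)
    then have "\<exists>b\<in>(Basis::(real^'d) set). indicator {0..2*pi} (x \<bullet> b) = (0::real)"
      by (intro bexI[of _ "axis i 1"]) (auto simp: Basis_vec_def)
    then have "(\<Prod>b\<in>(Basis::(real^'d) set). indicator {0..2*pi} (x \<bullet> b)) = (0::real)"
      by (simp add: prod_zero_iff)
    then show ?thesis using False by simp
  qed
  have integrand: "indicator torus_cell x *\<^sub>R cis (phase k x) = (\<Prod>b\<in>Basis. f b (x \<bullet> b))" for x
    unfolding f_def prod.distrib
    using sumph[of x] by (simp add: ind euclidean_representation cis_sum scaleR_conv_of_real[of "prod _ _"])
  have zero: "integral\<^sup>L lborel (f (axis j 1)) = 0"
  proof -
    have "(f (axis j 1) has_integral (0 - 0)) {0..2*pi}" if "True"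
    proof -
      define F where "F t = - \<i> / of_int (k $ j) * cis (of_int (k $ j) * t)" for t
      have "((\<lambda>t. cis (of_int (k $ j) * t)) has_integral (F (2*pi) - F 0)) {0..2*pi}"
      proof (rule fundamental_theorem_of_calculus)
        fix t
        have "((\<lambda>z. - \<i> / of_int (k $ j) * exp (\<i> * (of_int (k $ j) * z))) has_field_derivative
            exp (\<i> * (of_int (k $ j) * of_real t))) (at (of_real t))"
          using j by (auto intro!: derivative_eq_intros)
        from has_vector_derivative_real_field[OF this]
        show "(F has_vector_derivative cis (of_int (k $ j) * t)) (at t within {0..2*pi})"
          by (simp add: F_def[abs_def] cis_conv_exp)
      qed simp
      moreover have "F (2*pi) = F 0"
      proof -
        have "cis (of_int (k $ j) * (2*pi)) = 1"
          using cos_int_2pin[of "k $ j"] sin_int_2pin[of "k $ j"]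
          by (intro complex_eqI) (simp_all add: ac_simps)
        then show ?thesis by (simp add: F_def)
      qed
      ultimately have "((\<lambda>t. cis (of_int (k $ j) * t)) has_integral 0) {0..2*pi}" by simp
      then show ?thesis
        by (subst has_integral_cong[where g = "\<lambda>t. cis (of_int (k $ j) * t)"]) (auto simp: f_def ph)
    qed
    then have "integral {0..2*pi} (f (axis j 1)) = 0" by (simp add: integral_unique)
    moreover have "integral UNIV (f (axis j 1)) = integral {0..2*pi} (f (axis j 1))"
    proof -
      have "f (axis j 1) = (\<lambda>t. if t \<in> {0..2*pi} then f (axis j 1) t else 0)"
        by (auto simp: f_def)
      then show ?thesis by (metis integral_restrict_UNIV)
    qed
    ultimately show ?thesis
      using integral_lborel[OF int[of "axis j 1"]] by simp
  qed
  have "(LINT x:torus_cell|lebesgue. cis (phase k x)) = (LINT x|lborel. indicator torus_cell x *\<^sub>R cis (phase k x))"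
    unfolding set_lebesgue_integral_def
  proof (rule integral_completion)
    have "(\<lambda>x. cis (phase k x)) \<in> borel_measurable borel"
      by (intro borel_measurable_continuous_onI continuous_intros)
    then show "(\<lambda>x. indicator torus_cell x *\<^sub>R cis (phase k x)) \<in> borel_measurable lborel"
      by (simp add: torus_cell_def)
  qed
  also have "\<dots> = (LINT x|lborel. (\<Prod>b\<in>Basis. f b (x \<bullet> b)))"
    by (simp add: integrand)
  also have "\<dots> = (LINT y|(\<Pi>\<^sub>M b\<in>Basis. lborel). (\<Prod>b\<in>Basis. f b (y b)))"
  proof (subst lborel_eq, subst integral_distr)
    have "(\<lambda>x. cis (phase k ((x \<bullet> b) *\<^sub>R b))) \<in> borel_measurable borel" for b
      by (intro borel_measurable_continuous_onI continuous_intros)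
    then show "(\<lambda>x. \<Prod>b\<in>Basis. f b (x \<bullet> b)) \<in> borel_measurable borel"
      unfolding f_def by measurable
  qed (auto intro!: Bochner_Integration.integral_cong prod.cong)
  also have "\<dots> = (\<Prod>b\<in>Basis. integral\<^sup>L lborel (f b))"
    by (rule product_integral_prod) (auto simp: int)
  also have "\<dots> = 0"
    using zero by (auto intro!: bexI[of _ "axis j 1"] simp: Basis_vec_def)
  finally show ?thesis using False by (simp add: mean_def)
qed simp

section \<open>Absolutely convergent Fourier series\<close>

lemma abs_summable_le:
  fixes f :: "'k \<Rightarrow> 'b::real_normed_vector"
  assumes "g summable_on A" "\<And>x. x \<in> A \<Longrightarrow> norm (f x) \<le> (g x :: real)"
  shows "(\<lambda>x. norm (f x)) summable_on A"
  by (rule summable_on_comparison_test[OF assms(1)]) (use assms(2) in auto)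

lemma infsum_split_finite:
  fixes f :: "'k \<Rightarrow> complex"
  assumes "f summable_on UNIV" "finite F"
  shows "infsum f UNIV = sum f F + infsum f (- F)"
proof -
  have "infsum f (F \<union> - F) = infsum f F + infsum f (- F)"
    using assms by (intro infsum_Un_disjoint summable_on_subset_banach[OF assms(1)]) auto
  then show ?thesis using assms by simp
qed

lemma uniform_limit_infsum:
  fixes c :: "'k \<Rightarrow> complex" and h :: "'k \<Rightarrow> 'x \<Rightarrow> complex"
  assumes c: "(\<lambda>l. norm (c l)) summable_on UNIV" and h: "\<And>l x. norm (h l x) \<le> B"
  shows "uniform_limit UNIV (\<lambda>F x. \<Sum>l\<in>F. c l * h l x) (\<lambda>x. \<Sum>\<^sub>\<infinity>l. c l * h l x)
           (finite_subsets_at_top UNIV)"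
proof (rule uniform_limitI)
  fix e :: real assume "e > 0"
  define C where "C = \<bar>B\<bar> + 1"
  have C: "C > 0" "\<And>l x. norm (h l x) \<le> C" using h unfolding C_def by (auto intro: order_trans[OF h])
  have "\<forall>\<^sub>F F in finite_subsets_at_top UNIV. dist (\<Sum>l\<in>F. norm (c l)) (\<Sum>\<^sub>\<infinity>l. norm (c l)) < e / C"
    using infsum_tendsto[OF c] \<open>e > 0\<close> C by (intro tendstoD) auto
  moreover have "\<forall>\<^sub>F F in finite_subsets_at_top (UNIV::'k set). finite F"
    by (simp add: eventually_finite_subsets_at_top_weakI)
  ultimately show "\<forall>\<^sub>F F in finite_subsets_at_top UNIV.
      \<forall>x\<in>UNIV. dist (\<Sum>l\<in>F. c l * h l x) (\<Sum>\<^sub>\<infinity>l. c l * h l x) < e"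
  proof eventually_elim
    case (elim F)
    show ?case
    proof
      fix x
      have le: "norm (c l * h l x) \<le> norm (c l) * C" for l
        using C by (simp add: norm_mult mult_left_mono)
      have cC: "(\<lambda>l. norm (c l) * C) summable_on A" for A
        by (rule summable_on_subset_banach[OF summable_on_cmult_left[OF c]]) simp
      have s: "(\<lambda>l. norm (c l * h l x)) summable_on UNIV"
        by (rule abs_summable_le[OF cC]) (use le in auto)
      have n: "(\<Sum>\<^sub>\<infinity>l. norm (c l)) = (\<Sum>l\<in>F. norm (c l)) + (\<Sum>\<^sub>\<infinity>l\<in>-F. norm (c l))"
      proof -
        have "infsum (\<lambda>l. norm (c l)) (F \<union> - F) = infsum (\<lambda>l. norm (c l)) F + infsum (\<lambda>l. norm (c l)) (- F)"
          using elim by (intro infsum_Un_disjoint summable_on_subset_banach[OF c]) auto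
        then show ?thesis using elim by simp
      qed
      have "dist (\<Sum>l\<in>F. c l * h l x) (\<Sum>\<^sub>\<infinity>l. c l * h l x) = norm (\<Sum>\<^sub>\<infinity>l\<in>-F. c l * h l x)"
        using infsum_split_finite[OF abs_summable_summable[OF s], of F] elim by (simp add: dist_norm norm_minus_commute)
      also have "\<dots> \<le> (\<Sum>\<^sub>\<infinity>l\<in>-F. norm (c l) * C)"
        by (rule norm_infsum_le[OF has_sum_infsum has_sum_infsum])
           (use le cC summable_on_subset_banach[OF abs_summable_summable[OF s]] in auto)
      also have "\<dots> = (\<Sum>\<^sub>\<infinity>l\<in>-F. norm (c l)) * C"
        by (rule infsum_cmult_left) (use summable_on_subset_banach[OF c] in auto)
      also have "\<dots> < e"
        using elim n C infsum_nonneg[of "- F" "\<lambda>l. norm (c l)"] by (auto simp: dist_norm field_simps)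
      finally show "dist (\<Sum>l\<in>F. c l * h l x) (\<Sum>\<^sub>\<infinity>l. c l * h l x) < e" .
    qed
  qed
qed

lemma continuous_on_infsum:
  fixes c :: "'k \<Rightarrow> complex" and h :: "'k \<Rightarrow> 'x::topological_space \<Rightarrow> complex"
  assumes "(\<lambda>l. norm (c l)) summable_on UNIV" "\<And>l x. norm (h l x) \<le> B"
    and "\<And>l. continuous_on UNIV (h l)"
  shows "continuous_on UNIV (\<lambda>x. \<Sum>\<^sub>\<infinity>l. c l * h l x)"
  by (rule uniform_limit_theorem[OF _ uniform_limit_infsum[OF assms(1,2)]])
     (use assms(3) in \<open>auto intro!: always_eventually continuous_intros\<close>)

text \<open>
  Absolute convergence makes the series uniformly convergent, and the cell has finite measure.
\<close>

lemma mean_infsum: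
  fixes c :: "'k \<Rightarrow> complex" and h :: "'k \<Rightarrow> real^'d \<Rightarrow> complex"
  assumes c: "(\<lambda>l. norm (c l)) summable_on UNIV" and h: "\<And>l x. norm (h l x) \<le> B"
    and cont: "\<And>l. continuous_on UNIV (h l)"
  shows "mean (\<lambda>x. \<Sum>\<^sub>\<infinity>l. c l * h l x) = (\<Sum>\<^sub>\<infinity>l. c l * mean (h l))"
proof -
  let ?F = "finite_subsets_at_top (UNIV::'k set)"
  let ?s = "\<lambda>x. \<Sum>\<^sub>\<infinity>l. c l * h l x"
  have fin: "mean (\<lambda>x. \<Sum>l\<in>F. c l * h l x) = (\<Sum>l\<in>F. c l * mean (h l))" if "finite F" for F
    using that
  proof induction
    case empty
    then show ?case using mean_const[of 0] by (simp del: mean_const)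
  next
    case (insert l F)
    have "mean (\<lambda>x. c l * h l x + (\<Sum>l\<in>F. c l * h l x)) = mean (\<lambda>x. c l * h l x) + mean (\<lambda>x. \<Sum>l\<in>F. c l * h l x)"
      by (rule mean_add; rule cell_integrable_continuous; intro continuous_intros cont)
    then show ?case using insert by (simp add: mean_cmult)
  qed
  have "((\<lambda>F. mean (\<lambda>x. \<Sum>l\<in>F. c l * h l x)) \<longlongrightarrow> mean ?s) ?F"
  proof (rule tendstoI)
    fix e :: real assume "e > 0"
    have "\<forall>\<^sub>F F in ?F. \<forall>x\<in>UNIV. dist (\<Sum>l\<in>F. c l * h l x) (?s x) < e / 2"
      using uniform_limitD[OF uniform_limit_infsum[OF c h], of "e/2"] \<open>e > 0\<close> by auto
    then show "\<forall>\<^sub>F F in ?F. dist (mean (\<lambda>x. \<Sum>l\<in>F. c l * h l x)) (mean ?s) < e"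
    proof eventually_elim
      case (elim F)
      have "mean (\<lambda>x. \<Sum>l\<in>F. c l * h l x) - mean ?s = mean (\<lambda>x. (\<Sum>l\<in>F. c l * h l x) - ?s x)"
        by (rule mean_diff[symmetric]; rule cell_integrable_continuous)
           (auto intro!: continuous_intros cont continuous_on_infsum[OF c h])
      moreover have "norm (mean (\<lambda>x. (\<Sum>l\<in>F. c l * h l x) - ?s x)) \<le> e / 2"
        by (rule norm_mean_le) (use elim in \<open>auto simp: dist_norm intro: less_imp_le\<close>)
      ultimately show ?case using \<open>e > 0\<close> by (simp add: dist_norm)
    qed
  qed
  then have "((\<lambda>F. \<Sum>l\<in>F. c l * mean (h l)) \<longlongrightarrow> mean ?s) ?F"
    by (rule Lim_transform_eventually) (auto intro: eventually_finite_subsets_at_top_weakI simp: fin)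
  moreover have "((\<lambda>F. \<Sum>l\<in>F. c l * mean (h l)) \<longlongrightarrow> (\<Sum>\<^sub>\<infinity>l. c l * mean (h l))) ?F"
  proof (rule infsum_tendsto)
    have "norm (c l * mean (h l)) \<le> norm (c l) * B" for l
      using norm_mean_le[of "h l" B] h by (simp add: norm_mult mult_left_mono)
    then show "(\<lambda>l. c l * mean (h l)) summable_on UNIV"
      by (intro abs_summable_summable[OF abs_summable_le[OF summable_on_cmult_left[OF c, of B]]])
  qed
  ultimately show ?thesis by (intro tendsto_unique[where F = ?F]) auto
qed

lemma norm_mean_le_mean:
  fixes h :: "real^'d \<Rightarrow> complex"
  assumes "continuous_on UNIV h" "continuous_on UNIV g"
    and "\<And>x. x \<in> torus_cell \<Longrightarrow> norm (h x) \<le> g x"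
  shows "norm (mean h) \<le> Re (mean (\<lambda>x. of_real (g x)))"
proof -
  have ig: "integrable lebesgue (\<lambda>x. indicator torus_cell x *\<^sub>R g x)"
    using cell_integrable_continuous[OF assms(2)] by (simp add: set_integrable_def)
  have le: "norm (LINT x:torus_cell|lebesgue. h x) \<le> (LINT x|lebesgue. indicator torus_cell x *\<^sub>R g x)"
    unfolding set_lebesgue_integral_def
  proof (rule Bochner_Integration.integral_norm_bound_integral)
    show "integrable lebesgue (\<lambda>x. indicator torus_cell x *\<^sub>R h x)"
      using cell_integrable_continuous[OF assms(1)] by (simp add: set_integrable_def)
  qed (use ig assms in \<open>auto simp: indicator_def\<close>)
  have "(LINT x:torus_cell|lebesgue. complex_of_real (g x))
       = of_real (LINT x|lebesgue. indicator torus_cell x *\<^sub>R g x)"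
    unfolding set_lebesgue_integral_def integral_complex_of_real[symmetric]
    by (simp add: scaleR_conv_of_real)
  then have "Re (mean (\<lambda>x. of_real (g x)))
       = (LINT x|lebesgue. indicator torus_cell x *\<^sub>R g x) / (2 * pi) ^ CARD('d)"
    by (simp only: mean_def Re_divide_of_real Re_complex_of_real)
  moreover have "norm (mean h) = norm (LINT x:torus_cell|lebesgue. h x) / (2 * pi) ^ CARD('d)"
    by (simp only: mean_def norm_divide norm_of_real) simp
  ultimately show ?thesis
    using divide_right_mono[OF le, of "(2 * pi) ^ CARD('d)"] by simp
qed

section \<open>Uniqueness of Fourier coefficients\<close>

lemma one_plus_cos_half: "complex_of_real ((1 + cos t) / 2) = 1/2 + cis t / 4 + cis (- t) / 4"
  by (simp add: complex_eq_iff field_simps)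

text \<open>
  A cosine is half the sum of two characters, so multiplying by \<open>(1 + cos (x\<^sub>j -
  a\<^sub>j)) / 2\<close> preserves the vanishing of all Fourier coefficients.
\<close>

lemma mean_peak_kernel_eq_0:
  fixes D :: "real^'d \<Rightarrow> complex"
  assumes cont: "continuous_on UNIV D" and zero: "\<And>k. mean (\<lambda>x. D x * cis (phase k x)) = 0"
  shows "mean (\<lambda>x. D x * of_real (\<Prod>j\<in>UNIV. ((1 + cos (x $ j - a $ j)) / 2) ^ m)) = 0"
proof -
  define Z where "Z T \<longleftrightarrow> continuous_on UNIV T \<and> (\<forall>k. mean (\<lambda>x. D x * (T x * cis (phase k x))) = 0)" for T
  have Z1: "Z (\<lambda>_. 1)" using zero by (simp add: Z_def)
  have step: "Z (\<lambda>x. of_real ((1 + cos (x $ j - a $ j)) / 2) * T x)" if T: "Z T" for T j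
  proof -
    have ph: "phase (axis j 1) x = x $ j" for x :: "real^'d"
      unfolding phase_def axis_def by (simp add: if_distrib[of of_int] if_distrib[of "\<lambda>u. u * _"] cong: if_cong)
    have e: "D x * (of_real ((1 + cos (x $ j - a $ j)) / 2) * T x * cis (phase k x)) =
       (1/2) * (D x * (T x * cis (phase k x))) + ((cis (- (a $ j)) / 4) * (D x * (T x * cis (phase (k + axis j 1) x)))
        + (cis (a $ j) / 4) * (D x * (T x * cis (phase (k - axis j 1) x))))" for x k
    proof -
      have "cis (x $ j - a $ j) = cis (- (a $ j)) * cis (phase (axis j 1) x)"
        "cis (- (x $ j - a $ j)) = cis (a $ j) * cis (- phase (axis j 1) x)"
        by (simp_all add: cis_mult ph)
      moreover have "cis (phase (k + axis j 1) x) = cis (phase (axis j 1) x) * cis (phase k x)"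
        "cis (phase (k - axis j 1) x) = cis (- phase (axis j 1) x) * cis (phase k x)"
        by (simp_all add: phase_add phase_diff cis_mult add.commute)
      ultimately show ?thesis unfolding one_plus_cos_half by (simp add: algebra_simps add.commute[of "phase k x"])
    qed
    have cT: "continuous_on UNIV T" using T by (simp add: Z_def)
    have ic: "set_integrable lebesgue torus_cell (\<lambda>x. c * (D x * (T x * cis (phase k x))))" for c k
      by (rule cell_integrable_continuous) (intro continuous_intros cont cT)
    have ic2: "set_integrable lebesgue torus_cell (\<lambda>x. c * (D x * (T x * cis (phase k x))) + c' * (D x * (T x * cis (phase k' x))))" for c k c' k'
      by (rule cell_integrable_continuous) (intro continuous_intros cont cT)
    show ?thesis
      unfolding Z_def e mean_add[OF ic ic2] mean_add[OF ic ic] mean_cmult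
      using T by (auto simp: Z_def intro!: continuous_intros)
  qed
  have pow: "Z (\<lambda>x. of_real (((1 + cos (x $ j - a $ j)) / 2) ^ m) * T x)" if "Z T" for T j m
  proof (induction m)
    case (Suc m)
    show ?case using step[OF Suc, of j] by (simp add: mult.assoc)
  qed (use that in simp)
  have "Z (\<lambda>x. of_real (\<Prod>j\<in>S. ((1 + cos (x $ j - a $ j)) / 2) ^ m))" if "finite S" for S
    using that
  proof induction
    case (insert j S)
    show ?case
      unfolding prod.insert[OF insert.hyps] of_real_mult by (rule pow[OF insert.IH])
  qed (use Z1 in simp)
  from this[of UNIV] have "mean (\<lambda>x. D x * (of_real (\<Prod>j\<in>UNIV. ((1 + cos (x $ j - a $ j)) / 2) ^ m) * cis (phase 0 x))) = 0"
    unfolding Z_def using finite by blast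
  then show ?thesis by simp
qed

text \<open>
  The kernel \<open>\<Prod>\<^sub>j ((1 + cos (x\<^sub>j - a\<^sub>j)) / 2)\<^sup>m\<close> is a trigonometric polynomial which, as \<open>m\<close> grows,
  concentrates its mass at \<open>a\<close>.
\<close>

lemma continuous_eq_0_if_coeffs_0_interior:
  fixes D :: "real^'d \<Rightarrow> complex"
  assumes cont: "continuous_on UNIV D" and zero: "\<And>k. mean (\<lambda>x. D x * cis (phase k x)) = 0"
    and a: "\<And>j. 0 < a $ j \<and> a $ j < 2 * pi"
  shows "D a = 0"
proof (rule ccontr)
  assume "D a \<noteq> 0"
  define c where "c = norm (D a)"
  have c: "c > 0" using \<open>D a \<noteq> 0\<close> by (simp add: c_def)
  define q where "q t = (1 + cos t) / 2" for t :: real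
  define K where "K m x = (\<Prod>j\<in>UNIV. q (x $ j - a $ j) ^ m)" for m and x :: "real^'d"
  have q01: "0 \<le> q t" "q t \<le> 1" for t
  proof -
    have "0 \<le> 1 + cos t" using cos_ge_minus_one[of t] by linarith
    then show "0 \<le> q t" "q t \<le> 1" by (simp_all add: q_def)
  qed
  have K0: "0 \<le> K m x" for m x unfolding K_def by (intro prod_nonneg) (use q01 in auto)
  have Kcont: "continuous_on UNIV (K m)" for m
    unfolding K_def q_def by (intro continuous_intros) auto
  obtain r where r: "r > 0" "\<And>x. dist x a < r \<Longrightarrow> norm (D x - D a) < c / 2"
    using cont c unfolding continuous_on_iff by (metis UNIV_I dist_norm half_gt_zero)
  define \<delta> where "\<delta> = Min (insert (r / real CARD('d)) ((\<lambda>j. min (a $ j) (2*pi - a $ j)) ` UNIV))"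
  have d_le: "\<delta> \<le> r / real CARD('d)" "\<And>j. \<delta> \<le> a $ j" "\<And>j. \<delta> \<le> 2*pi - a $ j"
  proof -
    show "\<delta> \<le> r / real CARD('d)" unfolding \<delta>_def by (rule Min_le) auto
    have "\<delta> \<le> min (a $ j) (2*pi - a $ j)" for j unfolding \<delta>_def by (rule Min_le) auto
    then show "\<And>j. \<delta> \<le> a $ j" "\<And>j. \<delta> \<le> 2*pi - a $ j" by (auto simp: min.bounded_iff)
  qed
  have d_pos: "\<delta> > 0" unfolding \<delta>_def using r a by (subst Min_gr_iff) auto
  have d_pi: "\<delta> \<le> pi" using d_le(2,3)[of undefined] by linarith
  obtain B where B: "B \<ge> 0" "\<And>x. x \<in> torus_cell \<Longrightarrow> norm (D x) \<le> B"
  proof -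
    have "compact (D ` torus_cell)"
      by (intro compact_continuous_image continuous_on_subset[OF cont]) (auto simp: torus_cell_def)
    then obtain B where "\<And>x. x \<in> torus_cell \<Longrightarrow> norm (D x) \<le> B"
      using compact_imp_bounded bounded_iff by (metis imageI)
    then show thesis using that[of "max B 0"] by (meson max.cobounded2 max.coboundedI1)
  qed
  define \<rho> where "\<rho> = q \<delta>"
  have rho: "0 \<le> \<rho>" "\<rho> < 1"
  proof -
    have "cos \<delta> < cos 0" using d_pos d_pi by (intro cos_monotone_0_pi) auto
    then show "0 \<le> \<rho>" "\<rho> < 1" using q01 by (auto simp: \<rho>_def q_def)
  qed
  have far: "K m x \<le> \<rho> ^ m" if x: "x \<in> torus_cell" and j: "\<bar>x $ j - a $ j\<bar> \<ge> \<delta>" for m x j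
  proof -
    let ?t = "\<bar>x $ j - a $ j\<bar>"
    have xj: "0 \<le> x $ j" "x $ j \<le> 2 * pi" using x by (auto simp: torus_cell_def mem_box_cart)
    have t: "?t \<le> 2 * pi - \<delta>" using xj d_le(2)[of j] d_le(3)[of j] by linarith
    have "cos ?t \<le> cos \<delta>"
    proof (cases "?t \<le> pi")
      case True
      then show ?thesis using j d_pos by (intro cos_monotone_0_pi_le) auto
    next
      case False
      have "cos ?t = cos (2 * pi - ?t)" by (simp add: cos_diff)
      also have "\<dots> \<le> cos \<delta>" using False t d_pos by (intro cos_monotone_0_pi_le) auto
      finally show ?thesis .
    qed
    then have "q (x $ j - a $ j) \<le> \<rho>" by (simp add: q_def \<rho>_def)
    then have "q (x $ j - a $ j) ^ m \<le> \<rho> ^ m" using q01 by (intro power_mono) auto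
    moreover have "(\<Prod>i\<in>UNIV-{j}. q (x $ i - a $ i) ^ m) \<le> 1"
      by (intro prod_le_1) (use q01 in \<open>auto intro: power_le_one\<close>)
    moreover have "K m x = q (x $ j - a $ j) ^ m * (\<Prod>i\<in>UNIV-{j}. q (x $ i - a $ i) ^ m)"
      unfolding K_def by (rule prod.remove) auto
    ultimately show ?thesis
      using rho q01 mult_mono[of "q (x $ j - a $ j) ^ m" "\<rho> ^ m" "(\<Prod>i\<in>UNIV-{j}. q (x $ i - a $ i) ^ m)" 1]
      by (simp add: prod_nonneg)
  qed
  have "((\<lambda>h. q h ^ CARD('d)) \<longlongrightarrow> q 0 ^ CARD('d)) (at_right 0)"
    unfolding q_def by (intro tendsto_intros) auto
  then have "\<forall>\<^sub>F h in at_right 0. \<rho> < q h ^ CARD('d)"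
    by (rule order_tendstoD) (use rho in \<open>simp add: q_def\<close>)
  moreover have "\<forall>\<^sub>F h in at_right 0. h < \<delta>" using d_pos
    by (simp add: eventually_at_right_less eventually_at_right_field) (use d_pos in blast)
  moreover have "\<forall>\<^sub>F h in at_right (0::real). h > 0" by (simp add: eventually_at_right_less)
  ultimately have "\<forall>\<^sub>F h in at_right 0. \<rho> < q h ^ CARD('d) \<and> h < \<delta> \<and> h > 0"
    by eventually_elim auto
  then obtain h where h: "\<rho> < q h ^ CARD('d)" "h < \<delta>" "h > 0"
    using eventually_happens[of _ "at_right (0::real)"] trivial_limit_at_right_real by blast
  define \<tau> where "\<tau> = q h ^ CARD('d)"
  let ?Q = "cbox (\<chi> j. a $ j - h) (\<chi> j. a $ j + h)"
  have QK: "\<tau> ^ m \<le> K m x" if "x \<in> ?Q" for x m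
  proof -
    have "q h ^ m \<le> q (x $ j - a $ j) ^ m" for j
    proof (rule power_mono)
      have "\<bar>x $ j - a $ j\<bar> \<le> h" using that by (auto simp: mem_box_cart abs_le_iff) (smt (verit))+
      then have "cos h \<le> cos \<bar>x $ j - a $ j\<bar>" using h d_pi by (intro cos_monotone_0_pi_le) auto
      then show "q h \<le> q (x $ j - a $ j)" by (simp add: q_def)
    qed (use q01 in auto)
    then have "(\<Prod>j\<in>(UNIV::'d set). q h ^ m) \<le> K m x"
      unfolding K_def by (intro prod_mono) (use q01 in auto)
    then show ?thesis by (simp add: \<tau>_def power_mult[symmetric] mult.commute)
  qed
  have Qcell: "?Q \<subseteq> torus_cell"
    using h d_le(2,3) by (auto simp: torus_cell_def mem_box_cart subset_iff) (smt (verit))+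
  define v where "v = measure lborel ?Q / (2 * pi) ^ CARD('d)"
  have "measure lborel ?Q > 0"
    using content_pos_lt[of "\<chi> j. a $ j - h" "\<chi> j. a $ j + h"] h
    by (auto simp: Basis_vec_def inner_axis)
  then have v: "v > 0" by (simp add: v_def)
  have lower: "\<tau> ^ m * v \<le> Re (mean (\<lambda>x. of_real (K m x)))" for m
  proof -
    have le: "(LINT x|lebesgue. indicator ?Q x *\<^sub>R \<tau> ^ m) \<le> (LINT x|lebesgue. indicator torus_cell x *\<^sub>R K m x)"
    proof (rule integral_mono)
      have "integrable lebesgue (indicator ?Q :: _ \<Rightarrow> real)"
        by (rule integrable_real_indicator) (use emeasure_lborel_cbox_finite in auto)
      then show "integrable lebesgue (\<lambda>x. indicator ?Q x *\<^sub>R \<tau> ^ m)"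
        by simp
      show "integrable lebesgue (\<lambda>x. indicator torus_cell x *\<^sub>R K m x)"
        using cell_integrable_continuous[OF Kcont] by (simp add: set_integrable_def)
    qed (use QK Qcell K0 in \<open>auto simp: indicator_def\<close>)
    have eq: "(LINT x|lebesgue. indicator ?Q x *\<^sub>R \<tau> ^ m) = \<tau> ^ m * measure lborel ?Q"
      by simp
    have "(LINT x:torus_cell|lebesgue. complex_of_real (K m x))
         = of_real (LINT x|lebesgue. indicator torus_cell x *\<^sub>R K m x)"
      unfolding set_lebesgue_integral_def integral_complex_of_real[symmetric]
      by (simp add: scaleR_conv_of_real)
    then have "Re (mean (\<lambda>x. of_real (K m x)))
         = (LINT x|lebesgue. indicator torus_cell x *\<^sub>R K m x) / (2 * pi) ^ CARD('d)"
      by (simp only: mean_def Re_divide_of_real Re_complex_of_real)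
    then show ?thesis
      using divide_right_mono[OF le[unfolded eq], of "(2 * pi) ^ CARD('d)"] unfolding v_def by simp
  qed
  have main: "c / 2 * v * \<tau> ^ m \<le> 2 * B * \<rho> ^ m" for m
  proof -
    define \<kappa> where "\<kappa> = Re (mean (\<lambda>x. of_real (K m x)))"
    have iK: "set_integrable lebesgue torus_cell (\<lambda>x. complex_of_real (K m x))"
      by (intro cell_integrable_continuous continuous_intros Kcont)
    have \<kappa>: "mean (\<lambda>x. of_real (K m x)) = of_real \<kappa>"
      unfolding \<kappa>_def mean_def set_lebesgue_integral_def
      using set_integral_complex_of_real[of lebesgue torus_cell "K m"]
      by (simp add: set_lebesgue_integral_def Re_divide_of_real Im_divide_of_real complex_eq_iff del: of_real_power of_real_mult)
    have "mean (\<lambda>x. D a * of_real (K m x)) - mean (\<lambda>x. D x * of_real (K m x))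
        = mean (\<lambda>x. D a * of_real (K m x) - D x * of_real (K m x))"
      by (rule mean_diff[symmetric]; rule cell_integrable_continuous; intro continuous_intros cont Kcont)
    then have "D a * of_real \<kappa> = mean (\<lambda>x. D a * of_real (K m x) - D x * of_real (K m x))"
      using mean_peak_kernel_eq_0[OF cont zero, of a m] \<kappa> by (simp add: mean_cmult K_def q_def)
    moreover have "norm (mean (\<lambda>x. D a * of_real (K m x) - D x * of_real (K m x)))
        \<le> Re (mean (\<lambda>x. of_real (c / 2 * K m x + 2 * B * \<rho> ^ m)))"
    proof (rule norm_mean_le_mean)
      fix x :: "real^'d" assume x: "x \<in> torus_cell"
      have eq: "norm (D a * of_real (K m x) - D x * of_real (K m x)) = norm (D x - D a) * K m x"
        using K0[of m x] by (simp add: norm_mult norm_minus_commute flip: left_diff_distrib)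
      show "norm (D a * of_real (K m x) - D x * of_real (K m x)) \<le> c / 2 * K m x + 2 * B * \<rho> ^ m"
      proof (cases "\<forall>j. \<bar>x $ j - a $ j\<bar> < \<delta>")
        case True
        have "dist x a \<le> (\<Sum>j\<in>UNIV. \<bar>(x - a) $ j\<bar>)" unfolding dist_norm by (rule norm_le_l1_cart)
        also have "\<dots> < (\<Sum>j\<in>(UNIV::'d set). \<delta>)" using True by (intro sum_strict_mono) auto
        also have "\<dots> \<le> r" using d_le(1) by (simp add: field_simps)
        finally have "norm (D x - D a) \<le> c / 2" using r(2) by (auto intro: less_imp_le)
        then have "norm (D x - D a) * K m x \<le> c / 2 * K m x" by (intro mult_right_mono K0)
        moreover have "0 \<le> 2 * B * \<rho> ^ m" using B rho by simp
        ultimately show ?thesis using eq by linarith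
      next
        case False
        then obtain j where "\<bar>x $ j - a $ j\<bar> \<ge> \<delta>" by (auto simp: not_less)
        then have "K m x \<le> \<rho> ^ m" by (rule far[OF x])
        moreover have "a \<in> torus_cell" using a by (auto simp: torus_cell_def mem_box_cart intro: less_imp_le)
        then have "norm (D x - D a) \<le> 2 * B" using B(2)[of a] B(2)[OF x] norm_triangle_ineq4[of "D x" "D a"] by linarith
        ultimately have "norm (D x - D a) * K m x \<le> 2 * B * \<rho> ^ m"
          using K0 B by (intro mult_mono) auto
        moreover have "0 \<le> c / 2 * K m x" using c K0 by simp
        ultimately show ?thesis using eq by linarith
      qed
    qed (intro continuous_intros cont Kcont)+
    moreover have "mean (\<lambda>x. of_real (c / 2 * K m x + 2 * B * \<rho> ^ m)) = of_real (c / 2 * \<kappa> + 2 * B * \<rho> ^ m)"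
    proof -
      have "mean (\<lambda>x. of_real (c / 2) * of_real (K m x) + of_real (2 * B * \<rho> ^ m))
        = mean (\<lambda>x. of_real (c / 2) * of_real (K m x)) + mean (\<lambda>x::real^'d. of_real (2 * B * \<rho> ^ m))"
        by (rule mean_add; rule cell_integrable_continuous; intro continuous_intros Kcont)
      then show ?thesis by (simp only: mean_cmult mean_const \<kappa> of_real_add of_real_mult)
    qed
    ultimately have "c * \<bar>\<kappa>\<bar> \<le> c / 2 * \<kappa> + 2 * B * \<rho> ^ m"
      by (metis (no_types, lifting) Re_complex_of_real c_def norm_mult norm_of_real)
    moreover have "\<tau> ^ m * v \<le> \<kappa>" using lower by (simp add: \<kappa>_def)
    moreover have "0 \<le> \<tau> ^ m * v" using v q01 by (simp add: \<tau>_def)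
    ultimately have "c / 2 * \<kappa> \<le> 2 * B * \<rho> ^ m" and "c / 2 * (\<tau> ^ m * v) \<le> c / 2 * \<kappa>"
      using c by (auto simp: field_simps)
    then show ?thesis by (simp add: algebra_simps)
  qed
  have tau: "\<tau> > 0" using h(1) rho(1) by (simp add: \<tau>_def)
  have "(\<lambda>m. 2 * B * (\<rho> / \<tau>) ^ m) \<longlonglongrightarrow> 2 * B * 0"
    using rho h(1) tau by (intro tendsto_intros LIMSEQ_power_zero) (auto simp: \<tau>_def)
  moreover have "c / 2 * v \<le> 2 * B * (\<rho> / \<tau>) ^ m" for m
    using main[of m] tau by (simp add: power_divide field_simps)
  ultimately have "c / 2 * v \<le> 0" by (intro LIMSEQ_le_const) auto
  then show False using c v by (simp add: mult_le_0_iff)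
qed

lemma torus_periodic_int_shift:
  assumes "torus_periodic f"
  shows "f (x + axis j (2 * pi * of_int m)) = f x"
proof (induction m arbitrary: x rule: int_induct[where k = 0])
  case base
  then show ?case by (simp add: axis_def vec_eq_iff flip: zero_vec_def)
next
  case (step1 i)
  have "x + axis j (2 * pi * of_int (i + 1)) = (x + axis j (2 * pi * of_int i)) + axis j (2 * pi)"
    by (simp add: vec_eq_iff axis_def algebra_simps)
  then show ?case using assms step1 unfolding torus_periodic_def by metis
next
  case (step2 i)
  have "(x + axis j (2 * pi * of_int (i - 1))) + axis j (2 * pi) = x + axis j (2 * pi * of_int i)"
    by (simp add: vec_eq_iff axis_def algebra_simps)
  then show ?case using assms step2 unfolding torus_periodic_def by metis
qed

lemma torus_periodic_into_cell:
  fixes f :: "real^'d \<Rightarrow> 'a"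
  assumes "torus_periodic f"
  obtains y where "f y = f x" "y \<in> torus_cell"
proof -
  define y where "y S = (\<chi> j. if j \<in> S then x $ j - 2 * pi * of_int \<lfloor>x $ j / (2 * pi)\<rfloor> else x $ j)" for S
  have "f (y S) = f x" if "finite S" for S
    using that
  proof induction
    case empty
    then show ?case by (simp add: y_def)
  next
    case (insert j S)
    have "y (insert j S) = y S + axis j (2 * pi * of_int (- \<lfloor>x $ j / (2 * pi)\<rfloor>))"
      using insert by (auto simp: y_def vec_eq_iff axis_def)
    then show ?case using insert torus_periodic_int_shift[OF assms] by metis
  qed
  then have "f (y UNIV) = f x" by simp
  moreover have "y UNIV \<in> torus_cell"
  proof -
    have "0 \<le> x $ j - 2 * pi * of_int \<lfloor>x $ j / (2 * pi)\<rfloor> \<and> x $ j - 2 * pi * of_int \<lfloor>x $ j / (2 * pi)\<rfloor> \<le> 2 * pi" for j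
      using floor_divide_lower[of "2 * pi" "x $ j"] floor_divide_upper[of "2 * pi" "x $ j"] by (simp add: algebra_simps)
    then show ?thesis by (simp add: y_def torus_cell_def mem_box_cart)
  qed
  ultimately show thesis by (rule that)
qed

text \<open>
  By periodicity every point has a translate in the cell; boundary points are limits of interior
  ones.
\<close>

lemma continuous_eq_0_if_coeffs_0:
  fixes D :: "real^'d \<Rightarrow> complex"
  assumes cont: "continuous_on UNIV D" and per: "torus_periodic D"
    and zero: "\<And>k. mean (\<lambda>x. D x * cis (phase k x)) = 0"
  shows "D x = 0"
proof -
  obtain y where y: "D y = D x" "y \<in> torus_cell" by (rule torus_periodic_into_cell[OF per])
  let ?c = "\<chi> j::'d. 2 * pi"
  have "D z = 0" if "z \<in> box 0 ?c" for z
    by (rule continuous_eq_0_if_coeffs_0_interior[OF cont zero]) (use that in \<open>auto simp: mem_box_cart\<close>)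
  moreover have "(\<chi> j. pi) \<in> box 0 ?c" by (simp add: mem_box_cart)
  then have "closure (box 0 ?c) = cbox 0 ?c" by (intro closure_box) auto
  ultimately have "D y = 0"
    using continuous_constant_on_closure[of "box 0 ?c" D 0 y] y(2) cont
    by (auto simp: torus_cell_def intro: continuous_on_subset)
  then show ?thesis using y by simp
qed

section \<open>Summable and square summable sequences\<close>

text \<open>
  Bounds on the finite sums say both that the family is summable and how large its sum is; no
  separate summability hypothesis is then needed.
\<close>

definition l1_le :: "('k \<Rightarrow> 'b::real_normed_vector) \<Rightarrow> real \<Rightarrow> bool" where
  "l1_le c B \<longleftrightarrow> (\<forall>F. finite F \<longrightarrow> (\<Sum>k\<in>F. norm (c k)) \<le> B)"

definition l2_le :: "('k \<Rightarrow> 'b::real_normed_vector) \<Rightarrow> real \<Rightarrow> bool" where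
  "l2_le c B \<longleftrightarrow> (\<forall>F. finite F \<longrightarrow> L2_set (\<lambda>k. norm (c k)) F \<le> B)"

lemma l1_leD: "l1_le c B \<Longrightarrow> finite F \<Longrightarrow> (\<Sum>k\<in>F. norm (c k)) \<le> B"
  by (simp add: l1_le_def)

lemma l2_leD: "l2_le c B \<Longrightarrow> finite F \<Longrightarrow> L2_set (\<lambda>k. norm (c k)) F \<le> B"
  by (simp add: l2_le_def)

lemma l1_le_nonneg: "l1_le c B \<Longrightarrow> 0 \<le> B"
  using l1_leD[of c B "{}"] by simp

lemma l2_le_nonneg: "l2_le c B \<Longrightarrow> 0 \<le> B"
  using l2_leD[of c B "{}"] by simp

lemma l1_le_norm: "l1_le c B \<Longrightarrow> norm (c k) \<le> B"
  using l1_leD[of c B "{k}"] by simp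

lemma l2_le_norm: "l2_le c B \<Longrightarrow> norm (c k) \<le> B"
  using l2_leD[of c B "{k}"] by (simp add: L2_set_def)

lemma l1_le_summable: "l1_le c B \<Longrightarrow> (\<lambda>k. norm (c k)) summable_on UNIV"
  by (intro nonneg_bdd_above_summable_on bdd_aboveI[of _ B]) (auto simp: l1_le_def)

lemma summable_imp_l1_le:
  assumes "(\<lambda>k. norm (c k)) summable_on UNIV"
  shows "l1_le c (\<Sum>\<^sub>\<infinity>k. norm (c k))"
  unfolding l1_le_def using finite_sum_le_infsum[OF assms] by simp

lemma l1_le_infsum: "l1_le c B \<Longrightarrow> (\<Sum>\<^sub>\<infinity>k. norm (c k)) \<le> B"
  by (intro infsum_le_finite_sums l1_le_summable) (auto simp: l1_le_def)

lemma l1_le_mono: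
  assumes "l1_le d B" "\<And>k. norm (c k) \<le> norm (d k)" "B \<le> B'"
  shows "l1_le c B'"
  unfolding l1_le_def
proof (intro allI impI)
  fix F :: "'a set" assume "finite F"
  have "(\<Sum>k\<in>F. norm (c k)) \<le> (\<Sum>k\<in>F. norm (d k))" by (intro sum_mono assms)
  also have "\<dots> \<le> B" using assms(1) \<open>finite F\<close> by (rule l1_leD)
  finally show "(\<Sum>k\<in>F. norm (c k)) \<le> B'" using assms(3) by simp
qed

lemma l2_le_mono:
  assumes "l2_le d B" "\<And>k. norm (c k) \<le> norm (d k)" "B \<le> B'"
  shows "l2_le c B'"
  unfolding l2_le_def
proof (intro allI impI)
  fix F :: "'a set" assume "finite F"
  have "L2_set (\<lambda>k. norm (c k)) F \<le> L2_set (\<lambda>k. norm (d k)) F" by (intro L2_set_mono assms) auto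
  also have "\<dots> \<le> B" using assms(1) \<open>finite F\<close> by (rule l2_leD)
  finally show "L2_set (\<lambda>k. norm (c k)) F \<le> B'" using assms(3) by simp
qed

lemma l1_le_add:
  assumes "l1_le c A" "l1_le d B" shows "l1_le (\<lambda>k. c k + d k) (A + B)"
  unfolding l1_le_def
proof (intro allI impI)
  fix F :: "'a set" assume F: "finite F"
  have "(\<Sum>k\<in>F. norm (c k + d k)) \<le> (\<Sum>k\<in>F. norm (c k)) + (\<Sum>k\<in>F. norm (d k))"
    by (simp add: sum.distrib[symmetric] sum_mono norm_triangle_ineq)
  then show "(\<Sum>k\<in>F. norm (c k + d k)) \<le> A + B"
    using l1_leD[OF assms(1) F] l1_leD[OF assms(2) F] by linarith
qed

lemma l2_le_add:
  assumes "l2_le c A" "l2_le d B" shows "l2_le (\<lambda>k. c k + d k) (A + B)"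
  unfolding l2_le_def
proof (intro allI impI)
  fix F :: "'a set" assume F: "finite F"
  have "L2_set (\<lambda>k. norm (c k + d k)) F \<le> L2_set (\<lambda>k. norm (c k) + norm (d k)) F"
    by (intro L2_set_mono norm_triangle_ineq) auto
  also have "\<dots> \<le> L2_set (\<lambda>k. norm (c k)) F + L2_set (\<lambda>k. norm (d k)) F"
    by (rule L2_set_triangle_ineq)
  finally show "L2_set (\<lambda>k. norm (c k + d k)) F \<le> A + B"
    using l2_leD[OF assms(1) F] l2_leD[OF assms(2) F] by linarith
qed

lemma l1_le_cmult:
  fixes c :: "'k \<Rightarrow> 'b::real_normed_div_algebra"
  assumes "l1_le c B" shows "l1_le (\<lambda>k. a * c k) (norm a * B)"
  using assms unfolding l1_le_def
  by (simp add: norm_mult sum_distrib_left[symmetric] mult_left_mono)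

lemma l2_le_cmult:
  fixes c :: "'k \<Rightarrow> 'b::real_normed_div_algebra"
  assumes "l2_le c B" shows "l2_le (\<lambda>k. a * c k) (norm a * B)"
  using assms unfolding l2_le_def
  by (simp add: norm_mult L2_set_right_distrib[symmetric] mult_left_mono)

lemma l1_le_zero: "l1_le (\<lambda>_. 0) 0" and l2_le_zero: "l2_le (\<lambda>_. 0) 0"
  by (simp_all add: l1_le_def l2_le_def L2_set_def)

lemma l1_le_sum:
  assumes "finite S" "\<And>i. i \<in> S \<Longrightarrow> l1_le (c i) (B i)"
  shows "l1_le (\<lambda>k. \<Sum>i\<in>S. c i k) (\<Sum>i\<in>S. B i)"
  using assms by induction (auto simp: l1_le_zero intro: l1_le_add)

lemma l2_le_sum:
  assumes "finite S" "\<And>i. i \<in> S \<Longrightarrow> l2_le (c i) (B i)"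
  shows "l2_le (\<lambda>k. \<Sum>i\<in>S. c i k) (\<Sum>i\<in>S. B i)"
  using assms by induction (auto simp: l2_le_zero intro: l2_le_add)

lemma l1_le_norm_iff [simp]: "l1_le (\<lambda>k. norm (c k)) B \<longleftrightarrow> l1_le c B"
  by (simp add: l1_le_def)

lemma l2_le_norm_iff [simp]: "l2_le (\<lambda>k. norm (c k)) B \<longleftrightarrow> l2_le c B"
  by (simp add: l2_le_def)

lemma l1_imp_l2_le:
  assumes "l1_le c B" shows "l2_le c B"
  unfolding l2_le_def
proof (intro allI impI)
  fix F :: "'a set" assume F: "finite F"
  have "L2_set (\<lambda>k. norm (c k)) F \<le> (\<Sum>k\<in>F. norm (c k))" by (intro L2_set_le_sum) auto
  then show "L2_set (\<lambda>k. norm (c k)) F \<le> B" using l1_leD[OF assms F] by linarith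
qed

lemma l2_le_iff_sum_power2:
  assumes "0 \<le> B"
  shows "l2_le c B \<longleftrightarrow> (\<forall>F. finite F \<longrightarrow> (\<Sum>k\<in>F. (norm (c k))\<^sup>2) \<le> B\<^sup>2)"
proof -
  have "sqrt x \<le> B \<longleftrightarrow> x \<le> B\<^sup>2" for x
    using assms real_sqrt_le_iff[of x "B\<^sup>2"] by simp
  then show ?thesis by (simp add: l2_le_def L2_set_def)
qed

definition conv :: "('k::ab_group_add \<Rightarrow> 'b::{real_normed_field,banach}) \<Rightarrow> ('k \<Rightarrow> 'b) \<Rightarrow> 'k \<Rightarrow> 'b" where
  "conv c d k = (\<Sum>\<^sub>\<infinity>m. c m * d (k - m))"

lemma bij_minus_left: "bij (\<lambda>m::'k::ab_group_add. k - m)"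
  by (rule bij_betw_byWitness[where f' = "\<lambda>m. k - m"]) auto

lemma conv_commute: "conv c d k = conv d c k"
  unfolding conv_def
  using infsum_reindex_bij_betw[OF bij_minus_left[of k], of "\<lambda>m. c m * d (k - m)"]
  by (simp add: mult.commute)

lemma conv_summable_left:
  fixes c d :: "'k::ab_group_add \<Rightarrow> 'b::{real_normed_field,banach}"
  assumes "l1_le c A" "\<And>k. norm (d k) \<le> B"
  shows "(\<lambda>m. norm (c m * d (k - m))) summable_on UNIV"
proof (rule abs_summable_le[OF summable_on_cmult_left[OF l1_le_summable[OF assms(1)], of B]])
  show "norm (c m * d (k - m)) \<le> norm (c m) * B" for m
    using assms(2) by (simp add: norm_mult mult_left_mono)
qed

lemma conv_summable_right:
  fixes c d :: "'k::ab_group_add \<Rightarrow> 'b::{real_normed_field,banach}"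
  assumes "l1_le d A" "\<And>k. norm (c k) \<le> B"
  shows "(\<lambda>m. norm (c m * d (k - m))) summable_on UNIV"
  using conv_summable_left[OF assms, where k = k] summable_on_reindex_bij_betw[OF bij_minus_left[of k], of "\<lambda>m. norm (d m * c (k - m))"]
  by (simp add: mult.commute)

lemma L2_set_sum_le:
  assumes "finite G"
  shows "L2_set (\<lambda>k. \<Sum>m\<in>G. f m k) F \<le> (\<Sum>m\<in>G. L2_set (f m) F)"
  using assms
proof induction
  case empty then show ?case by (simp add: L2_set_def)
next
  case (insert m G)
  then show ?case using L2_set_triangle_ineq[of "f m" "\<lambda>k. \<Sum>m\<in>G. f m k" F] by simp
qed

lemma conv_tendsto:
  fixes c d :: "'k::ab_group_add \<Rightarrow> 'b::{real_normed_field,banach}"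
  assumes "(\<lambda>m. norm (c m * d (k - m))) summable_on UNIV"
  shows "((\<lambda>G. \<Sum>m\<in>G. c m * d (k - m)) \<longlongrightarrow> conv c d k) (finite_subsets_at_top UNIV)"
  unfolding conv_def by (rule infsum_tendsto[OF abs_summable_summable[OF assms]])

lemma eventually_finite: "\<forall>\<^sub>F G in finite_subsets_at_top UNIV. finite G"
  by (simp add: eventually_finite_subsets_at_top_weakI)

text \<open>Young's inequality for convolutions.\<close>

lemma conv_l1:
  fixes c d :: "'k::ab_group_add \<Rightarrow> 'b::{real_normed_field,banach}"
  assumes c: "l1_le c A" and d: "l1_le d B"
  shows "l1_le (conv c d) (A * B)"
  unfolding l1_le_def
proof (intro allI impI)
  fix F :: "'k set" assume F: "finite F"
  have "(\<Sum>k\<in>F. norm (\<Sum>m\<in>G. c m * d (k - m))) \<le> A * B" if G: "finite G" for G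
  proof -
    have sh: "(\<Sum>k\<in>F. norm (d (k - m))) \<le> B" for m
      using l1_leD[OF d, of "(\<lambda>k. k - m) ` F"] F by (simp add: sum.reindex inj_on_def)
    have "(\<Sum>k\<in>F. norm (\<Sum>m\<in>G. c m * d (k - m))) \<le> (\<Sum>k\<in>F. \<Sum>m\<in>G. norm (c m) * norm (d (k - m)))"
      by (intro sum_mono sum_norm_le) (simp add: norm_mult)
    also have "\<dots> = (\<Sum>m\<in>G. norm (c m) * (\<Sum>k\<in>F. norm (d (k - m))))"
      by (subst sum.swap) (simp add: sum_distrib_left)
    also have "\<dots> \<le> (\<Sum>m\<in>G. norm (c m) * B)" by (intro sum_mono mult_left_mono sh) auto
    also have "\<dots> \<le> A * B"
      using l1_leD[OF c G] l1_le_nonneg[OF d] by (simp add: sum_distrib_right[symmetric] mult_right_mono)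
    finally show ?thesis .
  qed
  then have "\<forall>\<^sub>F G in finite_subsets_at_top UNIV. (\<Sum>k\<in>F. norm (\<Sum>m\<in>G. c m * d (k - m))) \<le> A * B"
    using eventually_finite by (rule eventually_mono[rotated])
  moreover have "((\<lambda>G. \<Sum>k\<in>F. norm (\<Sum>m\<in>G. c m * d (k - m))) \<longlongrightarrow> (\<Sum>k\<in>F. norm (conv c d k))) (finite_subsets_at_top UNIV)"
    by (intro tendsto_sum tendsto_norm conv_tendsto conv_summable_left[OF c l1_le_norm[OF d]])
  ultimately show "(\<Sum>k\<in>F. norm (conv c d k)) \<le> A * B"
    by (intro tendsto_upperbound) auto
qed

lemma conv_l2:
  fixes c d :: "'k::ab_group_add \<Rightarrow> 'b::{real_normed_field,banach}"
  assumes c: "l1_le c A" and d: "l2_le d B"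
  shows "l2_le (conv c d) (A * B)"
  unfolding l2_le_def
proof (intro allI impI)
  fix F :: "'k set" assume F: "finite F"
  have "L2_set (\<lambda>k. norm (\<Sum>m\<in>G. c m * d (k - m))) F \<le> A * B" if G: "finite G" for G
  proof -
    have sh: "L2_set (\<lambda>k. norm (d (k - m))) F \<le> B" for m
      using l2_leD[OF d, of "(\<lambda>k. k - m) ` F"] F by (simp add: L2_set_def sum.reindex inj_on_def)
    have "L2_set (\<lambda>k. norm (\<Sum>m\<in>G. c m * d (k - m))) F \<le> L2_set (\<lambda>k. \<Sum>m\<in>G. norm (c m) * norm (d (k - m))) F"
      by (intro L2_set_mono sum_norm_le) (simp_all add: norm_mult)
    also have "\<dots> \<le> (\<Sum>m\<in>G. L2_set (\<lambda>k. norm (c m) * norm (d (k - m))) F)"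
      by (rule L2_set_sum_le[OF G])
    also have "\<dots> \<le> (\<Sum>m\<in>G. norm (c m) * B)"
      by (intro sum_mono) (simp add: L2_set_right_distrib[symmetric] mult_left_mono sh)
    also have "\<dots> \<le> A * B"
      using l1_leD[OF c G] l2_le_nonneg[OF d] by (simp add: sum_distrib_right[symmetric] mult_right_mono)
    finally show ?thesis .
  qed
  then have "\<forall>\<^sub>F G in finite_subsets_at_top UNIV. L2_set (\<lambda>k. norm (\<Sum>m\<in>G. c m * d (k - m))) F \<le> A * B"
    using eventually_finite by (rule eventually_mono[rotated])
  moreover have "((\<lambda>G. L2_set (\<lambda>k. norm (\<Sum>m\<in>G. c m * d (k - m))) F) \<longlongrightarrow> L2_set (\<lambda>k. norm (conv c d k)) F) (finite_subsets_at_top UNIV)"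
    unfolding L2_set_def
    by (intro tendsto_real_sqrt tendsto_sum tendsto_power tendsto_norm conv_tendsto conv_summable_left[OF c l2_le_norm[OF d]])
  ultimately show "L2_set (\<lambda>k. norm (conv c d k)) F \<le> A * B"
    by (intro tendsto_upperbound) auto
qed

lemma conv_l2':
  fixes c d :: "'k::ab_group_add \<Rightarrow> 'b::{real_normed_field,banach}"
  assumes c: "l2_le c A" and d: "l1_le d B"
  shows "l2_le (conv c d) (A * B)"
proof -
  have "conv c d = conv d c" by (rule ext) (rule conv_commute)
  then show ?thesis using conv_l2[OF d c] by (simp add: mult.commute)
qed

lemma conv_diff:
  fixes c d c' d' :: "'k::ab_group_add \<Rightarrow> 'b::{real_normed_field,banach}"
  assumes "(\<lambda>m. norm (c m * d (k - m))) summable_on UNIV" "(\<lambda>m. norm (c' m * d' (k - m))) summable_on UNIV"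
    "(\<lambda>m. norm (c m * d' (k - m))) summable_on UNIV"
  shows "conv c d k - conv c' d' k = conv c (\<lambda>l. d l - d' l) k + conv (\<lambda>l. c l - c' l) d' k"
proof -
  note s = assms[THEN abs_summable_summable]
  have m: "(\<lambda>m. - f m) summable_on UNIV" if "f summable_on UNIV" for f :: "'k \<Rightarrow> 'b"
    using that by (simp add: summable_on_uminus)
  have "conv c (\<lambda>l. d l - d' l) k = conv c d k - conv c d' k"
    unfolding conv_def
    using infsum_add[OF s(1) m[OF s(3)]] by (simp add: algebra_simps infsum_uminus)
  moreover have "conv (\<lambda>l. c l - c' l) d' k = conv c d' k - conv c' d' k"
    unfolding conv_def
    using infsum_add[OF s(3) m[OF s(2)]] by (simp add: algebra_simps infsum_uminus)
  ultimately show ?thesis by simp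
qed

lemma norm_conv_le:
  fixes c d :: "'k::ab_group_add \<Rightarrow> 'b::{real_normed_field,banach}"
  assumes "(\<lambda>m. norm (c m * d (k - m))) summable_on UNIV" and "f summable_on UNIV"
    and "\<And>m. w * (norm (c m) * norm (d (k - m))) \<le> f m" and "w \<ge> 0"
  shows "w * norm (conv c d k) \<le> infsum f UNIV"
proof -
  have "w * norm (conv c d k) \<le> w * (\<Sum>\<^sub>\<infinity>m. norm (c m * d (k - m)))"
    unfolding conv_def using norm_infsum_bound[OF assms(1)] assms(4) by (rule mult_left_mono)
  also have "\<dots> = (\<Sum>\<^sub>\<infinity>m. w * norm (c m * d (k - m)))"
    by (rule infsum_cmult_right[symmetric]) (use assms(1) in simp)
  also have "\<dots> \<le> infsum f UNIV"
    by (rule infsum_mono) (use assms(1,2,3) in \<open>auto intro: summable_on_cmult_right simp: norm_mult\<close>)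
  finally show ?thesis .
qed

section \<open>The Wiener algebra\<close>

definition fco :: "(real^'d \<Rightarrow> real) \<Rightarrow> int^'d \<Rightarrow> complex" where
  "fco g k = mean (\<lambda>x. of_real (g x) * cis (- phase k x))"

lemma fourier_coeff_nth: "fourier_coeff f k $ i = fco (\<lambda>x. f x $ i) k"
  by (simp add: fourier_coeff_def fco_def mean_def)

lemma fco_minus: "fco g (- k) = cnj (fco g k)"
  unfolding fco_def mean_cnj[symmetric] by (simp add: phase_minus cis_cnj)

definition wiener :: "(real^'d \<Rightarrow> real) \<Rightarrow> bool" where
  "wiener g \<longleftrightarrow> continuous_on UNIV g \<and> torus_periodic g \<and> (\<lambda>k. norm (fco g k)) summable_on UNIV"

lemma series_coefficient:
  fixes c :: "int^'d \<Rightarrow> complex"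
  assumes "(\<lambda>k. norm (c k)) summable_on UNIV"
  shows "mean (\<lambda>x. (\<Sum>\<^sub>\<infinity>l. c l * cis (phase l x)) * cis (- phase k x)) = c k"
proof -
  have "mean (\<lambda>x. (\<Sum>\<^sub>\<infinity>l. c l * cis (phase l x)) * cis (- phase k x))
      = mean (\<lambda>x. \<Sum>\<^sub>\<infinity>l. c l * cis (phase (l - k) x))"
    by (simp add: infsum_cmult_left'[symmetric] mult.assoc cis_mult phase_diff)
  also have "\<dots> = (\<Sum>\<^sub>\<infinity>l. c l * mean (\<lambda>x. cis (phase (l - k) x)))"
    by (rule mean_infsum[OF assms, of _ 1]) (auto intro!: continuous_intros)
  also have "\<dots> = (\<Sum>\<^sub>\<infinity>l\<in>{k}. c l * mean (\<lambda>x. cis (phase (l - k) x)))"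
    by (rule infsum_cong_neutral) (auto simp: mean_character)
  also have "\<dots> = c k" by simp
  finally show ?thesis .
qed

text \<open>
  Both sides are continuous and periodic with the same Fourier coefficients, so uniqueness applies.
\<close>

lemma wiener_series:
  assumes "wiener g"
  shows "complex_of_real (g x) = (\<Sum>\<^sub>\<infinity>k. fco g k * cis (phase k x))"
proof -
  let ?S = "\<lambda>x. \<Sum>\<^sub>\<infinity>k. fco g k * cis (phase k x)"
  have g: "continuous_on UNIV g" "torus_periodic g" "(\<lambda>k. norm (fco g k)) summable_on UNIV"
    using assms by (auto simp: wiener_def)
  have cS: "continuous_on UNIV ?S"
    by (rule continuous_on_infsum[OF g(3), of _ 1]) (auto intro!: continuous_intros)
  have "of_real (g x) - ?S x = 0"
  proof (rule continuous_eq_0_if_coeffs_0[where D = "\<lambda>x. of_real (g x) - ?S x"])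
    show "continuous_on UNIV (\<lambda>x. of_real (g x) - ?S x)"
      by (intro continuous_intros g cS)
    show "torus_periodic (\<lambda>x. of_real (g x) - ?S x)"
      using g(2) by (simp add: torus_periodic_def cis_phase_periodic)
    fix k :: "int^'a"
    have "mean (\<lambda>x. (of_real (g x) - ?S x) * cis (phase k x))
        = mean (\<lambda>x. of_real (g x) * cis (- phase (-k) x) - ?S x * cis (- phase (-k) x))"
      by (simp add: phase_minus left_diff_distrib)
    also have "\<dots> = mean (\<lambda>x. of_real (g x) * cis (- phase (-k) x)) - mean (\<lambda>x. ?S x * cis (- phase (-k) x))"
      by (rule mean_diff; rule cell_integrable_continuous; intro continuous_intros g cS)
    also have "\<dots> = 0"
      unfolding series_coefficient[OF g(3)] fco_def[symmetric] by simp
    finally show "mean (\<lambda>x. (of_real (g x) - ?S x) * cis (phase k x)) = 0" .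
  qed
  then show ?thesis by simp
qed

lemma wiener_of_series:
  fixes c :: "int^'d \<Rightarrow> complex"
  assumes c: "(\<lambda>k. norm (c k)) summable_on UNIV"
    and g: "\<And>x. complex_of_real (g x) = (\<Sum>\<^sub>\<infinity>k. c k * cis (phase k x))"
  shows "wiener g" and "fco g = c"
proof -
  show fco: "fco g = c"
    by (rule ext) (simp add: fco_def g series_coefficient[OF c])
  have "continuous_on UNIV (\<lambda>x. Re (\<Sum>\<^sub>\<infinity>k. c k * cis (phase k x)))"
    by (intro continuous_intros continuous_on_infsum[OF c, of _ 1]) (auto intro!: continuous_intros)
  then have "continuous_on UNIV g" by (simp add: g[symmetric])
  moreover have "torus_periodic g"
    unfolding torus_periodic_def
  proof (intro allI)
    fix x j
    have "complex_of_real (g (x + axis j (2 * pi))) = complex_of_real (g x)"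
      unfolding g by (simp add: cis_phase_periodic)
    then show "g (x + axis j (2 * pi)) = g x" by simp
  qed
  ultimately show "wiener g" using c by (simp add: wiener_def fco)
qed

lemma wiener_integrable:
  "continuous_on UNIV g \<Longrightarrow> set_integrable lebesgue torus_cell (\<lambda>x. of_real (g x) * cis (- phase k x))"
  by (intro cell_integrable_continuous continuous_intros)

lemma fco_add:
  "continuous_on UNIV f \<Longrightarrow> continuous_on UNIV g \<Longrightarrow> fco (\<lambda>x. f x + g x) = (\<lambda>k. fco f k + fco g k)"
  by (simp add: fun_eq_iff fco_def distrib_right mean_add wiener_integrable)

lemma fco_diff:
  "continuous_on UNIV f \<Longrightarrow> continuous_on UNIV g \<Longrightarrow> fco (\<lambda>x. f x - g x) = (\<lambda>k. fco f k - fco g k)"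
  by (simp add: fun_eq_iff fco_def left_diff_distrib mean_diff wiener_integrable)

lemma fco_cmult: "fco (\<lambda>x. a * f x) = (\<lambda>k. of_real a * fco f k)"
  by (simp add: fun_eq_iff fco_def mult.assoc mean_cmult)

lemma fco_const: "fco (\<lambda>x. a) = (\<lambda>k. if k = 0 then of_real a else 0)"
proof
  fix k
  have "fco (\<lambda>x. a) k = of_real a * mean (\<lambda>x. cis (phase (- k) x))"
    by (simp add: fco_def mean_cmult phase_minus)
  then show "fco (\<lambda>x. a) k = (if k = 0 then of_real a else 0)"
    by (simp add: mean_character)
qed

lemma wiener_const: "wiener (\<lambda>x. a)"
proof -
  have "(\<lambda>k. norm (fco (\<lambda>x::real^'d. a) k)) summable_on UNIV"
    by (rule finite_nonzero_values_imp_summable_on) (auto simp: fco_const intro: finite_subset[of _ "{0}"])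
  then show ?thesis by (simp add: wiener_def torus_periodic_def)
qed

lemma wiener_continuous: "wiener g \<Longrightarrow> continuous_on UNIV g"
  and wiener_summable: "wiener g \<Longrightarrow> (\<lambda>k. norm (fco g k)) summable_on UNIV"
  by (auto simp: wiener_def)

lemma wiener_iff_l1_le:
  "wiener g \<longleftrightarrow> continuous_on UNIV g \<and> torus_periodic g \<and> (\<exists>B. l1_le (fco g) B)"
  using l1_le_summable summable_imp_l1_le unfolding wiener_def by blast

lemma wiener_add: "wiener f \<Longrightarrow> wiener g \<Longrightarrow> wiener (\<lambda>x. f x + g x)"
  unfolding wiener_iff_l1_le
  by (auto simp: fco_add torus_periodic_def intro!: continuous_intros intro: l1_le_add)

lemma wiener_cmult: "wiener f \<Longrightarrow> wiener (\<lambda>x. a * f x)"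
  unfolding wiener_iff_l1_le
  by (auto simp: fco_cmult torus_periodic_def intro!: continuous_intros intro: l1_le_cmult)

lemma wiener_diff: "wiener f \<Longrightarrow> wiener g \<Longrightarrow> wiener (\<lambda>x. f x - g x)"
  using wiener_add[of f "\<lambda>x. -1 * g x"] wiener_cmult[of g "-1"] by simp

lemma wiener_sum:
  assumes "finite S" "\<And>i. i \<in> S \<Longrightarrow> wiener (f i)"
  shows "wiener (\<lambda>x. \<Sum>i\<in>S. f i x)" and "fco (\<lambda>x. \<Sum>i\<in>S. f i x) = (\<lambda>k. \<Sum>i\<in>S. fco (f i) k)"
proof -
  have "wiener (\<lambda>x. \<Sum>i\<in>S. f i x) \<and> fco (\<lambda>x. \<Sum>i\<in>S. f i x) = (\<lambda>k. \<Sum>i\<in>S. fco (f i) k)"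
    using assms
    by induction (auto simp: wiener_const wiener_add fco_const fco_add wiener_continuous)
  then show "wiener (\<lambda>x. \<Sum>i\<in>S. f i x)" "fco (\<lambda>x. \<Sum>i\<in>S. f i x) = (\<lambda>k. \<Sum>i\<in>S. fco (f i) k)"
    by auto
qed

lemma wiener_bound:
  assumes "wiener g" "l1_le (fco g) B"
  shows "\<bar>g x\<bar> \<le> B"
proof -
  have "\<bar>g x\<bar> = norm (\<Sum>\<^sub>\<infinity>k. fco g k * cis (phase k x))"
    using wiener_series[OF assms(1), of x] by (metis norm_of_real)
  also have "\<dots> \<le> (\<Sum>\<^sub>\<infinity>k. norm (fco g k * cis (phase k x)))"
    by (rule norm_infsum_bound) (use assms(1) in \<open>simp add: norm_mult wiener_def\<close>)
  also have "\<dots> \<le> B" using l1_le_infsum[OF assms(2)] by (simp add: norm_mult)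
  finally show ?thesis .
qed

text \<open>
  The product of two absolutely convergent Fourier series is the Fourier series with the convolved
  coefficients.
\<close>

lemma wiener_mult:
  assumes f: "wiener f" and g: "wiener g"
  shows "fco (\<lambda>x. f x * g x) = conv (fco f) (fco g)" and "wiener (\<lambda>x. f x * g x)"
proof -
  obtain A B where A: "l1_le (fco f) A" and B: "l1_le (fco g) B"
    using f g unfolding wiener_iff_l1_le by blast
  have fb: "\<bar>f x\<bar> \<le> A" for x using wiener_bound[OF f A] .
  show conv: "fco (\<lambda>x. f x * g x) = conv (fco f) (fco g)"
  proof
    fix k
    have "fco (\<lambda>x. f x * g x) k
        = mean (\<lambda>x. of_real (f x) * (\<Sum>\<^sub>\<infinity>l. fco g l * cis (phase l x)) * cis (- phase k x))"
      unfolding wiener_series[OF g, symmetric] by (simp add: fco_def)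
    also have "\<dots> = mean (\<lambda>x. \<Sum>\<^sub>\<infinity>l. fco g l * (of_real (f x) * cis (- phase (k - l) x)))"
    proof -
      have t: "fco g l * (of_real (f x) * cis (- phase (k - l) x))
          = (of_real (f x) * cis (- phase k x)) * (fco g l * cis (phase l x))" for x l
      proof -
        have "cis (- phase (k - l) x) = cis (- phase k x) * cis (phase l x)"
          by (simp add: phase_diff cis_mult)
        then show ?thesis by simp
      qed
      show ?thesis unfolding t infsum_cmult_right' by (simp add: mult_ac)
    qed
    also have "\<dots> = (\<Sum>\<^sub>\<infinity>l. fco g l * mean (\<lambda>x. of_real (f x) * cis (- phase (k - l) x)))"
      by (rule mean_infsum[OF wiener_summable[OF g], of _ A])
         (use fb wiener_continuous[OF f] in \<open>auto simp: norm_mult intro!: continuous_intros\<close>)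
    also have "\<dots> = conv (fco g) (fco f) k"
      by (simp add: conv_def fco_def)
    finally show "fco (\<lambda>x. f x * g x) k = conv (fco f) (fco g) k"
      by (simp add: conv_commute)
  qed
  show "wiener (\<lambda>x. f x * g x)"
    unfolding wiener_iff_l1_le conv
    using f g conv_l1[OF A B] by (auto simp: wiener_def torus_periodic_def intro!: continuous_intros)
qed

section \<open>Weights\<close>

definition emb :: "int^'d \<Rightarrow> real^'d" where "emb k = (\<chi> j. of_int (k $ j))"

lemma emb_add: "emb (k + l) = emb k + emb l"
  and emb_diff: "emb (k - l) = emb k - emb l"
  and emb_minus: "emb (- k) = - emb k"
  by (simp_all add: emb_def vec_eq_iff)

abbreviation jb :: "int^'d \<Rightarrow> real" where "jb \<equiv> japanese_bracket"

lemma jb_eq: "jb k = sqrt (1\<^sup>2 + (norm (emb k))\<^sup>2)"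
  by (simp add: japanese_bracket_def emb_def norm_vec_def L2_set_def sum_nonneg)

lemma jb_ge_1: "1 \<le> jb k"
  by (simp add: jb_eq)

lemma jb_pos: "0 < jb k"
  using jb_ge_1[of k] by linarith

lemma norm_emb_le_jb: "norm (emb k) \<le> jb k"
  unfolding jb_eq by (rule real_le_rsqrt) simp

lemma component_le_emb: "\<bar>of_int (k $ j)\<bar> \<le> norm (emb k)"
  using component_le_norm_cart[of "emb k" j] by (simp add: emb_def)

lemma component_le_jb: "\<bar>of_int (k $ j)\<bar> \<le> jb k"
  using component_le_emb norm_emb_le_jb order_trans by blast

lemma jb_minus: "jb (- k) = jb k"
  by (simp add: jb_eq emb_minus)

lemma jb_add_le: "jb (k + l) \<le> jb k + norm (emb l)"
proof -
  have "jb (k + l) \<le> sqrt ((1 + 0)\<^sup>2 + (norm (emb k) + norm (emb l))\<^sup>2)"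
    unfolding jb_eq emb_add
    by (intro real_sqrt_le_mono add_mono power_mono norm_triangle_ineq) auto
  also have "\<dots> \<le> sqrt (1\<^sup>2 + (norm (emb k))\<^sup>2) + sqrt (0\<^sup>2 + (norm (emb l))\<^sup>2)"
    by (rule real_sqrt_sum_squares_triangle_ineq)
  finally show ?thesis by (simp add: jb_eq)
qed

lemma jb_diff_le: "\<bar>jb k - jb l\<bar> \<le> norm (emb (k - l))"
  using jb_add_le[of l "k - l"] jb_add_le[of k "l - k"]
  by (simp add: abs_le_iff emb_diff norm_minus_commute)

lemma jb_add_mult: "jb (k + l) \<le> 2 * (jb k * jb l)"
proof -
  have "jb (k + l) \<le> jb k + jb l" using jb_add_le[of k l] norm_emb_le_jb[of l] by linarith
  also have "\<dots> \<le> jb k * jb l + jb k * jb l"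
    using jb_ge_1[of k] jb_ge_1[of l] jb_pos[of k] jb_pos[of l]
    by (intro add_mono) (simp_all add: mult_le_cancel_left1 mult_le_cancel_right1)
  finally show ?thesis by simp
qed

lemma jb_add_powr:
  assumes "s \<ge> 0"
  shows "jb (k + l) powr s \<le> 2 powr s * (jb k powr s + jb l powr s)"
proof -
  have "jb (k + l) \<le> 2 * max (jb k) (jb l)"
    using jb_add_le[of k l] norm_emb_le_jb[of l] by linarith
  then have "jb (k + l) powr s \<le> (2 * max (jb k) (jb l)) powr s"
    using assms jb_pos[of "k+l"] by (intro powr_mono2) auto
  also have "\<dots> = 2 powr s * max (jb k) (jb l) powr s"
    using jb_pos[of k] by (simp add: powr_mult)
  also have "\<dots> \<le> 2 powr s * (jb k powr s + jb l powr s)"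
    by (intro mult_left_mono) (auto simp: max_def)
  finally show ?thesis .
qed

definition wt :: "real \<Rightarrow> (int^'d \<Rightarrow> 'b::real_normed_vector) \<Rightarrow> int^'d \<Rightarrow> real" where
  "wt r c k = jb k powr r * norm (c k)"

lemma wt_nonneg [simp]: "0 \<le> wt r c k" by (simp add: wt_def)

lemma norm_wt [simp]: "norm (wt r c k) = wt r c k" by (simp add: wt_def abs_mult)

lemma wt_zero: "wt 0 c k = norm (c k)"
  using jb_pos[of k] by (simp add: wt_def)

lemma wt_one: "wt 1 c k = jb k * norm (c k)"
  using jb_pos[of k] by (simp add: wt_def)

lemma norm_le_wt: "r \<ge> 0 \<Longrightarrow> norm (c k) \<le> wt r c k"
  using ge_one_powr_ge_zero[of "jb k" r] jb_ge_1[of k]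
  by (simp add: wt_def mult_le_cancel_right1)

lemma l1_le_of_wt: "r \<ge> 0 \<Longrightarrow> l1_le (wt r c) B \<Longrightarrow> l1_le c B"
  by (rule l1_le_mono) (auto simp: norm_le_wt)

lemma l2_le_of_wt: "r \<ge> 0 \<Longrightarrow> l2_le (wt r c) B \<Longrightarrow> l2_le c B"
  by (rule l2_le_mono) (auto simp: norm_le_wt)

lemma wt_add_le: "wt r (\<lambda>k. c k + d k) k \<le> wt r c k + wt r d k"
  by (simp add: wt_def distrib_left[symmetric] mult_left_mono norm_triangle_ineq)

lemma wt_cmult: "wt r (\<lambda>k. a * c k) = (\<lambda>k. norm a * wt r c k)"
  for a :: "'b::real_normed_div_algebra"
  by (simp add: wt_def fun_eq_iff norm_mult)

lemma wt_l1_add: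
  assumes "l1_le (wt r c) A" "l1_le (wt r d) B"
  shows "l1_le (wt r (\<lambda>k. c k + d k)) (A + B)"
  by (rule l1_le_mono[OF l1_le_add[OF assms]]) (auto simp: wt_add_le)

lemma wt_l2_add:
  assumes "l2_le (wt r c) A" "l2_le (wt r d) B"
  shows "l2_le (wt r (\<lambda>k. c k + d k)) (A + B)"
  by (rule l2_le_mono[OF l2_le_add[OF assms]]) (auto simp: wt_add_le)

lemma wt_l1_cmult: "l1_le (wt r c) A \<Longrightarrow> l1_le (wt r (\<lambda>k. a * c k)) (norm a * A)"
  for a :: "'b::real_normed_div_algebra"
  unfolding wt_cmult using l1_le_cmult[of "wt r c" A "norm a"] by simp

lemma wt_l2_cmult: "l2_le (wt r c) A \<Longrightarrow> l2_le (wt r (\<lambda>k. a * c k)) (norm a * A)"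
  for a :: "'b::real_normed_div_algebra"
  unfolding wt_cmult using l2_le_cmult[of "wt r c" A "norm a"] by simp

lemma abs_le_abs_if: "0 \<le> x \<Longrightarrow> x \<le> y \<Longrightarrow> \<bar>x\<bar> \<le> \<bar>y\<bar>" for x y :: real
  by simp

text \<open>
  The weight \<open>\<langle>k\<rangle>\<close> is submultiplicative up to a factor
  \<open>2\<close>, so the weighted space is an algebra.
\<close>

lemma conv_wt1_l1:
  fixes c d :: "int^'d \<Rightarrow> complex"
  assumes c: "l1_le (wt 1 c) A" and d: "l1_le (wt 1 d) B"
  shows "l1_le (wt 1 (conv c d)) (2 * (A * B))"
proof (rule l1_le_mono)
  show "l1_le (\<lambda>k. 2 * conv (wt 1 c) (wt 1 d) k) (norm (2::real) * (A * B))"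
    by (intro l1_le_cmult conv_l1 assms)
  fix k
  have c': "l1_le c A" and d': "l1_le d B" using c d by (auto intro: l1_le_of_wt[of 1])
  have s: "(\<lambda>m. wt 1 c m * wt 1 d (k - m)) summable_on UNIV"
    using conv_summable_left[OF c l1_le_norm[OF d], where k = k] by (simp add: norm_mult)
  have "jb k * norm (conv c d k) \<le> (\<Sum>\<^sub>\<infinity>m. 2 * (wt 1 c m * wt 1 d (k - m)))"
  proof (rule norm_conv_le)
    fix m
    have "jb (m + (k - m)) * (norm (c m) * norm (d (k - m))) \<le> 2 * (jb m * jb (k - m)) * (norm (c m) * norm (d (k - m)))"
      by (intro mult_right_mono jb_add_mult) auto
    then show "jb k * (norm (c m) * norm (d (k - m))) \<le> 2 * (wt 1 c m * wt 1 d (k - m))"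
      by (simp add: wt_one mult_ac)
  qed (use s jb_pos[of k] in \<open>auto intro!: conv_summable_left[OF c' l1_le_norm[OF d']] summable_on_cmult_right\<close>)
  also have "\<dots> = 2 * conv (wt 1 c) (wt 1 d) k"
    unfolding conv_def by (rule infsum_cmult_right) (use s in auto)
  finally have "jb k * norm (conv c d k) \<le> 2 * conv (wt 1 c) (wt 1 d) k" .
  from abs_le_abs_if[OF _ this] show "norm (wt 1 (conv c d) k) \<le> norm (2 * conv (wt 1 c) (wt 1 d) k)"
    using jb_pos[of k] by (simp add: wt_one)
qed simp

text \<open>
  The product estimate in \<open>H\<^sup>s\<close>: the weight at \<open>k = m + l\<close> falls on
  the larger of the two frequencies, and the other factor is summed in
  \<open>\<ell>\<^sup>1\<close>.
\<close>

lemma conv_wt_l2: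
  fixes c d :: "int^'d \<Rightarrow> complex"
  assumes s: "s \<ge> 0" and c: "l1_le c A" and d: "l1_le d B"
    and c2: "l2_le (wt s c) A'" and d2: "l2_le (wt s d) B'"
  shows "l2_le (wt s (conv c d)) (2 powr s * (A' * B + A * B'))"
proof (rule l2_le_mono)
  let ?n = "\<lambda>c k. norm (c k :: complex)"
  let ?R = "\<lambda>k. 2 powr s * (conv (wt s c) (?n d) k + conv (?n c) (wt s d) k)"
  show "l2_le ?R (norm (2 powr s) * (A' * B + A * B'))"
    by (intro l2_le_cmult l2_le_add conv_l2 conv_l2') (use assms in simp_all)
  fix k
  have s1: "(\<lambda>m. wt s c m * norm (d (k - m))) summable_on UNIV"
    using conv_summable_right[of "?n d" B "wt s c" A'] d l2_le_norm[OF c2] by (simp add: norm_mult)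
  have s2: "(\<lambda>m. norm (c m) * wt s d (k - m)) summable_on UNIV"
    using conv_summable_left[of "?n c" A "wt s d" B'] c l2_le_norm[OF d2] by (simp add: norm_mult)
  let ?f = "\<lambda>m. 2 powr s * (wt s c m * norm (d (k - m)) + norm (c m) * wt s d (k - m))"
  have "jb k powr s * norm (conv c d k) \<le> infsum ?f UNIV"
  proof (rule norm_conv_le)
    fix m
    have "jb (m + (k - m)) powr s * (norm (c m) * norm (d (k - m)))
        \<le> 2 powr s * (jb m powr s + jb (k - m) powr s) * (norm (c m) * norm (d (k - m)))"
      by (intro mult_right_mono jb_add_powr s) auto
    then show "jb k powr s * (norm (c m) * norm (d (k - m))) \<le> ?f m"
      by (simp add: wt_def algebra_simps)
  qed (auto intro!: conv_summable_left[OF c l1_le_norm[OF d]] summable_on_cmult_right summable_on_add s1 s2)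
  also have "\<dots> = ?R k"
    unfolding conv_def infsum_add[OF s1 s2, symmetric]
    by (rule infsum_cmult_right) (intro summable_on_add s1 s2)
  finally have "jb k powr s * norm (conv c d k) \<le> ?R k" .
  from abs_le_abs_if[OF _ this] show "norm (wt s (conv c d) k) \<le> norm (?R k)"
    unfolding norm_wt wt_def[of s "conv c d"] by simp
qed simp

section \<open>Polynomials acting on the Wiener algebra\<close>

definition hat :: "(real^'d \<Rightarrow> real^'n) \<Rightarrow> 'n \<Rightarrow> int^'d \<Rightarrow> complex" where
  "hat u a = fco (\<lambda>x. u x $ a)"

definition wiener_vec :: "(real^'d \<Rightarrow> real^'n) \<Rightarrow> bool" where
  "wiener_vec u \<longleftrightarrow> (\<forall>a. wiener (\<lambda>x. u x $ a))"

lemma fco_zero: "fco (\<lambda>x. 0) = (\<lambda>k. 0)"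
  by (simp add: fco_const fun_eq_iff)

lemma bounded_linear_expand:
  fixes f :: "real^'n \<Rightarrow> real"
  assumes "bounded_linear f"
  shows "f v = (\<Sum>a\<in>UNIV. f (axis a 1) * v $ a)"
proof -
  interpret bounded_linear f by fact
  have "f v = f (\<Sum>a\<in>UNIV. v $ a *\<^sub>R axis a 1)"
    using basis_expansion[of v] by (simp add: scalar_mult_eq_scaleR)
  then show ?thesis by (simp add: sum scaleR mult.commute)
qed

lemma polynomial_wiener:
  assumes "real_polynomial_function f" "wiener_vec u"
  shows "wiener (\<lambda>x. f (u x))"
  using assms(1)
proof induction
  case (linear f)
  have "(\<lambda>x. f (u x)) = (\<lambda>x. \<Sum>a\<in>UNIV. f (axis a 1) * u x $ a)"
    by (rule ext) (rule bounded_linear_expand[OF linear])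
  moreover have "wiener (\<lambda>x. \<Sum>a\<in>UNIV. f (axis a 1) * u x $ a)"
    using assms(2) by (intro wiener_sum(1) wiener_cmult) (auto simp: wiener_vec_def)
  ultimately show ?case by (simp only:)
next
  case (const c)
  show ?case by (rule wiener_const)
next
  case (add f g)
  show ?case by (rule wiener_add[OF add.IH])
next
  case (mult f g)
  show ?case by (rule wiener_mult(2)[OF mult.IH])
qed

lemma wt_zero_fun [simp]: "wt r (\<lambda>k. 0) = (\<lambda>k. 0)"
  by (simp add: wt_def fun_eq_iff)

lemma wt_l1_sum:
  assumes "finite S" "\<And>i. i \<in> S \<Longrightarrow> l1_le (wt r (c i)) (B i)"
  shows "l1_le (wt r (\<lambda>k. \<Sum>i\<in>S. c i k)) (\<Sum>i\<in>S. B i)"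
  using assms by induction (auto simp: l1_le_zero intro: wt_l1_add)

lemma wt_l2_sum:
  assumes "finite S" "\<And>i. i \<in> S \<Longrightarrow> l2_le (wt r (c i)) (B i)"
  shows "l2_le (wt r (\<lambda>k. \<Sum>i\<in>S. c i k)) (\<Sum>i\<in>S. B i)"
  using assms by induction (auto simp: l2_le_zero intro: wt_l2_add)

lemma l1_le_weaken: "l1_le c A \<Longrightarrow> A \<le> B \<Longrightarrow> l1_le c B"
  by (rule l1_le_mono) auto

lemma l2_le_weaken: "l2_le c A \<Longrightarrow> A \<le> B \<Longrightarrow> l2_le c B"
  by (rule l2_le_mono) auto

lemma l1_le_single: "l1_le (\<lambda>k. if k = i then a else 0) (norm a)"
  unfolding l1_le_def by (auto simp: if_distrib[of norm] cong: if_cong)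

text \<open>
  Bounds for the composition with a function \<open>f\<close>, uniform on \<open>W\<^sup>1\<close>-balls of radius \<open>R\<close>, each linear
  in the size of the argument: in the weighted Wiener algebra, in \<open>H\<^sup>s\<close>, and, for differences, in \<open>L\<^sup>2\<close>.
\<close>

definition tame :: "real \<Rightarrow> (real^'n::finite \<Rightarrow> real) \<Rightarrow> real \<Rightarrow> real \<Rightarrow> 'd::finite itself \<Rightarrow> bool" where
  "tame s f R C _ \<longleftrightarrow> 0 \<le> C \<and>
     (\<forall>(u::real^'d \<Rightarrow> real^'n) \<rho>. wiener_vec u \<and> \<rho> \<le> R \<and> (\<forall>a. l1_le (wt 1 (hat u a)) \<rho>) \<longrightarrow>
        l1_le (wt 1 (fco (\<lambda>x. f (u x) - f 0))) (C * \<rho>) \<and>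
        (\<forall>B. (\<forall>a. l2_le (wt s (hat u a)) B) \<longrightarrow> l2_le (wt s (fco (\<lambda>x. f (u x) - f 0))) (C * B)) \<and>
        (\<forall>v D. wiener_vec v \<and> (\<forall>a. l1_le (wt 1 (hat v a)) R) \<and> (\<forall>a. l2_le (\<lambda>k. hat u a k - hat v a k) D) \<longrightarrow>
           l2_le (\<lambda>k. fco (\<lambda>x. f (u x)) k - fco (\<lambda>x. f (v x)) k) (C * D)))"

lemma tameI:
  assumes "0 \<le> C"
    and "\<And>(u::real^'d \<Rightarrow> real^'n) \<rho>. wiener_vec u \<Longrightarrow> 0 \<le> \<rho> \<Longrightarrow> \<rho> \<le> R \<Longrightarrow> (\<And>a. l1_le (wt 1 (hat u a)) \<rho>) \<Longrightarrow>
        l1_le (wt 1 (fco (\<lambda>x. f (u x) - f 0))) (C * \<rho>)"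
    and "\<And>(u::real^'d \<Rightarrow> real^'n) B. wiener_vec u \<Longrightarrow> (\<And>a. l1_le (wt 1 (hat u a)) R) \<Longrightarrow> 0 \<le> B \<Longrightarrow>
        (\<And>a. l2_le (wt s (hat u a)) B) \<Longrightarrow> l2_le (wt s (fco (\<lambda>x. f (u x) - f 0))) (C * B)"
    and "\<And>(u::real^'d \<Rightarrow> real^'n) v D. wiener_vec u \<Longrightarrow> wiener_vec v \<Longrightarrow> (\<And>a. l1_le (wt 1 (hat u a)) R) \<Longrightarrow>
        (\<And>a. l1_le (wt 1 (hat v a)) R) \<Longrightarrow> 0 \<le> D \<Longrightarrow> (\<And>a. l2_le (\<lambda>k. hat u a k - hat v a k) D) \<Longrightarrow>
        l2_le (\<lambda>k. fco (\<lambda>x. f (u x)) k - fco (\<lambda>x. f (v x)) k) (C * D)"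
  shows "tame s f R C TYPE('d)"
  unfolding tame_def
proof (intro conjI allI impI; (elim conjE)?)
  show "0 \<le> C" by fact
next
  fix u :: "real^'d \<Rightarrow> real^'n" and \<rho>
  assume "wiener_vec u" "\<rho> \<le> R" "\<forall>a. l1_le (wt 1 (hat u a)) \<rho>"
  then show "l1_le (wt 1 (fco (\<lambda>x. f (u x) - f 0))) (C * \<rho>)"
    using l1_le_nonneg by (intro assms(2)) auto
next
  fix u :: "real^'d \<Rightarrow> real^'n" and \<rho> B
  assume "wiener_vec u" "\<rho> \<le> R" "\<forall>a. l1_le (wt 1 (hat u a)) \<rho>" "\<forall>a. l2_le (wt s (hat u a)) B"
  then show "l2_le (wt s (fco (\<lambda>x. f (u x) - f 0))) (C * B)"
    using l2_le_nonneg l1_le_weaken by (intro assms(3)) blast+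
next
  fix u v :: "real^'d \<Rightarrow> real^'n" and \<rho> D
  assume "wiener_vec u" "\<rho> \<le> R" "\<forall>a. l1_le (wt 1 (hat u a)) \<rho>" "wiener_vec v"
    "\<forall>a. l1_le (wt 1 (hat v a)) R" "\<forall>a. l2_le (\<lambda>k. hat u a k - hat v a k) D"
  then show "l2_le (\<lambda>k. fco (\<lambda>x. f (u x)) k - fco (\<lambda>x. f (v x)) k) (C * D)"
    using l2_le_nonneg l1_le_weaken by (intro assms(4)) blast+
qed

lemma tameD:
  assumes "tame s f R C TYPE('d::finite)"
  shows "0 \<le> C"
    and "\<And>(u::real^'d \<Rightarrow> real^'n) \<rho>. wiener_vec u \<Longrightarrow> \<rho> \<le> R \<Longrightarrow> (\<And>a. l1_le (wt 1 (hat u a)) \<rho>) \<Longrightarrow>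
        l1_le (wt 1 (fco (\<lambda>x. f (u x) - f 0))) (C * \<rho>)"
    and "\<And>(u::real^'d \<Rightarrow> real^'n) B. wiener_vec u \<Longrightarrow> (\<And>a. l1_le (wt 1 (hat u a)) R) \<Longrightarrow>
        (\<And>a. l2_le (wt s (hat u a)) B) \<Longrightarrow> l2_le (wt s (fco (\<lambda>x. f (u x) - f 0))) (C * B)"
    and "\<And>(u::real^'d \<Rightarrow> real^'n) v D. wiener_vec u \<Longrightarrow> wiener_vec v \<Longrightarrow> (\<And>a. l1_le (wt 1 (hat u a)) R) \<Longrightarrow>
        (\<And>a. l1_le (wt 1 (hat v a)) R) \<Longrightarrow> (\<And>a. l2_le (\<lambda>k. hat u a k - hat v a k) D) \<Longrightarrow>
        l2_le (\<lambda>k. fco (\<lambda>x. f (u x)) k - fco (\<lambda>x. f (v x)) k) (C * D)"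
  using assms unfolding tame_def by blast+

lemma tame_mono:
  fixes f :: "real^'n::finite \<Rightarrow> real"
  assumes "tame s f R C TYPE('d::finite)" "C \<le> C'"
  shows "tame s f R C' TYPE('d)"
proof (rule tameI)
  show "0 \<le> C'" using tameD(1)[OF assms(1)] assms(2) by linarith
next
  fix u :: "real^'d \<Rightarrow> real^'n" and \<rho>
  assume u: "wiener_vec u" "0 \<le> \<rho>" "\<rho> \<le> R" "\<And>a. l1_le (wt 1 (hat u a)) \<rho>"
  show "l1_le (wt 1 (fco (\<lambda>x. f (u x) - f 0))) (C' * \<rho>)"
    by (rule l1_le_weaken[OF tameD(2)[OF assms(1) u(1,3,4)]]) (rule mult_right_mono[OF assms(2) u(2)])
next
  fix u :: "real^'d \<Rightarrow> real^'n" and B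
  assume u: "wiener_vec u" "\<And>a. l1_le (wt 1 (hat u a)) R" "0 \<le> B" "\<And>a. l2_le (wt s (hat u a)) B"
  show "l2_le (wt s (fco (\<lambda>x. f (u x) - f 0))) (C' * B)"
    by (rule l2_le_weaken[OF tameD(3)[OF assms(1) u(1,2,4)]]) (rule mult_right_mono[OF assms(2) u(3)])
next
  fix u v :: "real^'d \<Rightarrow> real^'n" and D
  assume u: "wiener_vec u" "wiener_vec v" "\<And>a. l1_le (wt 1 (hat u a)) R" "\<And>a. l1_le (wt 1 (hat v a)) R"
    "0 \<le> D" "\<And>a. l2_le (\<lambda>k. hat u a k - hat v a k) D"
  show "l2_le (\<lambda>k. fco (\<lambda>x. f (u x)) k - fco (\<lambda>x. f (v x)) k) (C' * D)"
    by (rule l2_le_weaken[OF tameD(4)[OF assms(1) u(1-4,6)]]) (rule mult_right_mono[OF assms(2) u(5)])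
qed

text \<open>
  Tameness passes to constants, linear forms, sums and products, by the algebra property and the
  product estimate.
\<close>

lemma polynomial_tame:
  fixes f :: "real^'n \<Rightarrow> real"
  assumes "real_polynomial_function f" and R: "0 \<le> R" and s: "0 \<le> s"
  shows "\<exists>C. tame s f R C TYPE('d::finite)"
  using assms(1)
proof induction
  case (linear f)
  define \<alpha> where "\<alpha> a = f (axis a 1)" for a
  define C where "C = (\<Sum>a\<in>UNIV. \<bar>\<alpha> a\<bar>)"
  have f: "f v = (\<Sum>a\<in>UNIV. \<alpha> a * v $ a)" for v
    unfolding \<alpha>_def by (rule bounded_linear_expand[OF linear])
  have fc: "fco (\<lambda>x. f (u x)) = (\<lambda>k. \<Sum>a\<in>UNIV. of_real (\<alpha> a) * hat u a k)"
    if "wiener_vec u" for u :: "real^'d \<Rightarrow> real^'n"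
    using that unfolding f wiener_vec_def
    by (subst wiener_sum(2)) (auto simp: wiener_cmult fco_cmult hat_def)
  have f0: "f 0 = 0" by (simp add: f)
  have C: "C * x = (\<Sum>a\<in>UNIV. norm (complex_of_real (\<alpha> a)) * x)" for x by (simp add: C_def sum_distrib_right)
  have "tame s f R C TYPE('d)"
  proof (rule tameI)
    show "0 \<le> C" by (simp add: C_def sum_nonneg)
  next
    fix u :: "real^'d \<Rightarrow> real^'n" and \<rho>
    assume u: "wiener_vec u" "\<And>a. l1_le (wt 1 (hat u a)) \<rho>"
    show "l1_le (wt 1 (fco (\<lambda>x. f (u x) - f 0))) (C * \<rho>)"
      unfolding f0 diff_0_right fc[OF u(1)] C by (intro wt_l1_sum wt_l1_cmult u) simp
  next
    fix u :: "real^'d \<Rightarrow> real^'n" and B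
    assume u: "wiener_vec u" "\<And>a. l2_le (wt s (hat u a)) B"
    show "l2_le (wt s (fco (\<lambda>x. f (u x) - f 0))) (C * B)"
      unfolding f0 diff_0_right fc[OF u(1)] C by (intro wt_l2_sum wt_l2_cmult u) simp
  next
    fix u v :: "real^'d \<Rightarrow> real^'n" and D
    assume u: "wiener_vec u" "wiener_vec v" "\<And>a. l2_le (\<lambda>k. hat u a k - hat v a k) D"
    have "(\<lambda>k. fco (\<lambda>x. f (u x)) k - fco (\<lambda>x. f (v x)) k)
       = (\<lambda>k. \<Sum>a\<in>UNIV. of_real (\<alpha> a) * (hat u a k - hat v a k))"
      by (simp add: fc u sum_subtractf right_diff_distrib)
    then show "l2_le (\<lambda>k. fco (\<lambda>x. f (u x)) k - fco (\<lambda>x. f (v x)) k) (C * D)"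
      unfolding C by (simp only:) (intro l2_le_sum l2_le_cmult u; simp)
  qed
  then show ?case ..
next
  case (const c)
  have "tame s (\<lambda>x. c) R 0 TYPE('d)"
    by (rule tameI) (auto simp: fco_zero l1_le_zero l2_le_zero)
  then show ?case ..
next
  case (add f g)
  then obtain Cf Cg where f: "tame s f R Cf TYPE('d)" and g: "tame s g R Cg TYPE('d)" by blast
  note w = polynomial_wiener[OF add.hyps(1)] polynomial_wiener[OF add.hyps(2)]
  note c = w[THEN wiener_continuous]
  have "tame s (\<lambda>x. f x + g x) R (Cf + Cg) TYPE('d)"
  proof (rule tameI)
    show "0 \<le> Cf + Cg" using tameD(1)[OF f] tameD(1)[OF g] by simp
  next
    fix u :: "real^'d \<Rightarrow> real^'n" and \<rho>
    assume u: "wiener_vec u" "\<rho> \<le> R" "\<And>a. l1_le (wt 1 (hat u a)) \<rho>"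
    have "fco (\<lambda>x. f (u x) + g (u x) - (f 0 + g 0)) = fco (\<lambda>x. (f (u x) - f 0) + (g (u x) - g 0))"
      by (simp add: algebra_simps)
    also have "\<dots> = (\<lambda>k. fco (\<lambda>x. f (u x) - f 0) k + fco (\<lambda>x. g (u x) - g 0) k)"
      by (rule fco_add; intro continuous_intros c u)
    finally show "l1_le (wt 1 (fco (\<lambda>x. f (u x) + g (u x) - (f 0 + g 0)))) ((Cf + Cg) * \<rho>)"
      unfolding distrib_right by (simp only:) (intro wt_l1_add tameD(2)[OF f] tameD(2)[OF g] u)
  next
    fix u :: "real^'d \<Rightarrow> real^'n" and B
    assume u: "wiener_vec u" "\<And>a. l1_le (wt 1 (hat u a)) R" "\<And>a. l2_le (wt s (hat u a)) B"
    have "fco (\<lambda>x. f (u x) + g (u x) - (f 0 + g 0)) = fco (\<lambda>x. (f (u x) - f 0) + (g (u x) - g 0))"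
      by (simp add: algebra_simps)
    also have "\<dots> = (\<lambda>k. fco (\<lambda>x. f (u x) - f 0) k + fco (\<lambda>x. g (u x) - g 0) k)"
      by (rule fco_add; intro continuous_intros c u)
    finally show "l2_le (wt s (fco (\<lambda>x. f (u x) + g (u x) - (f 0 + g 0)))) ((Cf + Cg) * B)"
      unfolding distrib_right by (simp only:) (intro wt_l2_add tameD(3)[OF f] tameD(3)[OF g] u)
  next
    fix u v :: "real^'d \<Rightarrow> real^'n" and D
    assume u: "wiener_vec u" "wiener_vec v" "\<And>a. l1_le (wt 1 (hat u a)) R" "\<And>a. l1_le (wt 1 (hat v a)) R"
      "\<And>a. l2_le (\<lambda>k. hat u a k - hat v a k) D"
    have "(\<lambda>k. fco (\<lambda>x. f (u x) + g (u x)) k - fco (\<lambda>x. f (v x) + g (v x)) k)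
       = (\<lambda>k. (fco (\<lambda>x. f (u x)) k - fco (\<lambda>x. f (v x)) k) + (fco (\<lambda>x. g (u x)) k - fco (\<lambda>x. g (v x)) k))"
      by (simp add: fco_add c u algebra_simps)
    then show "l2_le (\<lambda>k. fco (\<lambda>x. f (u x) + g (u x)) k - fco (\<lambda>x. f (v x) + g (v x)) k) ((Cf + Cg) * D)"
      unfolding distrib_right by (simp only:) (intro l2_le_add tameD(4)[OF f] tameD(4)[OF g] u)
  qed
  then show ?case ..
next
  case (mult f g)
  then obtain Cf Cg where f: "tame s f R Cf TYPE('d)" and g: "tame s g R Cg TYPE('d)" by blast
  note w = polynomial_wiener[OF mult.hyps(1)] polynomial_wiener[OF mult.hyps(2)]
  note c = w[THEN wiener_continuous]
  have C0: "0 \<le> Cf" "0 \<le> Cg" using tameD(1)[OF f] tameD(1)[OF g] by auto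
  define K where "K = \<bar>f 0\<bar> * Cg + \<bar>g 0\<bar> * Cf"
  define C1 where "C1 = 2 * (Cf * (Cg * R)) + K"
  define C2 where "C2 = 2 powr s * (2 * (Cf * (Cg * R))) + K"
  define C3 where "C3 = (Cf * R + \<bar>f 0\<bar>) * Cg + (Cg * R + \<bar>g 0\<bar>) * Cf"
  have C123: "0 \<le> C1" "0 \<le> C2" "0 \<le> C3"
    using C0 R by (auto simp: C1_def C2_def C3_def K_def)
  have wF: "wiener (\<lambda>x. f (u x) - f 0)" "wiener (\<lambda>x. g (u x) - g 0)" if "wiener_vec u" for u :: "real^'d \<Rightarrow> real^'n"
    by (rule wiener_diff[OF w(1)[OF that] wiener_const], rule wiener_diff[OF w(2)[OF that] wiener_const])
  have prod: "fco (\<lambda>x. f (u x) * g (u x) - f 0 * g 0) =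
      (\<lambda>k. conv (fco (\<lambda>x. f (u x) - f 0)) (fco (\<lambda>x. g (u x) - g 0)) k
        + (of_real (f 0) * fco (\<lambda>x. g (u x) - g 0) k + of_real (g 0) * fco (\<lambda>x. f (u x) - f 0) k))"
    if u: "wiener_vec u" for u :: "real^'d \<Rightarrow> real^'n"
  proof -
    have e: "f (u x) * g (u x) - f 0 * g 0
      = (f (u x) - f 0) * (g (u x) - g 0) + (f 0 * (g (u x) - g 0) + g 0 * (f (u x) - f 0))" for x
      by (simp add: left_diff_distrib right_diff_distrib)
    note F = wF[OF u] and FG = wiener_mult(2)[OF wF[OF u]]
    have G: "wiener (\<lambda>x. f 0 * (g (u x) - g 0))" "wiener (\<lambda>x. g 0 * (f (u x) - f 0))"
      by (rule wiener_cmult, rule F)+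
    show ?thesis
      unfolding e fco_add[OF FG[THEN wiener_continuous] wiener_add[OF G, THEN wiener_continuous]]
        fco_add[OF G[THEN wiener_continuous]] fco_cmult wiener_mult(1)[OF F] ..
  qed
  have "tame s (\<lambda>x. f x * g x) R (C1 + C2 + C3) TYPE('d)"
  proof (rule tameI)
    show "0 \<le> C1 + C2 + C3" using C123 by simp
  next
    fix u :: "real^'d \<Rightarrow> real^'n" and \<rho>
    assume u: "wiener_vec u" "\<rho> \<le> R" "0 \<le> \<rho>" "\<And>a. l1_le (wt 1 (hat u a)) \<rho>"
    note F = tameD(2)[OF f u(1,2,4)] and G = tameD(2)[OF g u(1,2,4)]
    have "l1_le (wt 1 (fco (\<lambda>x. f (u x) * g (u x) - f 0 * g 0)))
       (2 * ((Cf * \<rho>) * (Cg * \<rho>)) + (norm (complex_of_real (f 0)) * (Cg * \<rho>) + norm (complex_of_real (g 0)) * (Cf * \<rho>)))"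
      unfolding prod[OF u(1)] by (intro wt_l1_add wt_l1_cmult conv_wt1_l1 F G)
    moreover have "(Cf * \<rho>) * (Cg * \<rho>) \<le> (Cf * R) * (Cg * \<rho>)"
      using u C0 by (intro mult_right_mono mult_left_mono) auto
    then have "2 * ((Cf * \<rho>) * (Cg * \<rho>)) + (norm (complex_of_real (f 0)) * (Cg * \<rho>) + norm (complex_of_real (g 0)) * (Cf * \<rho>)) \<le> C1 * \<rho>"
      by (simp add: C1_def K_def algebra_simps)
    moreover have "C1 * \<rho> \<le> (C1 + C2 + C3) * \<rho>" using C123 u by (intro mult_right_mono) auto
    ultimately show "l1_le (wt 1 (fco (\<lambda>x. f (u x) * g (u x) - f 0 * g 0))) ((C1 + C2 + C3) * \<rho>)"
      by (elim l1_le_weaken) linarith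
  next
    fix u :: "real^'d \<Rightarrow> real^'n" and B
    assume u: "wiener_vec u" "\<And>a. l1_le (wt 1 (hat u a)) R" "0 \<le> B" "\<And>a. l2_le (wt s (hat u a)) B"
    note F1 = l1_le_of_wt[OF _ tameD(2)[OF f u(1) order_refl u(2)], simplified]
      and G1 = l1_le_of_wt[OF _ tameD(2)[OF g u(1) order_refl u(2)], simplified]
    note F = tameD(3)[OF f u(1,2,4)] and G = tameD(3)[OF g u(1,2,4)]
    have "l2_le (wt s (fco (\<lambda>x. f (u x) * g (u x) - f 0 * g 0)))
       (2 powr s * ((Cf * B) * (Cg * R) + (Cf * R) * (Cg * B)) + (norm (complex_of_real (f 0)) * (Cg * B) + norm (complex_of_real (g 0)) * (Cf * B)))"
      unfolding prod[OF u(1)] by (intro wt_l2_add wt_l2_cmult conv_wt_l2 s F G F1 G1)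
    moreover have "2 powr s * ((Cf * B) * (Cg * R) + (Cf * R) * (Cg * B)) + (norm (complex_of_real (f 0)) * (Cg * B) + norm (complex_of_real (g 0)) * (Cf * B)) = C2 * B"
      by (simp add: C2_def K_def algebra_simps)
    moreover have "C2 * B \<le> (C1 + C2 + C3) * B" using C123 u by (intro mult_right_mono) auto
    ultimately show "l2_le (wt s (fco (\<lambda>x. f (u x) * g (u x) - f 0 * g 0))) ((C1 + C2 + C3) * B)"
      by (elim l2_le_weaken) linarith
  next
    fix u v :: "real^'d \<Rightarrow> real^'n" and D
    assume u: "wiener_vec u" "wiener_vec v" "\<And>a. l1_le (wt 1 (hat u a)) R" "\<And>a. l1_le (wt 1 (hat v a)) R"
      "0 \<le> D" "\<And>a. l2_le (\<lambda>k. hat u a k - hat v a k) D"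
    have full: "l1_le (fco (\<lambda>x. h (v x))) (Ch * R + \<bar>h 0\<bar>)"
      if h: "tame s h R Ch TYPE('d)" "wiener (\<lambda>x. h (v x))" and v: "wiener_vec v" "\<And>a. l1_le (wt 1 (hat v a)) R"
      for h Ch and v :: "real^'d \<Rightarrow> real^'n"
    proof -
      have "l1_le (fco (\<lambda>x. h (v x) - h 0)) (Ch * R)"
        using l1_le_of_wt[OF _ tameD(2)[OF h(1) v(1) order_refl v(2)]] by simp
      moreover have "l1_le (fco (\<lambda>x::real^'d. h 0)) \<bar>h 0\<bar>"
        unfolding fco_const using l1_le_single[of 0 "complex_of_real (h 0)"] by simp
      moreover have "fco (\<lambda>x. h (v x)) = (\<lambda>k. fco (\<lambda>x. h (v x) - h 0) k + fco (\<lambda>x. h 0) k)"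
        using h(2) by (simp add: fco_add[symmetric] wiener_continuous wiener_diff wiener_const)
      ultimately show ?thesis by (simp only: l1_le_add)
    qed
    have e1: "(\<lambda>k. fco (\<lambda>x. f (u x) * g (u x)) k - fco (\<lambda>x. f (v x) * g (v x)) k)
       = fco (\<lambda>x. f (u x) * g (u x) - f (v x) * g (v x))"
      by (rule fco_diff[symmetric]; intro continuous_intros c u)
    have e2: "f (u x) * g (u x) - f (v x) * g (v x)
        = f (v x) * (g (u x) - g (v x)) + g (u x) * (f (u x) - f (v x))" for x
      by (simp add: left_diff_distrib right_diff_distrib)
    have e3: "fco (\<lambda>x. f (v x) * (g (u x) - g (v x)) + g (u x) * (f (u x) - f (v x)))
       = (\<lambda>k. conv (fco (\<lambda>x. f (v x))) (fco (\<lambda>x. g (u x) - g (v x))) k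
         + conv (fco (\<lambda>x. g (u x))) (fco (\<lambda>x. f (u x) - f (v x))) k)"
    proof -
      have d: "wiener (\<lambda>x. g (u x) - g (v x))" "wiener (\<lambda>x. f (u x) - f (v x))"
        by (rule wiener_diff; rule w; rule u)+
      note m = wiener_mult[OF w(1)[OF u(2)] d(1)] wiener_mult[OF w(2)[OF u(1)] d(2)]
      show ?thesis
        unfolding fco_add[OF m(2,4)[THEN wiener_continuous]] m(1,3) ..
    qed
    note eq = e1[unfolded e2, unfolded e3]
    have "l2_le (fco (\<lambda>x. g (u x) - g (v x))) (Cg * D)" "l2_le (fco (\<lambda>x. f (u x) - f (v x))) (Cf * D)"
      using tameD(4)[OF g u(1-4,6)] tameD(4)[OF f u(1-4,6)] by (simp_all add: fco_diff c u)
    then have "l2_le (\<lambda>k. fco (\<lambda>x. f (u x) * g (u x)) k - fco (\<lambda>x. f (v x) * g (v x)) k)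
        ((Cf * R + \<bar>f 0\<bar>) * (Cg * D) + (Cg * R + \<bar>g 0\<bar>) * (Cf * D))"
      unfolding eq using full[OF f w(1) u(2,4)] full[OF g w(2) u(1,3)] u(1,2) by (intro l2_le_add conv_l2) auto
    moreover have "(Cf * R + \<bar>f 0\<bar>) * (Cg * D) + (Cg * R + \<bar>g 0\<bar>) * (Cf * D) = C3 * D"
      by (simp add: C3_def algebra_simps)
    moreover have "C3 * D \<le> (C1 + C2 + C3) * D" using C123 u by (intro mult_right_mono) auto
    ultimately show "l2_le (\<lambda>k. fco (\<lambda>x. f (u x) * g (u x)) k - fco (\<lambda>x. f (v x) * g (v x)) k) ((C1 + C2 + C3) * D)"
      by (elim l2_le_weaken) linarith
  qed
  then show ?case ..
qed

section \<open>The embedding of Sobolev spaces into the weighted Wiener algebra\<close>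

lemma int_sum_bounded:
  fixes b :: real
  assumes "b > 1"
  shows "\<exists>Z. \<forall>m::nat. (\<Sum>i\<in>{- int m..int m}. ((1 + \<bar>of_int i\<bar>) / 2) powr (- b)) \<le> Z"
proof -
  define h where "h n = ((1 + real n) / 2) powr (- b)" for n :: nat
  have "summable (\<lambda>n. real (Suc n) powr (- b))"
    using assms by (subst summable_Suc_iff) (simp add: summable_real_powr_iff)
  then have "summable (\<lambda>n. (1/2) powr (- b) * real (Suc n) powr (- b))" by (rule summable_mult)
  also have "(\<lambda>n. (1/2) powr (- b) * real (Suc n) powr (- b)) = h"
    by (auto simp: h_def powr_mult[symmetric] fun_eq_iff algebra_simps add_divide_distrib)
  finally have h: "summable h" .
  have "(\<Sum>i\<in>{- int m..int m}. ((1 + \<bar>of_int i\<bar>) / 2) powr (- b)) \<le> 2 * suminf h" for m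
  proof -
    have sub: "{- int m..int m} \<subseteq> int ` {..m} \<union> (\<lambda>n. - int n) ` {..m}"
    proof
      fix i assume i: "i \<in> {- int m..int m}"
      show "i \<in> int ` {..m} \<union> (\<lambda>n. - int n) ` {..m}"
      proof (cases "i \<ge> 0")
        case True
        then show ?thesis using i by (intro UnI1 image_eqI[of _ _ "nat i"]) auto
      next
        case False
        then show ?thesis using i by (intro UnI2 image_eqI[of _ _ "nat (- i)"]) auto
      qed
    qed
    let ?g = "\<lambda>i. ((1 + \<bar>of_int i\<bar>) / 2) powr (- b)"
    have "(\<Sum>i\<in>{- int m..int m}. ?g i) \<le> (\<Sum>i\<in>int ` {..m} \<union> (\<lambda>n. - int n) ` {..m}. ?g i)"
      by (rule sum_mono2) (use sub in auto)
    also have "\<dots> \<le> (\<Sum>i\<in>int ` {..m}. ?g i) + (\<Sum>i\<in>(\<lambda>n. - int n) ` {..m}. ?g i)"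
      by (subst sum_Un) (auto simp: sum_nonneg)
    also have "\<dots> = (\<Sum>n\<le>m. h n) + (\<Sum>n\<le>m. h n)"
      by (simp add: sum.reindex inj_on_def h_def)
    also have "(\<Sum>n\<le>m. h n) \<le> suminf h"
      by (rule sum_le_suminf[OF h]) (auto simp: h_def)
    finally show ?thesis by simp
  qed
  then show ?thesis by blast
qed

text \<open>
  Since \<open>\<langle>k\<rangle> \<ge> (1 + |k\<^sub>j|) / 2\<close> for every \<open>j\<close>,
  the weight is at most a product of one-dimensional weights with exponent \<open>\<alpha> / d >
  1\<close>, and the sum of a product over a box factorises.
\<close>

lemma lattice_sum_bounded:
  assumes "\<alpha> > real CARD('d)"
  shows "\<exists>Z. \<forall>F. finite F \<longrightarrow> (\<Sum>k\<in>F. jb (k :: int^'d) powr (- \<alpha>)) \<le> Z"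
proof -
  define b where "b = \<alpha> / real CARD('d)"
  have b: "b > 1" using assms by (simp add: b_def)
  define g where "g i = ((1 + \<bar>of_int i\<bar>) / 2) powr (- b)" for i :: int
  obtain Z where Z: "\<And>m::nat. (\<Sum>i\<in>{- int m..int m}. g i) \<le> Z"
    using int_sum_bounded[OF b] unfolding g_def by blast
  have le: "jb k powr (- \<alpha>) \<le> (\<Prod>j\<in>UNIV. g (k $ j))" for k :: "int^'d"
  proof -
    have "jb k powr (- \<alpha>) = (\<Prod>j\<in>(UNIV::'d set). jb k powr (- b))"
      using jb_pos[of k] by (simp add: b_def powr_realpow[symmetric] powr_powr)
    also have "\<dots> \<le> (\<Prod>j\<in>UNIV. g (k $ j))"
    proof (rule prod_mono, safe)
      fix j
      have "(1 + \<bar>of_int (k $ j)\<bar>) / 2 \<le> jb k"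
        using jb_ge_1[of k] component_le_jb[of k j] by simp
      then show "jb k powr (- b) \<le> g (k $ j)"
        unfolding g_def using b by (intro powr_mono2') auto
    qed simp
    finally show ?thesis .
  qed
  have "(\<Sum>k\<in>F. jb k powr (- \<alpha>)) \<le> Z ^ CARD('d)" if F: "finite F" for F :: "(int^'d) set"
  proof -
    define M where "M = Max (insert 0 ((\<lambda>(k,j). nat \<bar>k $ j\<bar>) ` (F \<times> UNIV)))"
    have M: "nat \<bar>k $ j\<bar> \<le> M" if "k \<in> F" for k j
      unfolding M_def by (rule Max_ge) (use F that in \<open>auto intro!: image_eqI[of _ _ "(k,j)"]\<close>)
    let ?B = "PiE (UNIV :: 'd set) (\<lambda>_. {- int M..int M})"
    have fB: "finite ?B" by (intro finite_PiE) auto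
    have sub: "F \<subseteq> vec_lambda ` ?B"
    proof
      fix k assume k: "k \<in> F"
      have "vec_nth k \<in> ?B"
      proof (rule PiE_I)
        fix j
        show "k $ j \<in> {- int M..int M}" using M[OF k, of j] by (simp add: abs_le_iff) linarith
      qed auto
      then show "k \<in> vec_lambda ` ?B" by (intro image_eqI[of _ _ "vec_nth k"]) (simp_all add: vec_nth_inverse)
    qed
    have "(\<Sum>k\<in>F. jb k powr (- \<alpha>)) \<le> (\<Sum>k\<in>F. \<Prod>j\<in>UNIV. g (k $ j))"
      by (intro sum_mono le)
    also have "\<dots> \<le> (\<Sum>k\<in>vec_lambda ` ?B. \<Prod>j\<in>UNIV. g (k $ j))"
      by (rule sum_mono2) (use sub fB in \<open>auto simp: g_def intro!: prod_nonneg\<close>)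
    also have "\<dots> = (\<Sum>k\<in>?B. \<Prod>j\<in>UNIV. g (k j))"
      by (subst sum.reindex) (auto simp: inj_on_def vec_lambda_inject)
    also have "\<dots> = infsum (\<lambda>k. \<Prod>j\<in>UNIV. g (k j)) ?B" using fB by simp
    also have "\<dots> = (\<Prod>j\<in>(UNIV :: 'd set). infsum g {- int M..int M})"
      by (rule infsum_prod_PiE) (use fB in auto)
    also have "\<dots> = (\<Sum>i\<in>{- int M..int M}. g i) ^ CARD('d)" by simp
    also have "\<dots> \<le> Z ^ CARD('d)"
      by (intro power_mono Z sum_nonneg) (auto simp: g_def)
    finally show ?thesis .
  qed
  then show ?thesis by blast
qed

text \<open>
  Cauchy--Schwarz against the weight \<open>\<langle>k\<rangle>\<^sup>1\<^sup>-\<^sup>s\<close>,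
  which is square summable exactly for these \<open>s\<close>.
\<close>

lemma sobolev_embedding:
  assumes "s > real CARD('d) / 2 + 1"
  shows "\<exists>C>0. \<forall>(c :: int^'d \<Rightarrow> complex) B. l2_le (wt s c) B \<longrightarrow> l1_le (wt 1 c) (C * B)"
proof -
  have "2 * (s - 1) > real CARD('d)" using assms by simp
  from lattice_sum_bounded[OF this] obtain Z where
    Z: "\<And>F. finite F \<Longrightarrow> (\<Sum>k\<in>F. jb (k :: int^'d) powr (- (2 * (s - 1)))) \<le> Z" by blast
  have Z0: "Z \<ge> 0" using Z[of "{}"] by simp
  have "l1_le (wt 1 c) ((sqrt Z + 1) * B)" if B: "l2_le (wt s c) B" for c :: "int^'d \<Rightarrow> complex" and B
    unfolding l1_le_def
  proof (intro allI impI)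
    fix F :: "(int^'d) set" assume F: "finite F"
    have "(\<Sum>k\<in>F. norm (wt 1 c k)) = (\<Sum>k\<in>F. \<bar>jb k powr (1 - s)\<bar> * \<bar>wt s c k\<bar>)"
    proof (rule sum.cong)
      fix k :: "int^'d"
      have "jb k powr (1 - s) * jb k powr s = jb k powr 1" by (simp only: powr_add[symmetric]) simp
      then show "norm (wt 1 c k) = \<bar>jb k powr (1 - s)\<bar> * \<bar>wt s c k\<bar>"
        by (simp add: wt_def abs_mult mult.assoc[symmetric])
    qed simp
    also have "\<dots> \<le> L2_set (\<lambda>k. jb k powr (1 - s)) F * L2_set (wt s c) F"
      by (rule L2_set_mult_ineq)
    also have "L2_set (\<lambda>k. jb k powr (1 - s)) F \<le> sqrt Z"
    proof -
      have "(jb k powr (1 - s))\<^sup>2 = jb k powr (- (2 * (s - 1)))" for k :: "int^'d"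
        by (simp add: power2_eq_square powr_add[symmetric] algebra_simps)
      then show ?thesis unfolding L2_set_def using Z[OF F] by (simp add: algebra_simps)
    qed
    also have "L2_set (wt s c) F \<le> B" using l2_leD[OF B F] by simp
    also have "sqrt Z * B \<le> (sqrt Z + 1) * B" using l2_le_nonneg[OF B] by (intro mult_right_mono) auto
    finally show "(\<Sum>k\<in>F. norm (wt 1 c k)) \<le> (sqrt Z + 1) * B"
      using Z0 by (auto simp: mult_left_mono mult_right_mono)
  qed
  moreover have "sqrt Z + 1 > 0" using Z0 by (simp add: add_nonneg_pos)
  ultimately show ?thesis by blast
qed

section \<open>Energy estimates for symmetric systems\<close>

text \<open>
  A symbol supported in frequencies \<open>\<lesssim> \<nu>\<close> and varying by
  \<open>O(1/\<nu>)\<close> per unit: its commutator with a derivative is then of order zero, with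
  constants independent of \<open>\<nu>\<close>.
\<close>

definition cutoff :: "real \<Rightarrow> real \<Rightarrow> real \<Rightarrow> (int^'d \<Rightarrow> real) \<Rightarrow> bool" where
  "cutoff \<Lambda> \<rho> \<nu> p \<longleftrightarrow> 0 < \<nu> \<and> 0 \<le> \<Lambda> \<and> 0 \<le> \<rho> \<and> (\<forall>k. 0 \<le> p k \<and> p k \<le> 1) \<and>
     (\<forall>k l. \<bar>p k - p l\<bar> \<le> \<Lambda> * norm (emb (k - l)) / \<nu>) \<and>
     (\<forall>k. \<rho> * \<nu> \<le> norm (emb k) \<longrightarrow> p k = 0)"

text \<open>
  The point of the cutoff conditions: on the support \<open>|k| \<lesssim> \<nu>\<close>, so the
  factor \<open>1/\<nu>\<close> in the variation pays for one derivative.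
\<close>

lemma cutoff_variation:
  assumes "cutoff \<Lambda> \<rho> \<nu> p" "p k \<noteq> 0"
  shows "\<bar>p k - p l\<bar> * norm (emb k) \<le> \<Lambda> * \<rho> * norm (emb (k - l))"
proof -
  have c: "0 < \<nu>" "0 \<le> \<Lambda>" "0 \<le> \<rho>" "\<bar>p k - p l\<bar> \<le> \<Lambda> * norm (emb (k - l)) / \<nu>" "norm (emb k) \<le> \<rho> * \<nu>"
    using assms unfolding cutoff_def by (auto simp: not_le[symmetric] intro: less_imp_le)
  have "\<bar>p k - p l\<bar> * norm (emb k) \<le> (\<Lambda> * norm (emb (k - l)) / \<nu>) * (\<rho> * \<nu>)"
    by (intro mult_mono c) (use c in auto)
  then show ?thesis using c by (simp add: field_simps)
qed

lemma abs_emb_diff: "\<bar>of_int (l $ j) - of_int (k $ j)\<bar> \<le> norm (emb (k - l))"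
  using component_le_emb[of "l - k" j] emb_minus[of "l - k"] norm_minus_cancel[of "emb (l - k)"] by simp

lemma multiplier_commutator_L2:
  assumes c: "cutoff \<Lambda> \<rho> \<nu> p"
  shows "\<bar>p k * of_int (l $ j) - p l * of_int (k $ j)\<bar> \<le> (1 + \<Lambda> * \<rho>) * jb (k - l)"
proof -
  have main: "\<bar>p k * of_int (l $ j) - p l * of_int (k $ j)\<bar> \<le> (1 + \<Lambda> * \<rho>) * norm (emb (k - l))"
    if k: "p k \<noteq> 0" for k l
  proof -
    have "p k * of_int (l $ j) - p l * of_int (k $ j)
        = p k * (of_int (l $ j) - of_int (k $ j)) + (p k - p l) * of_int (k $ j)"
      by (simp add: algebra_simps)
    then have "\<bar>p k * of_int (l $ j) - p l * of_int (k $ j)\<bar>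
        \<le> \<bar>p k\<bar> * \<bar>of_int (l $ j) - of_int (k $ j)\<bar> + \<bar>p k - p l\<bar> * \<bar>of_int (k $ j)\<bar>"
      by (metis abs_mult abs_triangle_ineq)
    also have "\<dots> \<le> 1 * norm (emb (k - l)) + \<bar>p k - p l\<bar> * norm (emb k)"
      using c by (intro add_mono mult_mono abs_emb_diff component_le_emb) (auto simp: cutoff_def)
    also have "\<dots> \<le> (1 + \<Lambda> * \<rho>) * norm (emb (k - l))"
      using cutoff_variation[OF c k, of l] by (simp add: algebra_simps)
    finally show ?thesis .
  qed
  have n: "(1 + \<Lambda> * \<rho>) * norm (emb (k - l)) \<le> (1 + \<Lambda> * \<rho>) * jb (k - l)"
    using c by (intro mult_left_mono norm_emb_le_jb) (auto simp: cutoff_def)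
  consider "p k \<noteq> 0" | "p l \<noteq> 0" | "p k = 0" "p l = 0" by blast
  then show ?thesis
  proof cases
    case 1 then show ?thesis using main[of k l] n by linarith
  next
    case 2
    have "norm (emb (l - k)) = norm (emb (k - l))" by (simp add: emb_diff norm_minus_commute)
    then show ?thesis using main[OF 2, of k] n by (simp add: abs_minus_commute)
  next
    case 3
    then show ?thesis using c jb_pos[of "k - l"] by (simp add: cutoff_def)
  qed
qed

lemma powr_diff_le:
  fixes x y a :: real
  assumes "0 < x" "0 < y" "1 \<le> a"
  shows "\<bar>x powr a - y powr a\<bar> \<le> a * max x y powr (a - 1) * \<bar>x - y\<bar>"
proof -
  have *: "\<bar>x powr a - y powr a\<bar> \<le> a * max x y powr (a - 1) * \<bar>x - y\<bar>" if xy: "0 < x" "x < y" for x y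
  proof -
    have "\<exists>z. x < z \<and> z < y \<and> y powr a - x powr a = (y - x) * (a * z powr (a - 1))"
      by (rule MVT2[OF xy(2)]) (use xy in \<open>auto intro!: derivative_eq_intros\<close>)
    then obtain z where z: "x < z" "z < y" "y powr a - x powr a = (y - x) * (a * z powr (a - 1))" by blast
    have "z powr (a - 1) \<le> y powr (a - 1)" using z xy assms by (intro powr_mono2) auto
    then have "(y - x) * (a * z powr (a - 1)) \<le> (y - x) * (a * y powr (a - 1))"
      using assms xy by (intro mult_left_mono) auto
    moreover have "0 \<le> (y - x) * (a * z powr (a - 1))" using assms xy by auto
    ultimately show ?thesis using z xy by (simp add: max_def algebra_simps abs_if)
  qed
  consider "x < y" | "y < x" | "x = y" by linarith
  then show ?thesis
  proof cases
    case 1 then show ?thesis using *[OF assms(1)] by blast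
  next
    case 2 then show ?thesis using *[OF assms(2) 2] by (simp add: abs_minus_commute max.commute)
  qed auto
qed

lemma multiplier_commutator_Hs:
  fixes k l :: "int^'d"
  assumes c: "cutoff \<Lambda> \<rho> \<nu> p" and s: "1 \<le> 2 * s"
  defines "C \<equiv> (1 + \<Lambda> * \<rho> + 2 * s) * 2 powr s"
  shows "\<bar>p k * jb k powr (2 * s) * of_int (l $ j) - p l * jb l powr (2 * s) * of_int (k $ j)\<bar>
    \<le> C * (jb (k - l) * jb k powr s * jb l powr s + jb (k - l) powr s * jb k powr s * jb l
           + jb (k - l) powr s * jb k * jb l powr s)"
proof -
  have LR: "0 \<le> \<Lambda> * \<rho>" and p01: "\<And>k. 0 \<le> p k" "\<And>k. p k \<le> 1" using c by (auto simp: cutoff_def)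
  have C: "2 powr s \<le> C" "0 \<le> C" using LR s by (auto simp: C_def)
  have main: "\<bar>p k * jb k powr (2 * s) * of_int (l $ j) - p l * jb l powr (2 * s) * of_int (k $ j)\<bar>
    \<le> C * (jb (k - l) * jb k powr s * jb l powr s + jb (k - l) powr s * jb k powr s * jb l
           + jb (k - l) powr s * jb k * jb l powr s)" if pk: "p k \<noteq> 0" for k l
  proof -
    define \<mu> where "\<mu> = max (jb k) (jb l)"
    let ?m = "norm (emb (k - l))"
    have pos: "0 < jb k" "0 < jb l" "0 < \<mu>" "0 \<le> ?m" "0 < jb (k-l)" using jb_pos by (auto simp: \<mu>_def less_max_iff_disj)
    have mle: "?m \<le> jb (k - l)" by (rule norm_emb_le_jb)
    have dbl: "jb q powr (2 * s) = jb q powr s * jb q powr s" for q :: "int^'d" by (simp add: powr_add[symmetric])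
    have t1: "0 \<le> jb (k - l) * jb k powr s * jb l powr s" and t2: "0 \<le> jb (k - l) powr s * jb k powr s * jb l"
      and t3: "0 \<le> jb (k - l) powr s * jb k * jb l powr s" using pos by auto
    show ?thesis
    proof (cases "2 * ?m \<le> \<mu>")
      case True
      \<comment> \<open>comparable frequencies: the multiplier varies slowly\<close>
      have min: "\<mu> \<le> 2 * jb k" "\<mu> \<le> 2 * jb l"
        using jb_diff_le[of k l] True by (auto simp: \<mu>_def max_def split: if_splits)
      have mu2: "\<mu> powr (2 * s) \<le> 2 powr s * (jb k powr s * jb l powr s)"
      proof -
        have "\<mu> * \<mu> \<le> 2 * (jb k * jb l)"
          using min pos by (auto simp: \<mu>_def max_def split: if_splits)
        then have "(\<mu> * \<mu>) powr s \<le> (2 * (jb k * jb l)) powr s" using s pos by (intro powr_mono2) auto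
        then show ?thesis using pos by (simp add: powr_mult powr_add[symmetric] dbl)
      qed
      have le: "jb k powr (2 * s) \<le> \<mu> powr (2 * s)" "jb l powr (2 * s) \<le> \<mu> powr (2 * s)"
        using s pos by (auto intro!: powr_mono2 simp: \<mu>_def)
      have dif: "jb k * \<bar>jb k powr (2 * s) - jb l powr (2 * s)\<bar> \<le> 2 * s * ?m * \<mu> powr (2 * s)"
      proof -
        have "\<bar>jb k powr (2 * s) - jb l powr (2 * s)\<bar> \<le> 2 * s * \<mu> powr (2 * s - 1) * ?m"
          unfolding \<mu>_def
          by (rule order_trans[OF powr_diff_le[OF pos(1,2) s] mult_left_mono[OF jb_diff_le]]) (use s in simp)
        then have "jb k * \<bar>jb k powr (2 * s) - jb l powr (2 * s)\<bar> \<le> \<mu> * (2 * s * \<mu> powr (2 * s - 1) * ?m)"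
          using pos s by (intro mult_mono) (auto simp: \<mu>_def)
        also have "\<dots> = 2 * s * ?m * (\<mu> powr 1 * \<mu> powr (2 * s - 1))" using pos by simp
        also have "\<dots> = 2 * s * ?m * \<mu> powr (2 * s)" by (simp only: powr_add[symmetric]) simp
        finally show ?thesis .
      qed
      have "p k * jb k powr (2 * s) * of_int (l $ j) - p l * jb l powr (2 * s) * of_int (k $ j)
         = p k * jb k powr (2 * s) * (of_int (l $ j) - of_int (k $ j))
           + (p k - p l) * of_int (k $ j) * jb l powr (2 * s)
           + p k * (of_int (k $ j) * (jb k powr (2 * s) - jb l powr (2 * s)))"
        by (simp add: algebra_simps)
      also have "\<bar>\<dots>\<bar> \<le> \<bar>p k * jb k powr (2 * s) * (of_int (l $ j) - of_int (k $ j))\<bar>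
           + \<bar>(p k - p l) * of_int (k $ j) * jb l powr (2 * s)\<bar>
           + \<bar>p k * (of_int (k $ j) * (jb k powr (2 * s) - jb l powr (2 * s)))\<bar>"
        by linarith
      also have "\<dots> \<le> 1 * \<mu> powr (2 * s) * ?m + \<Lambda> * \<rho> * ?m * \<mu> powr (2 * s) + 1 * (2 * s * ?m * \<mu> powr (2 * s))"
      proof (intro add_mono)
        show "\<bar>p k * jb k powr (2 * s) * (of_int (l $ j) - of_int (k $ j))\<bar> \<le> 1 * \<mu> powr (2 * s) * ?m"
          unfolding abs_mult using p01 le by (intro mult_mono abs_emb_diff) auto
        have "\<bar>p k - p l\<bar> * \<bar>of_int (k $ j)\<bar> \<le> \<bar>p k - p l\<bar> * norm (emb k)"
          by (intro mult_left_mono component_le_emb) auto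
        also have "\<dots> \<le> \<Lambda> * \<rho> * ?m" by (rule cutoff_variation[OF c pk])
        finally have v: "\<bar>p k - p l\<bar> * \<bar>of_int (k $ j)\<bar> \<le> \<Lambda> * \<rho> * ?m" .
        show "\<bar>(p k - p l) * of_int (k $ j) * jb l powr (2 * s)\<bar> \<le> \<Lambda> * \<rho> * ?m * \<mu> powr (2 * s)"
          using mult_mono[OF v le(2)] LR pos by (simp add: abs_mult)
        have "\<bar>of_int (k $ j)\<bar> * \<bar>jb k powr (2 * s) - jb l powr (2 * s)\<bar> \<le> jb k * \<bar>jb k powr (2 * s) - jb l powr (2 * s)\<bar>"
          by (intro mult_right_mono component_le_jb) auto
        note v = order_trans[OF this dif]
        show "\<bar>p k * (of_int (k $ j) * (jb k powr (2 * s) - jb l powr (2 * s)))\<bar> \<le> 1 * (2 * s * ?m * \<mu> powr (2 * s))"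
          using mult_mono[OF p01(2) v, of k] p01(1)[of k] by (simp add: abs_mult)
      qed
      also have "\<dots> = (1 + \<Lambda> * \<rho> + 2 * s) * (?m * \<mu> powr (2 * s))" by (simp add: algebra_simps)
      also have "\<dots> \<le> (1 + \<Lambda> * \<rho> + 2 * s) * (jb (k - l) * (2 powr s * (jb k powr s * jb l powr s)))"
        using LR s mle mu2 pos by (intro mult_left_mono mult_mono) auto
      also have "\<dots> = C * (jb (k - l) * jb k powr s * jb l powr s)" by (simp add: C_def algebra_simps)
      also have "\<dots> \<le> C * (jb (k - l) * jb k powr s * jb l powr s + jb (k - l) powr s * jb k powr s * jb l
           + jb (k - l) powr s * jb k * jb l powr s)"
        by (intro mult_left_mono C) (use t1 t2 t3 in linarith)
      finally show ?thesis .
    next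
      case False
      \<comment> \<open>distant frequencies: both are dominated by their difference\<close>
      have b: "jb q powr s \<le> 2 powr s * jb (k - l) powr s" if "jb q \<le> \<mu>" for q :: "int^'d"
      proof -
        have "jb q \<le> 2 * jb (k - l)" using that False mle by linarith
        then have "jb q powr s \<le> (2 * jb (k - l)) powr s" using s jb_pos[of q] by (intro powr_mono2) auto
        then show ?thesis using pos by (simp add: powr_mult)
      qed
      have e: "\<bar>p q * jb q powr (2 * s) * of_int (r $ j)\<bar> \<le> 2 powr s * (jb (k - l) powr s * jb q powr s * jb r)"
        if "jb q \<le> \<mu>" for q r
      proof -
        have "\<bar>p q * jb q powr (2 * s) * of_int (r $ j)\<bar> \<le> 1 * (jb q powr s * jb q powr s) * jb r"
          unfolding abs_mult dbl using p01 by (intro mult_mono component_le_jb) auto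
        also have "\<dots> \<le> 1 * ((2 powr s * jb (k - l) powr s) * jb q powr s) * jb r"
          using b[OF that] jb_pos[of r] by (intro mult_right_mono mult_left_mono) auto
        finally show ?thesis by (simp add: algebra_simps)
      qed
      have "\<bar>p k * jb k powr (2 * s) * of_int (l $ j) - p l * jb l powr (2 * s) * of_int (k $ j)\<bar>
        \<le> 2 powr s * (jb (k - l) powr s * jb k powr s * jb l) + 2 powr s * (jb (k - l) powr s * jb l powr s * jb k)"
        using e[of k l] e[of l k] unfolding \<mu>_def by linarith
      also have "\<dots> = 2 powr s * (0 + jb (k - l) powr s * jb k powr s * jb l + jb (k - l) powr s * jb k * jb l powr s)"
        by (simp add: algebra_simps)
      also have "\<dots> \<le> C * (jb (k - l) * jb k powr s * jb l powr s + jb (k - l) powr s * jb k powr s * jb l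
           + jb (k - l) powr s * jb k * jb l powr s)"
        using C t1 t2 t3 by (intro mult_mono) auto
      finally show ?thesis .
    qed
  qed
  have sym: "jb (l - k) = jb (k - l)" using jb_minus[of "l - k"] by simp
  consider "p k \<noteq> 0" | "p l \<noteq> 0" | "p k = 0" "p l = 0" by blast
  then show ?thesis
  proof cases
    case 1 then show ?thesis by (rule main)
  next
    case 2
    then show ?thesis using main[OF 2, of k] unfolding sym by (simp add: abs_minus_commute algebra_simps)
  next
    case 3
    then show ?thesis using C jb_pos[of "k - l"] jb_pos[of k] jb_pos[of l] by (simp add: mult_nonneg_nonneg add_nonneg_nonneg)
  qed
qed

lemma finite_conv_le:
  fixes f h :: "'k::ab_group_add \<Rightarrow> real"
  assumes "(\<lambda>m. norm (\<bar>h m\<bar> * \<bar>f (k - m)\<bar>)) summable_on UNIV" "finite G"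
  shows "(\<Sum>l\<in>G. \<bar>f (k - l)\<bar> * \<bar>h l\<bar>) \<le> conv (\<lambda>m. \<bar>h m\<bar>) (\<lambda>m. \<bar>f m\<bar>) k"
  unfolding conv_def using finite_sum_le_infsum[OF _ assms(2), of "\<lambda>m. \<bar>h m\<bar> * \<bar>f (k - m)\<bar>" UNIV] assms(1)
  by (simp add: mult.commute abs_mult)

lemma trilinear_conv:
  fixes f g h :: "'k::ab_group_add \<Rightarrow> real"
  assumes s: "\<And>k. (\<lambda>m. norm (\<bar>h m\<bar> * \<bar>f (k - m)\<bar>)) summable_on UNIV"
    and E: "l2_le (conv (\<lambda>m. \<bar>h m\<bar>) (\<lambda>m. \<bar>f m\<bar>)) E" and g: "l2_le g B" and G: "finite G"
  shows "(\<Sum>k\<in>G. \<Sum>l\<in>G. \<bar>f (k - l)\<bar> * \<bar>g k\<bar> * \<bar>h l\<bar>) \<le> B * E"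
proof -
  let ?c = "conv (\<lambda>m. \<bar>h m\<bar>) (\<lambda>m. \<bar>f m\<bar>)"
  have "(\<Sum>k\<in>G. \<Sum>l\<in>G. \<bar>f (k - l)\<bar> * \<bar>g k\<bar> * \<bar>h l\<bar>) = (\<Sum>k\<in>G. \<bar>g k\<bar> * (\<Sum>l\<in>G. \<bar>f (k - l)\<bar> * \<bar>h l\<bar>))"
    by (simp add: sum_distrib_left mult_ac)
  also have "\<dots> \<le> (\<Sum>k\<in>G. \<bar>g k\<bar> * \<bar>?c k\<bar>)"
    by (intro sum_mono mult_left_mono order_trans[OF finite_conv_le[OF s G] abs_ge_self]) auto
  also have "\<dots> \<le> L2_set g G * L2_set ?c G" by (rule L2_set_mult_ineq)
  also have "\<dots> \<le> B * E"
    using l2_leD[OF g G] l2_leD[OF E G] l2_le_nonneg[OF g]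
    by (intro mult_mono) (auto simp: L2_set_def sum_nonneg)
  finally show ?thesis .
qed

lemma trilinear_1:
  fixes f g h :: "'k::ab_group_add \<Rightarrow> real"
  assumes "l1_le f A" "l2_le g B" "l2_le h D" "finite G"
  shows "(\<Sum>k\<in>G. \<Sum>l\<in>G. \<bar>f (k - l)\<bar> * \<bar>g k\<bar> * \<bar>h l\<bar>) \<le> A * B * D"
proof -
  have f: "l1_le (\<lambda>m. \<bar>f m\<bar>) A" and h: "l2_le (\<lambda>m. \<bar>h m\<bar>) D"
    using assms by (simp_all flip: real_norm_def)
  have "(\<Sum>k\<in>G. \<Sum>l\<in>G. \<bar>f (k - l)\<bar> * \<bar>g k\<bar> * \<bar>h l\<bar>) \<le> B * (D * A)"
    by (rule trilinear_conv[OF conv_summable_right[OF f l2_le_norm[OF h]] conv_l2'[OF h f] assms(2,4)])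
  then show ?thesis by (simp add: algebra_simps)
qed

lemma trilinear_3:
  fixes f g h :: "'k::ab_group_add \<Rightarrow> real"
  assumes "l2_le f A" "l2_le g B" "l1_le h D" "finite G"
  shows "(\<Sum>k\<in>G. \<Sum>l\<in>G. \<bar>f (k - l)\<bar> * \<bar>g k\<bar> * \<bar>h l\<bar>) \<le> A * B * D"
proof -
  have f: "l2_le (\<lambda>m. \<bar>f m\<bar>) A" and h: "l1_le (\<lambda>m. \<bar>h m\<bar>) D"
    using assms by (simp_all flip: real_norm_def)
  have "(\<Sum>k\<in>G. \<Sum>l\<in>G. \<bar>f (k - l)\<bar> * \<bar>g k\<bar> * \<bar>h l\<bar>) \<le> B * (D * A)"
    by (rule trilinear_conv[OF conv_summable_left[OF h l2_le_norm[OF f]] conv_l2[OF h f] assms(2,4)])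
  then show ?thesis by (simp add: algebra_simps)
qed

lemma trilinear_2:
  fixes f g h :: "'k::ab_group_add \<Rightarrow> real"
  assumes f: "l2_le f A" and g: "l1_le g B" and h: "l2_le h D" and G: "finite G"
  shows "(\<Sum>k\<in>G. \<Sum>l\<in>G. \<bar>f (k - l)\<bar> * \<bar>g k\<bar> * \<bar>h l\<bar>) \<le> A * B * D"
proof -
  have "(\<Sum>l\<in>G. \<bar>f (k - l)\<bar> * \<bar>h l\<bar>) \<le> A * D" for k
  proof -
    have "L2_set (\<lambda>l. f (k - l)) G \<le> A"
      using l2_leD[OF f, of "(\<lambda>l. k - l) ` G"] G by (simp add: L2_set_def sum.reindex inj_on_def)
    then have "L2_set (\<lambda>l. f (k - l)) G * L2_set h G \<le> A * D"
      using l2_leD[OF h G] l2_le_nonneg[OF f] by (intro mult_mono) (auto simp: L2_set_def sum_nonneg)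
    then show ?thesis using L2_set_mult_ineq[of "\<lambda>l. f (k - l)" h G] by linarith
  qed
  then have "(\<Sum>k\<in>G. \<bar>g k\<bar> * (\<Sum>l\<in>G. \<bar>f (k - l)\<bar> * \<bar>h l\<bar>)) \<le> (\<Sum>k\<in>G. \<bar>g k\<bar> * (A * D))"
    by (intro sum_mono mult_left_mono) auto
  also have "\<dots> \<le> B * (A * D)"
    using l1_leD[OF g G] l2_le_nonneg[OF f] l2_le_nonneg[OF h]
    by (simp add: sum_distrib_right[symmetric] mult_right_mono)
  finally show ?thesis by (simp add: sum_distrib_left mult_ac)
qed

definition deriv_coeff :: "'d \<Rightarrow> (int^'d \<Rightarrow> complex) \<Rightarrow> int^'d \<Rightarrow> complex" where
  "deriv_coeff j w l = \<i> * of_int (l $ j) * w l"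

lemma norm_deriv_coeff_le: "norm (deriv_coeff j w l) \<le> wt 1 w l"
  unfolding deriv_coeff_def wt_one using component_le_jb[of l j]
  by (simp add: norm_mult mult_right_mono)

lemma deriv_coeff_l1: "l1_le (wt 1 w) R \<Longrightarrow> l1_le (deriv_coeff j w) R"
  by (rule l1_le_mono) (auto simp: norm_deriv_coeff_le)

text \<open>
  The energy identity behind symmetric hyperbolic systems, on the Fourier side: exchanging the two
  frequencies (and the two components) turns the multiplier \<open>\<sigma>(k) l\<^sub>j\<close> into the commutator
  \<open>\<sigma>(k) l\<^sub>j - \<sigma>(l) k\<^sub>j\<close>, in which the loss of derivative has cancelled.
\<close>

lemma symmetric_energy:
  fixes c :: "'n::finite \<Rightarrow> 'n \<Rightarrow> int^'d \<Rightarrow> complex" and w :: "'n \<Rightarrow> int^'d \<Rightarrow> complex" and \<sigma> :: "int^'d \<Rightarrow> real"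
  assumes sym: "\<And>a b. c a b = c b a" and herm: "\<And>a b m. c a b (- m) = cnj (c a b m)"
    and S: "finite S" "\<And>k. k \<notin> S \<Longrightarrow> \<sigma> k = 0"
    and summ: "\<And>a b k. (\<lambda>l. norm (deriv_coeff j (w b) l * c a b (k - l))) summable_on UNIV"
    and B: "\<And>a b G. finite G \<Longrightarrow> (\<Sum>k\<in>G. \<Sum>l\<in>G. \<bar>\<sigma> k * of_int (l $ j) - \<sigma> l * of_int (k $ j)\<bar>
               * (norm (c a b (k - l)) * norm (w a k) * norm (w b l))) \<le> B"
  shows "\<bar>\<Sum>k\<in>S. \<sigma> k * Re (\<Sum>a\<in>UNIV. \<Sum>b\<in>UNIV. cnj (w a k) * conv (c a b) (deriv_coeff j (w b)) k)\<bar>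
     \<le> real CARD('n) ^ 2 * B"
proof -
  define t where "t k l a b = of_real (\<sigma> k) * (cnj (w a k) * (deriv_coeff j (w b) l * c a b (k - l)))" for k l a b
  define T where "T G = (\<Sum>k\<in>G. \<Sum>l\<in>G. \<Sum>a\<in>UNIV. \<Sum>b\<in>UNIV. t k l a b)" for G
  have half: "\<bar>Re (T G)\<bar> \<le> real CARD('n) ^ 2 * B" if G: "finite G" for G
  proof -
    have swap: "(\<Sum>k\<in>G. \<Sum>l\<in>G. \<Sum>a\<in>UNIV. \<Sum>b\<in>UNIV. f k l a b) = (\<Sum>k\<in>G. \<Sum>l\<in>G. \<Sum>a\<in>UNIV. \<Sum>b\<in>UNIV. f l k b a)"
      for f :: "int^'d \<Rightarrow> int^'d \<Rightarrow> 'n \<Rightarrow> 'n \<Rightarrow> complex"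
    proof -
      have "(\<Sum>k\<in>G. \<Sum>l\<in>G. \<Sum>a\<in>UNIV. \<Sum>b\<in>UNIV. f k l a b) = (\<Sum>k\<in>G. \<Sum>l\<in>G. \<Sum>a\<in>UNIV. \<Sum>b\<in>UNIV. f k l b a)"
        by (intro sum.cong refl sum.swap)
      also have "\<dots> = (\<Sum>k\<in>G. \<Sum>l\<in>G. \<Sum>a\<in>UNIV. \<Sum>b\<in>UNIV. f l k b a)" by (rule sum.swap)
      finally show ?thesis .
    qed
    have "cnj (T G) = (\<Sum>k\<in>G. \<Sum>l\<in>G. \<Sum>a\<in>UNIV. \<Sum>b\<in>UNIV. cnj (t l k b a))"
      unfolding T_def cnj_sum by (rule swap)
    then have "T G + cnj (T G) = (\<Sum>k\<in>G. \<Sum>l\<in>G. \<Sum>a\<in>UNIV. \<Sum>b\<in>UNIV. t k l a b + cnj (t l k b a))"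
      by (simp add: T_def sum.distrib)
    also have "\<dots> = (\<Sum>k\<in>G. \<Sum>l\<in>G. \<Sum>a\<in>UNIV. \<Sum>b\<in>UNIV. of_real (\<sigma> k * of_int (l $ j) - \<sigma> l * of_int (k $ j))
               * (\<i> * c a b (k - l) * cnj (w a k) * w b l))"
    proof (intro sum.cong refl)
      fix k l a b
      have "cnj (c b a (l - k)) = c a b (k - l)"
        using herm[of b a "k - l"] sym[of a b] by simp
      then show "t k l a b + cnj (t l k b a) = of_real (\<sigma> k * of_int (l $ j) - \<sigma> l * of_int (k $ j))
               * (\<i> * c a b (k - l) * cnj (w a k) * w b l)"
        by (simp add: t_def deriv_coeff_def algebra_simps)
    qed
    finally have "norm (T G + cnj (T G)) \<le> (\<Sum>k\<in>G. \<Sum>l\<in>G. \<Sum>a\<in>UNIV. \<Sum>b\<in>UNIV. \<bar>\<sigma> k * of_int (l $ j) - \<sigma> l * of_int (k $ j)\<bar>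
               * (norm (c a b (k - l)) * norm (w a k) * norm (w b l)))"
      by (simp only:) (intro sum_norm_le; simp add: norm_mult del: of_real_diff of_real_mult)
    also have "\<dots> = (\<Sum>a\<in>UNIV. \<Sum>b\<in>UNIV. \<Sum>k\<in>G. \<Sum>l\<in>G. \<bar>\<sigma> k * of_int (l $ j) - \<sigma> l * of_int (k $ j)\<bar>
               * (norm (c a b (k - l)) * norm (w a k) * norm (w b l)))"
    proof -
      have "(\<Sum>k\<in>G. \<Sum>l\<in>G. \<Sum>a\<in>UNIV. \<Sum>b\<in>UNIV. f k l a b) = (\<Sum>a\<in>UNIV. \<Sum>b\<in>UNIV. \<Sum>k\<in>G. \<Sum>l\<in>G. f k l a b)"
        for f :: "int^'d \<Rightarrow> int^'d \<Rightarrow> 'n \<Rightarrow> 'n \<Rightarrow> real"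
      proof -
        have "(\<Sum>k\<in>G. \<Sum>l\<in>G. \<Sum>a\<in>UNIV. \<Sum>b\<in>UNIV. f k l a b) = (\<Sum>k\<in>G. \<Sum>a\<in>UNIV. \<Sum>l\<in>G. \<Sum>b\<in>UNIV. f k l a b)"
          by (intro sum.cong refl sum.swap)
        also have "\<dots> = (\<Sum>a\<in>UNIV. \<Sum>k\<in>G. \<Sum>l\<in>G. \<Sum>b\<in>UNIV. f k l a b)" by (rule sum.swap)
        also have "\<dots> = (\<Sum>a\<in>UNIV. \<Sum>k\<in>G. \<Sum>b\<in>UNIV. \<Sum>l\<in>G. f k l a b)"
          by (intro sum.cong refl sum.swap)
        also have "\<dots> = (\<Sum>a\<in>UNIV. \<Sum>b\<in>UNIV. \<Sum>k\<in>G. \<Sum>l\<in>G. f k l a b)"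
          by (intro sum.cong refl sum.swap)
        finally show ?thesis .
      qed
      then show ?thesis .
    qed
    also have "\<dots> \<le> (\<Sum>a\<in>(UNIV::'n set). \<Sum>b\<in>(UNIV::'n set). B)" by (intro sum_mono B G)
    also have "\<dots> = real CARD('n) ^ 2 * B" by (simp add: power2_eq_square)
    finally have "norm (T G + cnj (T G)) \<le> real CARD('n) ^ 2 * B" .
    moreover have "T G + cnj (T G) = of_real (2 * Re (T G))" by (rule complex_add_cnj)
    ultimately have "2 * \<bar>Re (T G)\<bar> \<le> real CARD('n) ^ 2 * B" by (simp add: abs_mult)
    then show ?thesis using abs_ge_zero[of "Re (T G)"] by linarith
  qed
  let ?s = "\<lambda>G. \<Sum>k\<in>S. \<Sum>a\<in>UNIV. \<Sum>b\<in>UNIV. of_real (\<sigma> k) * (cnj (w a k) * (\<Sum>l\<in>G. deriv_coeff j (w b) l * c a b (k - l)))"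
  have TG: "T G = ?s G" if "finite G" "S \<subseteq> G" for G
  proof -
    have "T G = (\<Sum>k\<in>S. \<Sum>l\<in>G. \<Sum>a\<in>UNIV. \<Sum>b\<in>UNIV. t k l a b)"
      unfolding T_def by (rule sum.mono_neutral_right) (use that S in \<open>auto simp: t_def\<close>)
    also have "\<dots> = (\<Sum>k\<in>S. \<Sum>a\<in>UNIV. \<Sum>l\<in>G. \<Sum>b\<in>UNIV. t k l a b)"
      by (intro sum.cong refl sum.swap)
    also have "\<dots> = (\<Sum>k\<in>S. \<Sum>a\<in>UNIV. \<Sum>b\<in>UNIV. \<Sum>l\<in>G. t k l a b)"
      by (intro sum.cong refl sum.swap)
    finally show ?thesis by (simp add: t_def sum_distrib_left)
  qed
  let ?L = "\<Sum>k\<in>S. \<Sum>a\<in>UNIV. \<Sum>b\<in>UNIV. of_real (\<sigma> k) * (cnj (w a k) * conv (c a b) (deriv_coeff j (w b)) k)"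
  have lim: "((\<lambda>G. \<bar>Re (?s G)\<bar>) \<longlongrightarrow> \<bar>Re ?L\<bar>) (finite_subsets_at_top UNIV)"
  proof -
    have "((\<lambda>G. \<Sum>l\<in>G. deriv_coeff j (w b) l * c a b (k - l)) \<longlongrightarrow> conv (c a b) (deriv_coeff j (w b)) k) (finite_subsets_at_top UNIV)" for a b k
      unfolding conv_commute[of "c a b"] by (rule conv_tendsto[OF summ])
    then show ?thesis by (intro tendsto_rabs tendsto_Re tendsto_sum tendsto_mult tendsto_const)
  qed
  have "\<forall>\<^sub>F G in finite_subsets_at_top UNIV. finite G \<and> S \<subseteq> G"
    using S(1) unfolding eventually_finite_subsets_at_top by blast
  then have "\<forall>\<^sub>F G in finite_subsets_at_top UNIV. \<bar>Re (?s G)\<bar> \<le> real CARD('n) ^ 2 * B"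
  proof (rule eventually_mono)
    fix G assume G: "finite G \<and> S \<subseteq> G"
    show "\<bar>Re (?s G)\<bar> \<le> real CARD('n) ^ 2 * B"
      using half[of G] G unfolding TG[OF conjunct1[OF G] conjunct2[OF G]] by blast
  qed
  then have "\<bar>Re ?L\<bar> \<le> real CARD('n) ^ 2 * B"
    by (intro tendsto_upperbound[OF lim]) auto
  moreover have "Re ?L = (\<Sum>k\<in>S. \<sigma> k * Re (\<Sum>a\<in>UNIV. \<Sum>b\<in>UNIV. cnj (w a k) * conv (c a b) (deriv_coeff j (w b)) k))"
  proof -
    have "Re (of_real r * z) = r * Re z" for r z by simp
    then show ?thesis by (simp only: sum_distrib_left[symmetric] Re_sum)
  qed
  ultimately show ?thesis by (simp only:)
qed

text \<open>
  With \<open>\<sigma> = p\<close> the commutator is bounded by \<open>|k - l|\<close>, which the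
  coefficient absorbs in the weighted Wiener norm.
\<close>

lemma energy_estimate_L2:
  fixes c :: "'n::finite \<Rightarrow> 'n \<Rightarrow> int^'d \<Rightarrow> complex" and w :: "'n \<Rightarrow> int^'d \<Rightarrow> complex"
  assumes sym: "\<And>a b. c a b = c b a" and herm: "\<And>a b m. c a b (- m) = cnj (c a b m)"
    and cut: "cutoff \<Lambda> \<rho> \<nu> p" and S: "finite S" "\<And>k. k \<notin> S \<Longrightarrow> p k = 0"
    and \<Gamma>: "\<And>a b. l1_le (wt 1 (c a b)) \<Gamma>" and R: "\<And>a. l1_le (wt 1 (w a)) R" and D: "\<And>a. l2_le (w a) D"
  shows "\<bar>\<Sum>k\<in>S. p k * Re (\<Sum>a\<in>UNIV. \<Sum>b\<in>UNIV. cnj (w a k) * conv (c a b) (deriv_coeff j (w b)) k)\<bar>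
     \<le> real CARD('n) ^ 2 * ((1 + \<Lambda> * \<rho>) * (\<Gamma> * D * D))"
proof (rule symmetric_energy[OF sym herm S])
  fix a b k
  show "(\<lambda>l. norm (deriv_coeff j (w b) l * c a b (k - l))) summable_on UNIV"
    by (rule conv_summable_left[OF deriv_coeff_l1[OF R] l1_le_norm[OF l1_le_of_wt[OF _ \<Gamma>]]]) simp
next
  fix a b and G :: "(int^'d) set" assume G: "finite G"
  have LR: "0 \<le> 1 + \<Lambda> * \<rho>" using cut by (simp add: cutoff_def)
  have "(\<Sum>k\<in>G. \<Sum>l\<in>G. \<bar>p k * of_int (l $ j) - p l * of_int (k $ j)\<bar> * (norm (c a b (k - l)) * norm (w a k) * norm (w b l)))
     \<le> (\<Sum>k\<in>G. \<Sum>l\<in>G. (1 + \<Lambda> * \<rho>) * (\<bar>wt 1 (c a b) (k - l)\<bar> * \<bar>norm (w a k)\<bar> * \<bar>norm (w b l)\<bar>))"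
  proof (intro sum_mono)
    fix k l
    have "\<bar>p k * of_int (l $ j) - p l * of_int (k $ j)\<bar> * (norm (c a b (k - l)) * norm (w a k) * norm (w b l))
      \<le> ((1 + \<Lambda> * \<rho>) * jb (k - l)) * (norm (c a b (k - l)) * norm (w a k) * norm (w b l))"
      by (intro mult_right_mono multiplier_commutator_L2[OF cut]) auto
    then show "\<bar>p k * of_int (l $ j) - p l * of_int (k $ j)\<bar> * (norm (c a b (k - l)) * norm (w a k) * norm (w b l))
      \<le> (1 + \<Lambda> * \<rho>) * (\<bar>wt 1 (c a b) (k - l)\<bar> * \<bar>norm (w a k)\<bar> * \<bar>norm (w b l)\<bar>)"
      using jb_pos[of "k - l"] by (simp add: wt_one algebra_simps abs_mult)
  qed
  also have "\<dots> = (1 + \<Lambda> * \<rho>) * (\<Sum>k\<in>G. \<Sum>l\<in>G. \<bar>wt 1 (c a b) (k - l)\<bar> * \<bar>norm (w a k)\<bar> * \<bar>norm (w b l)\<bar>)"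
    by (simp only: sum_distrib_left)
  also have "\<dots> \<le> (1 + \<Lambda> * \<rho>) * (\<Gamma> * D * D)"
    using D G by (intro mult_left_mono[OF _ LR] trilinear_1[OF \<Gamma>]) auto
  finally show "(\<Sum>k\<in>G. \<Sum>l\<in>G. \<bar>p k * of_int (l $ j) - p l * of_int (k $ j)\<bar> * (norm (c a b (k - l)) * norm (w a k) * norm (w b l)))
     \<le> (1 + \<Lambda> * \<rho>) * (\<Gamma> * D * D)" .
qed

text \<open>
  Here \<open>\<sigma> = p \<langle>k\<rangle>\<^sup>2\<^sup>s\<close>; its commutator loses
  \<open>|k - l|\<close> and leaves \<open>\<langle>k\<rangle>\<^sup>s
  \<langle>l\<rangle>\<^sup>s\<close>, up to a term in which the derivatives fall on the
  coefficient.
\<close>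

lemma energy_estimate_Hs:
  fixes c :: "'n::finite \<Rightarrow> 'n \<Rightarrow> int^'d \<Rightarrow> complex" and w :: "'n \<Rightarrow> int^'d \<Rightarrow> complex"
  assumes sym: "\<And>a b. c a b = c b a" and herm: "\<And>a b m. c a b (- m) = cnj (c a b m)"
    and cut: "cutoff \<Lambda> \<rho> \<nu> p" and S: "finite S" "\<And>k. k \<notin> S \<Longrightarrow> p k = 0" and s: "1 \<le> 2 * s"
    and \<Gamma>: "\<And>a b. l1_le (wt 1 (c a b)) \<Gamma>" and \<Gamma>s: "\<And>a b. l2_le (wt s (c a b)) \<Gamma>s"
    and R: "\<And>a. l1_le (wt 1 (w a)) R" and D: "\<And>a. l2_le (wt s (w a)) D"
  shows "\<bar>\<Sum>k\<in>S. p k * jb k powr (2 * s) * Re (\<Sum>a\<in>UNIV. \<Sum>b\<in>UNIV. cnj (w a k) * conv (c a b) (deriv_coeff j (w b)) k)\<bar>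
     \<le> real CARD('n) ^ 2 * (((1 + \<Lambda> * \<rho> + 2 * s) * 2 powr s) * (\<Gamma> * D * D + \<Gamma>s * D * R + \<Gamma>s * R * D))"
proof (rule symmetric_energy[OF sym herm S(1)])
  show "p k * jb k powr (2 * s) = 0" if "k \<notin> S" for k using S(2)[OF that] by simp
next
  fix a b k
  show "(\<lambda>l. norm (deriv_coeff j (w b) l * c a b (k - l))) summable_on UNIV"
    by (rule conv_summable_left[OF deriv_coeff_l1[OF R] l1_le_norm[OF l1_le_of_wt[OF _ \<Gamma>]]]) simp
next
  fix a b and G :: "(int^'d) set" assume G: "finite G"
  let ?C = "(1 + \<Lambda> * \<rho> + 2 * s) * 2 powr s"
  have C: "0 \<le> ?C" using cut s by (auto simp: cutoff_def)
  let ?x = "\<lambda>k l. \<bar>p k * jb k powr (2 * s) * of_int (l $ j) - p l * jb l powr (2 * s) * of_int (k $ j)\<bar>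
       * (norm (c a b (k - l)) * norm (w a k) * norm (w b l))"
  let ?y = "\<lambda>k l. \<bar>wt 1 (c a b) (k - l)\<bar> * \<bar>wt s (w a) k\<bar> * \<bar>wt s (w b) l\<bar>
      + \<bar>wt s (c a b) (k - l)\<bar> * \<bar>wt s (w a) k\<bar> * \<bar>wt 1 (w b) l\<bar>
      + \<bar>wt s (c a b) (k - l)\<bar> * \<bar>wt 1 (w a) k\<bar> * \<bar>wt s (w b) l\<bar>"
  have "(\<Sum>k\<in>G. \<Sum>l\<in>G. ?x k l) \<le> (\<Sum>k\<in>G. \<Sum>l\<in>G. ?C * ?y k l)"
  proof (intro sum_mono)
    fix k l
    have "?x k l \<le> (?C * (jb (k - l) * jb k powr s * jb l powr s + jb (k - l) powr s * jb k powr s * jb l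
           + jb (k - l) powr s * jb k * jb l powr s)) * (norm (c a b (k - l)) * norm (w a k) * norm (w b l))"
      by (intro mult_right_mono multiplier_commutator_Hs[OF cut s]) auto
    also have "\<dots> = ?C * ?y k l"
      using jb_pos[of "k - l"] jb_pos[of k] jb_pos[of l] by (simp add: wt_def algebra_simps abs_mult)
    finally show "?x k l \<le> ?C * ?y k l" .
  qed
  also have "\<dots> = ?C * ((\<Sum>k\<in>G. \<Sum>l\<in>G. \<bar>wt 1 (c a b) (k - l)\<bar> * \<bar>wt s (w a) k\<bar> * \<bar>wt s (w b) l\<bar>)
      + (\<Sum>k\<in>G. \<Sum>l\<in>G. \<bar>wt s (c a b) (k - l)\<bar> * \<bar>wt s (w a) k\<bar> * \<bar>wt 1 (w b) l\<bar>)
      + (\<Sum>k\<in>G. \<Sum>l\<in>G. \<bar>wt s (c a b) (k - l)\<bar> * \<bar>wt 1 (w a) k\<bar> * \<bar>wt s (w b) l\<bar>))"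
    by (simp only: sum_distrib_left[symmetric] sum.distrib)
  also have "\<dots> \<le> ?C * (\<Gamma> * D * D + \<Gamma>s * D * R + \<Gamma>s * R * D)"
    by (intro mult_left_mono[OF _ C] add_mono trilinear_1[OF \<Gamma> D D G] trilinear_3[OF \<Gamma>s D R G] trilinear_2[OF \<Gamma>s R D G])
  finally show "(\<Sum>k\<in>G. \<Sum>l\<in>G. ?x k l) \<le> ?C * (\<Gamma> * D * D + \<Gamma>s * D * R + \<Gamma>s * R * D)" .
qed

section \<open>Sobolev norms in terms of Fourier coefficients\<close>

lemma hat_eq: "hat V a k = fourier_coeff V k $ a"
  by (simp add: hat_def fourier_coeff_nth)

lemma sobolev_l2_le_summable:
  assumes summ: "(\<lambda>k. jb k powr (2 * s) * (norm (fourier_coeff V k))\<^sup>2) summable_on UNIV"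
  shows "l2_le (wt s (fourier_coeff V)) (sobolev_norm s V)"
proof -
  have sq: "(norm (wt s (fourier_coeff V) k))\<^sup>2 = jb k powr (2 * s) * (norm (fourier_coeff V k))\<^sup>2" for k
    by (simp add: wt_def power_mult_distrib power2_eq_square[of "_ powr _"] powr_add[symmetric])
  have pos: "0 \<le> (\<Sum>\<^sub>\<infinity>k. jb k powr (2 * s) * (norm (fourier_coeff V k))\<^sup>2)"
    by (intro infsum_nonneg) auto
  then have "0 \<le> sobolev_norm s V" by (simp add: sobolev_norm_def)
  then show ?thesis
    unfolding l2_le_iff_sum_power2[OF \<open>0 \<le> sobolev_norm s V\<close>] sq
    using finite_sum_le_infsum[OF summ] pos by (simp add: sobolev_norm_def)
qed

lemma sobolev_l2_le: "in_sobolev s V \<Longrightarrow> l2_le (wt s (fourier_coeff V)) (sobolev_norm s V)"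
  by (rule sobolev_l2_le_summable) (simp add: in_sobolev_def)

lemma sobolev_norm_le:
  fixes V :: "real^'d \<Rightarrow> real^'n"
  assumes "l2_le (wt s (fourier_coeff V)) B"
  shows "sobolev_norm s V \<le> B" and "torus_L2 V \<Longrightarrow> in_sobolev s V"
    and "l2_le (wt s (fourier_coeff V)) (sobolev_norm s V)"
proof -
  have sq: "(norm (wt s (fourier_coeff V) k))\<^sup>2 = jb k powr (2 * s) * (norm (fourier_coeff V k))\<^sup>2" for k
    by (simp add: wt_def power_mult_distrib power2_eq_square[of "_ powr _"] powr_add[symmetric])
  have B: "0 \<le> B" using l2_le_nonneg[OF assms] .
  have le: "(\<Sum>k\<in>F. jb k powr (2 * s) * (norm (fourier_coeff V k))\<^sup>2) \<le> B\<^sup>2" if "finite F" for F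
    using assms that unfolding l2_le_iff_sum_power2[OF B] sq by blast
  have summ: "(\<lambda>k. jb k powr (2 * s) * (norm (fourier_coeff V k))\<^sup>2) summable_on UNIV"
    by (intro nonneg_bdd_above_summable_on bdd_aboveI[of _ "B\<^sup>2"]) (auto simp: le)
  then show "l2_le (wt s (fourier_coeff V)) (sobolev_norm s V)" by (rule sobolev_l2_le_summable)
  from summ show "torus_L2 V \<Longrightarrow> in_sobolev s V" by (simp add: in_sobolev_def)
  have "(\<Sum>\<^sub>\<infinity>k. jb k powr (2 * s) * (norm (fourier_coeff V k))\<^sup>2) \<le> B\<^sup>2"
    by (rule infsum_le_finite_sums[OF summ]) (use le in auto)
  then show "sobolev_norm s V \<le> B"
    unfolding sobolev_norm_def using B real_sqrt_le_mono by fastforce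
qed

lemma sobolev_norm_nonneg: "0 \<le> sobolev_norm s V"
  unfolding sobolev_norm_def by (intro real_sqrt_ge_zero infsum_nonneg) auto

lemma wt_hat_le: "wt s (hat V a) k \<le> wt s (fourier_coeff V) k"
  by (simp add: wt_def hat_eq Finite_Cartesian_Product.norm_nth_le mult_left_mono)

lemma hat_l2_le: "l2_le (wt s (fourier_coeff V)) B \<Longrightarrow> l2_le (wt s (hat V a)) B"
  by (rule l2_le_mono) (auto simp: wt_hat_le)

section \<open>Differentiation of Fourier series\<close>

lemma norm_cis_minus_1_le: "norm (cis t - 1) \<le> \<bar>t\<bar>"
  using dist_exp_i_1[of t] abs_sin_x_le_abs_x[of "t/2"] by (simp add: cis_conv_exp)

lemma character_quotient_tendsto: "((\<lambda>h. (cis (r * h) - 1) / of_real h) \<longlongrightarrow> \<i> * of_real r) (at 0)"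
proof -
  have "((\<lambda>z. exp (\<i> * (of_real r * z))) has_field_derivative \<i> * of_real r) (at 0)"
    by (auto intro!: derivative_eq_intros)
  then have "((\<lambda>z. (exp (\<i> * (of_real r * z)) - 1) / z) \<longlongrightarrow> \<i> * of_real r) (at 0)"
    by (simp add: DERIV_def)
  moreover have "filterlim complex_of_real (at 0) (at 0)"
    by (rule filterlim_atI) (auto intro!: tendsto_eq_intros simp: eventually_at_filter)
  ultimately have "((\<lambda>h. (exp (\<i> * (of_real r * of_real h)) - 1) / of_real h) \<longlongrightarrow> \<i> * of_real r) (at 0)"
    by (rule filterlim_compose)
  then show ?thesis by (simp add: cis_conv_exp)
qed

lemma series_directional_derivative:
  fixes c :: "int^'d \<Rightarrow> complex"
  assumes c: "l1_le (wt 1 c) R"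
  shows "((\<lambda>h. ((\<Sum>\<^sub>\<infinity>k. c k * cis (phase k (x + axis j h))) - (\<Sum>\<^sub>\<infinity>k. c k * cis (phase k x))) / of_real h)
     \<longlongrightarrow> (\<Sum>\<^sub>\<infinity>k. deriv_coeff j c k * cis (phase k x))) (at 0)"
proof -
  define b where "b k = of_real (jb k) * c k" for k
  define H where "H k h = cis (phase k x) * ((cis (of_int (k $ j) * h) - 1) / of_real h) / of_real (jb k)" for k and h :: real
  have jb0: "complex_of_real (jb k) \<noteq> 0" for k :: "int^'d" using jb_pos[of k] by simp
  have b: "(\<lambda>k. norm (b k)) summable_on UNIV"
  proof -
    have "(\<lambda>k. norm (b k)) = (\<lambda>k. norm (wt 1 c k))"
      by (rule ext) (simp only: norm_wt, simp add: b_def norm_mult wt_one abs_of_pos[OF jb_pos])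
    then show ?thesis using l1_le_summable[OF c] by simp
  qed
  have Hb: "norm (H k h) \<le> 1" for k h
  proof (cases "h = 0")
    case False
    have "norm (cis (of_int (k $ j) * h) - 1) \<le> jb k * \<bar>h\<bar>"
      using norm_cis_minus_1_le[of "of_int (k $ j) * h"] mult_right_mono[OF component_le_jb[of k j], of "\<bar>h\<bar>"]
      by (simp add: abs_mult)
    then show ?thesis using False jb_pos[of k]
      by (simp add: H_def norm_mult norm_divide divide_simps mult.commute)
  qed (simp add: H_def)
  have "uniform_limit UNIV (\<lambda>F h. \<Sum>k\<in>F. b k * H k h) (\<lambda>h. \<Sum>\<^sub>\<infinity>k. b k * H k h) (finite_subsets_at_top UNIV)"
    by (rule uniform_limit_infsum[OF b Hb])
  moreover have "((\<lambda>h. \<Sum>k\<in>F. b k * H k h) \<longlongrightarrow> (\<Sum>k\<in>F. deriv_coeff j c k * cis (phase k x))) (at 0)" for F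
  proof (rule tendsto_sum)
    fix k
    have "((\<lambda>h. b k * H k h) \<longlongrightarrow> b k * (cis (phase k x) * (\<i> * of_real (of_int (k $ j))) / of_real (jb k))) (at 0)"
      unfolding H_def by (intro tendsto_intros character_quotient_tendsto jb0)
    then show "((\<lambda>h. b k * H k h) \<longlongrightarrow> deriv_coeff j c k * cis (phase k x)) (at 0)"
      using jb0[of k] by (simp add: b_def deriv_coeff_def mult_ac)
  qed
  moreover have "((\<lambda>F. \<Sum>k\<in>F. deriv_coeff j c k * cis (phase k x)) \<longlongrightarrow> (\<Sum>\<^sub>\<infinity>k. deriv_coeff j c k * cis (phase k x)))
      (finite_subsets_at_top UNIV)"
    by (rule infsum_tendsto[OF abs_summable_summable])
       (use l1_le_summable[OF deriv_coeff_l1[OF c, of j]] in \<open>simp add: norm_mult\<close>)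
  ultimately have lim: "((\<lambda>h. \<Sum>\<^sub>\<infinity>k. b k * H k h) \<longlongrightarrow> (\<Sum>\<^sub>\<infinity>k. deriv_coeff j c k * cis (phase k x))) (at 0)"
    by (intro swap_uniform_limit[where S = UNIV]) (auto intro: always_eventually)
  have "(\<Sum>\<^sub>\<infinity>k. b k * H k h) = ((\<Sum>\<^sub>\<infinity>k. c k * cis (phase k (x + axis j h))) - (\<Sum>\<^sub>\<infinity>k. c k * cis (phase k x))) / of_real h" for h
  proof -
    have cs: "(\<lambda>k. c k * cis (f k)) summable_on UNIV" for f
      by (rule abs_summable_summable) (use l1_le_summable[OF l1_le_of_wt[OF _ c]] in \<open>simp add: norm_mult\<close>)
    have "b k * H k h = (c k * cis (phase k (x + axis j h)) + - (c k * cis (phase k x))) * inverse (of_real h)" for k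
    proof -
      have "b k * H k h = c k * (cis (phase k x) * (cis (of_int (k $ j) * h) - 1)) * inverse (of_real h)"
        using jb0[of k] by (simp add: b_def H_def divide_inverse)
      moreover have "cis (phase k (x + axis j h)) = cis (phase k x) * cis (of_int (k $ j) * h)"
        by (simp add: phase_add_axis cis_mult)
      ultimately show ?thesis by (simp only: right_diff_distrib mult_1_right add_uminus_conv_diff)
    qed
    then have "(\<Sum>\<^sub>\<infinity>k. b k * H k h) = (\<Sum>\<^sub>\<infinity>k. (c k * cis (phase k (x + axis j h)) + - (c k * cis (phase k x))) * inverse (of_real h))"
      by simp
    also have "\<dots> = (\<Sum>\<^sub>\<infinity>k. c k * cis (phase k (x + axis j h)) + - (c k * cis (phase k x))) * inverse (of_real h)"
      by (rule infsum_cmult_left')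
    also have "(\<Sum>\<^sub>\<infinity>k. c k * cis (phase k (x + axis j h)) + - (c k * cis (phase k x)))
        = (\<Sum>\<^sub>\<infinity>k. c k * cis (phase k (x + axis j h))) + (\<Sum>\<^sub>\<infinity>k. - (c k * cis (phase k x)))"
      by (rule infsum_add) (use cs in \<open>auto simp: summable_on_uminus\<close>)
    finally show ?thesis by (simp add: infsum_uminus divide_inverse)
  qed
  then show ?thesis using lim by simp
qed

text \<open>
  Differentiability in space is part of the notion of solution, so only the directional derivative
  along an axis has to be identified with the series.
\<close>

lemma partial_deriv_series:
  fixes V :: "real^'d \<Rightarrow> real^'n"
  assumes V: "wiener_vec V" "V differentiable (at x)" "l1_le (wt 1 (hat V a)) R"
  shows "complex_of_real (partial_deriv j V x $ a) = (\<Sum>\<^sub>\<infinity>k. deriv_coeff j (hat V a) k * cis (phase k x))"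
proof -
  define D where "D = frechet_derivative V (at x)"
  have D: "(V has_derivative D) (at x)" using V(2) unfolding D_def by (simp add: frechet_derivative_works)
  have ax: "axis j h = h *\<^sub>R axis j (1::real)" for h by (simp add: vec_eq_iff axis_def)
  have "((\<lambda>h. x + h *\<^sub>R axis j 1) has_derivative (\<lambda>h. h *\<^sub>R axis j 1)) (at 0)"
    by (auto intro!: derivative_eq_intros)
  moreover have "(V has_derivative D) (at (x + 0 *\<^sub>R axis j 1))" using D by simp
  ultimately have "((\<lambda>h. V (x + h *\<^sub>R axis j 1)) has_derivative (\<lambda>h. D (h *\<^sub>R axis j 1))) (at 0)"
    by (rule has_derivative_compose)
  then have d1: "((\<lambda>h. V (x + h *\<^sub>R axis j 1) $ a) has_derivative (\<lambda>h. D (h *\<^sub>R axis j 1) $ a)) (at 0)"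
    by (rule bounded_linear.has_derivative[OF bounded_linear_vec_nth])
  have d2: "(\<lambda>h. D (h *\<^sub>R axis j 1) $ a) = (\<lambda>h. h * (D (axis j 1) $ a))"
    using has_derivative_bounded_linear[OF D] by (simp add: linear_simps)
  have dd: "((\<lambda>h. V (x + axis j h) $ a) has_field_derivative D (axis j 1) $ a) (at 0)"
  proof -
    have e: "(\<lambda>h. V (x + axis j h) $ a) = (\<lambda>h. V (x + h *\<^sub>R axis j 1) $ a)"
    proof
      fix h show "V (x + axis j h) $ a = V (x + h *\<^sub>R axis j 1) $ a" by (simp only: ax[of h])
    qed
    have m: "(\<lambda>h. h * (D (axis j 1) $ a)) = (*) (D (axis j 1) $ a)"
      by (rule ext) (rule mult.commute)
    show ?thesis using d1 unfolding e has_field_derivative_def d2 m .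
  qed
  have "((\<lambda>h. (V (x + axis j h) $ a - V x $ a) / h) \<longlongrightarrow> D (axis j 1) $ a) (at 0)"
  proof -
    have z: "x + axis j 0 = x" by (simp add: axis_def vec_eq_iff)
    show ?thesis using dd unfolding DERIV_def add_0_left z .
  qed
  then have 1: "((\<lambda>h. complex_of_real ((V (x + axis j h) $ a - V x $ a) / h)) \<longlongrightarrow> of_real (D (axis j 1) $ a)) (at 0)"
    by (rule tendsto_of_real)
  have w: "wiener (\<lambda>x. V x $ a)" using V(1) by (simp add: wiener_vec_def)
  have 2: "((\<lambda>h. complex_of_real ((V (x + axis j h) $ a - V x $ a) / h)) \<longlongrightarrow> (\<Sum>\<^sub>\<infinity>k. deriv_coeff j (hat V a) k * cis (phase k x))) (at 0)"
    using series_directional_derivative[OF V(3), of x j] wiener_series[OF w] by (simp add: hat_def)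
  show ?thesis
    using tendsto_unique[OF _ 1 2] by (simp add: D_def partial_deriv_def)
qed

text \<open>
  The functions for which the equation can be read on the Fourier side, together with a bound in the
  weighted Wiener algebra. The estimates below depend on the solution only through this bound.
\<close>

definition good :: "(real^'d \<Rightarrow> real^'n) \<Rightarrow> real \<Rightarrow> bool" where
  "good V R \<longleftrightarrow> wiener_vec V \<and> (\<forall>x. V differentiable (at x)) \<and> (\<forall>a. l1_le (wt 1 (hat V a)) R)"

lemma goodD:
  assumes "good V R"
  shows "wiener_vec V" "wiener (\<lambda>x. V x $ a)" "V differentiable (at x)" "l1_le (wt 1 (hat V a)) R" "0 \<le> R"
  using assms l1_le_nonneg unfolding good_def wiener_vec_def by blast+

lemma wiener_partial_deriv:
  fixes V :: "real^'d \<Rightarrow> real^'n"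
  assumes V: "good V R"
  shows "wiener (\<lambda>x. partial_deriv j V x $ a)" and "fco (\<lambda>x. partial_deriv j V x $ a) = deriv_coeff j (hat V a)"
  using wiener_of_series[OF l1_le_summable[OF deriv_coeff_l1[OF goodD(4)[OF V, of a], of j]] partial_deriv_series[OF goodD(1,3,4)[OF V]]]
  by auto

section \<open>The system on the Fourier side\<close>

text \<open>
  Each entry of the matrices is a polynomial in the solution, so every term is a product in the
  Wiener algebra.
\<close>

lemma quasilinear_coeff:
  fixes V :: "real^'d \<Rightarrow> real^'n" and B :: "'d \<Rightarrow> real^'n \<Rightarrow> real^'n^'n"
  assumes V: "good V R" and B: "\<And>j a b. real_polynomial_function (\<lambda>u. B j u $ a $ b)"
  shows "wiener (\<lambda>x. quasilinear B V x $ a)"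
    and "fco (\<lambda>x. quasilinear B V x $ a)
       = (\<lambda>k. \<Sum>j\<in>UNIV. \<Sum>b\<in>UNIV. conv (fco (\<lambda>x. B j (V x) $ a $ b)) (deriv_coeff j (hat V b)) k)"
proof -
  have eq: "(\<lambda>x. quasilinear B V x $ a) = (\<lambda>x. \<Sum>j\<in>UNIV. \<Sum>b\<in>UNIV. B j (V x) $ a $ b * partial_deriv j V x $ b)"
    by (simp add: quasilinear_def matrix_vector_mult_def)
  note w = polynomial_wiener[OF B goodD(1)[OF V]] and d = wiener_partial_deriv[OF V]
  note wd = wiener_mult[OF w d(1)]
  have wb: "wiener (\<lambda>x. \<Sum>b\<in>UNIV. B j (V x) $ a $ b * partial_deriv j V x $ b)" for j
    by (rule wiener_sum(1)) (simp_all add: wd)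
  show "wiener (\<lambda>x. quasilinear B V x $ a)"
    unfolding eq by (rule wiener_sum(1)) (simp_all add: wb)
  have fb: "fco (\<lambda>x. \<Sum>b\<in>UNIV. B j (V x) $ a $ b * partial_deriv j V x $ b)
     = (\<lambda>k. \<Sum>b\<in>UNIV. conv (fco (\<lambda>x. B j (V x) $ a $ b)) (deriv_coeff j (hat V b)) k)" for j
    by (subst wiener_sum(2)) (simp_all add: wd d(2))
  show "fco (\<lambda>x. quasilinear B V x $ a)
       = (\<lambda>k. \<Sum>j\<in>UNIV. \<Sum>b\<in>UNIV. conv (fco (\<lambda>x. B j (V x) $ a $ b)) (deriv_coeff j (hat V b)) k)"
    unfolding eq by (subst wiener_sum(2)) (simp_all add: wb fb)
qed

definition perturbation_coeff ::
    "('d \<Rightarrow> real^'n \<Rightarrow> real^'n^'n) \<Rightarrow> (real^'d \<Rightarrow> real^'n) \<Rightarrow> 'd \<Rightarrow> 'n \<Rightarrow> 'n \<Rightarrow> int^'d \<Rightarrow> complex" where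
  "perturbation_coeff A V j a b = fco (\<lambda>x. A j (V x) $ a $ b - A j 0 $ a $ b)"

definition lin_coeff :: "('d::finite \<Rightarrow> real^'n \<Rightarrow> real^'n^'n) \<Rightarrow> (real^'d \<Rightarrow> real^'n) \<Rightarrow> 'n::finite \<Rightarrow> int^'d \<Rightarrow> complex" where
  "lin_coeff A V a k = (\<Sum>j\<in>UNIV. \<Sum>b\<in>UNIV. of_real (A j 0 $ a $ b) * deriv_coeff j (hat V b) k)"

definition nonlin_coeff :: "('d::finite \<Rightarrow> real^'n \<Rightarrow> real^'n^'n) \<Rightarrow> (real^'d \<Rightarrow> real^'n) \<Rightarrow> 'n::finite \<Rightarrow> int^'d \<Rightarrow> complex" where
  "nonlin_coeff A V a k = (\<Sum>j\<in>UNIV. \<Sum>b\<in>UNIV. conv (perturbation_coeff A V j a b) (deriv_coeff j (hat V b)) k)"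

lemma conv_single_left: "conv (\<lambda>k. if k = 0 then c else 0) d k = c * d k"
proof -
  have "conv (\<lambda>k. if k = 0 then c else 0) d k = (\<Sum>\<^sub>\<infinity>m\<in>{0}. c * d (k - m))"
    unfolding conv_def by (rule infsum_cong_neutral) auto
  then show ?thesis by simp
qed

lemma quasilinear_lin_coeff:
  fixes V :: "real^'d \<Rightarrow> real^'n"
  assumes V: "good V R"
  shows "wiener (\<lambda>x. quasilinear (\<lambda>j u. A j 0) V x $ a)"
    and "fco (\<lambda>x. quasilinear (\<lambda>j u. A j 0) V x $ a) = lin_coeff A V a"
  using quasilinear_coeff[OF V, of "\<lambda>j u. A j 0" a]
  by (auto simp: real_polynomial_function.intros(2) fco_const conv_single_left lin_coeff_def fun_eq_iff)

lemma quasilinear_nonlin_coeff: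
  fixes V :: "real^'d \<Rightarrow> real^'n"
  assumes V: "good V R" and A: "\<And>j a b. real_polynomial_function (\<lambda>u. A j u $ a $ b)"
  shows "wiener (\<lambda>x. quasilinear (\<lambda>j u. A j u - A j 0) V x $ a)"
    and "fco (\<lambda>x. quasilinear (\<lambda>j u. A j u - A j 0) V x $ a) = nonlin_coeff A V a"
proof -
  have B: "real_polynomial_function (\<lambda>u. (A j u - A j 0) $ a $ b)" for j a b
    using real_polynomial_function_diff[OF A[of j a b] real_polynomial_function.intros(2)[of "A j 0 $ a $ b"]] by simp
  note q = quasilinear_coeff[where B = "\<lambda>j u. A j u - A j 0", OF V B, where a = a]
  show "wiener (\<lambda>x. quasilinear (\<lambda>j u. A j u - A j 0) V x $ a)" by (rule q(1))
  show "fco (\<lambda>x. quasilinear (\<lambda>j u. A j u - A j 0) V x $ a) = nonlin_coeff A V a"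
    using q(2) by (simp add: nonlin_coeff_def perturbation_coeff_def fun_eq_iff)
qed

lemma quasilinear_split:
  "quasilinear A V x = quasilinear (\<lambda>j u. A j 0) V x + quasilinear (\<lambda>j u. A j u - A j 0) V x"
  by (simp add: quasilinear_def sum.distrib[symmetric] matrix_vector_mult_add_rdistrib[symmetric])

lemma quasilinear_full_coeff:
  fixes V :: "real^'d \<Rightarrow> real^'n"
  assumes V: "good V R" and A: "\<And>j a b. real_polynomial_function (\<lambda>u. A j u $ a $ b)"
  shows "wiener (\<lambda>x. quasilinear A V x $ a)"
    and "fco (\<lambda>x. quasilinear A V x $ a) = (\<lambda>k. lin_coeff A V a k + nonlin_coeff A V a k)"
proof -
  note l = quasilinear_lin_coeff[OF V, of A a] and n = quasilinear_nonlin_coeff[OF V A, where a = a]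
  have eq: "(\<lambda>x. quasilinear A V x $ a)
     = (\<lambda>x. quasilinear (\<lambda>j u. A j 0) V x $ a + quasilinear (\<lambda>j u. A j u - A j 0) V x $ a)"
    by (subst quasilinear_split) simp
  show "wiener (\<lambda>x. quasilinear A V x $ a)" unfolding eq by (rule wiener_add[OF l(1) n(1)])
  show "fco (\<lambda>x. quasilinear A V x $ a) = (\<lambda>k. lin_coeff A V a k + nonlin_coeff A V a k)"
    unfolding eq fco_add[OF l(1)[THEN wiener_continuous] n(1)[THEN wiener_continuous]] l(2) n(2) ..
qed

text \<open>
  An even symbol keeps the Hermitian symmetry of the coefficients, so the sum defining the filter is
  already real.
\<close>

lemma fourier_multiplier_coeff:
  fixes G :: "real^'d \<Rightarrow> real^'n"
  assumes fin: "finite {k. m k \<noteq> 0}" and even: "\<And>k. m (- k) = m k"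
  shows "wiener (\<lambda>x. fourier_multiplier m G x $ a)"
    and "fco (\<lambda>x. fourier_multiplier m G x $ a) = (\<lambda>k. of_real (m k) * hat G a k)"
proof -
  define c where "c k = of_real (m k) * hat G a k" for k
  have summ: "(\<lambda>k. norm (c k)) summable_on UNIV"
    by (rule finite_nonzero_values_imp_summable_on) (rule finite_subset[OF _ fin], auto simp: c_def)
  have c_minus: "c (- k) = cnj (c k)" for k
    by (simp add: c_def even hat_def fco_minus)
  have "complex_of_real (fourier_multiplier m G x $ a) = (\<Sum>\<^sub>\<infinity>k. c k * cis (phase k x))" for x
  proof -
    let ?S = "\<Sum>\<^sub>\<infinity>k. c k * cis (phase k x)"
    have "cnj ?S = (\<Sum>\<^sub>\<infinity>k. c (- k) * cis (phase (- k) x))"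
      unfolding infsum_cnj[symmetric] by (simp add: c_minus phase_minus cis_cnj)
    also have "\<dots> = ?S"
      using infsum_reindex_bij_betw[of uminus UNIV UNIV "\<lambda>k. c k * cis (phase k x)"] bij_uminus by blast
    finally have "Im ?S = 0" by (simp add: complex_eq_iff)
    then have "?S = of_real (Re ?S)" by (simp add: complex_eq_iff)
    moreover have "fourier_multiplier m G x $ a = Re ?S"
      by (simp add: fourier_multiplier_def c_def hat_eq)
    ultimately show ?thesis by simp
  qed
  from wiener_of_series[OF summ this]
  show "wiener (\<lambda>x. fourier_multiplier m G x $ a)" "fco (\<lambda>x. fourier_multiplier m G x $ a) = (\<lambda>k. of_real (m k) * hat G a k)"
    by (auto simp: c_def)
qed

definition box_modes :: "nat \<Rightarrow> (int^'d) set" where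
  "box_modes N = {k. \<forall>j. \<bar>k $ j\<bar> \<le> int N}"

lemma finite_box_modes: "finite (box_modes N :: (int^'d) set)"
proof (rule finite_subset)
  show "box_modes N \<subseteq> vec_lambda ` PiE (UNIV :: 'd set) (\<lambda>_. {- int N..int N})"
  proof
    fix k :: "int^'d" assume k: "k \<in> box_modes N"
    show "k \<in> vec_lambda ` PiE (UNIV :: 'd set) (\<lambda>_. {- int N..int N})"
      by (rule image_eqI[of _ _ "vec_nth k"]) (use k in \<open>auto simp: box_modes_def vec_nth_inverse abs_le_iff minus_le_iff\<close>)
  qed
qed (intro finite_imageI finite_PiE; simp)

definition smooth_symbol :: "(real^'d \<Rightarrow> real) \<Rightarrow> nat \<Rightarrow> int^'d \<Rightarrow> real" where
  "smooth_symbol chi N k = chi (\<chi> j. of_int (k $ j) / real N)"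

lemma smooth_symbol_props:
  assumes "cutoff_profile chi" "N \<ge> 1"
  shows "0 \<le> smooth_symbol chi N k" "smooth_symbol chi N k \<le> 1"
    and "smooth_symbol chi N (- k) = smooth_symbol chi N k"
    and "(\<And>j. 2 * \<bar>of_int (k $ j)\<bar> \<le> real N) \<Longrightarrow> smooth_symbol chi N k = 1"
    and "real N \<le> \<bar>of_int (k $ j)\<bar> \<Longrightarrow> smooth_symbol chi N k = 0"
    and "k \<notin> box_modes N \<Longrightarrow> smooth_symbol chi N k = 0"
proof -
  have c: "\<And>k. 0 \<le> chi k \<and> chi k \<le> 1" "\<And>k. chi (- k) = chi k"
    "\<And>k. (\<forall>j. \<bar>k $ j\<bar> \<le> 1 / 2) \<Longrightarrow> chi k = 1" "\<And>k. (\<exists>j. \<bar>k $ j\<bar> \<ge> 1) \<Longrightarrow> chi k = 0"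
    using assms(1) unfolding cutoff_profile_def by blast+
  show "0 \<le> smooth_symbol chi N k" "smooth_symbol chi N k \<le> 1" using c(1) by (auto simp: smooth_symbol_def)
  have "(\<chi> j. of_int ((- k) $ j) / real N) = - (\<chi> j. of_int (k $ j) / real N)" by (simp add: vec_eq_iff)
  then show "smooth_symbol chi N (- k) = smooth_symbol chi N k"
    unfolding smooth_symbol_def by (simp only: c(2))
  show "smooth_symbol chi N k = 1" if "\<And>j. 2 * \<bar>of_int (k $ j)\<bar> \<le> real N"
    unfolding smooth_symbol_def using that assms(2) by (intro c(3)) (auto simp: abs_divide divide_simps mult.commute)
  show z: "smooth_symbol chi N k = 0" if "real N \<le> \<bar>of_int (k $ j)\<bar>" for j
    unfolding smooth_symbol_def using that assms(2) by (intro c(4)) (auto simp: abs_divide divide_simps intro!: exI[of _ j])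
  show "smooth_symbol chi N k = 0" if "k \<notin> box_modes N"
  proof -
    obtain j where "\<not> \<bar>k $ j\<bar> \<le> int N" using \<open>k \<notin> box_modes N\<close> by (auto simp: box_modes_def)
    then have "real N \<le> \<bar>of_int (k $ j)\<bar>" by linarith
    then show ?thesis by (rule z)
  qed
qed

lemma smooth_filter_coeff:
  fixes G :: "real^'d \<Rightarrow> real^'n"
  assumes "cutoff_profile chi" "N \<ge> 1"
  shows "wiener (\<lambda>x. smooth_filter chi N G x $ a)"
    and "fco (\<lambda>x. smooth_filter chi N G x $ a) = (\<lambda>k. of_real (smooth_symbol chi N k) * hat G a k)"
proof -
  have eq: "smooth_filter chi N G = fourier_multiplier (smooth_symbol chi N) G"
    by (simp add: smooth_filter_def smooth_symbol_def[abs_def])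
  have fin: "finite {k. smooth_symbol chi N k \<noteq> 0}"
    by (rule finite_subset[OF _ finite_box_modes[of N]]) (use smooth_symbol_props(6)[OF assms] in blast)
  show "wiener (\<lambda>x. smooth_filter chi N G x $ a)"
    "fco (\<lambda>x. smooth_filter chi N G x $ a) = (\<lambda>k. of_real (smooth_symbol chi N k) * hat G a k)"
    unfolding eq by (rule fourier_multiplier_coeff[OF fin smooth_symbol_props(3)[OF assms]])+
qed

lemma sharp_filter_coeff:
  fixes G :: "real^'d \<Rightarrow> real^'n"
  shows "wiener (\<lambda>x. sharp_filter N G x $ a)"
    and "fco (\<lambda>x. sharp_filter N G x $ a) = (\<lambda>k. indicator (box_modes N) k * hat G a k)"
proof -
  have eq: "sharp_filter N G = fourier_multiplier (indicator (box_modes N)) G"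
    by (simp add: sharp_filter_def box_modes_def)
  have fin: "finite {k. indicator (box_modes N) k \<noteq> (0::real)}"
    by (rule finite_subset[OF _ finite_box_modes[of N]]) (auto simp: indicator_def)
  have ev: "indicator (box_modes N) (- k) = (indicator (box_modes N) k :: real)" for k :: "int^'d"
    by (simp add: indicator_def box_modes_def)
  show "wiener (\<lambda>x. sharp_filter N G x $ a)"
    "fco (\<lambda>x. sharp_filter N G x $ a) = (\<lambda>k. indicator (box_modes N) k * hat G a k)"
    unfolding eq fourier_multiplier_coeff(2)[OF fin ev]
    by (rule fourier_multiplier_coeff(1)[OF fin ev]) (simp add: fun_eq_iff indicator_def)
qed

definition linear_symbol :: "filtering \<Rightarrow> (real^'d \<Rightarrow> real) \<Rightarrow> nat \<Rightarrow> int^'d \<Rightarrow> real" where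
  "linear_symbol \<phi> chi N k = (case \<phi> of Filter_All \<Rightarrow> smooth_symbol chi N k | Filter_Nonlinear \<Rightarrow> 1)"

lemma filtered_coeff:
  fixes V :: "real^'d \<Rightarrow> real^'n"
  assumes chi: "cutoff_profile chi" "N \<ge> 1"
    and V: "good V R" and A: "\<And>j a b. real_polynomial_function (\<lambda>u. A j u $ a $ b)"
  shows "wiener (\<lambda>x. filtered_quasilinear \<phi> chi A N V x $ a)"
    and "fco (\<lambda>x. filtered_quasilinear \<phi> chi A N V x $ a)
       = (\<lambda>k. of_real (linear_symbol \<phi> chi N k) * lin_coeff A V a k + of_real (smooth_symbol chi N k) * nonlin_coeff A V a k)"
proof -
  have "wiener (\<lambda>x. filtered_quasilinear \<phi> chi A N V x $ a) \<and> fco (\<lambda>x. filtered_quasilinear \<phi> chi A N V x $ a)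
       = (\<lambda>k. of_real (linear_symbol \<phi> chi N k) * lin_coeff A V a k + of_real (smooth_symbol chi N k) * nonlin_coeff A V a k)"
  proof (cases \<phi>)
    case Filter_All
    then show ?thesis
      using smooth_filter_coeff[OF chi, of "quasilinear A V" a] quasilinear_full_coeff(2)[OF V A, where a = a]
      by (simp add: linear_symbol_def hat_def distrib_left)
  next
    case Filter_Nonlinear
    let ?N = "smooth_filter chi N (quasilinear (\<lambda>j u. A j u - A j 0) V)"
    note l = quasilinear_lin_coeff[OF V, of A a] and n = smooth_filter_coeff[OF chi, of "quasilinear (\<lambda>j u. A j u - A j 0) V" a]
    have eq: "(\<lambda>x. filtered_quasilinear \<phi> chi A N V x $ a) = (\<lambda>x. quasilinear (\<lambda>j u. A j 0) V x $ a + ?N x $ a)"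
      using Filter_Nonlinear by simp
    show ?thesis
      unfolding eq fco_add[OF l(1)[THEN wiener_continuous] n(1)[THEN wiener_continuous]] l(2) n(2)
      using wiener_add[OF l(1) n(1)] quasilinear_nonlin_coeff(2)[OF V A, where a = a] Filter_Nonlinear
      by (simp add: linear_symbol_def hat_def)
  qed
  then show "wiener (\<lambda>x. filtered_quasilinear \<phi> chi A N V x $ a)" "fco (\<lambda>x. filtered_quasilinear \<phi> chi A N V x $ a)
       = (\<lambda>k. of_real (linear_symbol \<phi> chi N k) * lin_coeff A V a k + of_real (smooth_symbol chi N k) * nonlin_coeff A V a k)"
    by auto
qed

section \<open>Evolution of the Fourier coefficients\<close>

lemma has_vector_derivativeI_quotient:
  fixes f :: "real \<Rightarrow> 'b::real_normed_vector"
  assumes "((\<lambda>h. (f (t + h) - f t) /\<^sub>R h) \<longlongrightarrow> D) (at 0)"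
  shows "(f has_vector_derivative D) (at t)"
  unfolding has_vector_derivative_def has_derivative_at
proof
  show "bounded_linear (\<lambda>h. h *\<^sub>R D)" by (rule bounded_linear_scaleR_left)
  have "((\<lambda>h. norm ((f (t + h) - f t) /\<^sub>R h - D)) \<longlongrightarrow> 0) (at 0)"
    using tendsto_norm[OF tendsto_diff[OF assms tendsto_const[of D]]] by simp
  moreover have "\<forall>\<^sub>F h in at (0::real). norm ((f (t + h) - f t) /\<^sub>R h - D) = norm (f (t + h) - f t - h *\<^sub>R D) / norm h"
  proof (rule eventually_at_filter[THEN iffD2, OF always_eventually], intro allI impI)
    fix h :: real assume "h \<noteq> 0"
    then have "(f (t + h) - f t) /\<^sub>R h - D = (f (t + h) - f t - h *\<^sub>R D) /\<^sub>R h"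
      by (simp add: scaleR_diff_right)
    then show "norm ((f (t + h) - f t) /\<^sub>R h - D) = norm (f (t + h) - f t - h *\<^sub>R D) / norm h"
      by (simp add: divide_inverse mult.commute)
  qed
  ultimately show "((\<lambda>h. norm (f (t + h) - f t - h *\<^sub>R D) / norm h) \<longlongrightarrow> 0) (at 0)"
    by (rule Lim_transform_eventually)
qed

lemma mean_dominated_convergence:
  fixes h :: "nat \<Rightarrow> real^'d \<Rightarrow> complex"
  assumes "\<And>i. continuous_on UNIV (h i)" "continuous_on UNIV g"
    and lim: "\<And>x. (\<lambda>i. h i x) \<longlonglongrightarrow> g x" and B: "\<And>i x. norm (h i x) \<le> B"
  shows "(\<lambda>i. mean (h i)) \<longlonglongrightarrow> mean g"
proof -
  have "(\<lambda>i. LINT x|lebesgue. indicator torus_cell x *\<^sub>R h i x) \<longlonglongrightarrow> (LINT x|lebesgue. indicator torus_cell x *\<^sub>R g x)"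
  proof (rule integral_dominated_convergence[where w = "\<lambda>x. indicator torus_cell x *\<^sub>R B"])
    show "integrable lebesgue (\<lambda>x::real^'d. indicator torus_cell x *\<^sub>R B)"
      by (simp add: torus_cell_measure)
    show "(\<lambda>x. indicator torus_cell x *\<^sub>R g x) \<in> borel_measurable lebesgue"
      "(\<lambda>x. indicator torus_cell x *\<^sub>R h i x) \<in> borel_measurable lebesgue" for i
      using cell_integrable_continuous[OF assms(1)] cell_integrable_continuous[OF assms(2)]
      by (auto simp: set_integrable_def)
    show "AE x in lebesgue. (\<lambda>i. indicator torus_cell x *\<^sub>R h i x) \<longlonglongrightarrow> indicator torus_cell x *\<^sub>R g x"
      by (intro always_eventually allI tendsto_scaleR tendsto_const lim)
    show "AE x in lebesgue. norm (indicator torus_cell x *\<^sub>R h i x) \<le> indicator torus_cell x *\<^sub>R B" for i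
      by (intro always_eventually allI) (auto simp: indicator_def B)
  qed
  then show ?thesis
    unfolding mean_def set_lebesgue_integral_def by (intro tendsto_divide tendsto_const) auto
qed

lemma fourier_coeff_diff:
  assumes "\<And>a. continuous_on UNIV (\<lambda>x. V x $ a)" "\<And>a. continuous_on UNIV (\<lambda>x. W x $ a)"
  shows "fourier_coeff (\<lambda>x. V x - W x) = (\<lambda>k. fourier_coeff V k - fourier_coeff W k)"
  by (simp add: fun_eq_iff vec_eq_iff fourier_coeff_nth fco_diff assms)

lemma differentiable_component_continuous:
  fixes V :: "real^'d \<Rightarrow> real^'n"
  assumes "\<And>x. V differentiable (at x)"
  shows "continuous_on UNIV (\<lambda>x. V x $ a)"
  by (intro continuous_intros continuous_at_imp_continuous_on ballI differentiable_imp_continuous_within assms)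

text \<open>
  A common form for the three problems: the symbol \<open>ea\<close> acts on the
  constant-coefficient part and \<open>ch\<close> on the part in \<open>A\<^sub>j(U) -
  A\<^sub>j(0)\<close>. Both are \<open>1\<close> for the original problem.
\<close>

definition multiplier_system ::
    "('d::finite \<Rightarrow> real^'n::finite \<Rightarrow> real^'n^'n) \<Rightarrow> (int^'d \<Rightarrow> real) \<Rightarrow> (int^'d \<Rightarrow> real) \<Rightarrow>
     ((real^'d \<Rightarrow> real^'n) \<Rightarrow> real^'d \<Rightarrow> real^'n) \<Rightarrow> bool" where
  "multiplier_system A ea ch F \<longleftrightarrow> (\<forall>k. 0 \<le> ea k \<and> ea k \<le> 1 \<and> 0 \<le> ch k \<and> ch k \<le> 1) \<and>
     (\<forall>V R a. good V R \<longrightarrow> wiener (\<lambda>x. F V x $ a) \<and>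
        fco (\<lambda>x. F V x $ a) = (\<lambda>k. of_real (ea k) * lin_coeff A V a k + of_real (ch k) * nonlin_coeff A V a k))"

lemma deriv_coeff_diff: "deriv_coeff j (\<lambda>k. c k - d k) k = deriv_coeff j c k - deriv_coeff j d k"
  by (simp add: deriv_coeff_def algebra_simps)

text \<open>The constant-coefficient part is skew-adjoint.\<close>

lemma skew_linear_part:
  fixes M :: "'n::finite \<Rightarrow> 'n \<Rightarrow> real" and w :: "'n \<Rightarrow> int^'d \<Rightarrow> complex"
  assumes "\<And>a b. M a b = M b a"
  shows "Re (\<Sum>a\<in>UNIV. cnj (w a k) * (\<Sum>b\<in>UNIV. of_real (M a b) * deriv_coeff j (w b) k)) = 0"
proof -
  define Q where "Q = (\<Sum>a\<in>UNIV. \<Sum>b\<in>UNIV. of_real (M a b) * (cnj (w a k) * w b k))"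
  have "cnj Q = (\<Sum>a\<in>UNIV. \<Sum>b\<in>UNIV. of_real (M b a) * (cnj (w b k) * w a k))"
    unfolding Q_def by (simp add: assms mult.commute)
  also have "\<dots> = Q" unfolding Q_def by (rule sum.swap)
  finally have "Im Q = 0" by (simp add: complex_eq_iff)
  moreover have "(\<Sum>a\<in>UNIV. cnj (w a k) * (\<Sum>b\<in>UNIV. of_real (M a b) * deriv_coeff j (w b) k)) = \<i> * of_int (k $ j) * Q"
    by (simp add: Q_def deriv_coeff_def sum_distrib_left mult_ac)
  moreover have "Re (\<i> * of_int m * z) = - (of_int m * Im z)" for m z by simp
  ultimately show ?thesis by simp
qed

lemma lin_coeff_skew:
  fixes A :: "'d::finite \<Rightarrow> real^'n::finite \<Rightarrow> real^'n^'n" and w :: "'n \<Rightarrow> int^'d \<Rightarrow> complex"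
  assumes "\<And>j a b. A j 0 $ a $ b = A j 0 $ b $ a"
  shows "Re (\<Sum>a\<in>UNIV. cnj (w a k) * (\<Sum>j\<in>UNIV. \<Sum>b\<in>UNIV. of_real (A j 0 $ a $ b) * deriv_coeff j (w b) k)) = 0"
proof -
  have "(\<Sum>a\<in>UNIV. cnj (w a k) * (\<Sum>j\<in>UNIV. \<Sum>b\<in>UNIV. of_real (A j 0 $ a $ b) * deriv_coeff j (w b) k))
     = (\<Sum>j\<in>UNIV. \<Sum>a\<in>UNIV. cnj (w a k) * (\<Sum>b\<in>UNIV. of_real (A j 0 $ a $ b) * deriv_coeff j (w b) k))"
    unfolding sum_distrib_left by (rule sum.swap)
  then have "Re (\<Sum>a\<in>UNIV. cnj (w a k) * (\<Sum>j\<in>UNIV. \<Sum>b\<in>UNIV. of_real (A j 0 $ a $ b) * deriv_coeff j (w b) k))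
     = (\<Sum>j\<in>UNIV. Re (\<Sum>a\<in>UNIV. cnj (w a k) * (\<Sum>b\<in>UNIV. of_real (A j 0 $ a $ b) * deriv_coeff j (w b) k)))"
    by (simp only: Re_sum[of _ "UNIV :: 'd set"])
  also have "\<dots> = 0" by (rule sum.neutral, intro ballI, rule skew_linear_part, rule assms)
  finally show ?thesis .
qed

text \<open>
  A finite weighted sum of squared coefficients is differentiable in time term by term; this is why
  all energies below are truncated.
\<close>

lemma energy_derivative:
  fixes w :: "real \<Rightarrow> 'n::finite \<Rightarrow> 'k \<Rightarrow> complex"
  assumes "\<And>a k. k \<in> S \<Longrightarrow> ((\<lambda>\<tau>. w \<tau> a k) has_vector_derivative w' a k) (at t)"
  shows "((\<lambda>\<tau>. \<Sum>k\<in>S. \<sigma> k * (\<Sum>a\<in>UNIV. (cmod (w \<tau> a k))\<^sup>2)) has_real_derivative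
     (\<Sum>k\<in>S. \<sigma> k * (2 * Re (\<Sum>a\<in>UNIV. cnj (w t a k) * w' a k)))) (at t)"
proof -
  have sq_sum: "((\<lambda>\<tau>. (f \<tau>)\<^sup>2 + (g \<tau>)\<^sup>2) has_real_derivative 2 * f t * f' + 2 * g t * g') (at t)"
    if "(f has_real_derivative f') (at t)" "(g has_real_derivative g') (at t)" for f g :: "real \<Rightarrow> real" and f' g'
    using that by (auto intro!: derivative_eq_intros)
  have "((\<lambda>\<tau>. (cmod (w \<tau> a k))\<^sup>2) has_real_derivative 2 * Re (cnj (w t a k) * w' a k)) (at t)" if "k \<in> S" for a k
  proof -
    have "((\<lambda>\<tau>. Re (w \<tau> a k)) has_real_derivative Re (w' a k)) (at t)" "((\<lambda>\<tau>. Im (w \<tau> a k)) has_real_derivative Im (w' a k)) (at t)"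
      using bounded_linear.has_vector_derivative[OF bounded_linear_Re assms[OF that]]
        bounded_linear.has_vector_derivative[OF bounded_linear_Im assms[OF that]]
      by (auto simp: has_real_derivative_iff_has_vector_derivative)
    then have "((\<lambda>\<tau>. (Re (w \<tau> a k))\<^sup>2 + (Im (w \<tau> a k))\<^sup>2) has_real_derivative
       2 * Re (w t a k) * Re (w' a k) + 2 * Im (w t a k) * Im (w' a k)) (at t)"
      by (rule sq_sum)
    then show ?thesis by (simp add: cmod_power2 algebra_simps)
  qed
  then have "((\<lambda>\<tau>. \<Sum>k\<in>S. \<sigma> k * (\<Sum>a\<in>UNIV. (cmod (w \<tau> a k))\<^sup>2)) has_real_derivative
     (\<Sum>k\<in>S. \<sigma> k * (\<Sum>a\<in>UNIV. 2 * Re (cnj (w t a k) * w' a k)))) (at t)"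
    by (intro DERIV_sum DERIV_cmult) auto
  then show ?thesis by (simp only: Re_sum sum_distrib_left)
qed

text \<open>
  \<open>Cw\<close> is the constant of the embedding of \<open>H\<^sup>s\<close> into the weighted
  Wiener algebra.
\<close>

locale symmetric_system =
  fixes A :: "'d::finite \<Rightarrow> real^'n::finite \<Rightarrow> real^'n^'n" and s Cw :: real
  assumes A_sym: "A j u $ a $ b = A j u $ b $ a"
    and A_poly: "real_polynomial_function (\<lambda>u. A j u $ a $ b)"
    and s_gt: "s > real CARD('d) / 2 + 1"
    and Cw_pos: "Cw > 0"
    and embed: "l2_le (wt s c) B \<Longrightarrow> l1_le (wt 1 (c :: int^'d \<Rightarrow> complex)) (Cw * B)"
begin

lemma s_bounds: "1 \<le> 2 * s" "0 \<le> s" "1 < s"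
proof -
  have "0 < real CARD('d)" by simp
  then show "1 \<le> 2 * s" "0 \<le> s" "1 < s" using s_gt by linarith+
qed

lemma tame_constant: "0 \<le> R \<Longrightarrow> \<exists>C. \<forall>j a b. tame s (\<lambda>u. A j u $ a $ b) R C TYPE('d)"
proof -
  assume R: "0 \<le> R"
  define C0 where "C0 j a b = (SOME C. tame s (\<lambda>u. A j u $ a $ b) R C TYPE('d))" for j a b
  have C0: "tame s (\<lambda>u. A j u $ a $ b) R (C0 j a b) TYPE('d)" for j a b
    unfolding C0_def using polynomial_tame[OF A_poly R s_bounds(2)] by (rule someI_ex)
  have "C0 j a b \<le> (\<Sum>j\<in>UNIV. \<Sum>a\<in>UNIV. \<Sum>b\<in>UNIV. C0 j a b)" for j a b
  proof -
    have p: "0 \<le> C0 j a b" for j a b using tameD(1)[OF C0] .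
    have "C0 j a b \<le> (\<Sum>b\<in>UNIV. C0 j a b)" by (rule member_le_sum) (auto simp: p)
    also have "\<dots> \<le> (\<Sum>a\<in>UNIV. \<Sum>b\<in>UNIV. C0 j a b)"
      by (rule member_le_sum[of a UNIV "\<lambda>a. \<Sum>b\<in>UNIV. C0 j a b"]) (auto intro!: sum_nonneg p)
    also have "\<dots> \<le> (\<Sum>j\<in>UNIV. \<Sum>a\<in>UNIV. \<Sum>b\<in>UNIV. C0 j a b)"
      by (rule member_le_sum[of j UNIV "\<lambda>j. \<Sum>a\<in>UNIV. \<Sum>b\<in>UNIV. C0 j a b"]) (auto intro!: sum_nonneg p)
    finally show ?thesis .
  qed
  then show ?thesis using tame_mono[OF C0] by blast
qed

text \<open>
  A single tameness constant for all the matrix entries on the ball of radius \<open>R\<close>.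
\<close>

definition Ct :: "real \<Rightarrow> real" where
  "Ct R = (SOME C. \<forall>j a b. tame s (\<lambda>u. A j u $ a $ b) R C TYPE('d))"

lemma Ct: "0 \<le> R \<Longrightarrow> tame s (\<lambda>u. A j u $ a $ b) R (Ct R) TYPE('d)"
  unfolding Ct_def using someI_ex[OF tame_constant] by blast

lemma Ct_nonneg: "0 \<le> R \<Longrightarrow> 0 \<le> Ct R"
  using tameD(1)[OF Ct] by blast

lemma perturbation_l1:
  assumes "good V \<rho>" "\<rho> \<le> R"
  shows "l1_le (wt 1 (perturbation_coeff A V j a b)) (Ct R * \<rho>)"
  unfolding perturbation_coeff_def
  by (rule tameD(2)[OF Ct goodD(1)[OF assms(1)] assms(2) goodD(4)[OF assms(1)]])
     (use goodD(5)[OF assms(1)] assms(2) in linarith)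

lemma perturbation_l2:
  assumes "good V R" "\<And>a. l2_le (wt s (hat V a)) D"
  shows "l2_le (wt s (perturbation_coeff A V j a b)) (Ct R * D)"
  unfolding perturbation_coeff_def
  by (rule tameD(3)[OF Ct[OF goodD(5)[OF assms(1)]] goodD(1)[OF assms(1)] goodD(4)[OF assms(1)] assms(2)])

lemma perturbation_diff:
  assumes "good U R" "good V R" "\<And>a. l2_le (\<lambda>k. hat U a k - hat V a k) D"
  shows "l2_le (\<lambda>k. perturbation_coeff A U j a b k - perturbation_coeff A V j a b k) (Ct R * D)"
proof -
  note w = polynomial_wiener[OF A_poly[of j a b] goodD(1)[OF assms(1)], THEN wiener_continuous]
    polynomial_wiener[OF A_poly[of j a b] goodD(1)[OF assms(2)], THEN wiener_continuous]
  have "(\<lambda>k. perturbation_coeff A U j a b k - perturbation_coeff A V j a b k)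
     = (\<lambda>k. fco (\<lambda>x. A j (U x) $ a $ b) k - fco (\<lambda>x. A j (V x) $ a $ b) k)"
    by (simp add: perturbation_coeff_def fco_diff w)
  then show ?thesis
    using tameD(4)[OF Ct[OF goodD(5)[OF assms(1)]] goodD(1)[OF assms(1)] goodD(1)[OF assms(2)] goodD(4)[OF assms(1)] goodD(4)[OF assms(2)] assms(3)]
    by simp
qed

lemma perturbation_sym: "perturbation_coeff A V j a b = perturbation_coeff A V j b a"
  using A_sym[of j _ a b] by (simp add: perturbation_coeff_def)

lemma perturbation_herm: "perturbation_coeff A V j a b (- m) = cnj (perturbation_coeff A V j a b m)"
  unfolding perturbation_coeff_def by (rule fco_minus)

lemma good_mono: "good V \<rho> \<Longrightarrow> \<rho> \<le> R \<Longrightarrow> good V R"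
  unfolding good_def using l1_le_weaken by blast

lemma coeff_l1:
  assumes V: "good V R"
  shows "l1_le (lin_coeff A V a) ((\<Sum>j\<in>UNIV. \<Sum>b\<in>UNIV. \<bar>A j 0 $ a $ b\<bar>) * R)"
    and "l1_le (nonlin_coeff A V a) ((\<Sum>j\<in>(UNIV::'d set). \<Sum>b\<in>(UNIV::'n set). Ct R * R) * R)"
proof -
  have "l1_le (lin_coeff A V a) (\<Sum>j\<in>UNIV. \<Sum>b\<in>UNIV. norm (complex_of_real (A j 0 $ a $ b)) * R)"
    unfolding lin_coeff_def by (intro l1_le_sum l1_le_cmult deriv_coeff_l1 goodD(4)[OF V]) auto
  then show "l1_le (lin_coeff A V a) ((\<Sum>j\<in>UNIV. \<Sum>b\<in>UNIV. \<bar>A j 0 $ a $ b\<bar>) * R)"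
    by (simp add: sum_distrib_right)
  have "l1_le (nonlin_coeff A V a) (\<Sum>j\<in>(UNIV::'d set). \<Sum>b\<in>(UNIV::'n set). (Ct R * R) * R)"
    unfolding nonlin_coeff_def
    by (intro l1_le_sum conv_l1 deriv_coeff_l1 goodD(4)[OF V] l1_le_of_wt[OF _ perturbation_l1[OF V order_refl]]) auto
  then show "l1_le (nonlin_coeff A V a) ((\<Sum>j\<in>(UNIV::'d set). \<Sum>b\<in>(UNIV::'n set). Ct R * R) * R)"
    by (simp only: sum_distrib_right)
qed

text \<open>
  This uniform bound on the time derivative dominates the difference quotients when the equation is
  tested against a character.
\<close>

lemma system_bounded:
  assumes F: "multiplier_system A ea ch F"
  shows "\<exists>B. \<forall>V. good V R \<longrightarrow> (\<forall>a. l1_le (fco (\<lambda>x. F V x $ a)) B \<and> (\<forall>x. \<bar>F V x $ a\<bar> \<le> B))"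
proof -
  define B0 where "B0 a = (\<Sum>j\<in>UNIV. \<Sum>b\<in>UNIV. \<bar>A j 0 $ a $ b\<bar>) * R + (\<Sum>j\<in>(UNIV::'d set). \<Sum>b\<in>(UNIV::'n set). Ct R * R) * R" for a
  have l1: "l1_le (fco (\<lambda>x. F V x $ a)) (\<Sum>a\<in>UNIV. \<bar>B0 a\<bar>)" if V: "good V R" for V a
  proof -
    have ea: "\<And>k. 0 \<le> ea k" "\<And>k. ea k \<le> 1" "\<And>k. 0 \<le> ch k" "\<And>k. ch k \<le> 1"
      using F by (auto simp: multiplier_system_def)
    have eq: "fco (\<lambda>x. F V x $ a) = (\<lambda>k. of_real (ea k) * lin_coeff A V a k + of_real (ch k) * nonlin_coeff A V a k)"
      using F V unfolding multiplier_system_def by blast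
    have "l1_le (\<lambda>k. of_real (ea k) * lin_coeff A V a k) ((\<Sum>j\<in>UNIV. \<Sum>b\<in>UNIV. \<bar>A j 0 $ a $ b\<bar>) * R)"
      by (rule l1_le_mono[OF coeff_l1(1)[OF V, where a = a]]) (auto simp: norm_mult ea mult_left_le_one_le)
    moreover have "l1_le (\<lambda>k. of_real (ch k) * nonlin_coeff A V a k) ((\<Sum>j\<in>(UNIV::'d set). \<Sum>b\<in>(UNIV::'n set). Ct R * R) * R)"
      by (rule l1_le_mono[OF coeff_l1(2)[OF V, where a = a]]) (auto simp: norm_mult ea mult_left_le_one_le)
    ultimately have "l1_le (fco (\<lambda>x. F V x $ a)) (B0 a)"
      unfolding eq B0_def by (rule l1_le_add)
    moreover have "B0 a \<le> (\<Sum>a\<in>UNIV. \<bar>B0 a\<bar>)"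
      using member_le_sum[of a UNIV "\<lambda>a. \<bar>B0 a\<bar>"] by simp
    ultimately show ?thesis by (rule l1_le_weaken)
  qed
  moreover have "\<bar>F V x $ a\<bar> \<le> (\<Sum>a\<in>UNIV. \<bar>B0 a\<bar>)" if V: "good V R" for V a x
    using wiener_bound[OF _ l1[OF V]] F V unfolding multiplier_system_def by blast
  ultimately show ?thesis by blast
qed

lemma good_of_sobolev:
  fixes V :: "real^'d \<Rightarrow> real^'n"
  assumes "in_sobolev s V" "\<And>x. V differentiable (at x)" "sobolev_norm s V \<le> B"
  shows "good V (Cw * B)"
proof -
  have l2: "l2_le (wt s (hat V a)) B" for a
    by (rule l2_le_weaken[OF hat_l2_le[OF sobolev_l2_le[OF assms(1)]] assms(3)])
  note l1 = embed[OF l2]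
  have "wiener (\<lambda>x. V x $ a)" for a
    unfolding wiener_iff_l1_le
  proof (intro conjI)
    show "continuous_on UNIV (\<lambda>x. V x $ a)" by (rule differentiable_component_continuous[OF assms(2)])
    show "torus_periodic (\<lambda>x. V x $ a)"
      using assms(1) by (simp add: in_sobolev_def torus_L2_def torus_periodic_def)
    show "\<exists>B. l1_le (fco (\<lambda>x. V x $ a)) B"
      using l1_le_of_wt[OF _ l1, of a] unfolding hat_def by auto
  qed
  then show ?thesis using assms(2) l1 by (simp add: good_def wiener_vec_def)
qed

lemma solution_facts:
  fixes U :: "real \<Rightarrow> real^'d \<Rightarrow> real^'n"
  assumes "classical_solution s F U0 I U" "t \<in> I"
  shows "in_sobolev s (U t)" "U t differentiable (at x)" "good (U t) (Cw * sobolev_norm s (U t))"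
    "continuous_on UNIV (\<lambda>x. U t x $ a)"
proof -
  show 1: "in_sobolev s (U t)" and 2: "\<And>x. U t differentiable (at x)"
    using assms by (auto simp: classical_solution_def sobolev_continuous_on_def)
  show "good (U t) (Cw * sobolev_norm s (U t))" by (rule good_of_sobolev[OF 1 2 order_refl])
  show "continuous_on UNIV (\<lambda>x. U t x $ a)" by (rule differentiable_component_continuous[OF 2])
qed

lemma solution_diff_l2:
  fixes U U' :: "real \<Rightarrow> real^'d \<Rightarrow> real^'n"
  assumes cs: "classical_solution s F U0 I U" "t \<in> I" and cs': "classical_solution s F' U0' I' U'" "t' \<in> I'"
  shows "l2_le (wt s (fourier_coeff (\<lambda>x. U t x - U' t' x))) (sobolev_norm s (\<lambda>x. U t x - U' t' x))"
    and "sobolev_norm s (\<lambda>x. U t x - U' t' x) \<le> sobolev_norm s (U t) + sobolev_norm s (U' t')"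
    and "hat (\<lambda>x. U t x - U' t' x) a = (\<lambda>k. hat (U t) a k - hat (U' t') a k)"
proof -
  have eq: "fourier_coeff (\<lambda>x. U t x - U' t' x) = (\<lambda>k. fourier_coeff (U t) k + - fourier_coeff (U' t') k)"
    by (subst fourier_coeff_diff) (auto intro: solution_facts(4)[OF cs] solution_facts(4)[OF cs'])
  have "l2_le (wt s (\<lambda>k. - fourier_coeff (U' t') k)) (sobolev_norm s (U' t'))"
    using sobolev_l2_le[OF solution_facts(1)[OF cs']] by (simp add: wt_def[abs_def])
  then have "l2_le (wt s (fourier_coeff (\<lambda>x. U t x - U' t' x))) (sobolev_norm s (U t) + sobolev_norm s (U' t'))"
    unfolding eq by (intro wt_l2_add sobolev_l2_le[OF solution_facts(1)[OF cs]])
  from sobolev_norm_le(1,3)[OF this]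
  show "l2_le (wt s (fourier_coeff (\<lambda>x. U t x - U' t' x))) (sobolev_norm s (\<lambda>x. U t x - U' t' x))"
    "sobolev_norm s (\<lambda>x. U t x - U' t' x) \<le> sobolev_norm s (U t) + sobolev_norm s (U' t')" by auto
  show "hat (\<lambda>x. U t x - U' t' x) a = (\<lambda>k. hat (U t) a k - hat (U' t') a k)"
    unfolding hat_def by (simp add: fco_diff solution_facts(4)[OF cs] solution_facts(4)[OF cs'])
qed

lemma sobolev_norm_close:
  fixes U U' :: "real \<Rightarrow> real^'d \<Rightarrow> real^'n"
  assumes cs: "classical_solution s F U0 I U" "t \<in> I" and cs': "classical_solution s F' U0' I' U'" "t' \<in> I'"
  shows "sobolev_norm s (U t) \<le> sobolev_norm s (\<lambda>x. U t x - U' t' x) + sobolev_norm s (U' t')"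
proof -
  have "fourier_coeff (\<lambda>x. U t x - U' t' x) = (\<lambda>k. fourier_coeff (U t) k - fourier_coeff (U' t') k)"
    by (rule fourier_coeff_diff) (auto intro: solution_facts(4)[OF cs] solution_facts(4)[OF cs'])
  then have eq: "fourier_coeff (U t) = (\<lambda>k. fourier_coeff (\<lambda>x. U t x - U' t' x) k + fourier_coeff (U' t') k)"
    by (simp add: fun_eq_iff)
  have "l2_le (wt s (fourier_coeff (U t))) (sobolev_norm s (\<lambda>x. U t x - U' t' x) + sobolev_norm s (U' t'))"
    by (subst eq) (intro wt_l2_add solution_diff_l2(1)[OF cs cs'] sobolev_l2_le[OF solution_facts(1)[OF cs']])
  then show ?thesis by (rule sobolev_norm_le(1))
qed

text \<open>
  Continuity in time with values in \<open>H\<^sup>s\<close>, on an open interval.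
\<close>

lemma solution_locally_bounded:
  fixes U :: "real \<Rightarrow> real^'d \<Rightarrow> real^'n"
  assumes cs: "classical_solution s F U0 I U" "t \<in> I" and \<epsilon>: "0 < \<epsilon>"
  obtains e where "0 < e" "\<And>\<tau>. \<bar>\<tau> - t\<bar> < e \<Longrightarrow> \<tau> \<in> I \<and>
    sobolev_norm s (\<lambda>x. U \<tau> x - U t x) < \<epsilon> \<and> sobolev_norm s (U \<tau>) \<le> sobolev_norm s (U t) + \<epsilon>"
proof -
  have I: "open I" using cs by (simp add: classical_solution_def)
  obtain e1 where e1: "0 < e1" "\<And>\<tau>. \<bar>\<tau> - t\<bar> < e1 \<Longrightarrow> \<tau> \<in> I"
    using I cs(2) unfolding open_dist dist_real_def by blast
  have "((\<lambda>\<tau>. sobolev_norm s (\<lambda>x. U \<tau> x - U t x)) \<longlongrightarrow> 0) (at t within I)"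
    using cs by (simp add: classical_solution_def sobolev_continuous_on_def)
  then have "\<forall>\<^sub>F \<tau> in at t. sobolev_norm s (\<lambda>x. U \<tau> x - U t x) < \<epsilon>"
    unfolding at_within_open[OF cs(2) I] by (rule order_tendstoD(2)) (rule \<epsilon>)
  then obtain e2 where e2: "0 < e2" "\<And>\<tau>. \<tau> \<noteq> t \<Longrightarrow> \<bar>\<tau> - t\<bar> < e2 \<Longrightarrow> sobolev_norm s (\<lambda>x. U \<tau> x - U t x) < \<epsilon>"
    unfolding eventually_at dist_real_def by blast
  have self: "sobolev_norm s (\<lambda>x. U t x - U t x) = 0"
  proof -
    have "fourier_coeff (\<lambda>x. U t x - U t x) = (\<lambda>k. 0)"
      by (subst fourier_coeff_diff) (auto intro: solution_facts(4)[OF cs])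
    then show ?thesis by (simp add: sobolev_norm_def)
  qed
  show thesis
  proof (rule that[of "min e1 e2"])
    show "0 < min e1 e2" using e1 e2 by simp
    fix \<tau> assume \<tau>: "\<bar>\<tau> - t\<bar> < min e1 e2"
    then have I: "\<tau> \<in> I" using e1 by simp
    have d: "sobolev_norm s (\<lambda>x. U \<tau> x - U t x) < \<epsilon>"
      using e2(2)[of \<tau>] \<tau> self \<epsilon> by (cases "\<tau> = t") auto
    then show "\<tau> \<in> I \<and> sobolev_norm s (\<lambda>x. U \<tau> x - U t x) < \<epsilon> \<and> sobolev_norm s (U \<tau>) \<le> sobolev_norm s (U t) + \<epsilon>"
      using I sobolev_norm_close[OF cs(1) I cs] by linarith
  qed
qed

lemma solution_locally_good:
  fixes U :: "real \<Rightarrow> real^'d \<Rightarrow> real^'n"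
  assumes cs: "classical_solution s F U0 I U" "t \<in> I"
  obtains e where "0 < e" "\<And>\<tau>. \<bar>\<tau> - t\<bar> < e \<Longrightarrow> \<tau> \<in> I \<and> good (U \<tau>) (Cw * (sobolev_norm s (U t) + 1))"
proof -
  obtain e where "0 < e" "\<And>\<tau>. \<bar>\<tau> - t\<bar> < e \<Longrightarrow> \<tau> \<in> I \<and>
    sobolev_norm s (\<lambda>x. U \<tau> x - U t x) < 1 \<and> sobolev_norm s (U \<tau>) \<le> sobolev_norm s (U t) + 1"
    using solution_locally_bounded[OF cs zero_less_one] by blast
  then show thesis using that good_of_sobolev[OF solution_facts(1,2)[OF cs(1)]] by blast
qed

text \<open>
  The equation holds pointwise in \<open>x\<close>. Dominated convergence transfers it to the
  Fourier coefficients; the difference quotients are bounded by the mean value theorem because the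
  solution stays in a ball of the weighted Wiener algebra near \<open>t\<close>.
\<close>

lemma coeff_derivative:
  assumes F: "multiplier_system A ea ch F"
    and cs: "classical_solution s F U0 I U" "t \<in> I"
  shows "((\<lambda>\<tau>. hat (U \<tau>) a k) has_vector_derivative
     - (of_real (ea k) * lin_coeff A (U t) a k + of_real (ch k) * nonlin_coeff A (U t) a k)) (at t)"
proof (rule has_vector_derivativeI_quotient)
  obtain e where e: "0 < e" "\<And>\<tau>. \<bar>\<tau> - t\<bar> < e \<Longrightarrow> \<tau> \<in> I \<and> good (U \<tau>) (Cw * (sobolev_norm s (U t) + 1))"
    using solution_locally_good[OF cs] by blast
  obtain B where B: "\<And>V a x. good V (Cw * (sobolev_norm s (U t) + 1)) \<Longrightarrow> \<bar>F V x $ a\<bar> \<le> B"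
    using system_bounded[OF F] by blast
  have Fc: "wiener (\<lambda>x. F (U t) x $ a)"
    "fco (\<lambda>x. F (U t) x $ a) = (\<lambda>k. of_real (ea k) * lin_coeff A (U t) a k + of_real (ch k) * nonlin_coeff A (U t) a k)"
    using F e(2)[of t] e(1) unfolding multiplier_system_def by auto
  have der: "((\<lambda>\<tau>. U \<tau> x $ a) has_vector_derivative - F (U \<tau>) x $ a) (at \<tau>)" if "\<bar>\<tau> - t\<bar> < e" for \<tau> x
  proof -
    have "((\<lambda>\<tau>. U \<tau> x) has_vector_derivative - F (U \<tau>) x) (at \<tau>)"
      using cs e(2)[OF that] by (simp add: classical_solution_def)
    from bounded_linear.has_vector_derivative[OF bounded_linear_vec_nth this] show ?thesis by simp
  qed
  define q where "q h x = (U (t + h) x $ a - U t x $ a) / h" for h x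
  have qB: "\<bar>q h x\<bar> \<le> B" if "h \<noteq> 0" "\<bar>h\<bar> < e" for h x
  proof -
    have "norm (U (t + h) x $ a - U t x $ a) \<le> B * norm ((t + h) - t)"
    proof (rule field_differentiable_bound[of "{t - \<bar>h\<bar>..t + \<bar>h\<bar>}" "\<lambda>\<tau>. U \<tau> x $ a" "\<lambda>\<tau>. - F (U \<tau>) x $ a"])
      fix \<tau> assume "\<tau> \<in> {t - \<bar>h\<bar>..t + \<bar>h\<bar>}"
      then have \<tau>: "\<bar>\<tau> - t\<bar> < e" using that by auto
      show "((\<lambda>\<tau>. U \<tau> x $ a) has_field_derivative - F (U \<tau>) x $ a) (at \<tau> within {t - \<bar>h\<bar>..t + \<bar>h\<bar>})"
        using der[OF \<tau>] by (auto simp: has_real_derivative_iff_has_vector_derivative intro: has_vector_derivative_at_within)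
      show "norm (- F (U \<tau>) x $ a) \<le> B" using B e(2)[OF \<tau>] by simp
    qed auto
    then show ?thesis using that by (simp add: q_def abs_divide divide_le_eq)
  qed
  have quot: "(hat (U (t + h)) a k - hat (U t) a k) /\<^sub>R h = mean (\<lambda>x. of_real (q h x) * cis (- phase k x))"
    if "\<bar>h\<bar> < e" for h
  proof -
    have th: "t + h \<in> I" using e(2)[of "t + h"] that by simp
    have "fco (q h) k = of_real (1 / h) * fco (\<lambda>x. U (t + h) x $ a - U t x $ a) k"
      unfolding q_def using fco_cmult[of "1 / h" "\<lambda>x. U (t + h) x $ a - U t x $ a"] by (simp add: fun_eq_iff)
    also have "fco (\<lambda>x. U (t + h) x $ a - U t x $ a) k = hat (U (t + h)) a k - hat (U t) a k"
      by (simp add: fco_diff solution_facts(4)[OF cs] solution_facts(4)[OF cs(1) th] hat_def)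
    finally show ?thesis by (simp add: fco_def scaleR_conv_of_real divide_inverse)
  qed
  have qlim: "((\<lambda>h. q h x) \<longlongrightarrow> - F (U t) x $ a) (at 0)" for x
  proof -
    have "((\<lambda>\<tau>. U \<tau> x $ a) has_field_derivative - F (U t) x $ a) (at t)"
      using der[of t x] e(1) by (simp add: has_real_derivative_iff_has_vector_derivative)
    then show ?thesis by (simp add: DERIV_def q_def)
  qed
  let ?S = "{-e<..<e} :: real set"
  have at: "at (0::real) = at 0 within ?S" using e(1) by (intro at_within_open[symmetric]) auto
  show "((\<lambda>h. (hat (U (t + h)) a k - hat (U t) a k) /\<^sub>R h) \<longlongrightarrow>
      - (of_real (ea k) * lin_coeff A (U t) a k + of_real (ch k) * nonlin_coeff A (U t) a k)) (at 0)"
    unfolding at tendsto_at_iff_sequentially comp_def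
  proof (intro allI impI)
    fix X :: "nat \<Rightarrow> real" assume X: "\<forall>i. X i \<in> ?S - {0}" "X \<longlonglongrightarrow> 0"
    have X': "\<bar>X i\<bar> < e" "X i \<noteq> 0" for i using X(1)[rule_format, of i] by auto
    have Xf: "filterlim X (at 0) sequentially"
      by (rule filterlim_atI) (use X X' in auto)
    have "(\<lambda>i. mean (\<lambda>x. of_real (q (X i) x) * cis (- phase k x))) \<longlonglongrightarrow> mean (\<lambda>x. of_real (- F (U t) x $ a) * cis (- phase k x))"
    proof (rule mean_dominated_convergence)
      show "continuous_on UNIV (\<lambda>x. complex_of_real (q (X i) x) * cis (- phase k x))" for i
      proof -
        have "t + X i \<in> I" using e(2)[of "t + X i"] X'[of i] by simp
        then show ?thesis unfolding q_def
          by (intro continuous_intros solution_facts(4)[OF cs] solution_facts(4)[OF cs(1)]) (use X' in auto)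
      qed
      show "continuous_on UNIV (\<lambda>x. complex_of_real (- F (U t) x $ a) * cis (- phase k x))"
        using wiener_continuous[OF Fc(1)] by (auto intro!: continuous_intros)
      show "(\<lambda>i. complex_of_real (q (X i) x) * cis (- phase k x)) \<longlonglongrightarrow> of_real (- F (U t) x $ a) * cis (- phase k x)" for x
        by (intro tendsto_mult tendsto_const tendsto_of_real filterlim_compose[OF qlim Xf])
      show "norm (complex_of_real (q (X i) x) * cis (- phase k x)) \<le> B" for i x
        using qB[OF X'(2,1)] by (simp add: norm_mult)
    qed
    moreover have "mean (\<lambda>x. of_real (- F (U t) x $ a) * cis (- phase k x)) = - fco (\<lambda>x. F (U t) x $ a) k"
      using fun_cong[OF fco_cmult[of "-1" "\<lambda>x. F (U t) x $ a"], of k] by (simp add: fco_def)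
    ultimately show "(\<lambda>i. (hat (U (t + X i)) a k - hat (U t) a k) /\<^sub>R X i) \<longlonglongrightarrow>
        - (of_real (ea k) * lin_coeff A (U t) a k + of_real (ch k) * nonlin_coeff A (U t) a k)"
      using quot[OF X'(1)] Fc(2) by simp
  qed
qed

end

section \<open>Differential inequalities\<close>

text \<open>
  The function \<open>(f + m) e\<^sup>-\<^sup>K\<^sup>t\<close> is nonincreasing, which serves
  \<open>t0 \<le> t1\<close>, and \<open>(f + m) e\<^sup>K\<^sup>t\<close> is nondecreasing, which
  serves the other case. The constant \<open>m\<close> will be the contribution of the high
  frequencies.
\<close>

lemma gronwall:
  fixes f :: "real \<Rightarrow> real"
  assumes S: "is_interval S" "t0 \<in> S" "t1 \<in> S"
    and f: "\<And>\<tau>. \<tau> \<in> S \<Longrightarrow> \<exists>f'. (f has_real_derivative f') (at \<tau>) \<and> \<bar>f'\<bar> \<le> K * (f \<tau> + m)"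
  shows "f t1 + m \<le> (f t0 + m) * exp (K * \<bar>t1 - t0\<bar>)"
proof -
  have seg: "\<tau> \<in> S" if "min t0 t1 \<le> \<tau>" "\<tau> \<le> max t0 t1" for \<tau>
  proof (cases "t0 \<le> t1")
    case True
    then show ?thesis using that by (intro mem_is_interval_1_I[OF S(1,2,3)]) auto
  next
    case False
    then show ?thesis using that by (intro mem_is_interval_1_I[OF S(1,3,2)]) auto
  qed
  have "\<exists>f'. ((\<lambda>\<tau>. (f \<tau> + m) * exp (c * \<tau>)) has_real_derivative (f' + c * (f \<tau> + m)) * exp (c * \<tau>)) (at \<tau>)
        \<and> \<bar>f'\<bar> \<le> K * (f \<tau> + m)" if \<tau>: "\<tau> \<in> S" for \<tau> c
  proof -
    obtain f' where f': "(f has_real_derivative f') (at \<tau>)" "\<bar>f'\<bar> \<le> K * (f \<tau> + m)" using f[OF \<tau>] by blast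
    have "((\<lambda>\<tau>. (f \<tau> + m) * exp (c * \<tau>)) has_real_derivative (f' + c * (f \<tau> + m)) * exp (c * \<tau>)) (at \<tau>)"
      by (rule derivative_eq_intros f' refl)+ (simp add: algebra_simps)
    then show ?thesis using f'(2) by blast
  qed
  note der = this
  show ?thesis
  proof (cases "t0 \<le> t1")
    case True
    have "(f t1 + m) * exp (- K * t1) \<le> (f t0 + m) * exp (- K * t0)"
    proof (rule DERIV_nonpos_imp_nonincreasing[OF True])
      fix \<tau> assume "t0 \<le> \<tau>" "\<tau> \<le> t1"
      then have "\<tau> \<in> S" using seg True by simp
      from der[OF this, of "- K"] obtain f' where
        "((\<lambda>\<tau>. (f \<tau> + m) * exp (- K * \<tau>)) has_real_derivative (f' + - K * (f \<tau> + m)) * exp (- K * \<tau>)) (at \<tau>)"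
        "\<bar>f'\<bar> \<le> K * (f \<tau> + m)" by blast
      moreover from this(2) have "(f' + - K * (f \<tau> + m)) * exp (- K * \<tau>) \<le> 0"
        by (intro mult_nonpos_nonneg) auto
      ultimately show "\<exists>y. ((\<lambda>\<tau>. (f \<tau> + m) * exp (- K * \<tau>)) has_real_derivative y) (at \<tau>) \<and> y \<le> 0"
        by blast
    qed
    then have "(f t1 + m) * exp (- K * t1) * exp (K * t1) \<le> (f t0 + m) * exp (- K * t0) * exp (K * t1)"
      by (rule mult_right_mono) simp
    then show ?thesis using True by (simp add: mult.assoc exp_add[symmetric] algebra_simps)
  next
    case False
    then have le: "t1 \<le> t0" by simp
    have "(f t1 + m) * exp (K * t1) \<le> (f t0 + m) * exp (K * t0)"
    proof (rule DERIV_nonneg_imp_nondecreasing[OF le])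
      fix \<tau> assume "t1 \<le> \<tau>" "\<tau> \<le> t0"
      then have "\<tau> \<in> S" using seg le by simp
      from der[OF this, of K] obtain f' where
        "((\<lambda>\<tau>. (f \<tau> + m) * exp (K * \<tau>)) has_real_derivative (f' + K * (f \<tau> + m)) * exp (K * \<tau>)) (at \<tau>)"
        "\<bar>f'\<bar> \<le> K * (f \<tau> + m)" by blast
      moreover from this(2) have "0 \<le> (f' + K * (f \<tau> + m)) * exp (K * \<tau>)"
        by (intro mult_nonneg_nonneg) auto
      ultimately show "\<exists>y. ((\<lambda>\<tau>. (f \<tau> + m) * exp (K * \<tau>)) has_real_derivative y) (at \<tau>) \<and> y \<ge> 0"
        by blast
    qed
    then have "(f t1 + m) * exp (K * t1) * exp (- K * t1) \<le> (f t0 + m) * exp (K * t0) * exp (- K * t1)"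
      by (rule mult_right_mono) simp
    then show ?thesis using False by (simp add: mult.assoc exp_add[symmetric] algebra_simps)
  qed
qed

section \<open>Low-pass cutoffs\<close>

text \<open>
  Equal to \<open>1\<close> for \<open>|k| \<le> \<nu>/4\<close> and to \<open>0\<close> for
  \<open>|k| \<ge> \<nu>/2\<close>, the region in which a filter at scale \<open>\<nu>\<close> is
  the identity.
\<close>

definition ramp :: "real \<Rightarrow> int^'d \<Rightarrow> real" where
  "ramp \<nu> k = min 1 (max 0 (2 - 4 * norm (emb k) / \<nu>))"

lemma ramp_bounds: "0 \<le> ramp \<nu> k" "ramp \<nu> k \<le> 1"
  by (auto simp: ramp_def)

lemma ramp_abs: "\<bar>ramp \<nu> k\<bar> \<le> 1"
  using ramp_bounds[of \<nu> k] by linarith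

lemma ramp_one: "0 < \<nu> \<Longrightarrow> 4 * norm (emb k) \<le> \<nu> \<Longrightarrow> ramp \<nu> k = 1"
  by (simp add: ramp_def field_simps)

lemma ramp_zero: "0 < \<nu> \<Longrightarrow> \<nu> \<le> 2 * norm (emb k) \<Longrightarrow> ramp \<nu> k = 0"
  by (simp add: ramp_def field_simps)

lemma ramp_lipschitz: "0 < \<nu> \<Longrightarrow> \<bar>ramp \<nu> k - ramp \<nu> l\<bar> \<le> 4 * norm (emb (k - l)) / \<nu>"
proof -
  assume \<nu>: "0 < \<nu>"
  have clamp: "\<bar>min 1 (max 0 x) - min 1 (max 0 y)\<bar> \<le> \<bar>x - y\<bar>" for x y :: real
    by (auto simp: min_def max_def)
  have "\<bar>ramp \<nu> k - ramp \<nu> l\<bar> \<le> \<bar>(2 - 4 * norm (emb k) / \<nu>) - (2 - 4 * norm (emb l) / \<nu>)\<bar>"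
    unfolding ramp_def by (rule clamp)
  also have "\<dots> = 4 * \<bar>norm (emb k) - norm (emb l)\<bar> / \<nu>"
  proof -
    have "(2 - 4 * norm (emb k) / \<nu>) - (2 - 4 * norm (emb l) / \<nu>) = - (4 * (norm (emb k) - norm (emb l)) / \<nu>)"
      by (simp add: diff_divide_distrib right_diff_distrib)
    then show ?thesis using \<nu> by (simp only: abs_minus_cancel abs_divide abs_mult)
  qed
  also have "\<dots> \<le> 4 * norm (emb (k - l)) / \<nu>"
  proof (rule divide_right_mono)
    show "4 * \<bar>norm (emb k) - norm (emb l)\<bar> \<le> 4 * norm (emb (k - l))"
      unfolding emb_diff by (rule mult_left_mono[OF norm_triangle_ineq3]) simp
  qed (use \<nu> in linarith)
  finally show ?thesis .
qed

lemma ramp_cutoff: "0 < \<nu> \<Longrightarrow> cutoff 4 (1/2) \<nu> (ramp \<nu>)"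
  unfolding cutoff_def using ramp_bounds ramp_lipschitz ramp_zero[of \<nu>] by (auto simp: mult.commute)

lemma ramp_box: "k \<notin> box_modes N \<Longrightarrow> 0 < N \<Longrightarrow> ramp (real N) k = 0"
proof -
  assume "k \<notin> box_modes N" "0 < N"
  then obtain j where "\<not> \<bar>k $ j\<bar> \<le> int N" by (auto simp: box_modes_def)
  then have "real N \<le> \<bar>of_int (k $ j)\<bar>" by linarith
  then show ?thesis using component_le_emb[of k j] \<open>0 < N\<close> by (intro ramp_zero) auto
qed

text \<open>
  A ramp at a scale \<open>n \<ge> \<nu>\<close> varies by at most \<open>4/\<nu>\<close> per unit, so the product is a cutoff at scale \<open>\<nu>\<close>
  with constants independent of \<open>n\<close>; this allows truncation far beyond the scale of the filter.
\<close>

lemma cutoff_times_ramp: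
  assumes q: "cutoff \<Lambda> \<rho> \<nu> q" and n: "\<nu> \<le> n"
  shows "cutoff (\<Lambda> + 4) \<rho> \<nu> (\<lambda>k. ramp n k * q k)"
proof -
  have c: "0 < \<nu>" "0 \<le> \<Lambda>" "0 \<le> \<rho>" "\<And>k. 0 \<le> q k" "\<And>k. q k \<le> 1"
    "\<And>k l. \<bar>q k - q l\<bar> \<le> \<Lambda> * norm (emb (k - l)) / \<nu>" "\<And>k. \<rho> * \<nu> \<le> norm (emb k) \<Longrightarrow> q k = 0"
    using q by (auto simp: cutoff_def)
  have "\<bar>ramp n k * q k - ramp n l * q l\<bar> \<le> (\<Lambda> + 4) * norm (emb (k - l)) / \<nu>" for k l
  proof -
    have "\<bar>ramp n k * q k - ramp n l * q l\<bar> = \<bar>ramp n k * (q k - q l) + (ramp n k - ramp n l) * q l\<bar>"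
      by (simp add: algebra_simps)
    also have "\<dots> \<le> \<bar>ramp n k\<bar> * \<bar>q k - q l\<bar> + \<bar>ramp n k - ramp n l\<bar> * \<bar>q l\<bar>"
      by (metis abs_mult abs_triangle_ineq)
    also have "\<dots> \<le> 1 * (\<Lambda> * norm (emb (k - l)) / \<nu>) + (4 * norm (emb (k - l)) / n) * 1"
      using ramp_abs[of n k] c ramp_lipschitz[of n k l] n by (intro add_mono mult_mono) auto
    also have "4 * norm (emb (k - l)) / n \<le> 4 * norm (emb (k - l)) / \<nu>"
      using n c by (intro divide_left_mono) auto
    finally show ?thesis by (simp add: add_divide_distrib algebra_simps)
  qed
  then show ?thesis
    unfolding cutoff_def
    by (intro conjI allI impI mult_nonneg_nonneg mult_le_one) (use c ramp_bounds[of n] in auto)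
qed

text \<open>
  A Lipschitz square root with values in \<open>[0, 1]\<close> makes the symbol itself Lipschitz;
  rescaling by \<open>N\<close> gives the variation \<open>O(1/N)\<close>.
\<close>

lemma smooth_symbol_cutoff:
  fixes chi :: "real^'d \<Rightarrow> real"
  assumes "cutoff_profile chi"
  shows "\<exists>\<Lambda> \<rho>. \<forall>N\<ge>1. cutoff \<Lambda> \<rho> (real N) (smooth_symbol chi N)"
proof -
  obtain L where L: "L-lipschitz_on UNIV (\<lambda>k. sqrt (chi k))" and c01: "\<And>k. 0 \<le> chi k" "\<And>k. chi k \<le> 1"
    using assms by (auto simp: cutoff_profile_def)
  have L0: "0 \<le> L" using lipschitz_on_nonneg[OF L] .
  have lip: "\<bar>chi x - chi y\<bar> \<le> 2 * L * norm (x - y)" for x y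
  proof -
    have "chi x - chi y = (sqrt (chi x) - sqrt (chi y)) * (sqrt (chi x) + sqrt (chi y))"
      using c01 by (simp add: algebra_simps)
    then have "\<bar>chi x - chi y\<bar> = \<bar>sqrt (chi x) - sqrt (chi y)\<bar> * \<bar>sqrt (chi x) + sqrt (chi y)\<bar>" by (simp add: abs_mult)
    also have "\<dots> \<le> (L * norm (x - y)) * 2"
    proof (rule mult_mono)
      show "\<bar>sqrt (chi x) - sqrt (chi y)\<bar> \<le> L * norm (x - y)"
        using lipschitz_onD[OF L, of x y] by (simp add: dist_norm)
      have "sqrt (chi x) \<le> 1" "sqrt (chi y) \<le> 1" "0 \<le> sqrt (chi x)" "0 \<le> sqrt (chi y)" using c01 by auto
      then show "\<bar>sqrt (chi x) + sqrt (chi y)\<bar> \<le> 2" by linarith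
    qed (use L0 in auto)
    finally show ?thesis by (simp add: mult_ac)
  qed
  have "cutoff (2 * L) (real CARD('d)) (real N) (smooth_symbol chi N)" if N: "N \<ge> 1" for N
    unfolding cutoff_def
  proof (intro conjI allI impI)
    fix k l :: "int^'d"
    have "(\<chi> j. of_int (k $ j) / real N) - (\<chi> j. of_int (l $ j) / real N) = emb (k - l) /\<^sub>R real N"
      by (simp add: vec_eq_iff emb_def divide_inverse algebra_simps)
    then show "\<bar>smooth_symbol chi N k - smooth_symbol chi N l\<bar> \<le> 2 * L * norm (emb (k - l)) / real N"
      using lip[of "\<chi> j. of_int (k $ j) / real N" "\<chi> j. of_int (l $ j) / real N"] by (simp add: smooth_symbol_def divide_inverse mult_ac)
  next
    fix k :: "int^'d" assume k: "real CARD('d) * real N \<le> norm (emb k)"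
    show "smooth_symbol chi N k = 0"
    proof (rule ccontr)
      assume "smooth_symbol chi N k \<noteq> 0"
      then have "\<bar>of_int (k $ j)\<bar> < real N" for j
        using smooth_symbol_props(5)[OF assms N] not_le by blast
      then have "(\<Sum>j\<in>UNIV. \<bar>emb k $ j\<bar>) < (\<Sum>j\<in>(UNIV::'d set). real N)"
        by (intro sum_strict_mono) (auto simp: emb_def)
      then show False using norm_le_l1_cart[of "emb k"] k by simp
    qed
  qed (use N L0 smooth_symbol_props(1,2)[OF assms N] in auto)
  then show ?thesis by blast
qed

section \<open>Interpolation\<close>

text \<open>
  At each frequency \<open>\<langle>k\<rangle>\<^sup>r \<le> N\<^sup>r + N\<^sup>r\<^sup>-\<^sup>s
  \<langle>k\<rangle>\<^sup>s\<close>: the first term dominates when \<open>\<langle>k\<rangle>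
  \<le> N\<close>, the second otherwise.
\<close>

lemma sobolev_interpolation:
  fixes W :: "real^'d \<Rightarrow> real^'n"
  assumes 0: "l2_le (fourier_coeff W) (X * real N powr (- s))" and s: "l2_le (wt s (fourier_coeff W)) Y"
    and N: "N \<ge> 1" and r: "0 \<le> r" "r \<le> s"
  shows "l2_le (wt r (fourier_coeff W)) ((X + Y) * real N powr (r - s))"
proof (rule l2_le_mono)
  let ?c = "\<lambda>k. norm (fourier_coeff W k)"
  show "l2_le (\<lambda>k. real N powr r * ?c k + real N powr (r - s) * wt s (fourier_coeff W) k)
     (norm (real N powr r) * (X * real N powr (- s)) + norm (real N powr (r - s)) * Y)"
    using 0 s by (intro l2_le_add l2_le_cmult) auto
  show "norm (real N powr r) * (X * real N powr (- s)) + norm (real N powr (r - s)) * Y \<le> (X + Y) * real N powr (r - s)"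
    by (simp add: algebra_simps powr_add[symmetric] powr_diff powr_minus divide_inverse)
  show "norm (wt r (fourier_coeff W) k) \<le> norm (real N powr r * ?c k + real N powr (r - s) * wt s (fourier_coeff W) k)" for k
  proof -
    have "jb k powr r \<le> real N powr r + real N powr (r - s) * jb k powr s"
    proof (cases "jb k \<le> real N")
      case True
      then have "jb k powr r \<le> real N powr r" using r jb_pos[of k] by (intro powr_mono2) auto
      moreover have "0 \<le> real N powr (r - s) * jb k powr s" by simp
      ultimately show ?thesis by linarith
    next
      case False
      have "jb k powr (r - s) \<le> real N powr (r - s)" using False r N by (intro powr_mono2') auto
      then have "jb k powr (r - s) * jb k powr s \<le> real N powr (r - s) * jb k powr s" by (rule mult_right_mono) simp
      then have "jb k powr r \<le> real N powr (r - s) * jb k powr s" by (simp add: powr_add[symmetric])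
      moreover have "0 \<le> real N powr r" by simp
      ultimately show ?thesis by linarith
    qed
    then have "jb k powr r * ?c k \<le> (real N powr r + real N powr (r - s) * jb k powr s) * ?c k"
      by (rule mult_right_mono) simp
    then have "wt r (fourier_coeff W) k \<le> real N powr r * ?c k + real N powr (r - s) * wt s (fourier_coeff W) k"
      by (simp add: wt_def algebra_simps)
    from abs_le_abs_if[OF wt_nonneg this] show ?thesis by (simp only: real_norm_def)
  qed
qed

section \<open>Energy rates\<close>

text \<open>
  The constant-coefficient part drops out of the energy, whatever real symbol multiplies it.
\<close>

lemma rate_split:
  fixes w :: "'n::finite \<Rightarrow> complex" and X :: "'d::finite \<Rightarrow> 'n \<Rightarrow> 'n \<Rightarrow> complex"
  assumes "Re (\<Sum>a\<in>UNIV. cnj (w a) * L a) = 0"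
  shows "Re (\<Sum>a\<in>UNIV. cnj (w a) * - (of_real e * L a + of_real c * (\<Sum>j\<in>UNIV. \<Sum>b\<in>UNIV. X j a b)))
    = - (\<Sum>j\<in>UNIV. c * Re (\<Sum>a\<in>UNIV. \<Sum>b\<in>UNIV. cnj (w a) * X j a b))"
proof -
  have "cnj (w a) * - (of_real e * L a + of_real c * (\<Sum>j\<in>UNIV. \<Sum>b\<in>UNIV. X j a b))
     = - (of_real e * (cnj (w a) * L a)) - of_real c * (\<Sum>j\<in>UNIV. \<Sum>b\<in>UNIV. cnj (w a) * X j a b)" for a
  proof -
    have e: "(\<Sum>j\<in>UNIV. \<Sum>b\<in>UNIV. cnj (w a) * X j a b) = cnj (w a) * (\<Sum>j\<in>UNIV. \<Sum>b\<in>UNIV. X j a b)"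
      by (simp only: sum_distrib_left)
    have "u * - (x * l + y * z) = - (x * (u * l)) - y * (u * z)" for u x l y z :: complex
      by (simp add: algebra_simps)
    then show ?thesis unfolding e .
  qed
  then have "(\<Sum>a\<in>UNIV. cnj (w a) * - (of_real e * L a + of_real c * (\<Sum>j\<in>UNIV. \<Sum>b\<in>UNIV. X j a b)))
     = - (of_real e * (\<Sum>a\<in>UNIV. cnj (w a) * L a) + of_real c * (\<Sum>a\<in>UNIV. \<Sum>j\<in>UNIV. \<Sum>b\<in>UNIV. cnj (w a) * X j a b))"
    by (simp add: sum_subtractf sum_negf sum_distrib_left[symmetric])
  also have "(\<Sum>a\<in>UNIV. \<Sum>j\<in>UNIV. \<Sum>b\<in>UNIV. cnj (w a) * X j a b) = (\<Sum>j\<in>UNIV. \<Sum>a\<in>UNIV. \<Sum>b\<in>UNIV. cnj (w a) * X j a b)"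
    by (rule sum.swap)
  also have "Re (- (of_real e * (\<Sum>a\<in>UNIV. cnj (w a) * L a) + of_real c * \<dots>)) = - (c * Re \<dots>)"
    using assms by simp
  finally show ?thesis by (simp add: Re_sum[of _ "UNIV :: 'd set"] sum_distrib_left)
qed

lemma sum_swap_neg2:
  fixes f :: "'k \<Rightarrow> 'j \<Rightarrow> real"
  shows "(\<Sum>k\<in>S. p k * (2 * - (\<Sum>j\<in>J. f k j))) = - 2 * (\<Sum>j\<in>J. \<Sum>k\<in>S. p k * f k j)"
  by (subst sum.swap) (simp add: sum_distrib_left sum_negf mult_ac)

context symmetric_system
begin

text \<open>
  The rate of the \<open>H\<^sup>s\<close> energy of a solution in the ball of radius
  \<open>R\<close>, for a cutoff with constants \<open>\<Lambda>\<close> and \<open>\<rho>\<close>.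
\<close>

definition KH :: "real \<Rightarrow> real \<Rightarrow> real \<Rightarrow> real" where
  "KH \<Lambda> \<rho> R = 2 * (real CARD('d) * (real CARD('n) ^ 2 * (((1 + \<Lambda> * \<rho> + 2 * s) * 2 powr s) * (3 * (Ct R * R)))))"

lemma KH_nonneg: "0 \<le> \<Lambda> \<Longrightarrow> 0 \<le> \<rho> \<Longrightarrow> 0 \<le> R \<Longrightarrow> 0 \<le> KH \<Lambda> \<rho> R"
  using s_bounds Ct_nonneg by (simp add: KH_def)

text \<open>
  The symbol \<open>ch\<close> of the filter multiplies the weight of the energy, so the commutator
  estimate is applied to the product \<open>p ch\<close>.
\<close>

lemma Hs_energy_rate:
  assumes F: "multiplier_system A ea ch F" and cs: "classical_solution s F U0 I U" "t \<in> I"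
    and g: "good (U t) R" and D: "\<And>a. l2_le (wt s (hat (U t) a)) D"
    and cut: "cutoff \<Lambda> \<rho> \<nu> (\<lambda>k. p k * ch k)" and S: "finite S" "\<And>k. k \<notin> S \<Longrightarrow> p k = 0"
  shows "\<exists>E'. ((\<lambda>\<tau>. \<Sum>k\<in>S. p k * jb k powr (2 * s) * (\<Sum>a\<in>UNIV. (cmod (hat (U \<tau>) a k))\<^sup>2)) has_real_derivative E') (at t)
      \<and> \<bar>E'\<bar> \<le> KH \<Lambda> \<rho> R * D\<^sup>2"
proof -
  let ?w = "hat (U t)"
  let ?X = "\<lambda>k j a b. conv (perturbation_coeff A (U t) j a b) (deriv_coeff j (?w b)) k"
  let ?B = "real CARD('n) ^ 2 * (((1 + \<Lambda> * \<rho> + 2 * s) * 2 powr s) * (3 * (Ct R * R) * D\<^sup>2))"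
  have "((\<lambda>\<tau>. \<Sum>k\<in>S. p k * jb k powr (2 * s) * (\<Sum>a\<in>UNIV. (cmod (hat (U \<tau>) a k))\<^sup>2)) has_real_derivative
     (\<Sum>k\<in>S. p k * jb k powr (2 * s) * (2 * Re (\<Sum>a\<in>UNIV. cnj (?w a k) *
        - (of_real (ea k) * lin_coeff A (U t) a k + of_real (ch k) * nonlin_coeff A (U t) a k))))) (at t)"
    by (rule energy_derivative) (rule coeff_derivative[OF F cs])
  moreover have "Re (\<Sum>a\<in>UNIV. cnj (?w a k) *
        - (of_real (ea k) * lin_coeff A (U t) a k + of_real (ch k) * nonlin_coeff A (U t) a k))
      = - (\<Sum>j\<in>UNIV. ch k * Re (\<Sum>a\<in>UNIV. \<Sum>b\<in>UNIV. cnj (?w a k) * ?X k j a b))" for k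
    unfolding nonlin_coeff_def
    by (rule rate_split) (unfold lin_coeff_def, rule lin_coeff_skew, rule A_sym)
  ultimately have der: "((\<lambda>\<tau>. \<Sum>k\<in>S. p k * jb k powr (2 * s) * (\<Sum>a\<in>UNIV. (cmod (hat (U \<tau>) a k))\<^sup>2)) has_real_derivative
     (\<Sum>k\<in>S. p k * jb k powr (2 * s) * (2 * - (\<Sum>j\<in>UNIV. ch k * Re (\<Sum>a\<in>UNIV. \<Sum>b\<in>UNIV. cnj (?w a k) * ?X k j a b))))) (at t)"
    by (simp only:)
  have eq: "(\<Sum>k\<in>S. p k * jb k powr (2 * s) * (2 * - (\<Sum>j\<in>UNIV. ch k * Re (\<Sum>a\<in>UNIV. \<Sum>b\<in>UNIV. cnj (?w a k) * ?X k j a b))))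
      = - 2 * (\<Sum>j\<in>UNIV. \<Sum>k\<in>S. (p k * ch k) * jb k powr (2 * s) * Re (\<Sum>a\<in>UNIV. \<Sum>b\<in>UNIV. cnj (?w a k) * ?X k j a b))"
    by (subst sum.swap) (simp add: sum_distrib_left sum_negf mult_ac del: Re_sum)
  have B: "\<bar>\<Sum>k\<in>S. (p k * ch k) * jb k powr (2 * s) * Re (\<Sum>a\<in>UNIV. \<Sum>b\<in>UNIV. cnj (?w a k) * ?X k j a b)\<bar> \<le> ?B" for j
  proof -
    have "\<bar>\<Sum>k\<in>S. (p k * ch k) * jb k powr (2 * s) * Re (\<Sum>a\<in>UNIV. \<Sum>b\<in>UNIV. cnj (?w a k) * ?X k j a b)\<bar>
       \<le> real CARD('n) ^ 2 * (((1 + \<Lambda> * \<rho> + 2 * s) * 2 powr s) * ((Ct R * R) * D * D + (Ct R * D) * D * R + (Ct R * D) * R * D))"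
      by (rule energy_estimate_Hs[OF perturbation_sym perturbation_herm cut S(1) _ s_bounds(1)
            perturbation_l1[OF g order_refl] perturbation_l2[OF g D] goodD(4)[OF g] D]) (simp add: S(2))
    then show ?thesis by (simp add: power2_eq_square algebra_simps)
  qed
  have "\<bar>\<Sum>j\<in>UNIV. \<Sum>k\<in>S. (p k * ch k) * jb k powr (2 * s) * Re (\<Sum>a\<in>UNIV. \<Sum>b\<in>UNIV. cnj (?w a k) * ?X k j a b)\<bar>
      \<le> (\<Sum>j\<in>(UNIV::'d set). ?B)"
    by (rule order_trans[OF sum_abs]) (rule sum_mono, rule B)
  also have "\<dots> = real CARD('d) * ?B" by simp
  finally have "\<bar>- 2 * (\<Sum>j\<in>UNIV. \<Sum>k\<in>S. (p k * ch k) * jb k powr (2 * s) * Re (\<Sum>a\<in>UNIV. \<Sum>b\<in>UNIV. cnj (?w a k) * ?X k j a b))\<bar>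
     \<le> 2 * (real CARD('d) * ?B)"
    by (simp only: abs_mult)
  also have "\<dots> = KH \<Lambda> \<rho> R * D\<^sup>2" by (simp add: KH_def)
  finally show ?thesis using der unfolding eq by blast
qed

text \<open>
  The rate of the \<open>L\<^sup>2\<close> energy of a difference of solutions in the ball of radius
  \<open>R\<close>, per unit of the radius of the smaller ball containing both.
\<close>

definition KD :: "real \<Rightarrow> real" where
  "KD R = 2 * (real CARD('d) * (real CARD('n) ^ 2 * (4 * Ct R)))"

lemma KD_nonneg: "0 \<le> R \<Longrightarrow> 0 \<le> KD R"
  using Ct_nonneg by (simp add: KD_def)

text \<open>
  Writing the difference of the nonlinear terms as \<open>c(U) \<partial>w + (c(U) - c(V))
  \<partial>V\<close>, the first term is handled by symmetry and the second by the tame estimate in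
  \<open>L\<^sup>2\<close>. On the support of \<open>p\<close> all symbols are \<open>1\<close>, so
  the filter leaves no residual.
\<close>

lemma diff_energy_rate:
  assumes F: "multiplier_system A ea ch F" and cs: "classical_solution s F U0 I U" "t \<in> I"
    and F': "multiplier_system A ea' ch' F'" and cs': "classical_solution s F' V0 J V" "t \<in> J"
    and gU: "good (U t) r" and gV: "good (V t) r" and r: "r \<le> R"
    and D: "\<And>a. l2_le (\<lambda>k. hat (U t) a k - hat (V t) a k) D"
    and cut: "cutoff 4 (1/2) \<nu> p" and S: "finite S" "\<And>k. k \<notin> S \<Longrightarrow> p k = 0"
    and low: "\<And>k. p k \<noteq> 0 \<Longrightarrow> ea k = 1 \<and> ch k = 1 \<and> ea' k = 1 \<and> ch' k = 1"
  shows "\<exists>E'. ((\<lambda>\<tau>. \<Sum>k\<in>S. p k * (\<Sum>a\<in>UNIV. (cmod (hat (U \<tau>) a k - hat (V \<tau>) a k))\<^sup>2)) has_real_derivative E') (at t)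
      \<and> \<bar>E'\<bar> \<le> KD R * r * D\<^sup>2"
proof -
  define w where "w a k = hat (U t) a k - hat (V t) a k" for a k
  define c where "c = perturbation_coeff A (U t)"
  define \<delta> where "\<delta> j a b k = perturbation_coeff A (U t) j a b k - perturbation_coeff A (V t) j a b k" for j a b k
  define X where "X k j a b = conv (c j a b) (deriv_coeff j (w b)) k + conv (\<delta> j a b) (deriv_coeff j (hat (V t) b)) k" for k j a b
  have R0: "0 \<le> R" "0 \<le> r" using goodD(5)[OF gU] r by linarith+
  have D0: "0 \<le> D" using l2_le_nonneg[OF D] .
  have w1: "l1_le (wt 1 (w b)) (r + r)" for b
  proof -
    have "l1_le (wt 1 (\<lambda>k. - hat (V t) b k)) r" using goodD(4)[OF gV, of b] by (simp add: wt_def[abs_def])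
    from wt_l1_add[OF goodD(4)[OF gU, of b] this] show ?thesis by (simp add: w_def[abs_def])
  qed
  have c1: "l1_le (wt 1 (c j a b)) (Ct R * r)" for j a b
    unfolding c_def by (rule perturbation_l1[OF gU r])
  have d2: "l2_le (\<delta> j a b) (Ct R * D)" for j a b
    unfolding \<delta>_def[abs_def] by (rule perturbation_diff[OF good_mono[OF gU r] good_mono[OF gV r] D])
  have nl: "nonlin_coeff A (U t) a k - nonlin_coeff A (V t) a k = (\<Sum>j\<in>UNIV. \<Sum>b\<in>UNIV. X k j a b)" for a k
  proof -
    have "conv (perturbation_coeff A (U t) j a b) (deriv_coeff j (hat (U t) b)) k
        - conv (perturbation_coeff A (V t) j a b) (deriv_coeff j (hat (V t) b)) k = X k j a b" for j b
    proof -
      have pU: "l1_le (perturbation_coeff A (U t) j a b) (Ct R * r)" "l1_le (perturbation_coeff A (V t) j a b) (Ct R * r)"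
        by (rule l1_le_of_wt[OF _ perturbation_l1[OF gU r]] l1_le_of_wt[OF _ perturbation_l1[OF gV r]]; simp)+
      note n = l1_le_norm[OF deriv_coeff_l1[OF goodD(4)[OF gU, of b], of j]] l1_le_norm[OF deriv_coeff_l1[OF goodD(4)[OF gV, of b], of j]]
      have dw: "deriv_coeff j (w b) = (\<lambda>l. deriv_coeff j (hat (U t) b) l - deriv_coeff j (hat (V t) b) l)"
        by (simp add: fun_eq_iff w_def[abs_def] deriv_coeff_diff)
      show ?thesis
        unfolding X_def c_def \<delta>_def[abs_def] dw
        by (rule conv_diff[OF conv_summable_left[OF pU(1) n(1)] conv_summable_left[OF pU(2) n(2)] conv_summable_left[OF pU(1) n(2)]])
    qed
    then show ?thesis by (simp add: nonlin_coeff_def sum_subtractf[symmetric])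
  qed
  define L where "L a k = (\<Sum>j\<in>UNIV. \<Sum>b\<in>UNIV. of_real (A j 0 $ a $ b) * deriv_coeff j (w b) k)" for a k
  have lin: "lin_coeff A (U t) a k - lin_coeff A (V t) a k = L a k" for a k
    by (simp add: lin_coeff_def L_def w_def[abs_def] deriv_coeff_diff sum_subtractf[symmetric] right_diff_distrib)
  define w' where "w' a k = - (of_real (ea k) * lin_coeff A (U t) a k + of_real (ch k) * nonlin_coeff A (U t) a k)
       - - (of_real (ea' k) * lin_coeff A (V t) a k + of_real (ch' k) * nonlin_coeff A (V t) a k)" for a k
  have w': "w' a k = - (of_real 1 * L a k + of_real 1 * (\<Sum>j\<in>UNIV. \<Sum>b\<in>UNIV. X k j a b))" if "p k \<noteq> 0" for a k
    using low[OF that] lin[of a k] nl[of a k] by (simp add: w'_def algebra_simps)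
  have "((\<lambda>\<tau>. \<Sum>k\<in>S. p k * (\<Sum>a\<in>UNIV. (cmod (hat (U \<tau>) a k - hat (V \<tau>) a k))\<^sup>2)) has_real_derivative
     (\<Sum>k\<in>S. p k * (2 * Re (\<Sum>a\<in>UNIV. cnj (hat (U t) a k - hat (V t) a k) * w' a k)))) (at t)"
    by (rule energy_derivative, unfold w'_def, rule has_vector_derivative_diff;
        rule coeff_derivative[OF F cs] coeff_derivative[OF F' cs'])
  moreover have "p k * (2 * Re (\<Sum>a\<in>UNIV. cnj (hat (U t) a k - hat (V t) a k) * w' a k))
      = p k * (2 * - (\<Sum>j\<in>UNIV. 1 * Re (\<Sum>a\<in>UNIV. \<Sum>b\<in>UNIV. cnj (w a k) * X k j a b)))" for k
  proof (cases "p k = 0")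
    case False
    have skew: "Re (\<Sum>a\<in>UNIV. cnj (w a k) * L a k) = 0"
      unfolding L_def by (rule lin_coeff_skew) (rule A_sym)
    show ?thesis
      unfolding w'[OF False] w_def[symmetric] rate_split[OF skew] ..
  qed simp
  ultimately have der: "((\<lambda>\<tau>. \<Sum>k\<in>S. p k * (\<Sum>a\<in>UNIV. (cmod (hat (U \<tau>) a k - hat (V \<tau>) a k))\<^sup>2)) has_real_derivative
     (\<Sum>k\<in>S. p k * (2 * - (\<Sum>j\<in>UNIV. 1 * Re (\<Sum>a\<in>UNIV. \<Sum>b\<in>UNIV. cnj (w a k) * X k j a b))))) (at t)"
    by (simp only:)
  define Y1 where "Y1 j = (\<Sum>k\<in>S. p k * Re (\<Sum>a\<in>UNIV. \<Sum>b\<in>UNIV. cnj (w a k) * conv (c j a b) (deriv_coeff j (w b)) k))" for j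
  define Y2 where "Y2 j = (\<Sum>k\<in>S. p k * Re (\<Sum>a\<in>UNIV. \<Sum>b\<in>UNIV. cnj (w a k) * conv (\<delta> j a b) (deriv_coeff j (hat (V t) b)) k))" for j
  have eq: "(\<Sum>k\<in>S. p k * (2 * - (\<Sum>j\<in>UNIV. 1 * Re (\<Sum>a\<in>UNIV. \<Sum>b\<in>UNIV. cnj (w a k) * X k j a b)))) = - 2 * (\<Sum>j\<in>UNIV. Y1 j + Y2 j)"
  proof -
    have Re: "Re (\<Sum>a\<in>UNIV. \<Sum>b\<in>UNIV. cnj (w a k) * X k j a b)
       = Re (\<Sum>a\<in>UNIV. \<Sum>b\<in>UNIV. cnj (w a k) * conv (c j a b) (deriv_coeff j (w b)) k)
       + Re (\<Sum>a\<in>UNIV. \<Sum>b\<in>UNIV. cnj (w a k) * conv (\<delta> j a b) (deriv_coeff j (hat (V t) b)) k)" for k j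
      by (simp only: X_def distrib_left sum.distrib plus_complex.sel)
    have "Y1 j + Y2 j = (\<Sum>k\<in>S. p k * Re (\<Sum>a\<in>UNIV. \<Sum>b\<in>UNIV. cnj (w a k) * X k j a b))" for j
      by (simp only: Y1_def Y2_def Re distrib_left sum.distrib)
    then show ?thesis by (simp only: mult_1 sum_swap_neg2)
  qed
  have Y1: "\<bar>Y1 j\<bar> \<le> real CARD('n) ^ 2 * ((1 + 4 * (1/2)) * ((Ct R * r) * D * D))" for j
    unfolding Y1_def
    by (rule energy_estimate_L2[OF _ _ cut S c1 w1])
       (auto simp: c_def perturbation_herm D w_def[abs_def] intro: perturbation_sym)
  have Y2: "\<bar>Y2 j\<bar> \<le> real CARD('n) ^ 2 * (Ct R * r * D\<^sup>2)" for j
  proof -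
    let ?c = "\<lambda>a b. conv (\<delta> j a b) (deriv_coeff j (hat (V t) b))"
    have one: "(\<Sum>k\<in>S. cmod (w a k) * cmod (?c a b k)) \<le> Ct R * r * D\<^sup>2" for a b
    proof -
      have "(\<Sum>k\<in>S. \<bar>cmod (w a k)\<bar> * \<bar>cmod (?c a b k)\<bar>) \<le> L2_set (\<lambda>k. cmod (w a k)) S * L2_set (\<lambda>k. cmod (?c a b k)) S"
        by (rule L2_set_mult_ineq)
      also have "\<dots> \<le> D * ((Ct R * D) * r)"
        using l2_leD[OF D[of a] S(1)] l2_leD[OF conv_l2'[OF d2 deriv_coeff_l1[OF goodD(4)[OF gV]]] S(1), of j a b j b] D0
        by (intro mult_mono) (auto simp: w_def)
      finally show ?thesis by (simp add: power2_eq_square algebra_simps)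
    qed
    have "\<bar>Y2 j\<bar> \<le> (\<Sum>k\<in>S. \<Sum>a\<in>UNIV. \<Sum>b\<in>UNIV. cmod (w a k) * cmod (?c a b k))"
      unfolding Y2_def
    proof (rule order_trans[OF sum_abs], rule sum_mono)
      fix k
      have p: "0 \<le> p k" "p k \<le> 1" using cut by (auto simp: cutoff_def)
      have "\<bar>Re (\<Sum>a\<in>UNIV. \<Sum>b\<in>UNIV. cnj (w a k) * ?c a b k)\<bar> \<le> cmod (\<Sum>a\<in>UNIV. \<Sum>b\<in>UNIV. cnj (w a k) * ?c a b k)"
        by (rule abs_Re_le_cmod)
      also have "\<dots> \<le> (\<Sum>a\<in>UNIV. \<Sum>b\<in>UNIV. cmod (w a k) * cmod (?c a b k))"
        by (intro sum_norm_le) (simp add: norm_mult)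
      finally have "p k * \<bar>Re (\<Sum>a\<in>UNIV. \<Sum>b\<in>UNIV. cnj (w a k) * ?c a b k)\<bar> \<le> 1 * (\<Sum>a\<in>UNIV. \<Sum>b\<in>UNIV. cmod (w a k) * cmod (?c a b k))"
        using p by (intro mult_mono) auto
      then show "\<bar>p k * Re (\<Sum>a\<in>UNIV. \<Sum>b\<in>UNIV. cnj (w a k) * ?c a b k)\<bar> \<le> (\<Sum>a\<in>UNIV. \<Sum>b\<in>UNIV. cmod (w a k) * cmod (?c a b k))"
        using p by (simp only: abs_mult abs_of_nonneg[OF p(1)] mult_1)
    qed
    also have "\<dots> = (\<Sum>a\<in>UNIV. \<Sum>k\<in>S. \<Sum>b\<in>UNIV. cmod (w a k) * cmod (?c a b k))" by (rule sum.swap)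
    also have "\<dots> = (\<Sum>a\<in>UNIV. \<Sum>b\<in>UNIV. \<Sum>k\<in>S. cmod (w a k) * cmod (?c a b k))"
      by (intro sum.cong refl sum.swap)
    also have "\<dots> \<le> (\<Sum>a\<in>(UNIV::'n set). \<Sum>b\<in>(UNIV::'n set). Ct R * r * D\<^sup>2)" by (intro sum_mono one)
    also have "\<dots> = real CARD('n) ^ 2 * (Ct R * r * D\<^sup>2)" by (simp add: power2_eq_square)
    finally show ?thesis .
  qed
  have "\<bar>\<Sum>j\<in>UNIV. Y1 j + Y2 j\<bar> \<le> (\<Sum>j\<in>(UNIV::'d set). real CARD('n) ^ 2 * (4 * Ct R) * r * D\<^sup>2)"
  proof (rule order_trans[OF sum_abs], rule sum_mono)
    fix j
    have "\<bar>Y1 j + Y2 j\<bar> \<le> real CARD('n) ^ 2 * ((1 + 4 * (1/2)) * ((Ct R * r) * D * D)) + real CARD('n) ^ 2 * (Ct R * r * D\<^sup>2)"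
      using Y1[of j] Y2[of j] by linarith
    also have "\<dots> = real CARD('n) ^ 2 * (4 * Ct R) * r * D\<^sup>2" by (simp add: power2_eq_square algebra_simps)
    finally show "\<bar>Y1 j + Y2 j\<bar> \<le> real CARD('n) ^ 2 * (4 * Ct R) * r * D\<^sup>2" .
  qed
  then have "\<bar>- 2 * (\<Sum>j\<in>UNIV. Y1 j + Y2 j)\<bar> \<le> 2 * (\<Sum>j\<in>(UNIV::'d set). real CARD('n) ^ 2 * (4 * Ct R) * r * D\<^sup>2)"
    by (simp only: abs_mult)
  also have "\<dots> = KD R * r * D\<^sup>2" by (simp add: KD_def)
  finally show ?thesis using der unfolding eq by blast
qed

end

section \<open>Ordinary differential equations in Banach spaces\<close>

definition locally_lipschitz :: "('a::real_normed_vector \<Rightarrow> 'a) \<Rightarrow> bool" where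
  "locally_lipschitz f \<longleftrightarrow> (\<forall>R. \<exists>L\<ge>0. \<forall>x y. norm x \<le> R \<longrightarrow> norm y \<le> R \<longrightarrow> norm (f x - f y) \<le> L * norm (x - y))"

lemma locally_lipschitz_continuous:
  assumes "locally_lipschitz f"
  shows "continuous_on S f"
proof -
  have "\<exists>d>0. \<forall>y. dist y x < d \<longrightarrow> dist (f y) (f x) < e" if e: "0 < e" for x e
  proof -
    obtain L where L: "0 \<le> L" "\<And>y z. norm y \<le> norm x + 1 \<Longrightarrow> norm z \<le> norm x + 1 \<Longrightarrow> norm (f y - f z) \<le> L * norm (y - z)"
      using assms unfolding locally_lipschitz_def by blast
    show ?thesis
    proof (intro exI[of _ "min 1 (e / (L + 1))"] conjI allI impI)
      show "0 < min 1 (e / (L + 1))" using e L(1) by simp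
      fix y assume y: "dist y x < min 1 (e / (L + 1))"
      then have "norm y \<le> norm x + 1" using norm_triangle_ineq2[of y x] by (simp add: dist_norm)
      then have "norm (f y - f x) \<le> L * norm (y - x)" using L(2) by simp
      also have "\<dots> \<le> (L + 1) * norm (y - x)" by (intro mult_right_mono) auto
      also have "\<dots> < e" using y L(1) by (simp add: dist_norm field_simps)
      finally show "dist (f y) (f x) < e" by (simp add: dist_norm)
    qed
  qed
  then show ?thesis unfolding continuous_on_iff by blast
qed

lemma integral_lipschitz:
  fixes \<phi> :: "real \<Rightarrow> 'a::banach"
  assumes \<phi>: "continuous_on {a..b} \<phi>" and M: "\<And>t. t \<in> {a..b} \<Longrightarrow> norm (\<phi> t) \<le> M"
    and x: "x \<in> {a..b}" and y: "y \<in> {a..b}"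
  shows "norm (integral {a..x} \<phi> - integral {a..y} \<phi>) \<le> M * \<bar>x - y\<bar>"
proof -
  have *: "norm (integral {a..y} \<phi> - integral {a..x} \<phi>) \<le> M * (y - x)"
    if xy: "x \<le> y" "x \<in> {a..b}" "y \<in> {a..b}" for x y
  proof -
    have "integral {a..x} \<phi> + integral {x..y} \<phi> = integral {a..y} \<phi>"
      by (rule Henstock_Kurzweil_Integration.integral_combine)
         (use xy in \<open>auto intro!: integrable_continuous_real continuous_on_subset[OF \<phi>]\<close>)
    then have "integral {a..y} \<phi> - integral {a..x} \<phi> = integral {x..y} \<phi>" by (simp add: algebra_simps)
    moreover have "norm (integral {x..y} \<phi>) \<le> M * (y - x)"
      by (rule integral_bound) (use xy M in \<open>auto intro!: continuous_on_subset[OF \<phi>]\<close>)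
    ultimately show ?thesis by simp
  qed
  show ?thesis
    using *[of x y] *[of y x] x y by (cases "x \<le> y") (auto simp: norm_minus_commute)
qed

text \<open>
  Picard--Lindelof: the integral operator is a contraction of ratio \<open>1/2\<close> on the curves
  staying in the unit ball around \<open>x0\<close>. Freezing time outside \<open>[t0 - h, t0 +
  h]\<close> lets these curves be bounded continuous functions on the whole line.
\<close>

lemma ode_local_solution:
  fixes f :: "'a::banach \<Rightarrow> 'a"
  assumes f: "locally_lipschitz f"
  shows "\<exists>h>0. \<exists>u. u t0 = x0 \<and> (\<forall>t\<in>{t0 - h<..<t0 + h}. (u has_vector_derivative f (u t)) (at t))"
proof -
  obtain L where L: "0 \<le> L" "\<And>y z. norm y \<le> norm x0 + 1 \<Longrightarrow> norm z \<le> norm x0 + 1 \<Longrightarrow> norm (f y - f z) \<le> L * norm (y - z)"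
    using f unfolding locally_lipschitz_def by blast
  have nb: "norm x \<le> norm x0 + 1" if "x \<in> cball x0 1" for x
    using that norm_triangle_ineq2[of x x0] by (simp add: dist_norm norm_minus_commute)
  define B where "B = norm (f x0) + L + 1"
  have B: "norm (f x) \<le> B" if x: "x \<in> cball x0 1" for x
  proof -
    have "norm (f x - f x0) \<le> L * norm (x - x0)" using L(2)[OF nb[OF x]] by simp
    also have "\<dots> \<le> L * 1" using x L(1) by (intro mult_left_mono) (auto simp: dist_norm norm_minus_commute)
    finally show ?thesis using norm_triangle_ineq2[of "f x" "f x0"] by (simp add: B_def)
  qed
  have B0: "1 \<le> B" using L(1) by (simp add: B_def)
  define h where "h = min (1 / B) (1 / (2 * (L + 1)))"
  have h: "0 < h" "B * h \<le> 1" "L * h \<le> 1 / 2"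
  proof -
    show "0 < h" using B0 L(1) by (simp add: h_def)
    have "B * h \<le> B * (1 / B)" using B0 by (intro mult_left_mono) (auto simp: h_def)
    then show "B * h \<le> 1" using B0 by simp
    have "L * h \<le> (L + 1) * (1 / (2 * (L + 1)))" using L(1) \<open>0 < h\<close> by (intro mult_mono) (auto simp: h_def)
    also have "(L + 1) * (1 / (2 * (L + 1))) = 1 / 2" using L(1) by (simp add: field_simps)
    finally show "L * h \<le> 1 / 2" .
  qed
  define a where "a = t0 - h"
  define b where "b = t0 + h"
  define cl where "cl t = max a (min b t)" for t
  have ab: "a \<le> t0" "t0 \<le> b" using h by (auto simp: a_def b_def)
  have cl: "cl t \<in> {a..b}" "\<bar>cl t - t0\<bar> \<le> h" for t using ab h by (auto simp: cl_def a_def b_def)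
  define \<Phi> where "\<Phi> v t = x0 + (integral {a..cl t} (\<lambda>\<tau>. f (v \<tau>)) - integral {a..t0} (\<lambda>\<tau>. f (v \<tau>)))" for v :: "real \<Rightarrow> 'a" and t
  define S where "S = PiC UNIV (\<lambda>_::real. cball x0 1)"
  have S: "v \<in> S \<longleftrightarrow> (\<forall>t. apply_bcontfun v t \<in> cball x0 1)" for v
    unfolding S_def mem_PiC_iff by auto
  have fv: "continuous_on {a..b} (\<lambda>\<tau>. f (apply_bcontfun v \<tau>))" for v :: "real \<Rightarrow>\<^sub>C 'a"
    by (rule continuous_on_compose2[OF locally_lipschitz_continuous[OF f, of UNIV]]) auto
  have near: "norm (\<Phi> (apply_bcontfun v) t - x0) \<le> 1" if v: "v \<in> S" for v t
  proof -
    have "norm (integral {a..cl t} (\<lambda>\<tau>. f (v \<tau>)) - integral {a..t0} (\<lambda>\<tau>. f (v \<tau>))) \<le> B * \<bar>cl t - t0\<bar>"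
      by (rule integral_lipschitz[OF fv _ cl(1)]) (use v ab S B in auto)
    also have "\<dots> \<le> B * h" using cl(2) B0 by (intro mult_left_mono) auto
    finally show ?thesis using h by (simp add: \<Phi>_def)
  qed
  have \<Phi>_cont: "continuous_on UNIV (\<Phi> (apply_bcontfun v))" for v :: "real \<Rightarrow>\<^sub>C 'a"
  proof -
    have "continuous_on {a..b} (\<lambda>x. integral {a..x} (\<lambda>\<tau>. f (v \<tau>)))"
      by (rule indefinite_integral_continuous_1[OF integrable_continuous_real[OF fv]])
    then have "continuous_on UNIV (\<lambda>t. integral {a..cl t} (\<lambda>\<tau>. f (v \<tau>)))"
      by (rule continuous_on_compose2) (use cl in \<open>auto simp: cl_def intro!: continuous_intros\<close>)
    then show ?thesis unfolding \<Phi>_def by (intro continuous_intros)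
  qed
  define T where "T v = Bcontfun (\<Phi> (apply_bcontfun v))" for v
  have T: "apply_bcontfun (T v) = \<Phi> (apply_bcontfun v)" if v: "v \<in> S" for v
    unfolding T_def
  proof (rule Bcontfun_inverse, rule bcontfun_normI[OF \<Phi>_cont])
    show "norm (\<Phi> (apply_bcontfun v) t) \<le> norm x0 + 1" for t
      using near[OF v, of t] norm_triangle_ineq2[of "\<Phi> (apply_bcontfun v) t" x0] by linarith
  qed
  have "\<exists>!v\<in>S. T v = v"
  proof (rule Banach_fix)
    show "complete S" unfolding complete_eq_closed S_def by (rule closed_PiC) auto
    show "S \<noteq> {}" using S[of "const_bcontfun x0"] by (auto simp: const_bcontfun.rep_eq)
    show "(0::real) \<le> 1/2" "(1/2::real) < 1" by auto
    show "T ` S \<subseteq> S"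
      using near T by (auto simp: S dist_norm norm_minus_commute)
    fix v w assume v: "v \<in> S" and w: "w \<in> S"
    show "dist (T v) (T w) \<le> 1/2 * dist v w"
    proof (rule dist_bound)
      fix t
      let ?\<phi> = "\<lambda>\<tau>. f (v \<tau>) - f (w \<tau>)"
      have i: "integral {a..x} ?\<phi> = integral {a..x} (\<lambda>\<tau>. f (v \<tau>)) - integral {a..x} (\<lambda>\<tau>. f (w \<tau>))" if "x \<in> {a..b}" for x
        by (rule Henstock_Kurzweil_Integration.integral_diff; rule integrable_continuous_real; rule continuous_on_subset[OF fv])
           (use that in auto)
      have "norm (integral {a..cl t} ?\<phi> - integral {a..t0} ?\<phi>) \<le> (L * dist v w) * \<bar>cl t - t0\<bar>"
      proof (rule integral_lipschitz[OF _ _ cl(1)])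
        show "continuous_on {a..b} ?\<phi>" by (intro continuous_on_diff fv)
        show "norm (?\<phi> \<tau>) \<le> L * dist v w" for \<tau>
        proof -
          have "norm (?\<phi> \<tau>) \<le> L * norm (v \<tau> - w \<tau>)" using v w S nb by (intro L(2)) auto
          also have "\<dots> \<le> L * dist v w"
            using dist_bounded[of v \<tau> w] L(1) by (intro mult_left_mono) (auto simp: dist_norm[of "apply_bcontfun v \<tau>"])
          finally show ?thesis .
        qed
      qed (use ab in auto)
      also have "\<dots> \<le> (L * dist v w) * h" using cl(2) L(1) by (intro mult_left_mono) auto
      also have "\<dots> = (L * h) * dist v w" by simp
      also have "\<dots> \<le> 1/2 * dist v w" using h(3) by (intro mult_right_mono) auto
      finally show "dist (T v t) (T w t) \<le> 1/2 * dist v w"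
        unfolding T[OF v] T[OF w] \<Phi>_def dist_norm using i[OF cl(1)[of t]] i[of t0] ab by (simp add: algebra_simps)
    qed
  qed
  then obtain v where v: "v \<in> S" "T v = v" by blast
  have veq: "apply_bcontfun v t = \<Phi> (apply_bcontfun v) t" for t using T[OF v(1)] v(2) by simp
  show ?thesis
  proof (intro exI[of _ h] exI[of _ "apply_bcontfun v"] conjI ballI)
    show "0 < h" by (rule h(1))
    have "cl t0 = t0" using ab by (simp add: cl_def)
    then show "apply_bcontfun v t0 = x0" by (subst veq) (simp add: \<Phi>_def)
    fix t assume t: "t \<in> {t0 - h<..<t0 + h}"
    have "((\<lambda>x. integral {a..x} (\<lambda>\<tau>. f (v \<tau>))) has_vector_derivative f (v t)) (at t within {a..b})"
      by (rule integral_has_vector_derivative[OF fv]) (use t in \<open>auto simp: a_def b_def\<close>)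
    then have d: "((\<lambda>x. integral {a..x} (\<lambda>\<tau>. f (v \<tau>))) has_vector_derivative f (v t)) (at t)"
      using t by (simp add: a_def b_def at_within_Icc_at)
    have "((\<lambda>x. x0 + (integral {a..x} (\<lambda>\<tau>. f (v \<tau>)) - integral {a..t0} (\<lambda>\<tau>. f (v \<tau>)))) has_vector_derivative f (v t)) (at t)"
      by (rule derivative_eq_intros d refl)+ simp
    then show "(apply_bcontfun v has_vector_derivative f (v t)) (at t)"
    proof (rule has_vector_derivative_transform_within_open[OF _ open_greaterThanLessThan t])
      fix x assume "x \<in> {t0 - h<..<t0 + h}"
      then have "cl x = x" by (auto simp: cl_def a_def b_def)
      then show "x0 + (integral {a..x} (\<lambda>\<tau>. f (v \<tau>)) - integral {a..t0} (\<lambda>\<tau>. f (v \<tau>))) = apply_bcontfun v x"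
        by (subst (2) veq) (simp add: \<Phi>_def)
    qed
  qed
qed

text \<open>
  Used to glue two solutions: a continuous curve that solves the equation on both sides of
  \<open>\<beta>\<close> satisfies the integral equation, hence solves it at \<open>\<beta>\<close>.
\<close>

lemma ode_derivative_at_junction:
  fixes f :: "'a::banach \<Rightarrow> 'a" and u :: "real \<Rightarrow> 'a"
  assumes f: "continuous_on UNIV f" and \<beta>: "a < \<beta>" "\<beta> < b" and u: "continuous_on {a..b} u"
    and d: "\<And>t. a < t \<Longrightarrow> t < b \<Longrightarrow> t \<noteq> \<beta> \<Longrightarrow> (u has_vector_derivative f (u t)) (at t)"
  shows "(u has_vector_derivative f (u \<beta>)) (at \<beta>)"
proof -
  have c: "continuous_on {a..b} (\<lambda>t. f (u t))"
    by (rule continuous_on_compose2[OF f u]) auto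
  have ft: "u a + integral {a..x} (\<lambda>t. f (u t)) = u x" if x: "x \<in> {a..b}" for x
  proof -
    have "((\<lambda>t. f (u t)) has_integral (u x - u a)) {a..x}"
      by (rule fundamental_theorem_of_calculus_interior_strong[of "{\<beta>}"])
         (use x d in \<open>auto intro: continuous_on_subset[OF u]\<close>)
    then show ?thesis by (simp add: integral_unique)
  qed
  have "((\<lambda>x. u a + integral {a..x} (\<lambda>t. f (u t))) has_vector_derivative 0 + f (u \<beta>)) (at \<beta> within {a..b})"
    by (intro has_vector_derivative_add has_vector_derivative_const integral_has_vector_derivative[OF c]) (use \<beta> in auto)
  then have "(u has_vector_derivative f (u \<beta>)) (at \<beta> within {a..b})"
    using \<beta> by (auto intro: has_vector_derivative_transform[OF _ ft[symmetric]] simp: ft)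
  then show ?thesis using \<beta> by (simp add: at_within_Icc_at)
qed

text \<open>
  A bounded solution has bounded derivative, so it is Lipschitz and has a limit at the right end of
  \<open>I\<close>, from which a local solution continues it.
\<close>

lemma ode_extend_right:
  fixes f :: "'a::banach \<Rightarrow> 'a" and u :: "real \<Rightarrow> 'a"
  assumes f: "locally_lipschitz f" and I: "open I" "is_interval I" "t0 \<in> I"
    and u: "\<And>t. t \<in> I \<Longrightarrow> (u has_vector_derivative f (u t)) (at t)"
    and \<beta>: "t0 < \<beta>" "\<beta> \<notin> I" and R: "\<And>t. t \<in> I \<Longrightarrow> t0 \<le> t \<Longrightarrow> norm (u t) \<le> R"
  shows "\<exists>J v. I \<subset> J \<and> open J \<and> is_interval J \<and> (\<forall>t\<in>I. v t = u t) \<and> (\<forall>t\<in>J. (v has_vector_derivative f (v t)) (at t))"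
proof -
  have lt: "t < \<beta>" if "t \<in> I" for t
    using mem_is_interval_1_I[OF I(2,3) that, of \<beta>] \<beta> by force
  define b where "b = Sup I"
  have bdd: "bdd_above I" using lt by (intro bdd_aboveI[of _ \<beta>]) (auto intro: less_imp_le)
  have le_b: "t \<le> b" if "t \<in> I" for t unfolding b_def using that bdd by (rule cSup_upper)
  have b_notin: "b \<notin> I"
  proof
    assume "b \<in> I"
    then obtain e where "0 < e" "ball b e \<subseteq> I" using I(1) open_contains_ball by blast
    then have "b + e / 2 \<in> I" by (auto simp: dist_real_def subset_iff)
    then show False using le_b \<open>0 < e\<close> by force
  qed
  have t0b: "t0 < b" using le_b[OF I(3)] b_notin I(3) by (cases "t0 = b") auto
  have inI: "t \<in> I" if t: "t0 \<le> t" "t < b" for t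
  proof -
    obtain x where "x \<in> I" "t < x" using less_cSup_iff[of I t] bdd I(3) t(2) unfolding b_def by auto
    then show ?thesis using mem_is_interval_1_I[OF I(2,3), of x t] t by simp
  qed
  obtain L where L: "0 \<le> L" "\<And>y z. norm y \<le> \<bar>R\<bar> \<Longrightarrow> norm z \<le> \<bar>R\<bar> \<Longrightarrow> norm (f y - f z) \<le> L * norm (y - z)"
    using f unfolding locally_lipschitz_def by blast
  define B where "B = norm (f 0) + L * \<bar>R\<bar>"
  have B: "norm (f (u t)) \<le> B" if "t \<in> I" "t0 \<le> t" for t
  proof -
    have "norm (u t) \<le> \<bar>R\<bar>" using R[OF that] by linarith
    then have "norm (f (u t) - f 0) \<le> L * norm (u t)" using L(2)[of "u t" 0] by simp
    also have "\<dots> \<le> L * \<bar>R\<bar>" using \<open>norm (u t) \<le> \<bar>R\<bar>\<close> L(1) by (rule mult_left_mono)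
    finally show ?thesis using norm_triangle_ineq2[of "f (u t)" "f 0"] by (simp add: B_def)
  qed
  have B0: "0 \<le> B" using L(1) by (simp add: B_def)
  have u_cont: "continuous_on I u"
    using u by (intro continuous_at_imp_continuous_on ballI has_vector_derivative_continuous)
  have lip: "norm (u t - u t') \<le> B * \<bar>t - t'\<bar>" if t: "t0 \<le> t" "t < b" "t0 \<le> t'" "t' < b" for t t'
  proof -
    have *: "norm (u y - u x) \<le> B * (y - x)" if xy: "t0 \<le> x" "x \<le> y" "y < b" for x y
    proof -
      have sub: "{x..y} \<subseteq> I" using xy inI by auto
      have "((\<lambda>t. f (u t)) has_integral (u y - u x)) {x..y}"
        by (rule fundamental_theorem_of_calculus[OF xy(2)], rule has_vector_derivative_at_within, rule u) (use sub in blast)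
      moreover have "norm (integral {x..y} (\<lambda>t. f (u t))) \<le> B * (y - x)"
      proof (rule integral_bound[OF xy(2)])
        show "continuous_on {x..y} (\<lambda>t. f (u t))"
          by (rule continuous_on_compose2[OF locally_lipschitz_continuous[OF f, of UNIV] continuous_on_subset[OF u_cont sub]]) auto
      qed (use B sub xy in auto)
      ultimately show ?thesis by (simp add: integral_unique)
    qed
    show ?thesis using *[of t t'] *[of t' t] t by (cases "t \<le> t'") (auto simp: norm_minus_commute)
  qed
  define X where "X n = b - (b - t0) / real (Suc n)" for n
  have X: "t0 \<le> X n" "X n < b" for n
  proof -
    have "(b - t0) / real (Suc n) \<le> (b - t0) / 1" by (rule divide_left_mono) (use t0b in auto)
    moreover have "0 < (b - t0) / real (Suc n)" by (rule divide_pos_pos) (use t0b in auto)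
    ultimately show "t0 \<le> X n" "X n < b" unfolding X_def div_by_1 by linarith+
  qed
  have Xlim: "X \<longlonglongrightarrow> b"
    unfolding X_def using LIMSEQ_inverse_real_of_nat[THEN tendsto_mult_left, of "b - t0", THEN tendsto_minus, THEN tendsto_add_const_iff[THEN iffD2], of b]
    by (simp add: divide_inverse)
  have "Cauchy (\<lambda>n. u (X n))"
  proof (rule metric_CauchyI)
    fix e :: real assume e: "0 < e"
    have "Cauchy X" using Xlim by (rule LIMSEQ_imp_Cauchy)
    then obtain M where M: "\<And>m n. m \<ge> M \<Longrightarrow> n \<ge> M \<Longrightarrow> dist (X m) (X n) < e / (B + 1)"
      using e B0 unfolding Cauchy_def by (metis add_nonneg_pos divide_pos_pos zero_less_one)
    have "dist (u (X m)) (u (X n)) < e" if "m \<ge> M" "n \<ge> M" for m n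
    proof -
      have "dist (u (X m)) (u (X n)) \<le> B * dist (X m) (X n)"
        using lip[OF X X, of m n] by (simp add: dist_norm)
      also have "\<dots> \<le> (B + 1) * dist (X m) (X n)" by (intro mult_right_mono) auto
      also have "\<dots> < e" using M[OF that] B0 by (simp add: field_simps)
      finally show ?thesis .
    qed
    then show "\<exists>M. \<forall>m\<ge>M. \<forall>n\<ge>M. dist (u (X m)) (u (X n)) < e" by blast
  qed
  then obtain x0 where x0: "(\<lambda>n. u (X n)) \<longlonglongrightarrow> x0" using Cauchy_convergent_iff convergent_def by blast
  have near: "norm (u t - x0) \<le> B * (b - t)" if t: "t0 \<le> t" "t < b" for t
  proof (rule LIMSEQ_le)
    show "(\<lambda>n. norm (u t - u (X n))) \<longlonglongrightarrow> norm (u t - x0)" by (intro tendsto_intros x0)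
    show "(\<lambda>n. B * \<bar>t - X n\<bar>) \<longlonglongrightarrow> B * (b - t)"
      using tendsto_mult_left[OF tendsto_rabs[OF tendsto_diff[OF tendsto_const[of t] Xlim]], of B] t by simp
    show "\<exists>N. \<forall>n\<ge>N. norm (u t - u (X n)) \<le> B * \<bar>t - X n\<bar>" using lip[OF t X] by blast
  qed
  obtain h z where h: "0 < h" and z: "z b = x0" "\<And>t. t \<in> {b - h<..<b + h} \<Longrightarrow> (z has_vector_derivative f (z t)) (at t)"
    using ode_local_solution[OF f, of b x0] by blast
  define v where "v t = (if t < b then u t else z t)" for t
  define J where "J = I \<union> {t0<..<b + h}"
  have J: "J = I \<union> {b..<b + h}" using inI t0b le_b h unfolding J_def by (auto simp: not_le)
  have d1: "(v has_vector_derivative f (v t)) (at t)" if "t \<in> I" for t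
  proof -
    have "(u has_vector_derivative f (v t)) (at t)"
      using u[OF that] le_b[OF that] that b_notin by (cases "t = b") (auto simp: v_def)
    then show ?thesis
    proof (rule has_vector_derivative_transform_within_open[OF _ I(1) that])
      show "u x = v x" if "x \<in> I" for x using le_b[OF that] that b_notin by (cases "x = b") (auto simp: v_def)
    qed
  qed
  have d2: "(v has_vector_derivative f (v t)) (at t)" if t: "b < t" "t < b + h" for t
  proof -
    have "(z has_vector_derivative f (v t)) (at t)" using z(2)[of t] t h by (simp add: v_def)
    then show ?thesis
      by (rule has_vector_derivative_transform_within_open[OF _ open_greaterThanLessThan[of b "b + h"]]) (use t in \<open>auto simp: v_def\<close>)
  qed
  have d3: "(v has_vector_derivative f (v b)) (at b)"
  proof (rule ode_derivative_at_junction[OF locally_lipschitz_continuous[OF f]])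
    let ?a = "(t0 + b) / 2" and ?b = "b + h / 2"
    show "?a < b" "b < ?b" using t0b h by auto
    show "(v has_vector_derivative f (v t)) (at t)" if "?a < t" "t < ?b" "t \<noteq> b" for t
    proof (cases "t < b")
      case True
      then show ?thesis using d1 inI[of t] that t0b by simp
    next
      case False
      then show ?thesis using d2[of t] that h by simp
    qed
    have vb: "isCont v b"
      unfolding continuous_at
    proof (rule filterlim_split_at)
      have "((\<lambda>t. B * (b - t)) \<longlongrightarrow> B * (b - b)) (at_left b)" by (intro tendsto_intros)
      moreover have "\<forall>\<^sub>F t in at_left b. norm (v t - x0) \<le> B * (b - t)"
        using eventually_at_left_real[OF t0b] by eventually_elim (use near in \<open>auto simp: v_def\<close>)
      ultimately have "((\<lambda>t. v t - x0) \<longlongrightarrow> 0) (at_left b)"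
        by (intro Lim_null_comparison[of "\<lambda>t. v t - x0" "\<lambda>t. B * (b - t)"]) auto
      then have "(v \<longlongrightarrow> x0) (at_left b)" by (rule LIM_zero_cancel)
      then show "(v \<longlongrightarrow> v b) (at_left b)" using z(1) by (simp add: v_def[of b])
      have "isCont z b" by (rule has_vector_derivative_continuous[OF z(2)]) (use h in auto)
      then have "(z \<longlongrightarrow> z b) (at_right b)" by (simp add: continuous_at filterlim_at_split)
      moreover have "\<forall>\<^sub>F t in at_right b. z t = v t" by (auto simp: eventually_at_filter v_def)
      ultimately have "(v \<longlongrightarrow> z b) (at_right b)" by (rule Lim_transform_eventually)
      then show "(v \<longlongrightarrow> v b) (at_right b)" by (simp add: v_def[of b])
    qed
    show "continuous_on {?a..?b} v"
    proof (intro continuous_at_imp_continuous_on ballI)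
      fix t assume t: "t \<in> {?a..?b}"
      consider "t < b" | "t = b" | "b < t" by linarith
      then show "isCont v t"
      proof cases
        case 1
        then have "t \<in> I" using t t0b by (intro inI) auto
        then show ?thesis by (rule has_vector_derivative_continuous[OF d1])
      next
        case 2 then show ?thesis using vb by simp
      next
        case 3
        then show ?thesis by (rule has_vector_derivative_continuous[OF d2]) (use t h in auto)
      qed
    qed
  qed
  show ?thesis
  proof (intro exI[of _ J] exI[of _ v] conjI ballI)
    show "I \<subset> J" using b_notin h unfolding J by auto
    show "open J" unfolding J_def using I(1) by auto
    have "(t0 + b) / 2 \<in> I \<inter> {t0<..<b + h}" using inI[of "(t0 + b) / 2"] t0b h by simp
    then have "connected (I \<union> {t0<..<b + h})"
      using I(2) by (intro connected_Un) (auto simp: is_interval_connected_1)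
    then show "is_interval J" unfolding J_def by (simp add: is_interval_connected_1)
    show "v t = u t" if "t \<in> I" for t using le_b[OF that] that b_notin by (cases "t = b") (auto simp: v_def)
    fix t assume "t \<in> J"
    then consider "t \<in> I" | "t = b" | "b < t" "t < b + h" unfolding J by force
    then show "(v has_vector_derivative f (v t)) (at t)"
      using d1 d2 d3 by cases auto
  qed
qed

lemma has_vector_derivative_reflect:
  assumes "(u has_vector_derivative D) (at (- t))"
  shows "((\<lambda>t. u (- t)) has_vector_derivative - D) (at t)"
proof -
  have "(uminus has_vector_derivative - (1::real)) (at t)"
    by (auto intro!: derivative_eq_intros)
  from vector_diff_chain_at[OF this, of u D] assms show ?thesis by (simp add: o_def)
qed

lemma ode_extend_left:
  fixes f :: "'a::banach \<Rightarrow> 'a" and u :: "real \<Rightarrow> 'a"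
  assumes f: "locally_lipschitz f" and I: "open I" "is_interval I" "t0 \<in> I"
    and u: "\<And>t. t \<in> I \<Longrightarrow> (u has_vector_derivative f (u t)) (at t)"
    and \<beta>: "\<beta> < t0" "\<beta> \<notin> I" and R: "\<And>t. t \<in> I \<Longrightarrow> t \<le> t0 \<Longrightarrow> norm (u t) \<le> R"
  shows "\<exists>J v. I \<subset> J \<and> open J \<and> is_interval J \<and> (\<forall>t\<in>I. v t = u t) \<and> (\<forall>t\<in>J. (v has_vector_derivative f (v t)) (at t))"
proof -
  have mem: "t \<in> uminus ` S \<longleftrightarrow> - t \<in> S" for t and S :: "real set"
    by (metis image_iff minus_minus)
  have f': "locally_lipschitz (\<lambda>x. - f x)"
    using f unfolding locally_lipschitz_def by (simp add: norm_minus_commute)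
  have "\<exists>J v. uminus ` I \<subset> J \<and> open J \<and> is_interval J \<and> (\<forall>t\<in>uminus ` I. v t = u (- t)) \<and> (\<forall>t\<in>J. (v has_vector_derivative - f (v t)) (at t))"
  proof (rule ode_extend_right[OF f', of "uminus ` I" "- t0" "\<lambda>t. u (- t)" "- \<beta>" R])
    show "open (uminus ` I)" using I(1) by (rule open_negations)
    show "is_interval (uminus ` I)" using I(2) by simp
    show "((\<lambda>t. u (- t)) has_vector_derivative - f (u (- t))) (at t)" if "t \<in> uminus ` I" for t
      by (rule has_vector_derivative_reflect) (use u that mem in auto)
  qed (use I \<beta> R mem in auto)
  then obtain J v where J: "uminus ` I \<subset> J" "open J" "is_interval J" "\<forall>t\<in>uminus ` I. v t = u (- t)"
    "\<forall>t\<in>J. (v has_vector_derivative - f (v t)) (at t)" by (elim exE conjE)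
  show ?thesis
  proof (intro exI[of _ "uminus ` J"] exI[of _ "\<lambda>t. v (- t)"] conjI ballI)
    show "I \<subset> uminus ` J"
    proof (rule psubsetI)
      show "I \<subseteq> uminus ` J" using J(1) mem by force
      obtain t where "t \<in> J" "t \<notin> uminus ` I" using J(1) by blast
      then show "I \<noteq> uminus ` J" using mem by force
    qed
    show "open (uminus ` J)" using J(2) by (rule open_negations)
    show "is_interval (uminus ` J)" using J(3) by simp
    show "v (- t) = u t" if "t \<in> I" for t using bspec[OF J(4), of "- t"] that by simp
    show "((\<lambda>t. v (- t)) has_vector_derivative f (v (- t))) (at t)" if "t \<in> uminus ` J" for t
      using has_vector_derivative_reflect[OF bspec[OF J(5)], of t] that mem by simp
  qed
qed

section \<open>Trigonometric polynomials and continuation of the filtered solutions\<close>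

lemma l1_le_finite_support:
  fixes c :: "'k \<Rightarrow> 'b::real_normed_vector"
  assumes "finite S" "\<And>k. k \<notin> S \<Longrightarrow> c k = 0"
  shows "l1_le c (\<Sum>k\<in>S. norm (c k))"
  unfolding l1_le_def
proof (intro allI impI)
  fix F :: "'k set" assume F: "finite F"
  have "(\<Sum>k\<in>F. norm (c k)) = (\<Sum>k\<in>F \<inter> S. norm (c k))"
    by (rule sum.mono_neutral_right) (use F assms(2) in auto)
  also have "\<dots> \<le> (\<Sum>k\<in>S. norm (c k))" by (rule sum_mono2) (use assms(1) in auto)
  finally show "(\<Sum>k\<in>F. norm (c k)) \<le> (\<Sum>k\<in>S. norm (c k))" .
qed

instance bcontfun :: (metric_space, banach) banach ..

text \<open>
  The real trigonometric monomial with coefficient \<open>z\<close> in component \<open>a\<close>,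
  as an element of the Banach space of bounded continuous functions.
\<close>

definition mode :: "int^'d \<Rightarrow> 'n::finite \<Rightarrow> complex \<Rightarrow> (real^'d) \<Rightarrow>\<^sub>C (real^'n)" where
  "mode k a z = Bcontfun (\<lambda>x. Re (z * cis (phase k x)) *\<^sub>R axis a 1)"

lemma mode_apply:
  fixes a :: "'n::finite"
  shows "apply_bcontfun (mode k a z) x = Re (z * cis (phase k x)) *\<^sub>R axis a 1"
proof -
  have "(\<lambda>x. Re (z * cis (phase k x)) *\<^sub>R (axis a 1 :: real^'n)) \<in> bcontfun"
  proof (rule bcontfun_normI)
    show "continuous_on UNIV (\<lambda>x. Re (z * cis (phase k x)) *\<^sub>R (axis a 1 :: real^'n))"
      by (intro continuous_intros)
    show "norm (Re (z * cis (phase k x)) *\<^sub>R (axis a 1 :: real^'n)) \<le> norm z" for x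
      using abs_Re_le_cmod[of "z * cis (phase k x)"] by (simp add: norm_mult)
  qed
  then show ?thesis unfolding mode_def by (simp add: Bcontfun_inverse)
qed

lemma norm_mode_le: "norm (mode k a z) \<le> norm z"
  by (rule norm_bound) (use abs_Re_le_cmod[of "z * cis (phase k _)"] in \<open>simp add: mode_apply norm_mult\<close>)

lemma bounded_linear_mode: "bounded_linear (mode k a)"
proof (rule bounded_linear_intro[of _ 1])
  show "mode k a (y + z) = mode k a y + mode k a z" for y z
    by (rule bcontfun_eqI) (simp add: mode_apply distrib_right scaleR_left_distrib plus_bcontfun.rep_eq)
  show "mode k a (r *\<^sub>R z) = r *\<^sub>R mode k a z" for r z
    by (rule bcontfun_eqI) (simp add: mode_apply scaleR_bcontfun.rep_eq)
  show "norm (mode k a z) \<le> norm z * 1" for z using norm_mode_le by simp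
qed

lemma bounded_linear_evaluation: "bounded_linear (\<lambda>v::'a::topological_space \<Rightarrow>\<^sub>C 'b::real_normed_vector. apply_bcontfun v x)"
  by (rule bounded_linear_intro[of _ 1])
     (auto simp: plus_bcontfun.rep_eq scaleR_bcontfun.rep_eq norm_bounded)

text \<open>
  The sharp truncation, as an element of the same space.
\<close>

definition trig :: "nat \<Rightarrow> (real^'d \<Rightarrow> real^'n) \<Rightarrow> (real^'d) \<Rightarrow>\<^sub>C (real^'n::finite)" where
  "trig N V = (\<Sum>a\<in>UNIV. \<Sum>k\<in>box_modes N. mode k a (hat V a k))"

lemma sharp_filter_eq:
  fixes V :: "real^'d \<Rightarrow> real^'n::finite"
  shows "sharp_filter N V x = (\<Sum>a\<in>UNIV. \<Sum>k\<in>box_modes N. Re (hat V a k * cis (phase k x)) *\<^sub>R axis a 1)"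
proof (subst vec_eq_iff, rule allI)
  fix i
  have "(\<Sum>\<^sub>\<infinity>k. of_real (indicator (box_modes N) k) * (fourier_coeff V k $ i) * cis (phase k x))
      = (\<Sum>\<^sub>\<infinity>k\<in>box_modes N. hat V i k * cis (phase k x))"
    by (rule infsum_cong_neutral) (auto simp: hat_eq)
  then have l: "sharp_filter N V x $ i = (\<Sum>k\<in>box_modes N. Re (hat V i k * cis (phase k x)))"
    unfolding sharp_filter_def fourier_multiplier_def box_modes_def[symmetric]
    by (simp add: finite_box_modes del: times_complex.sel)
  have "(\<Sum>a\<in>UNIV. \<Sum>k\<in>box_modes N. Re (hat V a k * cis (phase k x)) *\<^sub>R (axis a 1 :: real^'n)) $ i
      = (\<Sum>a\<in>UNIV. if a = i then \<Sum>k\<in>box_modes N. Re (hat V a k * cis (phase k x)) else 0)"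
    unfolding sum_component vector_scaleR_component by (rule sum.cong) (auto simp: axis_def)
  then show "sharp_filter N V x $ i = (\<Sum>a\<in>UNIV. \<Sum>k\<in>box_modes N. Re (hat V a k * cis (phase k x)) *\<^sub>R (axis a 1 :: real^'n)) $ i"
    unfolding l by simp
qed

lemma trig_apply: "apply_bcontfun (trig N V) = sharp_filter N V"
  unfolding fun_eq_iff trig_def sharp_filter_eq
  by (simp add: linear_sum[OF bounded_linear.linear[OF bounded_linear_evaluation]] mode_apply del: times_complex.sel)

lemma hat_sharp_filter: "hat (sharp_filter N V) a k = indicator (box_modes N) k * hat V a k"
  unfolding hat_def[of "sharp_filter N V"] sharp_filter_coeff(2) ..

lemma wiener_eqI:
  assumes "wiener f" "wiener g" "fco f = fco g"
  shows "f = g"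
proof
  fix x
  have "complex_of_real (f x) = complex_of_real (g x)"
    by (simp only: wiener_series[OF assms(1), of x] wiener_series[OF assms(2), of x] assms(3))
  then show "f x = g x" by simp
qed

text \<open>
  A function with absolutely convergent Fourier series is determined by its coefficients.
\<close>

lemma sharp_filter_id:
  assumes "wiener_vec V" "\<And>a k. k \<notin> box_modes N \<Longrightarrow> hat V a k = 0"
  shows "sharp_filter N V = V"
proof -
  have "(\<lambda>x. sharp_filter N V x $ a) = (\<lambda>x. V x $ a)" for a
  proof (rule wiener_eqI[OF sharp_filter_coeff(1)])
    show "wiener (\<lambda>x. V x $ a)" using assms(1) by (simp add: wiener_vec_def)
    show "fco (\<lambda>x. sharp_filter N V x $ a) = fco (\<lambda>x. V x $ a)"
      unfolding sharp_filter_coeff(2) using assms(2)[of _ a] by (auto simp: fun_eq_iff hat_def indicator_def)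
  qed
  then show ?thesis by (simp add: fun_eq_iff vec_eq_iff)
qed

lemma sharp_filter_differentiable:
  fixes V :: "real^'d \<Rightarrow> real^'n::finite"
  shows "sharp_filter N V differentiable (at x)"
proof -
  have ph: "phase k x = emb k \<bullet> x" for k and x :: "real^'d" by (simp add: phase_def emb_def inner_vec_def)
  have "((\<lambda>x. (p * cos (e \<bullet> x) - q * sin (e \<bullet> x)) *\<^sub>R v) has_derivative
      (\<lambda>h. (p * (- sin (e \<bullet> x) * (e \<bullet> h)) - q * (cos (e \<bullet> x) * (e \<bullet> h))) *\<^sub>R v)) (at x)"
    for p q and e :: "real^'d" and v :: "real^'n"
    by (auto intro!: derivative_eq_intros simp: algebra_simps)
  then have d: "(\<lambda>x. (p * cos (e \<bullet> x) - q * sin (e \<bullet> x)) *\<^sub>R v) differentiable (at x)"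
    for p q and e :: "real^'d" and v :: "real^'n"
    unfolding differentiable_def by blast
  show ?thesis
    unfolding sharp_filter_eq[abs_def] ph times_complex.sel cis.sel
    by (intro differentiable_sum finite_box_modes finite ballI d)
qed

lemma box_l1_le:
  fixes c :: "int^'d \<Rightarrow> complex"
  assumes "\<And>k. k \<notin> box_modes N \<Longrightarrow> c k = 0" "\<And>k. k \<in> box_modes N \<Longrightarrow> norm (c k) \<le> M"
  shows "l1_le (wt r c) ((\<Sum>k\<in>(box_modes N :: (int^'d) set). jb k powr r) * M)"
proof -
  have "l1_le (wt r c) (\<Sum>k\<in>box_modes N. norm (wt r c k))"
    by (rule l1_le_finite_support[OF finite_box_modes]) (use assms(1) in \<open>simp add: wt_def\<close>)
  moreover have "(\<Sum>k\<in>box_modes N. norm (wt r c k)) \<le> (\<Sum>k\<in>(box_modes N :: (int^'d) set). jb k powr r * M)"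
    by (rule sum_mono) (use assms(2) in \<open>auto simp: wt_def abs_mult intro!: mult_left_mono\<close>)
  ultimately show ?thesis unfolding sum_distrib_right by (rule l1_le_weaken)
qed

lemma sharp_filter_good:
  fixes V :: "real^'d \<Rightarrow> real^'n::finite"
  assumes "\<And>a k. norm (hat V a k) \<le> M"
  shows "good (sharp_filter N V) ((\<Sum>k\<in>(box_modes N :: (int^'d) set). jb k powr 1) * M)"
  unfolding good_def wiener_vec_def
proof (intro conjI allI sharp_filter_coeff(1) sharp_filter_differentiable box_l1_le)
  fix a k
  show "k \<notin> box_modes N \<Longrightarrow> hat (sharp_filter N V) a k = 0" by (simp add: hat_sharp_filter)
  show "norm (hat (sharp_filter N V) a k) \<le> M" if "k \<in> box_modes N"
    using assms[of a k] that by (simp add: hat_sharp_filter)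
qed

lemma norm_fourier_coeff_le: "norm (fourier_coeff V k) \<le> (\<Sum>a\<in>UNIV. norm (hat V a k))"
  unfolding norm_vec_def hat_eq by (rule L2_set_le_sum) auto

lemma continuous_imp_lebesgue_measurable:
  fixes f :: "real^'d \<Rightarrow> 'b::topological_space"
  assumes "continuous_on UNIV f"
  shows "f \<in> borel_measurable lebesgue"
proof (rule measurable_completion)
  have "f \<in> borel_measurable borel" by (rule borel_measurable_continuous_onI[OF assms])
  then show "f \<in> borel_measurable lborel" by simp
qed

lemma sharp_filter_sobolev:
  fixes V :: "real^'d \<Rightarrow> real^'n::finite"
  assumes "\<And>a k. norm (hat V a k) \<le> M"
  shows "in_sobolev s (sharp_filter N V)"
    and "sobolev_norm s (sharp_filter N V) \<le> (\<Sum>k\<in>(box_modes N::(int^'d) set). jb k powr s) * (real CARD('n) * M)"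
proof -
  have fc: "fourier_coeff (sharp_filter N V) k = (if k \<in> box_modes N then fourier_coeff V k else 0)" for k
    by (simp add: vec_eq_iff hat_eq[symmetric] hat_sharp_filter)
  have "norm (fourier_coeff V k) \<le> real CARD('n) * M" for k
    using order_trans[OF norm_fourier_coeff_le sum_bounded_above[of UNIV "\<lambda>a. norm (hat V a k)" M]] assms by simp
  then have le: "norm (wt s (fourier_coeff (sharp_filter N V)) k) \<le> (if k \<in> box_modes N then jb k powr s * (real CARD('n) * M) else 0)" for k
    by (auto simp: wt_def fc intro!: mult_left_mono)
  have "(\<Sum>k\<in>F. norm (wt s (fourier_coeff (sharp_filter N V)) k)) \<le> (\<Sum>k\<in>(box_modes N::(int^'d) set). jb k powr s * (real CARD('n) * M))" if "finite F" for F
  proof -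
    have "(\<Sum>k\<in>F. norm (wt s (fourier_coeff (sharp_filter N V)) k)) \<le> (\<Sum>k\<in>F. if k \<in> box_modes N then jb k powr s * (real CARD('n) * M) else 0)"
      by (rule sum_mono, rule le)
    also have "\<dots> = (\<Sum>k\<in>F \<inter> box_modes N. jb k powr s * (real CARD('n) * M))"
      using that by (simp add: sum.inter_restrict)
    also have "\<dots> \<le> (\<Sum>k\<in>(box_modes N :: (int^'d) set). jb k powr s * (real CARD('n) * M))"
    proof (rule sum_mono2[OF finite_box_modes])
      have "0 \<le> M" using assms order_trans[OF norm_ge_zero] by blast
      then show "0 \<le> jb k powr s * (real CARD('n) * M)" for k :: "int^'d" by simp
    qed auto
    finally show ?thesis .
  qed
  then have "l1_le (wt s (fourier_coeff (sharp_filter N V))) ((\<Sum>k\<in>(box_modes N::(int^'d) set). jb k powr s) * (real CARD('n) * M))"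
    unfolding l1_le_def sum_distrib_right by blast
  note l2 = l1_imp_l2_le[OF this]
  show "sobolev_norm s (sharp_filter N V) \<le> (\<Sum>k\<in>(box_modes N::(int^'d) set). jb k powr s) * (real CARD('n) * M)"
    by (rule sobolev_norm_le(1)[OF l2])
  have c: "continuous_on UNIV (sharp_filter N V)"
    by (intro continuous_at_imp_continuous_on ballI differentiable_imp_continuous_within sharp_filter_differentiable)
  have "torus_periodic (sharp_filter N V)"
    using sharp_filter_coeff(1)[of N V] by (simp add: wiener_def torus_periodic_def vec_eq_iff)
  moreover have "sharp_filter N V \<in> borel_measurable lebesgue"
    by (rule continuous_imp_lebesgue_measurable[OF c])
  moreover have "set_integrable lebesgue torus_cell (\<lambda>x. (norm (sharp_filter N V x))\<^sup>2)"
    by (intro cell_integrable_continuous continuous_intros c)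
  ultimately show "in_sobolev s (sharp_filter N V)"
    by (intro sobolev_norm_le(2)[OF l2]) (simp add: torus_L2_def)
qed

lemma norm_hat_bcontfun: "norm (hat (apply_bcontfun v) a k) \<le> norm (v :: (real^'d) \<Rightarrow>\<^sub>C (real^'n))"
  unfolding hat_def fco_def
proof (rule norm_mean_le)
  fix x
  have "\<bar>v x $ a\<bar> \<le> norm (v x)" by (rule component_le_norm_cart)
  then show "norm (complex_of_real (v x $ a) * cis (- phase k x)) \<le> norm v"
    using norm_bounded[of v x] by (simp add: norm_mult)
qed

lemma bounded_linear_hat: "bounded_linear (\<lambda>v :: (real^'d) \<Rightarrow>\<^sub>C (real^'n). hat (apply_bcontfun v) a k)"
proof (rule bounded_linear_intro[of _ 1])
  have c: "continuous_on UNIV (\<lambda>x. apply_bcontfun v x $ a)" for v :: "(real^'d) \<Rightarrow>\<^sub>C (real^'n)"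
    by (intro continuous_intros) auto
  show "hat (apply_bcontfun (v + w)) a k = hat (apply_bcontfun v) a k + hat (apply_bcontfun w) a k" for v w :: "(real^'d) \<Rightarrow>\<^sub>C (real^'n)"
    by (simp add: hat_def plus_bcontfun.rep_eq fco_add c)
  show "hat (apply_bcontfun (r *\<^sub>R v)) a k = r *\<^sub>R hat (apply_bcontfun v) a k" for r and v :: "(real^'d) \<Rightarrow>\<^sub>C (real^'n)"
    by (simp add: hat_def scaleR_bcontfun.rep_eq fco_cmult) (simp add: scaleR_conv_of_real)
  show "norm (hat (apply_bcontfun v) a k) \<le> norm v * 1" for v :: "(real^'d) \<Rightarrow>\<^sub>C (real^'n)"
    using norm_hat_bcontfun by simp
qed

lemma bounded_linear_trig: "bounded_linear (\<lambda>v :: (real^'d) \<Rightarrow>\<^sub>C (real^'n). trig N (apply_bcontfun v))"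
  unfolding trig_def
  by (intro bounded_linear_sum bounded_linear_compose[OF bounded_linear_mode bounded_linear_hat])

lemma trig_sharp_filter: "trig N (sharp_filter N V) = trig N V"
  unfolding trig_def by (intro sum.cong refl) (simp add: hat_sharp_filter)

text \<open>
  The initial condition only determines the solution almost everywhere.
\<close>

lemma fourier_coeff_cong_AE:
  fixes f g :: "real^'d \<Rightarrow> real^'n"
  assumes "AE x in lebesgue. f x = g x" and f: "f \<in> borel_measurable lebesgue" and g: "g \<in> borel_measurable lebesgue"
  shows "fourier_coeff f = fourier_coeff g"
proof -
  have m: "(\<lambda>x. indicator torus_cell x *\<^sub>R (complex_of_real (f x $ i) * cis (- phase k x))) \<in> borel_measurable lebesgue"
    if f: "f \<in> borel_measurable lebesgue" for f :: "real^'d \<Rightarrow> real^'n" and i k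
  proof -
    have "(\<lambda>x. complex_of_real (f x $ i)) \<in> borel_measurable lebesgue"
      by (rule measurable_compose[OF f borel_measurable_continuous_onI]) (intro continuous_intros)
    moreover have "(\<lambda>x::real^'d. cis (- phase k x)) \<in> borel_measurable lebesgue"
      by (intro continuous_imp_lebesgue_measurable continuous_intros)
    moreover have "(\<lambda>x::real^'d. indicator torus_cell x :: real) \<in> borel_measurable lebesgue"
      by (rule borel_measurable_indicator[OF torus_cell_measure(2)])
    ultimately show ?thesis by (intro borel_measurable_scaleR borel_measurable_times)
  qed
  have "(LINT x:torus_cell|lebesgue. complex_of_real (f x $ i) * cis (- phase k x))
      = (LINT x:torus_cell|lebesgue. complex_of_real (g x $ i) * cis (- phase k x))" for i k
    unfolding set_lebesgue_integral_def
    by (rule integral_cong_AE[OF m[OF f] m[OF g]]) (use assms(1) in \<open>auto elim: eventually_mono\<close>)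
  then show ?thesis by (simp add: fourier_coeff_def fun_eq_iff)
qed

context symmetric_system
begin

text \<open>
  Coefficient by coefficient, the two convolutions differ by one term in which the derivatives
  differ and one in which the matrices differ.
\<close>

lemma system_lipschitz:
  assumes F: "multiplier_system A ea ch F"
  shows "\<exists>C\<ge>0. \<forall>V W E a k. good V R \<and> good W R \<and> (\<forall>a. l1_le (wt 1 (\<lambda>k. hat V a k - hat W a k)) E) \<longrightarrow>
     norm (fco (\<lambda>x. F V x $ a) k - fco (\<lambda>x. F W x $ a) k) \<le> C * E"
proof -
  define C1 where "C1 = (\<Sum>a\<in>UNIV. \<Sum>j\<in>UNIV. \<Sum>b\<in>UNIV. \<bar>A j 0 $ a $ b\<bar>)"
  define C2 where "C2 = (\<Sum>j\<in>(UNIV::'d set). \<Sum>b\<in>(UNIV::'n set). 2 * \<bar>Ct R * R\<bar>)"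
  have main: "norm (fco (\<lambda>x. F V x $ a) k - fco (\<lambda>x. F W x $ a) k) \<le> (C1 + C2) * E"
    if V: "good V R" and W: "good W R" and E: "\<And>a. l1_le (wt 1 (\<lambda>k. hat V a k - hat W a k)) E" for V W E a k
  proof -
    have R: "0 \<le> R" using goodD(5)[OF V] .
    have E0: "0 \<le> E" using l1_le_nonneg[OF E] .
    define w where "w b k = hat V b k - hat W b k" for b k
    have ww: "(\<lambda>k. hat V b k - hat W b k) = w b" for b by (simp add: w_def fun_eq_iff)
    have dE: "l1_le (deriv_coeff j (w b)) E" for j b using deriv_coeff_l1[OF E[of b]] by (simp only: ww)
    have D: "l2_le (\<lambda>k. hat V b k - hat W b k) E" for b
      by (rule l1_imp_l2_le, rule l1_le_of_wt[OF _ E]) simp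
    have ec: "\<bar>ea k\<bar> \<le> 1" "\<bar>ch k\<bar> \<le> 1" using F by (auto simp: multiplier_system_def)
    have "lin_coeff A V a k - lin_coeff A W a k = (\<Sum>j\<in>UNIV. \<Sum>b\<in>UNIV. of_real (A j 0 $ a $ b) * deriv_coeff j (w b) k)"
      by (simp add: lin_coeff_def w_def[abs_def] deriv_coeff_diff sum_subtractf[symmetric] right_diff_distrib)
    also have "norm \<dots> \<le> (\<Sum>j\<in>UNIV. \<Sum>b\<in>UNIV. \<bar>A j 0 $ a $ b\<bar> * E)"
      by (intro sum_norm_le) (auto simp: norm_mult intro!: mult_left_mono l1_le_norm[OF dE])
    also have "\<dots> = (\<Sum>j\<in>UNIV. \<Sum>b\<in>UNIV. \<bar>A j 0 $ a $ b\<bar>) * E" by (simp only: sum_distrib_right)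
    also have "\<dots> \<le> C1 * E"
      unfolding C1_def using E0
      by (intro mult_right_mono member_le_sum[of a UNIV "\<lambda>a. \<Sum>j\<in>UNIV. \<Sum>b\<in>UNIV. \<bar>A j 0 $ a $ b\<bar>"]) (auto intro!: sum_nonneg)
    finally have lin: "norm (lin_coeff A V a k - lin_coeff A W a k) \<le> C1 * E" .
    have nl1: "norm (conv (perturbation_coeff A V j a b) (deriv_coeff j (hat V b)) k
        - conv (perturbation_coeff A W j a b) (deriv_coeff j (hat W b)) k) \<le> 2 * \<bar>Ct R * R\<bar> * E" for j b
    proof -
      have p: "l1_le (perturbation_coeff A V j a b) (Ct R * R)" "l1_le (perturbation_coeff A W j a b) (Ct R * R)"
        by (rule l1_le_of_wt[OF _ perturbation_l1[OF V order_refl]] l1_le_of_wt[OF _ perturbation_l1[OF W order_refl]]; simp)+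
      note n = l1_le_norm[OF deriv_coeff_l1[OF goodD(4)[OF V, of b], of j]] l1_le_norm[OF deriv_coeff_l1[OF goodD(4)[OF W, of b], of j]]
      have dw: "(\<lambda>l. deriv_coeff j (hat V b) l - deriv_coeff j (hat W b) l) = deriv_coeff j (w b)"
        by (simp add: fun_eq_iff w_def[abs_def] deriv_coeff_diff)
      note eq = conv_diff[OF conv_summable_left[OF p(1) n(1)] conv_summable_left[OF p(2) n(2)] conv_summable_left[OF p(1) n(2)]]
      have "norm (conv (perturbation_coeff A V j a b) (deriv_coeff j (w b)) k) \<le> (Ct R * R) * E"
        by (rule l1_le_norm[OF conv_l1[OF p(1) dE]])
      moreover have "norm (conv (\<lambda>l. perturbation_coeff A V j a b l - perturbation_coeff A W j a b l) (deriv_coeff j (hat W b)) k) \<le> (Ct R * E) * R"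
        by (rule l2_le_norm[OF conv_l2'[OF perturbation_diff[OF V W D] deriv_coeff_l1[OF goodD(4)[OF W]]]])
      ultimately have "norm (conv (perturbation_coeff A V j a b) (deriv_coeff j (hat V b)) k
        - conv (perturbation_coeff A W j a b) (deriv_coeff j (hat W b)) k) \<le> (Ct R * R) * E + (Ct R * E) * R"
        unfolding eq dw by (rule norm_triangle_mono)
      also have "\<dots> = 2 * \<bar>Ct R * R\<bar> * E" using Ct_nonneg[OF R] R by simp
      finally show ?thesis .
    qed
    have "nonlin_coeff A V a k - nonlin_coeff A W a k = (\<Sum>j\<in>UNIV. \<Sum>b\<in>UNIV. conv (perturbation_coeff A V j a b) (deriv_coeff j (hat V b)) k
        - conv (perturbation_coeff A W j a b) (deriv_coeff j (hat W b)) k)"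
      by (simp add: nonlin_coeff_def sum_subtractf[symmetric])
    also have "norm \<dots> \<le> (\<Sum>j\<in>(UNIV::'d set). \<Sum>b\<in>(UNIV::'n set). 2 * \<bar>Ct R * R\<bar> * E)"
      by (intro sum_norm_le nl1)
    also have "\<dots> = C2 * E" unfolding C2_def by (simp only: sum_distrib_right)
    finally have nl: "norm (nonlin_coeff A V a k - nonlin_coeff A W a k) \<le> C2 * E" .
    have FV: "fco (\<lambda>x. F V x $ a) k = of_real (ea k) * lin_coeff A V a k + of_real (ch k) * nonlin_coeff A V a k"
      "fco (\<lambda>x. F W x $ a) k = of_real (ea k) * lin_coeff A W a k + of_real (ch k) * nonlin_coeff A W a k"
      using F V W unfolding multiplier_system_def by metis+
    have "fco (\<lambda>x. F V x $ a) k - fco (\<lambda>x. F W x $ a) k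
       = of_real (ea k) * (lin_coeff A V a k - lin_coeff A W a k) + of_real (ch k) * (nonlin_coeff A V a k - nonlin_coeff A W a k)"
      unfolding FV by (simp add: algebra_simps)
    also have "norm \<dots> \<le> C1 * E + C2 * E"
    proof (rule norm_triangle_mono)
      have sm: "\<bar>e\<bar> * x \<le> y" if "\<bar>e\<bar> \<le> 1" "x \<le> y" "0 \<le> x" for e x y :: real
        using mult_right_mono[OF that(1,3)] that(2) by simp
      show "norm (complex_of_real (ea k) * (lin_coeff A V a k - lin_coeff A W a k)) \<le> C1 * E"
        "norm (complex_of_real (ch k) * (nonlin_coeff A V a k - nonlin_coeff A W a k)) \<le> C2 * E"
        unfolding norm_mult norm_of_real by (rule sm[OF ec(1) lin] sm[OF ec(2) nl]; simp)+
    qed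
    finally show ?thesis by (simp add: distrib_right)
  qed
  have "0 \<le> C1 + C2" by (auto simp: C1_def C2_def intro!: add_nonneg_nonneg sum_nonneg)
  with main show ?thesis by blast
qed

text \<open>
  A band-limited solution satisfies an ordinary differential equation with this right-hand side in
  the space of bounded continuous functions. Truncating the argument first makes the right-hand side
  defined on the whole space.
\<close>

definition rhs :: "nat \<Rightarrow> ((real^'d \<Rightarrow> real^'n) \<Rightarrow> real^'d \<Rightarrow> real^'n) \<Rightarrow> (real^'d) \<Rightarrow>\<^sub>C (real^'n) \<Rightarrow> (real^'d) \<Rightarrow>\<^sub>C (real^'n)" where
  "rhs N F v = - trig N (F (sharp_filter N (apply_bcontfun v)))"

lemma rhs_locally_lipschitz:
  assumes F: "multiplier_system A ea ch F"
  shows "locally_lipschitz (rhs N F)"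
  unfolding locally_lipschitz_def
proof
  fix R :: real
  define S where "S = (\<Sum>k\<in>(box_modes N :: (int^'d) set). jb k powr 1)"
  have S: "0 \<le> S" by (simp add: S_def sum_nonneg)
  obtain C where C: "0 \<le> C" "\<And>V W E a k. good V (S * \<bar>R\<bar>) \<Longrightarrow> good W (S * \<bar>R\<bar>) \<Longrightarrow> (\<And>a. l1_le (wt 1 (\<lambda>k. hat V a k - hat W a k)) E) \<Longrightarrow>
     norm (fco (\<lambda>x. F V x $ a) k - fco (\<lambda>x. F W x $ a) k) \<le> C * E"
    using system_lipschitz[OF F, of "S * \<bar>R\<bar>"] by blast
  define K where "K = (\<Sum>a\<in>(UNIV::'n set). \<Sum>k\<in>(box_modes N :: (int^'d) set). C * S)"
  have "norm (rhs N F v - rhs N F w) \<le> K * norm (v - w)" if "norm v \<le> R" "norm w \<le> R" for v w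
  proof -
    let ?V = "sharp_filter N (apply_bcontfun v)" and ?W = "sharp_filter N (apply_bcontfun w)"
    have g: "good (sharp_filter N (apply_bcontfun v)) (S * \<bar>R\<bar>)" if "norm v \<le> R" for v :: "(real^'d) \<Rightarrow>\<^sub>C (real^'n)"
      unfolding S_def by (rule sharp_filter_good, rule order_trans[OF norm_hat_bcontfun]) (use that in linarith)
    have dh: "hat (apply_bcontfun v) a k - hat (apply_bcontfun w) a k = hat (apply_bcontfun (v - w)) a k" for a k
      by (rule linear_diff[OF bounded_linear.linear[OF bounded_linear_hat], symmetric])
    have E: "l1_le (wt 1 (\<lambda>k. hat ?V a k - hat ?W a k)) (S * norm (v - w))" for a
      unfolding S_def
    proof (rule box_l1_le)
      show "k \<notin> box_modes N \<Longrightarrow> hat ?V a k - hat ?W a k = 0" for k by (simp add: hat_sharp_filter)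
      show "norm (hat ?V a k - hat ?W a k) \<le> norm (v - w)" if "k \<in> box_modes N" for k
        using that norm_hat_bcontfun[of "v - w" a k] by (simp add: hat_sharp_filter dh)
    qed
    have "norm (rhs N F v - rhs N F w) = norm (\<Sum>a\<in>UNIV. \<Sum>k\<in>box_modes N. mode k a (hat (F ?V) a k - hat (F ?W) a k))"
    proof -
      have "rhs N F v - rhs N F w = - (\<Sum>a\<in>UNIV. \<Sum>k\<in>box_modes N. mode k a (hat (F ?V) a k - hat (F ?W) a k))"
        by (simp add: rhs_def trig_def linear_diff[OF bounded_linear.linear[OF bounded_linear_mode]] sum_subtractf)
      then show ?thesis by (simp only: norm_minus_cancel)
    qed
    also have "\<dots> \<le> (\<Sum>a\<in>(UNIV::'n set). \<Sum>k\<in>(box_modes N :: (int^'d) set). C * (S * norm (v - w)))"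
      by (intro sum_norm_le order_trans[OF norm_mode_le]) (simp add: hat_def[of "F _"] C(2)[OF g[OF that(1)] g[OF that(2)] E])
    also have "\<dots> = K * norm (v - w)" unfolding K_def by (simp only: sum_distrib_right mult.assoc)
    finally show ?thesis .
  qed
  moreover have "0 \<le> K" unfolding K_def using C(1) S by (intro sum_nonneg) auto
  ultimately show "\<exists>L\<ge>0. \<forall>x y. norm x \<le> R \<longrightarrow> norm y \<le> R \<longrightarrow> norm (rhs N F x - rhs N F y) \<le> L * norm (x - y)" by blast
qed

lemma system_band_limited:
  assumes F: "multiplier_system A ea ch F" and ch: "\<And>k. k \<notin> box_modes N \<Longrightarrow> ch k = 0"
    and V: "good V R" "\<And>a k. k \<notin> box_modes N \<Longrightarrow> hat V a k = 0"
  shows "sharp_filter N (F V) = F V"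
proof (rule sharp_filter_id)
  show "wiener_vec (F V)" using F V(1) by (auto simp: multiplier_system_def wiener_vec_def)
  show "hat (F V) a k = 0" if "k \<notin> box_modes N" for a k
  proof -
    have "hat (F V) a k = of_real (ea k) * lin_coeff A V a k + of_real (ch k) * nonlin_coeff A V a k"
      using F V(1) unfolding multiplier_system_def hat_def by metis
    then show ?thesis using ch[OF that] V(2)[OF that] by (simp add: lin_coeff_def deriv_coeff_def)
  qed
qed

text \<open>
  Outside the band only the skew-adjoint constant-coefficient part acts, so
  \<open>|U\<^sub>k|\<close> is constant in time for each such frequency.
\<close>

lemma solution_band_limited:
  assumes F: "multiplier_system A ea ch F" and ch: "ch k = 0"
    and cs: "classical_solution s F U0 I U" "t \<in> I" and init: "\<And>a. hat (U 0) a k = 0"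
  shows "hat (U t) a k = 0"
proof -
  let ?f = "\<lambda>\<tau>. \<Sum>k\<in>{k}. 1 * (\<Sum>a\<in>UNIV. (cmod (hat (U \<tau>) a k))\<^sup>2)"
  have I: "is_interval I" "0 \<in> I" using cs(1) by (auto simp: classical_solution_def)
  have "?f t + 0 \<le> (?f 0 + 0) * exp (0 * \<bar>t - 0\<bar>)"
  proof (rule gronwall[OF I cs(2)])
    fix \<tau> assume \<tau>: "\<tau> \<in> I"
    let ?w' = "\<lambda>a k. - (of_real (ea k) * lin_coeff A (U \<tau>) a k + of_real (ch k) * nonlin_coeff A (U \<tau>) a k)"
    have "(?f has_real_derivative (\<Sum>k\<in>{k}. 1 * (2 * Re (\<Sum>a\<in>UNIV. cnj (hat (U \<tau>) a k) * ?w' a k)))) (at \<tau>)"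
      by (rule energy_derivative) (rule coeff_derivative[OF F cs(1) \<tau>])
    moreover have "Re (\<Sum>a\<in>UNIV. cnj (hat (U \<tau>) a k) * ?w' a k) = 0"
    proof -
      have skew: "Re (\<Sum>a\<in>UNIV. cnj (hat (U \<tau>) a k) * lin_coeff A (U \<tau>) a k) = 0"
        unfolding lin_coeff_def by (rule lin_coeff_skew) (rule A_sym)
      have "(\<Sum>a\<in>UNIV. cnj (hat (U \<tau>) a k) * ?w' a k) = - of_real (ea k) * (\<Sum>a\<in>UNIV. cnj (hat (U \<tau>) a k) * lin_coeff A (U \<tau>) a k)"
        by (simp add: ch sum_distrib_left mult_ac sum_negf)
      then show ?thesis using skew by simp
    qed
    ultimately show "\<exists>f'. (?f has_real_derivative f') (at \<tau>) \<and> \<bar>f'\<bar> \<le> 0 * (?f \<tau> + 0)" by force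
  qed
  then have "(\<Sum>a\<in>UNIV. (cmod (hat (U t) a k))\<^sup>2) \<le> 0" using init by simp
  then have "(\<Sum>a\<in>UNIV. (cmod (hat (U t) a k))\<^sup>2) = 0" by (intro antisym sum_nonneg) auto
  then show ?thesis by (simp add: sum_nonneg_eq_0_iff)
qed

text \<open>
  Otherwise the solution of the ordinary differential equation extends beyond the interval. The
  extension remains a trigonometric polynomial, because its component outside the band has zero
  derivative, and it is then a classical solution of the original problem, against maximality.
\<close>

lemma band_limited_continuation:
  assumes F: "multiplier_system A ea ch F" and ch: "\<And>k. k \<notin> box_modes N \<Longrightarrow> ch k = 0"
    and max: "maximal_solution s F U0 I U" and init: "\<And>a k. k \<notin> box_modes N \<Longrightarrow> hat (U 0) a k = 0"
    and good: "\<And>t. t \<in> I \<Longrightarrow> t \<in> closed_segment 0 t1 \<Longrightarrow> good (U t) R"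
  shows "t1 \<in> I"
proof (rule ccontr)
  assume t1: "t1 \<notin> I"
  have cs: "classical_solution s F U0 I U" using max by (simp add: maximal_solution_def)
  then have I: "open I" "is_interval I" "0 \<in> I" by (auto simp: classical_solution_def)
  have band: "hat (U t) a k = 0" if "t \<in> I" "k \<notin> box_modes N" for t a k
    by (rule solution_band_limited[OF F ch[OF that(2)] cs that(1) init[OF that(2)]])
  have UP: "sharp_filter N (U t) = U t" if "t \<in> I" for t
    by (rule sharp_filter_id[OF goodD(1)[OF solution_facts(3)[OF cs that]] band[OF that]])
  define u where "u t = trig N (U t)" for t
  have u_apply: "apply_bcontfun (u t) = U t" if "t \<in> I" for t unfolding u_def trig_apply by (rule UP[OF that])
  have u: "(u has_vector_derivative rhs N F (u t)) (at t)" if t: "t \<in> I" for t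
  proof -
    have "rhs N F (u t) = (\<Sum>a\<in>UNIV. \<Sum>k\<in>box_modes N. mode k a (- hat (F (U t)) a k))"
      unfolding rhs_def u_apply[OF t] UP[OF t] trig_def
      by (simp add: linear_neg[OF bounded_linear.linear[OF bounded_linear_mode]] sum_negf)
    moreover have "((\<lambda>\<tau>. hat (U \<tau>) a k) has_vector_derivative - hat (F (U t)) a k) (at t)" for a k
    proof -
      have "hat (F (U t)) a k = of_real (ea k) * lin_coeff A (U t) a k + of_real (ch k) * nonlin_coeff A (U t) a k"
        using F solution_facts(3)[OF cs t] unfolding multiplier_system_def hat_def by metis
      then show ?thesis using coeff_derivative[OF F cs t] by simp
    qed
    then have "(u has_vector_derivative (\<Sum>a\<in>UNIV. \<Sum>k\<in>box_modes N. mode k a (- hat (F (U t)) a k))) (at t)"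
      unfolding u_def[abs_def] trig_def
      by (intro has_vector_derivative_sum bounded_linear.has_vector_derivative[OF bounded_linear_mode])
    ultimately show ?thesis by simp
  qed
  have bound: "norm (u t) \<le> real CARD('n) * R" if "t \<in> I" "t \<in> closed_segment 0 t1" for t
  proof (rule norm_bound)
    fix x
    note g = good[OF that]
    have "\<bar>U t x $ a\<bar> \<le> R" for a
      using wiener_bound[OF goodD(2)[OF g]] l1_le_of_wt[OF _ goodD(4)[OF g]] unfolding hat_def by simp
    then have "norm (U t x) \<le> (\<Sum>a\<in>(UNIV::'n set). R)" by (intro order_trans[OF norm_le_l1_cart] sum_mono)
    then show "norm (u t x) \<le> real CARD('n) * R" by (simp add: u_apply[OF that(1)])
  qed
  have "\<exists>J v. I \<subset> J \<and> open J \<and> is_interval J \<and> (\<forall>t\<in>I. v t = u t) \<and> (\<forall>t\<in>J. (v has_vector_derivative rhs N F (v t)) (at t))"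
  proof (cases "0 < t1")
    case True
    have lt: "t < t1" if "t \<in> I" for t using mem_is_interval_1_I[OF I(2,3) that, of t1] t1 True by force
    show ?thesis
    proof (rule ode_extend_right[of "rhs N F" I 0 u t1 "real CARD('n) * R"])
      show "locally_lipschitz (rhs N F)" by (rule rhs_locally_lipschitz[OF F])
      show "(u has_vector_derivative rhs N F (u t)) (at t)" if "t \<in> I" for t by (rule u[OF that])
      show "norm (u t) \<le> real CARD('n) * R" if "t \<in> I" "0 \<le> t" for t
        using that lt[OF that(1)] by (intro bound) (auto simp: closed_segment_eq_real_ivl)
    qed (use I t1 True in auto)
  next
    case False
    then have t0: "t1 < 0" using t1 I(3) by (cases "t1 = 0") auto
    have lt: "t1 < t" if "t \<in> I" for t using mem_is_interval_1_I[OF I(2) that I(3), of t1] t1 t0 by force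
    show ?thesis
    proof (rule ode_extend_left[of "rhs N F" I 0 u t1 "real CARD('n) * R"])
      show "locally_lipschitz (rhs N F)" by (rule rhs_locally_lipschitz[OF F])
      show "(u has_vector_derivative rhs N F (u t)) (at t)" if "t \<in> I" for t by (rule u[OF that])
      show "norm (u t) \<le> real CARD('n) * R" if "t \<in> I" "t \<le> 0" for t
        using that lt[OF that(1)] t0 by (intro bound) (auto simp: closed_segment_eq_real_ivl)
    qed (use I t1 t0 in auto)
  qed
  then obtain J v where J: "I \<subset> J" "open J" "is_interval J" and "\<forall>t\<in>I. v t = u t"
    and "\<forall>t\<in>J. (v has_vector_derivative rhs N F (v t)) (at t)" by (elim exE conjE)
  then have vu: "\<And>t. t \<in> I \<Longrightarrow> v t = u t" and v: "\<And>t. t \<in> J \<Longrightarrow> (v has_vector_derivative rhs N F (v t)) (at t)" by simp_all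
  have J0: "0 \<in> J" using J(1) I(3) by blast
  let ?Q = "\<lambda>v. trig N (apply_bcontfun v)"
  have v_trig: "v t = ?Q (v t)" if t: "t \<in> J" for t
  proof -
    have Qr: "?Q (rhs N F w) = rhs N F w" for w
    proof -
      have "?Q (rhs N F w) = - ?Q (trig N (F (sharp_filter N (apply_bcontfun w))))"
        unfolding rhs_def by (rule linear_neg[OF bounded_linear.linear[OF bounded_linear_trig]])
      then show ?thesis unfolding trig_apply trig_sharp_filter rhs_def .
    qed
    have "((\<lambda>t. v t - ?Q (v t)) has_vector_derivative 0) (at \<tau> within J)" if "\<tau> \<in> J" for \<tau>
    proof -
      have "((\<lambda>t. v t - ?Q (v t)) has_vector_derivative rhs N F (v \<tau>) - ?Q (rhs N F (v \<tau>))) (at \<tau>)"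
        by (intro has_vector_derivative_diff v[OF that] bounded_linear.has_vector_derivative[OF bounded_linear_trig])
      then have "((\<lambda>t. v t - ?Q (v t)) has_vector_derivative 0) (at \<tau>)" unfolding Qr by simp
      then show ?thesis by (rule has_vector_derivative_at_within)
    qed
    then obtain c where c: "\<And>t. t \<in> J \<Longrightarrow> v t - ?Q (v t) = c"
      using has_vector_derivative_zero_constant[of J "\<lambda>t. v t - ?Q (v t)"] J(3) by (auto simp: is_interval_convex_1)
    have "v 0 - ?Q (v 0) = 0" unfolding vu[OF I(3)] u_apply[OF I(3)] by (simp add: u_def)
    then show ?thesis using c[OF t] c[OF J0] by simp
  qed
  define W where "W t = apply_bcontfun (v t)" for t
  have W: "W t = sharp_filter N (apply_bcontfun (v t))" if "t \<in> J" for t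
    unfolding W_def by (subst v_trig[OF that]) (rule trig_apply)
  have WU: "W t = U t" if "t \<in> I" for t using vu[OF that] u_apply[OF that] by (simp add: W_def)
  have "classical_solution s F U0 J W"
    unfolding classical_solution_def
  proof (intro conjI ballI allI J J0)
    show "sobolev_continuous_on s J W"
      unfolding sobolev_continuous_on_def
    proof (intro conjI ballI)
      show "in_sobolev s (W t)" if "t \<in> J" for t
        unfolding W[OF that] by (rule sharp_filter_sobolev(1)[OF norm_hat_bcontfun])
      fix t assume t: "t \<in> J"
      let ?C = "(\<Sum>k\<in>(box_modes N::(int^'d) set). jb k powr s)"
      have le: "sobolev_norm s (\<lambda>x. W \<tau> x - W t x) \<le> ?C * (real CARD('n) * norm (v \<tau> - v t))" if \<tau>: "\<tau> \<in> J" for \<tau>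
      proof -
        have "v \<tau> - v t = ?Q (v \<tau> - v t)"
          using v_trig[OF \<tau>] v_trig[OF t] linear_diff[OF bounded_linear.linear[OF bounded_linear_trig], of N "v \<tau>" "v t"] by simp
        then have "apply_bcontfun (v \<tau> - v t) = sharp_filter N (apply_bcontfun (v \<tau> - v t))" by (metis trig_apply)
        moreover have "(\<lambda>x. W \<tau> x - W t x) = apply_bcontfun (v \<tau> - v t)" by (simp add: fun_eq_iff W_def minus_bcontfun.rep_eq)
        ultimately have eq: "(\<lambda>x. W \<tau> x - W t x) = sharp_filter N (apply_bcontfun (v \<tau> - v t))" by simp
        show ?thesis unfolding eq by (rule sharp_filter_sobolev(2)[OF norm_hat_bcontfun])
      qed
      have "isCont v t" by (rule has_vector_derivative_continuous[OF v[OF t]])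
      then have "(v \<longlongrightarrow> v t) (at t within J)" using continuous_at_imp_continuous_at_within continuous_within by blast
      then have "((\<lambda>\<tau>. ?C * (real CARD('n) * norm (v \<tau> - v t))) \<longlongrightarrow> ?C * (real CARD('n) * norm (v t - v t))) (at t within J)"
        by (intro tendsto_intros)
      then have lim: "((\<lambda>\<tau>. ?C * (real CARD('n) * norm (v \<tau> - v t))) \<longlongrightarrow> 0) (at t within J)" by simp
      show "((\<lambda>\<tau>. sobolev_norm s (\<lambda>x. W \<tau> x - W t x)) \<longlongrightarrow> 0) (at t within J)"
      proof (rule Lim_null_comparison[OF _ lim])
        show "\<forall>\<^sub>F \<tau> in at t within J. norm (sobolev_norm s (\<lambda>x. W \<tau> x - W t x)) \<le> ?C * (real CARD('n) * norm (v \<tau> - v t))"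
          unfolding eventually_at_filter by (rule always_eventually) (simp add: sobolev_norm_nonneg le)
      qed
    qed
    show "W t differentiable (at x)" if "t \<in> J" for t x
      unfolding W[OF that] by (rule sharp_filter_differentiable)
    show "((\<lambda>\<tau>. W \<tau> x) has_vector_derivative - F (W t) x) (at t)" if t: "t \<in> J" for t x
    proof -
      have "((\<lambda>\<tau>. W \<tau> x) has_vector_derivative apply_bcontfun (rhs N F (v t)) x) (at t)"
        unfolding W_def by (rule bounded_linear.has_vector_derivative[OF bounded_linear_evaluation v[OF t]])
      moreover have "apply_bcontfun (rhs N F (v t)) x = - sharp_filter N (F (W t)) x"
        unfolding rhs_def W[OF t, symmetric] by (simp add: uminus_bcontfun.rep_eq trig_apply)
      moreover have "sharp_filter N (F (W t)) = F (W t)"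
      proof (rule system_band_limited[OF F ch])
        show "good (W t) ((\<Sum>k\<in>(box_modes N :: (int^'d) set). jb k powr 1) * norm (v t))"
          unfolding W[OF t] by (rule sharp_filter_good[OF norm_hat_bcontfun])
        show "k \<notin> box_modes N \<Longrightarrow> hat (W t) a k = 0" for a k unfolding W[OF t] by (simp add: hat_sharp_filter)
      qed
      ultimately show ?thesis by simp
    qed
    show "AE x in lebesgue. W 0 x = U0 x"
      unfolding WU[OF I(3)] using cs by (simp add: classical_solution_def)
  qed
  then show False using max J(1) WU unfolding maximal_solution_def by blast
qed

lemma quasilinear_multiplier_system: "multiplier_system A (\<lambda>k. 1) (\<lambda>k. 1) (quasilinear A)"
  unfolding multiplier_system_def using quasilinear_full_coeff[where A = A, OF _ A_poly] by simp

lemma filtered_multiplier_system: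
  assumes "cutoff_profile chi" "N \<ge> 1"
  shows "multiplier_system A (linear_symbol \<phi> chi N) (smooth_symbol chi N) (filtered_quasilinear \<phi> chi A N)"
  unfolding multiplier_system_def
  using smooth_symbol_props(1,2)[OF assms] filtered_coeff[OF assms _ A_poly, where \<phi> = \<phi>]
  by (simp add: linear_symbol_def split: filtering.split)

end

section \<open>Growth of the Sobolev norm\<close>

text \<open>
  On a segment of length at most \<open>1 / (2 K)\<close> the maximum of \<open>y\<close> is at most
  twice the initial value, since the increment is at most half the maximum. Iterating
  \<open>m\<close> times gives the bound. This replaces a differential inequality, \<open>y\<close>
  being only a supremum of differentiable energies.
\<close>

lemma short_time_doubling:
  fixes y :: "real \<Rightarrow> real"
  assumes cont: "continuous_on (closed_segment a b) y" and y0: "\<And>t. 0 \<le> y t" and K: "0 \<le> K"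
    and est: "\<And>t t' M. t \<in> closed_segment a b \<Longrightarrow> t' \<in> closed_segment a b \<Longrightarrow>
      (\<And>\<tau>. \<tau> \<in> closed_segment t t' \<Longrightarrow> y \<tau> \<le> M) \<Longrightarrow> y t' \<le> y t + K * M * \<bar>t' - t\<bar>"
    and m: "2 * K * \<bar>b - a\<bar> \<le> real m" "1 \<le> m"
  shows "y b \<le> 2 ^ m * y a"
proof -
  have step: "y t' \<le> 2 * y t" if t: "t \<in> closed_segment a b" "t' \<in> closed_segment a b" "2 * K * \<bar>t' - t\<bar> \<le> 1" for t t'
  proof -
    have sub: "closed_segment t t' \<subseteq> closed_segment a b"
      using t(1,2) by (simp add: closed_segment_subset convex_closed_segment)
    obtain u where u: "u \<in> closed_segment t t'" "\<And>\<tau>. \<tau> \<in> closed_segment t t' \<Longrightarrow> y \<tau> \<le> y u"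
      using continuous_attains_sup[OF compact_segment _ continuous_on_subset[OF cont sub]] by auto
    have ut: "closed_segment t u \<subseteq> closed_segment t t'"
      using u(1) by (simp add: closed_segment_subset convex_closed_segment)
    have "y u \<le> y t + K * y u * \<bar>u - t\<bar>"
      by (rule est) (use t(1) u sub ut in auto)
    also have "K * y u * \<bar>u - t\<bar> \<le> K * y u * \<bar>t' - t\<bar>"
      using u(1) K y0[of u] by (intro mult_left_mono) (auto simp: closed_segment_eq_real_ivl split: if_splits)
    also have "\<dots> = (2 * K * \<bar>t' - t\<bar>) * (y u / 2)" by simp
    also have "\<dots> \<le> 1 * (y u / 2)" using t(3) y0[of u] by (intro mult_right_mono) auto
    finally have "y u \<le> 2 * y t" by simp
    then show ?thesis using u(2)[of t'] by auto
  qed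
  define p where "p i = a + (real i / real m) * (b - a)" for i
  have p: "p i \<in> closed_segment a b" if "i \<le> m" for i
  proof -
    have "a + u * (b - a) = (1 - u) *\<^sub>R a + u *\<^sub>R b" for u by (simp add: algebra_simps)
    from this[of "real i / real m"] have "p i = (1 - real i / real m) *\<^sub>R a + (real i / real m) *\<^sub>R b"
      unfolding p_def .
    moreover have "0 \<le> real i / real m" "real i / real m \<le> 1" using that m(2) by (auto simp: divide_le_eq)
    ultimately show ?thesis unfolding in_segment by blast
  qed
  have "y (p i) \<le> 2 ^ i * y a" if "i \<le> m" for i
    using that
  proof (induction i)
    case 0
    then show ?case by (simp add: p_def)
  next
    case (Suc i)
    have "p (Suc i) - p i = (b - a) / real m" by (simp add: p_def add_divide_distrib algebra_simps)
    then have "\<bar>p (Suc i) - p i\<bar> = \<bar>b - a\<bar> / real m" by (simp add: abs_divide)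
    then have "2 * K * \<bar>p (Suc i) - p i\<bar> \<le> 1" using m by (simp add: divide_le_eq)
    then have "y (p (Suc i)) \<le> 2 * y (p i)" using Suc.prems by (intro step p) auto
    then show ?case using Suc by simp
  qed
  from this[of m] show ?thesis using m(2) by (simp add: p_def)
qed

lemma norm_fourier_coeff_power2: "(norm (fourier_coeff V k))\<^sup>2 = (\<Sum>a\<in>UNIV. (cmod (hat V a k))\<^sup>2)"
  by (simp add: norm_vec_def L2_set_def hat_eq sum_nonneg)

lemma sobolev_norm_cong: "fourier_coeff V = fourier_coeff W \<Longrightarrow> sobolev_norm r V = sobolev_norm r W"
  by (simp add: sobolev_norm_def)

lemma initial_data:
  fixes U :: "real \<Rightarrow> real^'d \<Rightarrow> real^'n"
  assumes "classical_solution s F U0 I U" "in_sobolev s U0"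
  shows "fourier_coeff (U 0) = fourier_coeff U0"
  using assms unfolding classical_solution_def sobolev_continuous_on_def in_sobolev_def torus_L2_def
  by (intro fourier_coeff_cong_AE) auto

lemma emb_le_jb_scaled: "0 < \<nu> \<Longrightarrow> \<nu> \<le> 4 * norm (emb k) \<Longrightarrow> 0 \<le> s \<Longrightarrow> 1 \<le> 4 powr s * \<nu> powr (- s) * jb k powr s"
proof -
  assume \<nu>: "0 < \<nu>" "\<nu> \<le> 4 * norm (emb k)" and s: "0 \<le> s"
  have "1 \<le> 4 * jb k / \<nu>" using \<nu> norm_emb_le_jb[of k] by (simp add: le_divide_eq)
  then have "1 \<le> (4 * jb k / \<nu>) powr s" using s by (rule ge_one_powr_ge_zero)
  also have "\<dots> = 4 powr s * \<nu> powr (- s) * jb k powr s"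
    using \<nu>(1) jb_pos[of k] by (simp add: powr_divide powr_mult powr_minus_divide)
  finally show ?thesis .
qed

context symmetric_system
begin

lemma sobolev_norm_diff_commute:
  fixes U U' :: "real \<Rightarrow> real^'d \<Rightarrow> real^'n"
  assumes cs: "classical_solution s F U0 I U" "t \<in> I" "t' \<in> I"
  shows "sobolev_norm r (\<lambda>x. U t x - U t' x) = sobolev_norm r (\<lambda>x. U t' x - U t x)"
proof -
  have "norm (fourier_coeff (\<lambda>x. U t x - U t' x) k) = norm (fourier_coeff (\<lambda>x. U t' x - U t x) k)" for k
    by (simp add: fourier_coeff_diff solution_facts(4)[OF cs(1,2)] solution_facts(4)[OF cs(1,3)] norm_minus_commute)
  then show ?thesis by (simp add: sobolev_norm_def)
qed

lemma sobolev_norm_continuous: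
  fixes U :: "real \<Rightarrow> real^'d \<Rightarrow> real^'n"
  assumes cs: "classical_solution s F U0 I U"
  shows "continuous_on I (\<lambda>t. sobolev_norm s (U t))"
  unfolding continuous_on_def
proof
  fix t assume t: "t \<in> I"
  have lim: "((\<lambda>\<tau>. sobolev_norm s (\<lambda>x. U \<tau> x - U t x)) \<longlongrightarrow> 0) (at t within I)"
    using cs t by (simp add: classical_solution_def sobolev_continuous_on_def)
  have "\<bar>sobolev_norm s (U \<tau>) - sobolev_norm s (U t)\<bar> \<le> sobolev_norm s (\<lambda>x. U \<tau> x - U t x)" if "\<tau> \<in> I" for \<tau>
    using sobolev_norm_close[OF cs that cs t] sobolev_norm_close[OF cs t cs that] sobolev_norm_diff_commute[OF cs that t, of s] by linarith
  then have "((\<lambda>\<tau>. sobolev_norm s (U \<tau>) - sobolev_norm s (U t)) \<longlongrightarrow> 0) (at t within I)"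
    by (intro Lim_null_comparison[OF _ lim]) (simp add: eventually_at_filter)
  then show "((\<lambda>\<tau>. sobolev_norm s (U \<tau>)) \<longlongrightarrow> sobolev_norm s (U t)) (at t within I)" by (rule LIM_zero_cancel)
qed

text \<open>
  The \<open>H\<^sup>s\<close> energy truncated at frequency \<open>n\<close> is differentiable with
  a rate independent of \<open>n\<close>; letting \<open>n\<close> exhaust all frequencies gives the
  increment bound for the full norm.
\<close>

lemma Hs_growth:
  assumes F: "multiplier_system A ea ch F" and cs: "classical_solution s F U0 I U"
    and cut: "\<And>n. n \<ge> n0 \<Longrightarrow> \<exists>\<nu>. cutoff \<Lambda> \<rho> \<nu> (\<lambda>k. ramp (real n) k * ch k)"
    and seg: "closed_segment t0 t1 \<subseteq> I" and g: "\<And>\<tau>. \<tau> \<in> closed_segment t0 t1 \<Longrightarrow> good (U \<tau>) R"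
    and m: "2 * KH \<Lambda> \<rho> R * \<bar>t1 - t0\<bar> \<le> real m" "1 \<le> m" and K: "0 \<le> KH \<Lambda> \<rho> R"
  shows "sobolev_norm s (U t1) \<le> 2 ^ m * sobolev_norm s (U t0)"
proof -
  let ?y = "\<lambda>t. (sobolev_norm s (U t))\<^sup>2"
  have "?y t1 \<le> 2 ^ m * ?y t0"
  proof (rule short_time_doubling[OF _ _ K _ m])
    show "continuous_on (closed_segment t0 t1) ?y"
      by (intro continuous_intros continuous_on_subset[OF sobolev_norm_continuous[OF cs] seg])
    show "?y t' \<le> ?y t + KH \<Lambda> \<rho> R * M * \<bar>t' - t\<bar>"
      if t: "t \<in> closed_segment t0 t1" "t' \<in> closed_segment t0 t1" and M: "\<And>\<tau>. \<tau> \<in> closed_segment t t' \<Longrightarrow> ?y \<tau> \<le> M" for t t' M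
    proof -
      define B where "B = ?y t + KH \<Lambda> \<rho> R * M * \<bar>t' - t\<bar>"
      have "0 \<le> ?y t" by simp
      also have "\<dots> \<le> M" by (rule M) simp
      finally have M0: "0 \<le> M" .
      then have B0: "0 \<le> B" using K by (simp add: B_def)
      have sub: "closed_segment t t' \<subseteq> closed_segment t0 t1"
        using t by (simp add: closed_segment_subset convex_closed_segment)
      have sq: "(norm (wt s (fourier_coeff (U \<tau>)) k))\<^sup>2 = jb k powr (2 * s) * (\<Sum>a\<in>UNIV. (cmod (hat (U \<tau>) a k))\<^sup>2)" for \<tau> k
        by (simp add: wt_def power_mult_distrib norm_fourier_coeff_power2 power2_eq_square[of "_ powr _"] powr_add[symmetric])
      have fin: "(\<Sum>k\<in>G. (norm (wt s (fourier_coeff (U t')) k))\<^sup>2) \<le> B" if G: "finite G" for G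
      proof -
        obtain n where n: "n \<ge> n0" "n \<ge> 1" "\<And>k. k \<in> G \<Longrightarrow> 4 * norm (emb k) \<le> real n"
        proof -
          obtain n1 where n1: "(\<Sum>k\<in>G. 4 * norm (emb k)) \<le> real n1" using real_arch_simple by blast
          have "4 * norm (emb k) \<le> real (max n1 (max n0 1))" if "k \<in> G" for k
            using member_le_sum[OF that, of "\<lambda>k. 4 * norm (emb k)"] G n1 by simp
          then show ?thesis using that[of "max n1 (max n0 1)"] by simp
        qed
        let ?E = "\<lambda>\<tau>. \<Sum>k\<in>box_modes n. ramp (real n) k * jb k powr (2 * s) * (\<Sum>a\<in>UNIV. (cmod (hat (U \<tau>) a k))\<^sup>2)"
        have box: "ramp (real n) k = 1" "k \<in> box_modes n" if "k \<in> G" for k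
        proof -
          show 1: "ramp (real n) k = 1" using n(2) n(3)[OF that] by (intro ramp_one) auto
          show "k \<in> box_modes n" using ramp_box[of k n] n(2) 1 by fastforce
        qed
        obtain \<nu> where \<nu>: "cutoff \<Lambda> \<rho> \<nu> (\<lambda>k. ramp (real n) k * ch k)" using cut[OF n(1)] by blast
        have rate: "\<exists>E'. (?E has_real_derivative E') (at \<tau>) \<and> \<bar>E'\<bar> \<le> KH \<Lambda> \<rho> R * ?y \<tau>" if \<tau>: "\<tau> \<in> closed_segment t t'" for \<tau>
        proof (rule Hs_energy_rate[OF F cs _ g _ \<nu> finite_box_modes])
          show \<tau>I: "\<tau> \<in> I" "\<tau> \<in> closed_segment t0 t1" using \<tau> sub seg by auto
          show "l2_le (wt s (hat (U \<tau>) a)) (sobolev_norm s (U \<tau>))" for a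
            by (rule hat_l2_le[OF sobolev_l2_le[OF solution_facts(1)[OF cs \<tau>I(1)]]])
          show "k \<notin> box_modes n \<Longrightarrow> ramp (real n) k = 0" for k using ramp_box[of k n] n(2) by simp
        qed
        define E' where "E' \<tau> = (SOME d. (?E has_real_derivative d) (at \<tau>) \<and> \<bar>d\<bar> \<le> KH \<Lambda> \<rho> R * ?y \<tau>)" for \<tau>
        have E': "(?E has_real_derivative E' \<tau>) (at \<tau>) \<and> \<bar>E' \<tau>\<bar> \<le> KH \<Lambda> \<rho> R * ?y \<tau>" if "\<tau> \<in> closed_segment t t'" for \<tau>
          unfolding E'_def by (rule someI_ex[OF rate[OF that]])
        have "norm (?E t' - ?E t) \<le> (KH \<Lambda> \<rho> R * M) * norm (t' - t)"
        proof (rule field_differentiable_bound[of "closed_segment t t'" ?E E'])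
          fix \<tau> assume \<tau>: "\<tau> \<in> closed_segment t t'"
          show "(?E has_field_derivative E' \<tau>) (at \<tau> within closed_segment t t')"
            by (rule has_field_derivative_at_within[OF conjunct1[OF E'[OF \<tau>]]])
          show "norm (E' \<tau>) \<le> KH \<Lambda> \<rho> R * M"
            unfolding real_norm_def by (rule order_trans[OF conjunct2[OF E'[OF \<tau>]] mult_left_mono[OF M[OF \<tau>] K]])
        qed auto
        then have E1: "?E t' \<le> ?E t + KH \<Lambda> \<rho> R * M * \<bar>t' - t\<bar>" by (simp add: abs_le_iff)
        have "?E t \<le> (\<Sum>k\<in>box_modes n. (norm (wt s (fourier_coeff (U t)) k))\<^sup>2)"
          unfolding sq by (intro sum_mono mult_right_mono) (auto simp: ramp_bounds mult_left_le_one_le intro!: sum_nonneg)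
        also have "\<dots> \<le> ?y t"
        proof -
          have "t \<in> I" using t(1) seg by blast
          from sobolev_l2_le[OF solution_facts(1)[OF cs this]] show ?thesis
            unfolding l2_le_iff_sum_power2[OF sobolev_norm_nonneg] using finite_box_modes by blast
        qed
        finally have E2: "?E t \<le> ?y t" .
        have "(\<Sum>k\<in>G. (norm (wt s (fourier_coeff (U t')) k))\<^sup>2) = (\<Sum>k\<in>G. ramp (real n) k * jb k powr (2 * s) * (\<Sum>a\<in>UNIV. (cmod (hat (U t') a k))\<^sup>2))"
          by (rule sum.cong[OF refl]) (simp only: sq box mult_1)
        also have "\<dots> \<le> ?E t'"
          by (rule sum_mono2[OF finite_box_modes]) (use box in \<open>auto simp: ramp_bounds intro!: mult_nonneg_nonneg sum_nonneg\<close>)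
        finally show ?thesis using E1 E2 unfolding B_def by linarith
      qed
      have "l2_le (wt s (fourier_coeff (U t'))) (sqrt B)"
        by (subst l2_le_iff_sum_power2) (use fin B0 in auto)
      then have "sobolev_norm s (U t') \<le> sqrt B" by (rule sobolev_norm_le(1))
      then have "?y t' \<le> (sqrt B)\<^sup>2" by (intro power_mono sobolev_norm_nonneg)
      then show ?thesis using B0 by (simp add: B_def)
    qed
  qed simp
  also have "\<dots> \<le> (2 ^ m * sobolev_norm s (U t0))\<^sup>2"
  proof -
    have "(2::real) ^ m * 1 \<le> 2 ^ m * 2 ^ m" by (intro mult_left_mono one_le_power) auto
    then show ?thesis by (simp add: power_mult_distrib power2_eq_square[of "2 ^ m"] mult_right_mono)
  qed
  finally show ?thesis by (rule power2_le_imp_le) (simp add: sobolev_norm_nonneg)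
qed

section \<open>The error estimate\<close>

text \<open>
  The constant of the error estimate, \<open>X\<close> bounding the time multiplied by the size of
  the solutions.
\<close>

definition CE :: "real \<Rightarrow> real \<Rightarrow> real" where
  "CE R X = 2 * 4 powr s * exp (KD R * X) + 2"

lemma CE_pos: "0 < CE R X"
  by (simp add: CE_def add_nonneg_pos)

lemma low_symbols:
  assumes chi: "cutoff_profile chi" "N \<ge> 1" and "ramp (real N) k \<noteq> 0"
  shows "smooth_symbol chi N k = 1" "linear_symbol \<phi> chi N k = 1"
proof -
  have "2 * norm (emb k) < real N" using ramp_zero[of "real N" k] assms(2,3) by force
  then have "2 * \<bar>of_int (k $ j)\<bar> \<le> real N" for j using component_le_emb[of k j] by linarith
  then show "smooth_symbol chi N k = 1" by (rule smooth_symbol_props(4)[OF chi])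
  then show "linear_symbol \<phi> chi N k = 1" by (simp add: linear_symbol_def split: filtering.split)
qed

lemma initial_coeffs:
  fixes U V :: "real \<Rightarrow> real^'d \<Rightarrow> real^'n"
  assumes U0: "in_sobolev s U0" and cs: "classical_solution s F U0 I U" and cs': "classical_solution s F' (sharp_filter N U0) J V"
  shows "hat (V 0) a k = indicator (box_modes N) k * hat (U 0) a k"
    and "sobolev_norm s (U 0) = sobolev_norm s U0" "sobolev_norm s (V 0) \<le> sobolev_norm s U0"
proof -
  have u: "fourier_coeff (U 0) = fourier_coeff U0" by (rule initial_data[OF cs U0])
  then show "sobolev_norm s (U 0) = sobolev_norm s U0" by (rule sobolev_norm_cong)
  have "norm (hat U0 a k) \<le> sobolev_norm s U0" for a k
    by (rule l2_le_norm[OF l2_le_of_wt[OF s_bounds(2) hat_l2_le[OF sobolev_l2_le[OF U0]]]])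
  from sharp_filter_sobolev(1)[OF this] have v: "fourier_coeff (V 0) = fourier_coeff (sharp_filter N U0)"
    by (rule initial_data[OF cs'])
  show *: "hat (V 0) a k = indicator (box_modes N) k * hat (U 0) a k" for a k
    unfolding hat_eq u v unfolding hat_eq[symmetric] by (rule hat_sharp_filter)
  have hu: "hat (U 0) a k = hat U0 a k" for a k by (simp only: hat_eq u)
  have "(norm (fourier_coeff (V 0) k))\<^sup>2 \<le> (norm (fourier_coeff U0 k))\<^sup>2" for k
    unfolding norm_fourier_coeff_power2 by (rule sum_mono) (simp add: * hu indicator_def)
  then have "norm (fourier_coeff (V 0) k) \<le> norm (fourier_coeff U0 k)" for k
    by (rule power2_le_imp_le) simp
  then have "l2_le (wt s (fourier_coeff (V 0))) (sobolev_norm s U0)"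
    by (intro l2_le_mono[OF sobolev_l2_le[OF U0]]) (auto simp: wt_def abs_mult intro!: mult_left_mono)
  then show "sobolev_norm s (V 0) \<le> sobolev_norm s U0" by (rule sobolev_norm_le(1))
qed

text \<open>
  Gronwall for the truncated \<open>L\<^sup>2\<close> energy \<open>E\<close> of the difference. The
  truncation leaves out frequencies above \<open>N/4\<close>, whose energy is at most
  \<open>\<mu>\<^sup>2 = O(N\<^sup>-\<^sup>2\<^sup>s)\<close>; the rate is bounded by \<open>E +
  \<mu>\<^sup>2\<close>, and \<open>E\<close> vanishes initially because the two data agree on the
  box.
\<close>

lemma error_estimate:
  fixes U V :: "real \<Rightarrow> real^'d \<Rightarrow> real^'n"
  assumes chi: "cutoff_profile chi" "N \<ge> 1" and U0: "in_sobolev s U0"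
    and cs: "classical_solution s (quasilinear A) U0 I U"
    and cs': "classical_solution s (filtered_quasilinear \<phi> chi A N) (sharp_filter N U0) J V"
    and seg: "closed_segment 0 t \<subseteq> I" "closed_segment 0 t \<subseteq> J"
    and a: "\<And>\<tau>. \<tau> \<in> closed_segment 0 t \<Longrightarrow> sobolev_norm s (U \<tau>) \<le> a" "\<And>\<tau>. \<tau> \<in> closed_segment 0 t \<Longrightarrow> sobolev_norm s (V \<tau>) \<le> a"
    and g: "\<And>\<tau>. \<tau> \<in> closed_segment 0 t \<Longrightarrow> good (U \<tau>) r" "\<And>\<tau>. \<tau> \<in> closed_segment 0 t \<Longrightarrow> good (V \<tau>) r"
    and r: "r \<le> R" "r * \<bar>t\<bar> \<le> X" and q: "0 \<le> q" "q \<le> s"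
  shows "l2_le (wt q (fourier_coeff (\<lambda>x. U t x - V t x))) (CE R X * a * real N powr (q - s))"
proof -
  let ?S = "closed_segment 0 t"
  let ?W = "\<lambda>\<tau> x. U \<tau> x - V \<tau> x"
  let ?w = "\<lambda>\<tau> a k. hat (U \<tau>) a k - hat (V \<tau>) a k"
  \<comment> \<open>The \<open>L\<^sup>2\<close> size of the frequencies above \<open>N/4\<close>, given the \<open>H\<^sup>s\<close> bound \<open>2 a\<close> of the difference.\<close>
  define \<mu> where "\<mu> = 4 powr s * real N powr (- s) * (2 * a)"
  define E where "E \<tau> = (\<Sum>k\<in>box_modes N. ramp (real N) k * (\<Sum>a\<in>UNIV. (cmod (?w \<tau> a k))\<^sup>2))" for \<tau>
  have UI: "\<tau> \<in> I" "\<tau> \<in> J" if "\<tau> \<in> ?S" for \<tau> using that seg by auto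
  have "0 \<le> sobolev_norm s (U 0)" by (rule sobolev_norm_nonneg)
  also have "\<dots> \<le> a" by (rule a(1)) simp
  finally have a0: "0 \<le> a" .
  have r0: "0 \<le> r" using goodD(5)[OF g(1)[of 0]] by simp
  have E0: "0 \<le> E \<tau>" for \<tau> unfolding E_def by (intro sum_nonneg mult_nonneg_nonneg ramp_bounds) auto
  have norm_W: "(norm (fourier_coeff (?W \<tau>) k))\<^sup>2 = (\<Sum>a\<in>UNIV. (cmod (?w \<tau> a k))\<^sup>2)" if "\<tau> \<in> ?S" for \<tau> k
    by (simp add: norm_fourier_coeff_power2 solution_diff_l2(3)[OF cs UI(1)[OF that] cs' UI(2)[OF that]])
  have high: "l2_le (wt s (fourier_coeff (?W \<tau>))) (2 * a)" if "\<tau> \<in> ?S" for \<tau>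
    using solution_diff_l2(1,2)[OF cs UI(1)[OF that] cs' UI(2)[OF that]] a[OF that] by (elim l2_le_weaken) linarith
  have total: "l2_le (fourier_coeff (?W \<tau>)) (sqrt (E \<tau> + \<mu>\<^sup>2))" if \<tau>: "\<tau> \<in> ?S" for \<tau>
  proof (subst l2_le_iff_sum_power2, simp add: E0, intro allI impI)
    fix G :: "(int^'d) set" assume G: "finite G"
    let ?n = "\<lambda>k. (norm (fourier_coeff (?W \<tau>) k))\<^sup>2"
    have "(\<Sum>k\<in>G. ramp (real N) k * ?n k) = (\<Sum>k\<in>G \<inter> box_modes N. ramp (real N) k * ?n k)"
      by (rule sum.mono_neutral_right) (use G ramp_box[of _ N] chi(2) in auto)
    also have "\<dots> \<le> (\<Sum>k\<in>box_modes N. ramp (real N) k * ?n k)"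
      by (rule sum_mono2[OF finite_box_modes]) (auto simp: ramp_bounds)
    also have "\<dots> = E \<tau>" unfolding E_def norm_W[OF \<tau>] ..
    finally have 1: "(\<Sum>k\<in>G. ramp (real N) k * ?n k) \<le> E \<tau>" .
    have "(\<Sum>k\<in>G. (1 - ramp (real N) k) * ?n k) \<le> (\<Sum>k\<in>G. (4 powr s * real N powr (- s))\<^sup>2 * (norm (wt s (fourier_coeff (?W \<tau>)) k))\<^sup>2)"
    proof (rule sum_mono)
      fix k
      show "(1 - ramp (real N) k) * ?n k \<le> (4 powr s * real N powr (- s))\<^sup>2 * (norm (wt s (fourier_coeff (?W \<tau>)) k))\<^sup>2"
      proof (cases "4 * norm (emb k) \<le> real N")
        case True
        then show ?thesis using ramp_one[of "real N" k] chi(2) by simp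
      next
        case False
        then have "1 \<le> 4 powr s * real N powr (- s) * jb k powr s"
          using chi(2) s_bounds by (intro emb_le_jb_scaled) auto
        then have "1 * norm (fourier_coeff (?W \<tau>) k) \<le> (4 powr s * real N powr (- s) * jb k powr s) * norm (fourier_coeff (?W \<tau>) k)"
          by (rule mult_right_mono) simp
        then have "?n k \<le> ((4 powr s * real N powr (- s) * jb k powr s) * norm (fourier_coeff (?W \<tau>) k))\<^sup>2"
          by (intro power_mono) auto
        also have "\<dots> = (4 powr s * real N powr (- s))\<^sup>2 * (norm (wt s (fourier_coeff (?W \<tau>)) k))\<^sup>2"
          by (simp add: wt_def power_mult_distrib)
        finally have "?n k \<le> (4 powr s * real N powr (- s))\<^sup>2 * (norm (wt s (fourier_coeff (?W \<tau>)) k))\<^sup>2" .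
        moreover have "(1 - ramp (real N) k) * ?n k \<le> ?n k"
          using ramp_bounds[of "real N" k] by (intro mult_left_le_one_le) auto
        ultimately show ?thesis by linarith
      qed
    qed
    also have "\<dots> = (4 powr s * real N powr (- s))\<^sup>2 * (\<Sum>k\<in>G. (norm (wt s (fourier_coeff (?W \<tau>)) k))\<^sup>2)"
      by (simp only: sum_distrib_left)
    also have "\<dots> \<le> (4 powr s * real N powr (- s))\<^sup>2 * (2 * a)\<^sup>2"
    proof (rule mult_left_mono)
      have "0 \<le> 2 * a" using a0 by simp
      from high[OF \<tau>] G show "(\<Sum>k\<in>G. (norm (wt s (fourier_coeff (?W \<tau>)) k))\<^sup>2) \<le> (2 * a)\<^sup>2"
        unfolding l2_le_iff_sum_power2[OF \<open>0 \<le> 2 * a\<close>] by blast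
    qed simp
    also have "\<dots> = \<mu>\<^sup>2" by (simp only: \<mu>_def power_mult_distrib)
    finally have 2: "(\<Sum>k\<in>G. (1 - ramp (real N) k) * ?n k) \<le> \<mu>\<^sup>2" .
    have "(\<Sum>k\<in>G. ?n k) = (\<Sum>k\<in>G. ramp (real N) k * ?n k) + (\<Sum>k\<in>G. (1 - ramp (real N) k) * ?n k)"
      unfolding sum.distrib[symmetric] by (intro sum.cong refl) (simp add: algebra_simps)
    then show "(\<Sum>k\<in>G. ?n k) \<le> (sqrt (E \<tau> + \<mu>\<^sup>2))\<^sup>2" using 1 2 E0[of \<tau>] by simp
  qed
  have "E t + \<mu>\<^sup>2 \<le> (E 0 + \<mu>\<^sup>2) * exp ((KD R * r) * \<bar>t - 0\<bar>)"
  proof (rule gronwall[of ?S])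
    show "is_interval ?S" by (simp add: is_interval_convex_1 convex_closed_segment)
    fix \<tau> assume \<tau>: "\<tau> \<in> ?S"
    have D: "l2_le (\<lambda>k. ?w \<tau> a k) (sqrt (E \<tau> + \<mu>\<^sup>2))" for a
    proof (rule l2_le_mono[OF total[OF \<tau>]])
      show "norm (?w \<tau> a k) \<le> norm (fourier_coeff (?W \<tau>) k)" for k
        using Finite_Cartesian_Product.norm_nth_le[of "fourier_coeff (?W \<tau>) k" a]
        unfolding hat_eq[symmetric] solution_diff_l2(3)[OF cs UI(1)[OF \<tau>] cs' UI(2)[OF \<tau>]] .
    qed simp
    have "\<exists>E'. ((\<lambda>\<tau>. \<Sum>k\<in>box_modes N. ramp (real N) k * (\<Sum>a\<in>UNIV. (cmod (?w \<tau> a k))\<^sup>2)) has_real_derivative E') (at \<tau>)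
        \<and> \<bar>E'\<bar> \<le> KD R * r * (sqrt (E \<tau> + \<mu>\<^sup>2))\<^sup>2"
      by (rule diff_energy_rate[OF quasilinear_multiplier_system cs UI(1)[OF \<tau>] filtered_multiplier_system[OF chi] cs' UI(2)[OF \<tau>]
            g(1)[OF \<tau>] g(2)[OF \<tau>] r(1) D ramp_cutoff finite_box_modes])
         (use chi(2) ramp_box[of _ N] low_symbols[OF chi] in auto)
    then show "\<exists>E'. (E has_real_derivative E') (at \<tau>) \<and> \<bar>E'\<bar> \<le> (KD R * r) * (E \<tau> + \<mu>\<^sup>2)"
      unfolding E_def[abs_def, symmetric] using E0[of \<tau>] by simp
  qed auto
  also have "E 0 = 0"
    unfolding E_def by (rule sum.neutral) (simp add: initial_coeffs(1)[OF U0 cs cs'])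
  also have "(0 + \<mu>\<^sup>2) * exp ((KD R * r) * \<bar>t - 0\<bar>) \<le> \<mu>\<^sup>2 * exp (KD R * X)"
    using mult_left_mono[OF r(2) KD_nonneg[of R]] r0 r(1) by (simp add: mult.assoc mult_left_mono)
  also have "\<dots> \<le> (\<mu> * exp (KD R * X))\<^sup>2"
  proof -
    have "0 \<le> r * \<bar>t\<bar>" using r0 by simp
    then have "0 \<le> X" using r(2) by linarith
    then have "0 \<le> KD R * X" using KD_nonneg[of R] r0 r(1) by (intro mult_nonneg_nonneg) auto
    then have "exp (KD R * X) * 1 \<le> exp (KD R * X) * exp (KD R * X)" by (intro mult_left_mono) auto
    then show ?thesis by (simp add: power_mult_distrib power2_eq_square[of "exp _"] mult_left_mono)
  qed
  finally have "sqrt (E t + \<mu>\<^sup>2) \<le> \<mu> * exp (KD R * X)"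
    using a0 by (intro real_le_lsqrt) (auto simp: \<mu>_def E0)
  with total[of t] have "l2_le (fourier_coeff (?W t)) (\<mu> * exp (KD R * X))" by (auto elim: l2_le_weaken)
  moreover have "\<mu> * exp (KD R * X) = (4 powr s * (2 * a) * exp (KD R * X)) * real N powr (- s)"
    by (simp add: \<mu>_def)
  ultimately have "l2_le (fourier_coeff (?W t)) ((4 powr s * (2 * a) * exp (KD R * X)) * real N powr (- s))" by (simp only:)
  from sobolev_interpolation[OF this high chi(2) q]
  have "l2_le (wt q (fourier_coeff (?W t))) ((4 powr s * (2 * a) * exp (KD R * X) + 2 * a) * real N powr (q - s))" by simp
  moreover have "4 powr s * (2 * a) * exp (KD R * X) + 2 * a = CE R X * a" by (simp add: CE_def algebra_simps)
  ultimately show ?thesis by (simp only:)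
qed

text \<open>
  The radius \<open>r\<close> in the error estimate is proportional to the size of the datum, and
  the time is at most \<open>T\<close> divided by that size, so \<open>r t\<close> is bounded
  independently of the datum.
\<close>

lemma error_on_existence_time:
  assumes chi: "cutoff_profile chi" and MT: "0 < M" "0 < T" and unif: "uniform_existence_time \<phi> chi A s M T C1"
  shows "\<exists>C>0. \<forall>U0 I U.
          in_sobolev s U0 \<and> sobolev_norm s U0 \<le> M \<and>
          maximal_solution s (quasilinear A) U0 I U \<longrightarrow>
          (\<forall>N\<ge>1. \<forall>J V.
             maximal_solution s (filtered_quasilinear \<phi> chi A N) (sharp_filter N U0) J V \<longrightarrow>
             (\<forall>t\<in>time_span T (sobolev_norm s U0). \<forall>r\<in>{0..s}.
                sobolev_norm r (\<lambda>x. U t x - V t x) \<le> C * sobolev_norm s U0 * real N powr (r - s)))"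
proof (intro exI[of _ "2 * CE (Cw * (2 * M)) (Cw * (2 * T))"] conjI allI impI ballI)
  show "0 < 2 * CE (Cw * (2 * M)) (Cw * (2 * T))" using CE_pos by simp
  fix U0 I U N J V t r
  assume U: "in_sobolev s U0 \<and> sobolev_norm s U0 \<le> M \<and> maximal_solution s (quasilinear A) U0 I U"
    and N: "N \<ge> 1" and V: "maximal_solution s (filtered_quasilinear \<phi> chi A N) (sharp_filter N U0) J V"
    and t: "t \<in> time_span T (sobolev_norm s U0)" and r: "r \<in> {0..s}"
  let ?a = "sobolev_norm s U0"
  have a0: "0 \<le> ?a" by (rule sobolev_norm_nonneg)
  have cU: "controlled_growth s T C1 ?a I U" and cV: "controlled_growth s T C1 ?a J V"
    using unif U V N unfolding uniform_existence_time_def by blast+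
  have t0: "0 \<le> t" using t by (auto simp: time_span_def split: if_splits)
  have span: "\<tau> \<in> time_span T ?a" if "\<tau> \<in> closed_segment 0 t" for \<tau>
    using that t t0 by (auto simp: time_span_def closed_segment_eq_real_ivl split: if_splits)
  have sub: "closed_segment 0 t \<subseteq> I" "closed_segment 0 t \<subseteq> J"
    using span cU cV unfolding controlled_growth_def by blast+
  have le: "sobolev_norm s (U \<tau>) \<le> 2 * ?a" "sobolev_norm s (V \<tau>) \<le> 2 * ?a" if "\<tau> \<in> closed_segment 0 t" for \<tau>
    using cU cV span[OF that] unfolding controlled_growth_def by (meson order_trans)+
  have cs: "classical_solution s (quasilinear A) U0 I U" "classical_solution s (filtered_quasilinear \<phi> chi A N) (sharp_filter N U0) J V"
    using U V by (auto simp: maximal_solution_def)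
  have tT: "?a * t \<le> T" using t MT a0 by (auto simp: time_span_def le_divide_eq mult.commute split: if_splits)
  have "l2_le (wt r (fourier_coeff (\<lambda>x. U t x - V t x))) (CE (Cw * (2 * M)) (Cw * (2 * T)) * (2 * ?a) * real N powr (r - s))"
  proof (rule error_estimate[OF chi N _ cs sub le])
    show "in_sobolev s U0" using U by blast
    show "good (U \<tau>) (Cw * (2 * ?a))" "good (V \<tau>) (Cw * (2 * ?a))" if "\<tau> \<in> closed_segment 0 t" for \<tau>
      using that sub le[OF that]
      by (auto intro: good_of_sobolev[OF solution_facts(1,2)[OF cs(1)]] good_of_sobolev[OF solution_facts(1,2)[OF cs(2)]])
    show "Cw * (2 * ?a) \<le> Cw * (2 * M)" using U Cw_pos by simp
    show "Cw * (2 * ?a) * \<bar>t\<bar> \<le> Cw * (2 * T)" using tT t0 Cw_pos by (simp add: mult.assoc)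
  qed (use r in auto)
  from sobolev_norm_le(1)[OF this]
  show "sobolev_norm r (\<lambda>x. U t x - V t x) \<le> 2 * CE (Cw * (2 * M)) (Cw * (2 * T)) * ?a * real N powr (r - s)"
    by (simp only: mult_ac)
qed

section \<open>Long-time convergence\<close>

lemma good_perturb:
  assumes V: "good V \<rho>" and W: "wiener_vec W" "\<And>x. W differentiable (at x)" and d: "\<And>a. l1_le (wt 1 (\<lambda>k. hat W a k - hat V a k)) \<delta>"
  shows "good W (\<rho> + \<delta>)"
  unfolding good_def
proof (intro conjI allI W)
  fix a
  have "l1_le (wt 1 (\<lambda>k. hat V a k + (hat W a k - hat V a k))) (\<rho> + \<delta>)"
    by (rule wt_l1_add[OF goodD(4)[OF V] d])
  then show "l1_le (wt 1 (hat W a)) (\<rho> + \<delta>)" by simp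
qed

lemma good_nearby:
  fixes U :: "real \<Rightarrow> real^'d \<Rightarrow> real^'n"
  assumes cs: "classical_solution s F U0 I U" "t \<in> I" "t' \<in> I"
    and d: "sobolev_norm s (\<lambda>x. U t x - U t' x) \<le> \<epsilon>" and g: "good (U t) \<rho>"
  shows "good (U t') (\<rho> + Cw * \<epsilon>)"
proof (rule good_perturb[OF g])
  note f' = solution_facts[OF cs(1,3)]
  show "wiener_vec (U t')" by (rule goodD(1)[OF f'(3)])
  show "U t' differentiable (at x)" for x by (rule f'(2))
  have "sobolev_norm s (\<lambda>x. U t' x - U t x) \<le> \<epsilon>" using d sobolev_norm_diff_commute[OF cs] by simp
  then have "l2_le (wt s (hat (\<lambda>x. U t' x - U t x) a)) \<epsilon>" for a
    by (rule l2_le_weaken[OF hat_l2_le[OF solution_diff_l2(1)[OF cs(1,3) cs(1,2)]]])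
  from embed[OF this] show "l1_le (wt 1 (\<lambda>k. hat (U t') a k - hat (U t) a k)) (Cw * \<epsilon>)" for a
    unfolding solution_diff_l2(3)[OF cs(1,3) cs(1,2)] .
qed

text \<open>
  Continuous induction: the condition with radius \<open>R\<close> implies itself with radius
  \<open>R - 1/2\<close>, and continuity in time with values in \<open>H\<^sup>s\<close> propagates
  it to a neighbourhood with radius \<open>R\<close>.
\<close>

lemma bootstrap:
  fixes V :: "real \<Rightarrow> real^'d \<Rightarrow> real^'n"
  assumes cs: "classical_solution s F U0 I V" and H: "is_interval H" "0 \<in> H" "H \<subseteq> I"
    and start: "good (V 0) R"
    and improve: "\<And>t. t \<in> H \<Longrightarrow> (\<And>\<tau>. \<tau> \<in> closed_segment 0 t \<Longrightarrow> good (V \<tau>) R) \<Longrightarrow> good (V t) (R - 1/2)"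
    and t: "t \<in> H"
  shows "good (V t) R"
proof -
  let ?P = "\<lambda>t. \<forall>\<tau>\<in>closed_segment 0 t. good (V \<tau>) R"
  have "?P t"
  proof (rule connected_induction_simple[where S = H and P = ?P, OF _ H(2) t])
    show "connected H" using H(1) by (simp add: is_interval_connected_1)
    show "?P 0" using start by simp
    fix a assume a: "a \<in> H"
    have pos: "0 < 1 / (4 * Cw)" using Cw_pos by simp
    have aI: "a \<in> I" using a H(3) by blast
    obtain e where e: "0 < e"
      "\<And>\<tau>. \<bar>\<tau> - a\<bar> < e \<Longrightarrow> \<tau> \<in> I \<and> sobolev_norm s (\<lambda>x. V \<tau> x - V a x) < 1 / (4 * Cw)
        \<and> sobolev_norm s (V \<tau>) \<le> sobolev_norm s (V a) + 1 / (4 * Cw)"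
    proof (rule solution_locally_bounded[OF cs aI pos])
      fix e assume A: "0 < e" and B: "\<And>\<tau>. \<bar>\<tau> - a\<bar> < e \<Longrightarrow> \<tau> \<in> I \<and> sobolev_norm s (\<lambda>x. V \<tau> x - V a x) < 1 / (4 * Cw)
        \<and> sobolev_norm s (V \<tau>) \<le> sobolev_norm s (V a) + 1 / (4 * Cw)"
      show thesis by (rule that[OF A B])
    qed
    let ?T = "H \<inter> {a - e<..<a + e}"
    have T: "is_interval ?T" using H(1) by (intro is_interval_Int) auto
    have near: "sobolev_norm s (\<lambda>x. V \<tau> x - V a x) \<le> 1 / (4 * Cw)" "\<tau> \<in> I" if "\<tau> \<in> ?T" for \<tau>
    proof -
      have "\<bar>\<tau> - a\<bar> < e" using that by auto
      from e(2)[OF this] show "sobolev_norm s (\<lambda>x. V \<tau> x - V a x) \<le> 1 / (4 * Cw)" "\<tau> \<in> I" by auto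
    qed
    have quarter: "Cw * (1 / (4 * Cw)) = 1 / 4" using Cw_pos by simp
    have aT: "a \<in> ?T" using a e(1) by simp
    show "\<exists>T. openin (top_of_set H) T \<and> a \<in> T \<and> (\<forall>x\<in>T. \<forall>y\<in>T. ?P x \<longrightarrow> ?P y)"
    proof (intro exI[of _ ?T] conjI ballI impI aT)
      show "openin (top_of_set H) ?T" by (rule openin_open_Int) simp
      fix x y \<tau> assume x: "x \<in> ?T" and y: "y \<in> ?T" and P: "?P x" and \<tau>: "\<tau> \<in> closed_segment 0 y"
      have "good (V x) (R - 1/2)" using improve[of x] x P by blast
      from good_nearby[OF cs near(2)[OF x] near(2)[OF aT] near(1)[OF x] this]
      have ga: "good (V a) (R - 1/4)" unfolding quarter by simp
      have all: "good (V \<sigma>) R" if \<sigma>: "\<sigma> \<in> ?T" for \<sigma>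
      proof -
        have "sobolev_norm s (\<lambda>x. V a x - V \<sigma> x) \<le> 1 / (4 * Cw)"
          unfolding sobolev_norm_diff_commute[OF cs near(2)[OF aT] near(2)[OF \<sigma>]] by (rule near(1)[OF \<sigma>])
        from good_nearby[OF cs near(2)[OF aT] near(2)[OF \<sigma>] this ga]
        have "good (V \<sigma>) (R - 1/4 + 1/4)" unfolding quarter .
        then show ?thesis by simp
      qed
      show "good (V \<tau>) R"
      proof (cases "\<tau> \<in> closed_segment 0 x")
        case True
        then show ?thesis using P by blast
      next
        case False
        then have "\<tau> \<in> closed_segment x y"
          using \<tau> by (auto simp: closed_segment_eq_real_ivl split: if_splits)
        moreover have "closed_segment x y \<subseteq> ?T"
          using x y T by (simp only: is_interval_convex_1 closed_segment_subset)
        ultimately show ?thesis using all by blast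
      qed
    qed
  qed
  then show ?thesis by simp
qed

text \<open>
  \<open>R\<close> exceeds by one the bound of \<open>U\<close> in the weighted Wiener algebra on
  the hull of the compact set and \<open>0\<close>. Growth backward in time also bounds the datum by
  the norm at any later time, which is why the supremum over the compact set alone suffices in the
  final bound.
\<close>

lemma long_time_error:
  assumes chi: "cutoff_profile chi"
  shows "\<exists>N0\<ge>1. \<exists>C>0. \<forall>U0 I U K.
        in_sobolev s U0 \<and> maximal_solution s (quasilinear A) U0 I U \<and>
        compact K \<and> K \<subseteq> I \<and>
        measure lebesgue (convex hull (insert 0 K)) = L \<and>
        (SUP t\<in>convex hull (insert 0 K). sobolev_norm s (U t)) = m \<longrightarrow>
        (\<forall>N\<ge>N0. \<forall>J V.
           maximal_solution s (filtered_quasilinear \<phi> chi A N) (sharp_filter N U0) J V \<longrightarrow>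
           K \<subseteq> J \<and>
           (\<forall>r\<in>{0..s}. \<forall>t\<in>K.
              sobolev_norm r (\<lambda>x. U t x - V t x)
                \<le> C * (SUP \<tau>\<in>K. sobolev_norm s (U \<tau>)) * real N powr (r - s)))"
proof -
  obtain \<Lambda> \<rho> where cut: "\<And>N. N \<ge> 1 \<Longrightarrow> cutoff \<Lambda> \<rho> (real N) (smooth_symbol chi N)"
    using smooth_symbol_cutoff[OF chi] by blast
  have \<Lambda>\<rho>: "0 \<le> \<Lambda>" "0 \<le> \<rho>" using cut[of 1] by (auto simp: cutoff_def)
  \<comment> \<open>The margin \<open>1\<close> is what the bootstrap spends: half of it for the error, half for continuity.\<close>
  define R where "R = Cw * \<bar>m\<bar> + 1"
  have R: "0 \<le> R" using Cw_pos by (simp add: R_def)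
  define K1 where "K1 = KH (\<Lambda> + 4) \<rho> R + KH 4 (1/2) R"
  have KH: "0 \<le> KH (\<Lambda> + 4) \<rho> R" "0 \<le> KH 4 (1/2) R" using \<Lambda>\<rho> R by (auto intro!: KH_nonneg)
  \<comment> \<open>The number of doubling steps needed to cover a time of length \<open>L\<close>, for either problem.\<close>
  define p where "p = Suc (nat \<lceil>2 * K1 * \<bar>L\<bar>\<rceil>)"
  have p: "2 * k * \<bar>t\<bar> \<le> real p" if "k \<le> K1" "0 \<le> k" "\<bar>t\<bar> \<le> \<bar>L\<bar>" for k t
  proof -
    have "2 * k * \<bar>t\<bar> \<le> 2 * K1 * \<bar>L\<bar>" using that by (intro mult_mono) auto
    also have "\<dots> \<le> real p" unfolding p_def by linarith
    finally show ?thesis .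
  qed
  define G where "G = (2::real) ^ p"
  have G: "1 \<le> G" by (simp add: G_def)
  \<comment> \<open>Any exponent strictly between \<open>d/2 + 1\<close> and \<open>s\<close> makes the error small in the weighted Wiener algebra.\<close>
  define q where "q = (real CARD('d) / 2 + 1 + s) / 2"
  have q: "real CARD('d) / 2 + 1 < q" "q < s" "0 \<le> q" using s_gt by (auto simp: q_def field_simps)
  obtain Cq where Cq: "0 < Cq" "\<And>(c :: int^'d \<Rightarrow> complex) B. l2_le (wt q c) B \<Longrightarrow> l1_le (wt 1 c) (Cq * B)"
    using sobolev_embedding[OF q(1)] by blast
  define C where "C = CE R (R * \<bar>L\<bar>) * G"
  have C: "0 < C" using CE_pos G by (simp add: C_def)
  have "((\<lambda>N. Cq * (C * \<bar>m\<bar>) * real N powr (q - s)) \<longlongrightarrow> Cq * (C * \<bar>m\<bar>) * 0) sequentially"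
    using q(2) by (intro tendsto_mult_left tendsto_neg_powr filterlim_real_sequentially) auto
  then have "\<forall>\<^sub>F N in sequentially. Cq * (C * \<bar>m\<bar>) * real N powr (q - s) < 1/2"
    by (rule order_tendstoD) simp
  then obtain N1 where N1: "\<And>N. N \<ge> N1 \<Longrightarrow> Cq * (C * \<bar>m\<bar>) * real N powr (q - s) < 1/2"
    unfolding eventually_sequentially by blast
  show ?thesis
  proof (intro exI[of _ "max N1 1"] exI[of _ "C * G"] conjI allI impI)
    show "0 < C * G" "1 \<le> max N1 1" using C G by auto
    fix U0 I U K N J V
    assume *: "in_sobolev s U0 \<and> maximal_solution s (quasilinear A) U0 I U \<and> compact K \<and> K \<subseteq> I \<and>
        measure lebesgue (convex hull (insert 0 K)) = L \<and> (SUP t\<in>convex hull (insert 0 K). sobolev_norm s (U t)) = m"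
      and N: "max N1 1 \<le> N" and V: "maximal_solution s (filtered_quasilinear \<phi> chi A N) (sharp_filter N U0) J V"
    have U0: "in_sobolev s U0" and K: "compact K" "K \<subseteq> I" using * by auto
    have N': "N \<ge> 1" "N \<ge> N1" using N by auto
    have cs: "classical_solution s (quasilinear A) U0 I U" "classical_solution s (filtered_quasilinear \<phi> chi A N) (sharp_filter N U0) J V"
      using * V by (auto simp: maximal_solution_def)
    have I: "is_interval I" "0 \<in> I" "is_interval J" "0 \<in> J" using cs by (auto simp: classical_solution_def)
    define Q where "Q = convex hull (insert 0 K)"
    have Q: "compact Q" "convex Q" "0 \<in> Q" "K \<subseteq> Q" "Q \<subseteq> I"
    proof -
      show "compact Q" unfolding Q_def by (intro compact_convex_hull compact_insert K)
      show "convex Q" unfolding Q_def by (rule convex_convex_hull)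
      show "0 \<in> Q" "K \<subseteq> Q" unfolding Q_def using hull_subset[of "insert 0 K" convex] by auto
      show "Q \<subseteq> I" unfolding Q_def using I K by (intro hull_minimal) (auto simp: is_interval_convex_1)
    qed
    have segQ: "closed_segment 0 t \<subseteq> Q" if "t \<in> Q" for t using Q that by (simp add: closed_segment_subset)
    have segI: "closed_segment 0 t \<subseteq> I" if "t \<in> Q" for t using segQ[OF that] Q by blast
    have bdd: "bdd_above ((\<lambda>t. sobolev_norm s (U t)) ` Q)"
      by (intro compact_imp_bounded[THEN bounded_imp_bdd_above] compact_continuous_image
          continuous_on_subset[OF sobolev_norm_continuous[OF cs(1)]] Q)
    have Um: "sobolev_norm s (U t) \<le> \<bar>m\<bar>" if "t \<in> Q" for t
      using cSUP_upper[OF that bdd] * unfolding Q_def by linarith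
    have tL: "\<bar>t\<bar> \<le> \<bar>L\<bar>" if t: "t \<in> Q" for t
    proof -
      have "measure lebesgue (closed_segment 0 t) \<le> measure lebesgue Q"
        by (rule measure_mono_fmeasurable[OF segQ[OF t]]) (use Q in \<open>auto simp: lmeasurable_compact closed_segment_eq_real_ivl\<close>)
      moreover have "measure lebesgue (closed_segment 0 t) = \<bar>t\<bar>" by (simp add: closed_segment_eq_real_ivl)
      ultimately show ?thesis using * unfolding Q_def by linarith
    qed
    have gU: "good (U t) (R - 1)" if "t \<in> Q" for t
      using good_of_sobolev[OF solution_facts(1,2)[OF cs(1)] Um[OF that]] that Q(5) unfolding R_def by auto
    have gU': "good (U t) R" if "t \<in> Q" for t by (rule good_mono[OF gU[OF that]]) simp
    have cutU: "\<exists>\<nu>. cutoff 4 (1/2) \<nu> (\<lambda>k. ramp (real n) k * 1)" if "n \<ge> 1" for n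
      using ramp_cutoff[of "real n"] that by (intro exI[of _ "real n"]) simp
    have cutV: "\<exists>\<nu>. cutoff (\<Lambda> + 4) \<rho> \<nu> (\<lambda>k. ramp (real n) k * smooth_symbol chi N k)" if "n \<ge> N" for n
      using cutoff_times_ramp[OF cut[OF N'(1)], of "real n"] that by auto
    have growU: "sobolev_norm s (U t1) \<le> G * sobolev_norm s (U t0)"
      if t: "t0 \<in> Q" "t1 \<in> Q" "\<bar>t1 - t0\<bar> \<le> \<bar>L\<bar>" for t0 t1
      unfolding G_def
    proof (rule Hs_growth[OF quasilinear_multiplier_system cs(1) cutU _ _ _ _ KH(2)])
      have sub: "closed_segment t0 t1 \<subseteq> Q" using Q t by (simp add: closed_segment_subset)
      then show "closed_segment t0 t1 \<subseteq> I" using Q by blast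
      show "\<tau> \<in> closed_segment t0 t1 \<Longrightarrow> good (U \<tau>) R" for \<tau> using gU' sub by blast
      show "2 * KH 4 (1 / 2) R * \<bar>t1 - t0\<bar> \<le> real p" by (rule p) (use KH t in \<open>auto simp: K1_def\<close>)
    qed (auto simp: p_def)
    have init: "sobolev_norm s (V 0) \<le> sobolev_norm s (U 0)" "hat (V 0) a k = indicator (box_modes N) k * hat (U 0) a k" for a k
      using initial_coeffs[OF U0 cs] by auto
    have err: "l2_le (wt r (fourier_coeff (\<lambda>x. U t x - V t x))) (C * sobolev_norm s (U 0) * real N powr (r - s))"
      if t: "t \<in> Q" and tJ: "closed_segment 0 t \<subseteq> J" and gV: "\<And>\<tau>. \<tau> \<in> closed_segment 0 t \<Longrightarrow> good (V \<tau>) R" and r: "0 \<le> r" "r \<le> s" for t r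
    proof -
      have "l2_le (wt r (fourier_coeff (\<lambda>x. U t x - V t x))) (CE R (R * \<bar>L\<bar>) * (G * sobolev_norm s (U 0)) * real N powr (r - s))"
      proof (rule error_estimate[OF chi N'(1) U0 cs segI[OF t] tJ _ _ _ gV order_refl _ r])
        fix \<tau> assume \<tau>: "\<tau> \<in> closed_segment 0 t"
        have \<tau>Q: "\<tau> \<in> Q" using \<tau> segQ[OF t] by blast
        show "sobolev_norm s (U \<tau>) \<le> G * sobolev_norm s (U 0)" by (rule growU) (use \<tau>Q Q tL in auto)
        show "good (U \<tau>) R" by (rule gU'[OF \<tau>Q])
        have "sobolev_norm s (V \<tau>) \<le> G * sobolev_norm s (V 0)"
          unfolding G_def
        proof (rule Hs_growth[OF filtered_multiplier_system[OF chi N'(1)] cs(2) cutV _ _ _ _ KH(1)])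
          have sub: "closed_segment 0 \<tau> \<subseteq> closed_segment 0 t" using \<tau> by (simp add: closed_segment_subset convex_closed_segment)
          then show "closed_segment 0 \<tau> \<subseteq> J" using tJ by blast
          show "\<sigma> \<in> closed_segment 0 \<tau> \<Longrightarrow> good (V \<sigma>) R" for \<sigma> using gV sub by blast
          show "2 * KH (\<Lambda> + 4) \<rho> R * \<bar>\<tau> - 0\<bar> \<le> real p" by (rule p) (use KH tL[OF \<tau>Q] in \<open>auto simp: K1_def\<close>)
        qed (auto simp: p_def)
        also have "\<dots> \<le> G * sobolev_norm s (U 0)" using init(1) G by (intro mult_left_mono) auto
        finally show "sobolev_norm s (V \<tau>) \<le> G * sobolev_norm s (U 0)" .
      next
        show "R * \<bar>t\<bar> \<le> R * \<bar>L\<bar>" using tL[OF t] R by (intro mult_left_mono)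
      qed
      then show ?thesis by (simp only: C_def mult.assoc)
    qed
    let ?H = "Q \<inter> J"
    have H: "is_interval ?H" "0 \<in> ?H" "?H \<subseteq> J"
      using Q I by (auto simp: is_interval_convex_1 intro: convex_Int)
    have segH: "closed_segment 0 t \<subseteq> ?H" if "t \<in> ?H" for t
      using H that by (simp only: is_interval_convex_1 closed_segment_subset)
    have gV: "good (V t) R" if t: "t \<in> ?H" for t
    proof (rule bootstrap[OF cs(2) H _ _ t])
      have "sobolev_norm s (V 0) \<le> \<bar>m\<bar>" using init(1) Um[OF Q(3)] by linarith
      from good_of_sobolev[OF solution_facts(1,2)[OF cs(2) I(4)] this] show "good (V 0) R"
        by (rule good_mono) (simp add: R_def)
      fix t assume t: "t \<in> ?H" and P: "\<And>\<tau>. \<tau> \<in> closed_segment 0 t \<Longrightarrow> good (V \<tau>) R"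
      have tIJ: "t \<in> I" "t \<in> J" "t \<in> Q" using t Q by auto
      note fV = solution_facts[OF cs(2) tIJ(2)]
      have small: "Cq * (C * sobolev_norm s (U 0) * real N powr (q - s)) \<le> 1/2"
      proof -
        have "Cq * (C * sobolev_norm s (U 0) * real N powr (q - s)) \<le> Cq * (C * \<bar>m\<bar> * real N powr (q - s))"
          using Cq C Um[OF Q(3)] by (intro mult_left_mono mult_right_mono) auto
        then show ?thesis using N1[OF N'(2)] by (simp add: mult.assoc)
      qed
      have "good (V t) ((R - 1) + 1/2)"
      proof (rule good_perturb[OF gU[OF tIJ(3)] goodD(1)[OF fV(3)] fV(2)])
        fix a
        have "l2_le (wt q (fourier_coeff (\<lambda>x. U t x - V t x))) (C * sobolev_norm s (U 0) * real N powr (q - s))"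
          using segH[OF t] q by (intro err tIJ P) auto
        from Cq(2)[OF hat_l2_le[OF this]]
        have "l1_le (wt 1 (hat (\<lambda>x. U t x - V t x) a)) (1/2)" by (rule l1_le_weaken[OF _ small])
        then show "l1_le (wt 1 (\<lambda>k. hat (V t) a k - hat (U t) a k)) (1/2)"
          unfolding solution_diff_l2(3)[OF cs(1) tIJ(1) cs(2) tIJ(2)] by (simp add: wt_def[abs_def] norm_minus_commute)
      qed
      then show "good (V t) (R - 1/2)" by simp
    qed
    have QJ: "t \<in> J" if t: "t \<in> Q" for t
    proof (rule band_limited_continuation[OF filtered_multiplier_system[OF chi N'(1)] smooth_symbol_props(6)[OF chi N'(1)] V])
      show "k \<notin> box_modes N \<Longrightarrow> hat (V 0) a k = 0" for a k by (simp add: init(2))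
      show "good (V \<tau>) R" if "\<tau> \<in> J" "\<tau> \<in> closed_segment 0 t" for \<tau>
        using gV[of \<tau>] that segQ[OF t] by blast
    qed
    show "K \<subseteq> J" using QJ Q(4) by blast
    show "\<forall>r\<in>{0..s}. \<forall>t\<in>K. sobolev_norm r (\<lambda>x. U t x - V t x) \<le> C * G * (SUP \<tau>\<in>K. sobolev_norm s (U \<tau>)) * real N powr (r - s)"
    proof (intro ballI)
      fix r t assume r: "r \<in> {0..s}" and t: "t \<in> K"
      have tQ: "t \<in> Q" "t \<in> ?H" using t Q QJ by auto
      have bddK: "bdd_above ((\<lambda>t. sobolev_norm s (U t)) ` K)" by (rule bdd_above_mono[OF bdd image_mono[OF Q(4)]])
      have "sobolev_norm s (U 0) \<le> G * sobolev_norm s (U t)" by (rule growU) (use tQ Q tL in auto)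
      also have "\<dots> \<le> G * (SUP \<tau>\<in>K. sobolev_norm s (U \<tau>))" using G cSUP_upper[OF t bddK] by (intro mult_left_mono) auto
      finally have 0: "sobolev_norm s (U 0) \<le> G * (SUP \<tau>\<in>K. sobolev_norm s (U \<tau>))" .
      have "sobolev_norm r (\<lambda>x. U t x - V t x) \<le> C * sobolev_norm s (U 0) * real N powr (r - s)"
        using segH[OF tQ(2)] gV r by (intro sobolev_norm_le(1)[OF err[OF tQ(1)]]) auto
      also have "\<dots> \<le> C * (G * (SUP \<tau>\<in>K. sobolev_norm s (U \<tau>))) * real N powr (r - s)"
        using 0 C by (intro mult_right_mono mult_left_mono) auto
      finally show "sobolev_norm r (\<lambda>x. U t x - V t x) \<le> C * G * (SUP \<tau>\<in>K. sobolev_norm s (U \<tau>)) * real N powr (r - s)"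
        by (simp only: mult.assoc)
    qed
  qed
qed

end

theorem proposition2p6:
  fixes A :: "'d::finite \<Rightarrow> real^'n::finite \<Rightarrow> real^'n^'n"
    and chi :: "real^'d \<Rightarrow> real"
    and \<phi> :: filtering
    and s :: real
  assumes "symmetric_polynomial_matrices A"
    and "cutoff_profile chi"
    and "s > real CARD('d) / 2 + 1"
  shows
    "(\<forall>M T C1. M > 0 \<and> T > 0 \<and> C1 > 0 \<and> uniform_existence_time \<phi> chi A s M T C1 \<longrightarrow>
       (\<exists>C>0. \<forall>U0 I U.
          in_sobolev s U0 \<and> sobolev_norm s U0 \<le> M \<and>
          maximal_solution s (quasilinear A) U0 I U \<longrightarrow>
          (\<forall>N\<ge>1. \<forall>I\<^sub>N U\<^sub>N.
             maximal_solution s (filtered_quasilinear \<phi> chi A N) (sharp_filter N U0) I\<^sub>N U\<^sub>N \<longrightarrow>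
             (\<forall>t\<in>time_span T (sobolev_norm s U0). \<forall>r\<in>{0..s}.
                sobolev_norm r (\<lambda>x. U t x - U\<^sub>N t x)
                  \<le> C * sobolev_norm s U0 * real N powr (r - s)))))
     \<and>
     (\<forall>L m. \<exists>N0\<ge>1. \<exists>C>0. \<forall>U0 I U K.
        in_sobolev s U0 \<and> maximal_solution s (quasilinear A) U0 I U \<and>
        compact K \<and> K \<subseteq> I \<and>
        measure lebesgue (convex hull (insert 0 K)) = L \<and>
        (SUP t\<in>convex hull (insert 0 K). sobolev_norm s (U t)) = m \<longrightarrow>
        (\<forall>N\<ge>N0. \<forall>I\<^sub>N U\<^sub>N.
           maximal_solution s (filtered_quasilinear \<phi> chi A N) (sharp_filter N U0) I\<^sub>N U\<^sub>N \<longrightarrow>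
           K \<subseteq> I\<^sub>N \<and>
           (\<forall>r\<in>{0..s}. \<forall>t\<in>K.
              sobolev_norm r (\<lambda>x. U t x - U\<^sub>N t x)
                \<le> C * (SUP \<tau>\<in>K. sobolev_norm s (U \<tau>)) * real N powr (r - s))))"
proof -
  obtain Cw where Cw: "0 < Cw" "\<And>(c :: int^'d \<Rightarrow> complex) B. l2_le (wt s c) B \<Longrightarrow> l1_le (wt 1 c) (Cw * B)"
    using sobolev_embedding[OF assms(3)] by blast
  interpret symmetric_system A s Cw
  proof
    show "A j u $ a $ b = A j u $ b $ a" for j u a b
      using assms(1) unfolding symmetric_polynomial_matrices_def transpose_def vec_eq_iff by simp
    show "real_polynomial_function (\<lambda>u. A j u $ a $ b)" for j a b
      using assms(1) by (simp add: symmetric_polynomial_matrices_def)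
  qed (use assms(3) Cw in auto)
  show ?thesis
    by (intro conjI allI impI, elim conjE, rule error_on_existence_time[OF assms(2)], assumption, assumption, assumption,
        rule long_time_error[OF assms(2)])
qed

end
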